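(* Let $M$ be a simple cographic matroid of rank $r$ such that all roots of its characteristic polynomial $\chi(M;\lambda)$ are integers. Then there exists a planar chordal graph $H$, with planar dual $G$, such that $M=M^{\perp}(G)=M(H)$.
   Context: For a matroid $M$ with no loops, $\chi(M;\lambda)=\sum_{X\in L(M)}\mu(\emptyset,X)\lambda^{\mathrm{rank}(M)-\mathrm{rank}(X)}$, where $L(M)$ is the lattice of flats and $\mu$ its Möbius function. $M(H)$ denotes the cycle matroid of a graph $H$ and $M^{\perp}(G)$ the cocycle (bond) matroid of $G$, the dual of $M(G)$; a matroid is cographic if it is isomorphic to $M^\perp(G)$ for some graph $G$. A matroid is simple if it has no loops and no parallel elements. A graph is chordal if it has no induced cycle of length greater than $3$. *)

theory Defs
  imports "HOL-Analysis.Analysis" "HOL-Computational_Algebra.Polynomial"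
begin

section \<open>Finite matroids\<close>

record 'e matroid =
  ground :: "'e set"
  indep :: "'e set set"

definition is_matroid :: "'e matroid \<Rightarrow> bool" where
  "is_matroid M \<longleftrightarrow>
     finite (ground M) \<and> indep M \<subseteq> Pow (ground M) \<and> {} \<in> indep M \<and>
     (\<forall>I\<in>indep M. \<forall>J. J \<subseteq> I \<longrightarrow> J \<in> indep M) \<and>
     (\<forall>I\<in>indep M. \<forall>J\<in>indep M. card I < card J \<longrightarrow> (\<exists>e\<in>J - I. insert e I \<in> indep M))"

definition rank_of :: "'e matroid \<Rightarrow> 'e set \<Rightarrow> nat" where
  "rank_of M X = Max (card ` {I \<in> indep M. I \<subseteq> X})"

definition matroid_rank :: "'e matroid \<Rightarrow> nat" where
  "matroid_rank M = rank_of M (ground M)"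

definition bases :: "'e matroid \<Rightarrow> 'e set set" where
  "bases M = {B \<in> indep M. \<forall>I\<in>indep M. B \<subseteq> I \<longrightarrow> I = B}"

definition dual_matroid :: "'e matroid \<Rightarrow> 'e matroid" where
  "dual_matroid M = \<lparr>ground = ground M, indep = {X. \<exists>B\<in>bases M. X \<subseteq> ground M - B}\<rparr>"

definition is_loop :: "'e matroid \<Rightarrow> 'e \<Rightarrow> bool" where
  "is_loop M e \<longleftrightarrow> e \<in> ground M \<and> {e} \<notin> indep M"

definition are_parallel :: "'e matroid \<Rightarrow> 'e \<Rightarrow> 'e \<Rightarrow> bool" where
  "are_parallel M e f \<longleftrightarrow>
     e \<in> ground M \<and> f \<in> ground M \<and> e \<noteq> f \<and>
     \<not> is_loop M e \<and> \<not> is_loop M f \<and> {e, f} \<notin> indep M"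

definition simple_matroid :: "'e matroid \<Rightarrow> bool" where
  "simple_matroid M \<longleftrightarrow> (\<nexists>e. is_loop M e) \<and> (\<nexists>e f. are_parallel M e f)"

definition matroid_iso :: "'e matroid \<Rightarrow> 'f matroid \<Rightarrow> bool" where
  "matroid_iso M N \<longleftrightarrow>
     (\<exists>\<phi>. bij_betw \<phi> (ground M) (ground N) \<and>
          (\<forall>X\<subseteq>ground M. X \<in> indep M \<longleftrightarrow> \<phi> ` X \<in> indep N))"

definition flats :: "'e matroid \<Rightarrow> 'e set set" where
  "flats M = {X. X \<subseteq> ground M \<and> (\<forall>e\<in>ground M - X. rank_of M X < rank_of M (insert e X))}"

text \<open>The Moebius function of a family \<open>L\<close> of sets ordered by inclusion. The guard
  \<open>finite Y\<close> only serves termination; it holds for all flats of a finite matroid.\<close>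

function mobius :: "'e set set \<Rightarrow> 'e set \<Rightarrow> 'e set \<Rightarrow> int" where
  "mobius L X Y =
     (if X = Y then 1
      else if X \<subset> Y \<and> finite Y then - (\<Sum>Z | Z \<in> L \<and> X \<subseteq> Z \<and> Z \<subset> Y. mobius L X Z)
      else 0)"
  by pat_completeness auto
termination
  by (relation "Wellfounded.measure (\<lambda>(L, X, Y). card Y)") (auto intro: psubset_card_mono)

declare mobius.simps [simp del]

definition char_poly :: "'e matroid \<Rightarrow> int poly" where
  "char_poly M =
     (\<Sum>X\<in>flats M. monom (mobius (flats M) {} X) (matroid_rank M - rank_of M X))"


section \<open>Finite graphs, with loops and parallel edges allowed\<close>

record ('v, 'e) mgraph =
  verts :: "'v set"
  edges :: "'e set"
  ends :: "'e \<Rightarrow> 'v set"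

definition is_mgraph :: "('v, 'e) mgraph \<Rightarrow> bool" where
  "is_mgraph G \<longleftrightarrow>
     finite (verts G) \<and> finite (edges G) \<and>
     (\<forall>e\<in>edges G. ends G e \<subseteq> verts G \<and> (card (ends G e) = 1 \<or> card (ends G e) = 2))"

text \<open>Edge sets of cycles; a loop is a cycle of length 1 and two parallel edges form a cycle
  of length 2.\<close>

definition cycles :: "('v, 'e) mgraph \<Rightarrow> 'e set set" where
  "cycles G = {set es |es vs.
     es \<noteq> [] \<and> length vs = length es \<and> distinct es \<and> distinct vs \<and> set es \<subseteq> edges G \<and>
     (\<forall>i<length es. ends G (es ! i) = {vs ! i, vs ! (Suc i mod length es)})}"

definition cycle_matroid :: "('v, 'e) mgraph \<Rightarrow> 'e matroid" where
  "cycle_matroid G =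
     \<lparr>ground = edges G, indep = {X. X \<subseteq> edges G \<and> (\<forall>C\<in>cycles G. \<not> C \<subseteq> X)}\<rparr>"

definition cocycle_matroid :: "('v, 'e) mgraph \<Rightarrow> 'e matroid" where
  "cocycle_matroid G = dual_matroid (cycle_matroid G)"

text \<open>Every finite graph has a copy with vertices and edges in \<open>nat\<close>.\<close>

definition cographic :: "'e matroid \<Rightarrow> bool" where
  "cographic M \<longleftrightarrow>
     (\<exists>G :: (nat, nat) mgraph. is_mgraph G \<and> matroid_iso M (cocycle_matroid G))"

definition adjacent :: "('v, 'e) mgraph \<Rightarrow> 'v \<Rightarrow> 'v \<Rightarrow> bool" where
  "adjacent G u v \<longleftrightarrow> (\<exists>e\<in>edges G. ends G e = {u, v})"

definition induced_cycle :: "('v, 'e) mgraph \<Rightarrow> 'v list \<Rightarrow> bool" where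
  "induced_cycle G vs \<longleftrightarrow>
     3 \<le> length vs \<and> distinct vs \<and> set vs \<subseteq> verts G \<and>
     (\<forall>i<length vs. \<forall>j<length vs.
        adjacent G (vs ! i) (vs ! j) \<longleftrightarrow>
        j = Suc i mod length vs \<or> i = Suc j mod length vs)"

definition chordal :: "('v, 'e) mgraph \<Rightarrow> bool" where
  "chordal G \<longleftrightarrow> (\<nexists>vs. induced_cycle G vs \<and> 3 < length vs)"


section \<open>Plane drawings and planar duals\<close>

text \<open>The edge \<open>e\<close> is drawn as \<open>\<gamma> e\<close>, which is an arc if \<open>e\<close> has two ends and a simple closed
  curve if \<open>e\<close> is a loop.\<close>

definition plane_drawing ::
    "('v, 'e) mgraph \<Rightarrow> ('v \<Rightarrow> complex) \<Rightarrow> ('e \<Rightarrow> real \<Rightarrow> complex) \<Rightarrow> bool" where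
  "plane_drawing H p \<gamma> \<longleftrightarrow>
     inj_on p (verts H) \<and>
     (\<forall>e\<in>edges H.
        simple_path (\<gamma> e) \<and>
        {pathstart (\<gamma> e), pathfinish (\<gamma> e)} = p ` ends H e \<and>
        path_image (\<gamma> e) \<inter> p ` verts H = p ` ends H e) \<and>
     (\<forall>e\<in>edges H. \<forall>f\<in>edges H. e \<noteq> f \<longrightarrow>
        path_image (\<gamma> e) \<inter> path_image (\<gamma> f) \<subseteq> p ` verts H)"

definition planar :: "('v, 'e) mgraph \<Rightarrow> bool" where
  "planar H \<longleftrightarrow> (\<exists>p \<gamma>. plane_drawing H p \<gamma>)"

definition faces ::
    "('v, 'e) mgraph \<Rightarrow> ('v \<Rightarrow> complex) \<Rightarrow> ('e \<Rightarrow> real \<Rightarrow> complex) \<Rightarrow> complex set set" where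
  "faces H p \<gamma> = components (- (p ` verts H \<union> (\<Union>e\<in>edges H. path_image (\<gamma> e))))"

text \<open>\<open>G\<close> is the dual of some plane drawing of \<open>H\<close>: its vertices correspond to the faces, and
  it has the same edges, each joining the faces that the drawn edge borders. A bridge of \<open>H\<close>
  borders a single face and hence is a loop of \<open>G\<close>.\<close>

definition planar_dual :: "('v, 'e) mgraph \<Rightarrow> ('w, 'e) mgraph \<Rightarrow> bool" where
  "planar_dual H G \<longleftrightarrow>
     (\<exists>p \<gamma> \<phi>. plane_drawing H p \<gamma> \<and>
        bij_betw \<phi> (verts G) (faces H p \<gamma>) \<and>
        edges G = edges H \<and>
        (\<forall>e\<in>edges H. \<phi> ` ends G e = {F \<in> faces H p \<gamma>. path_image (\<gamma> e) \<subseteq> frontier F}))"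

end

theory Submission
  imports Defs "HOL-Computational_Algebra.Fundamental_Theorem_Algebra"
begin

text \<open>Among the graphs whose cocycle matroid is \<open>M\<close>, one with the fewest vertices is connected, so
  simplicity of \<open>M\<close> makes it 3-edge-connected, and \<open>\<chi>(M)\<close> is the flow polynomial of this graph \<open>G\<close>.
  Integral roots force a local configuration in \<open>G\<close>: with \<open>n\<close> edges and \<open>t\<close> three-edge cuts, the first
  coefficients give the root sum \<open>n\<close> and the sum of squares \<open>n + 2t\<close>, and as no root is less than 1,
  summing \<open>(a - 2)(a - 3) \<ge> 0\<close> over the roots \<open>a\<close> other than 1 yields nearly as many three-edge cuts as
  vertices. Cutting \<open>G\<close> along a three-edge cut splits off a factor of the flow polynomial (the boundary
  states of three coloured edges that are invariant under colour permutations form a line), so that a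
  minimal side of such a cut may be assumed to contain only trivial ones; counting then gives a vertex
  of degree three with a double edge, or a triangle of vertices of degree three. Dually, these are
  simplicial vertices of degree two and three. Removing them inductively shows that \<open>G\<close> arises from the
  dual of a stacked triangulation of the sphere by deleting edges of the triangulation, which leaves a
  chordal graph \<open>H\<close> whose even edge sets are the cuts of \<open>G\<close>.

  Only a weak form of planar duality is needed. A stacked triangulation has a straight-line drawing in
  which the faces are known explicitly. Deleting an edge merges the faces bordering it, so by induction
  on the deleted edges the even edge sets of \<open>H\<close> are the cuts of the dual of its drawing. Hence this
  dual and \<open>G\<close> have the same cocycle matroid \<open>M = M(H)\<close>.\<close>

text \<open>The obstacle to a direct induction is that \<open>H\<close> need not be a triangulation:
  a new simplicial vertex would have to be drawn in a face of unknown shape. Therefore a full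
  stacked triangulation is carried along; the edges of \<open>H\<close> are an injected part of its
  edges, and a vertex of \<open>G\<close> stands for a set of triangles. The only demand on their
  position concerns loopless vertices of degree three: one common triangle must be bordered by all
  their edges, so that the next vertex can be stacked there.

  Values of the flow polynomial are computed from a Potts sum with edge weight \<open>k - 1\<close>
  on equal and \<open>-1\<close> on unequal colours, the Fourier transform of the count of
  nowhere-zero flows. It needs no orientation and turns a graph cut along three edges into a pairing
  of two boundary states.

  Roots less than 1 are excluded because the characteristic polynomial of a loopless matroid
  alternates in sign and does not vanish at arguments up to 0. The multiplicity of the root 1 is
  kept in all estimates: in the extremal case a second factor \<open>x - 1\<close> is what gives the
  contradiction.\<close>

section \<open>Cuts, connectivity and the two matroids of a graph\<close>

definition edge_cut :: "('v, 'e) mgraph \<Rightarrow> 'v set \<Rightarrow> 'e set" where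
  "edge_cut G U = {e \<in> edges G. ends G e \<inter> U \<noteq> {} \<and> ends G e - U \<noteq> {}}"

definition conn :: "('v, 'e) mgraph \<Rightarrow> 'e set \<Rightarrow> ('v \<times> 'v) set" where
  "conn G A = {(u, v). \<exists>e\<in>A. ends G e = {u, v}}\<^sup>*"

text \<open>Closure in the cycle matroid: \<open>e\<close> is spanned by \<open>A\<close> iff its
  ends are joined by edges of \<open>A\<close>. A loop is always linked.\<close>

definition linked :: "('v, 'e) mgraph \<Rightarrow> 'e set \<Rightarrow> 'e \<Rightarrow> bool" where
  "linked G A e \<longleftrightarrow> (\<forall>u v. ends G e = {u, v} \<longrightarrow> (u, v) \<in> conn G A)"

lemma mgraph_ends:
  assumes "is_mgraph G" "e \<in> edges G"
  obtains u v where "ends G e = {u, v}" "u \<in> verts G" "v \<in> verts G"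
proof -
  have "ends G e \<subseteq> verts G" "card (ends G e) = 1 \<or> card (ends G e) = 2"
    using assms by (auto simp: is_mgraph_def)
  then show thesis using that by (auto simp: card_1_singleton_iff card_2_iff)
qed

lemma conn_refl [simp]: "(u, u) \<in> conn G A"
  by (simp add: conn_def)

lemma conn_trans: "(u, v) \<in> conn G A \<Longrightarrow> (v, w) \<in> conn G A \<Longrightarrow> (u, w) \<in> conn G A"
  unfolding conn_def by (rule rtrancl_trans)

lemma conn_sym: "(u, v) \<in> conn G A \<Longrightarrow> (v, u) \<in> conn G A"
proof -
  have "sym {(u, v). \<exists>e\<in>A. ends G e = {u, v}}"
    by (auto simp: sym_def insert_commute)
  then show "(u, v) \<in> conn G A \<Longrightarrow> (v, u) \<in> conn G A"
    unfolding conn_def by (meson sym_rtrancl symD)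
qed

lemma conn_mono: "A \<subseteq> B \<Longrightarrow> conn G A \<subseteq> conn G B"
  unfolding conn_def by (rule rtrancl_mono) auto

lemma conn_edge: "e \<in> A \<Longrightarrow> ends G e = {u, v} \<Longrightarrow> (u, v) \<in> conn G A"
  unfolding conn_def by (rule r_into_rtrancl) auto

lemma conn_induct [consumes 1, case_names refl step]:
  assumes "(u, v) \<in> conn G A"
    and "P u"
    and "\<And>w w' e. (u, w) \<in> conn G A \<Longrightarrow> P w \<Longrightarrow> e \<in> A \<Longrightarrow> ends G e = {w, w'} \<Longrightarrow> P w'"
  shows "P v"
  using assms(1) unfolding conn_def
  by (induction rule: rtrancl_induct) (use assms(2,3) in \<open>auto simp: conn_def\<close>)

lemma conn_closed:
  assumes "(u, v) \<in> conn G A" "A \<inter> edge_cut G U = {}" "A \<subseteq> edges G" "u \<in> U"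
  shows "v \<in> U"
  using assms(1)
proof (induction rule: conn_induct)
  case (step w w' e)
  then show ?case using assms(2,3) by (auto simp: edge_cut_def)
qed (use assms in auto)

lemma cut_class:
  assumes "is_mgraph G" "A \<subseteq> edges G"
  shows "edge_cut G {v. (u, v) \<in> conn G A} \<subseteq> edges G - A"
proof
  fix e assume e: "e \<in> edge_cut G {v. (u, v) \<in> conn G A}"
  then have eE: "e \<in> edges G" by (simp add: edge_cut_def)
  obtain a b where ab: "ends G e = {a, b}" using mgraph_ends[OF assms(1) eE] by metis
  { assume "e \<in> A"
    then have "(a, b) \<in> conn G A" "(b, a) \<in> conn G A"
      using ab conn_edge[of e A G] by (auto simp: insert_commute)
    then have "(u, a) \<in> conn G A \<longleftrightarrow> (u, b) \<in> conn G A" using conn_trans by metis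
    then have False using e ab by (auto simp: edge_cut_def) }
  then show "e \<in> edges G - A" using eE by auto
qed

lemma linkedI: "ends G e = {u, v} \<Longrightarrow> (u, v) \<in> conn G A \<Longrightarrow> linked G A e"
  unfolding linked_def by (metis conn_sym doubleton_eq_iff)

lemma linked_mem: "e \<in> A \<Longrightarrow> linked G A e"
  unfolding linked_def by (meson conn_edge)

lemma linked_mono: "linked G A e \<Longrightarrow> A \<subseteq> B \<Longrightarrow> linked G B e"
  unfolding linked_def by (meson conn_mono subsetD)

text \<open>At most one traversal of \<open>e\<close> matters, and its direction distinguishes the
  last two cases.\<close>

lemma conn_insert_cases:
  assumes "(u, v) \<in> conn G (insert e A)" "ends G e = {a, b}"
  shows "(u, v) \<in> conn G A \<or> ((u, a) \<in> conn G A \<and> (b, v) \<in> conn G A)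
    \<or> ((u, b) \<in> conn G A \<and> (a, v) \<in> conn G A)"
  using assms(1)
proof (induction rule: conn_induct)
  case (step w w' d)
  show ?case
  proof (cases "d \<in> A")
    case True
    then have "(w, w') \<in> conn G A" using step conn_edge by metis
    then show ?thesis using step.IH conn_trans by metis
  next
    case False
    then have "{w, w'} = {a, b}" using step assms(2) by auto
    then have "(w = a \<and> w' = b) \<or> (w = b \<and> w' = a)" by (auto simp: doubleton_eq_iff)
    then show ?thesis using step.IH conn_trans conn_refl conn_sym by metis
  qed
qed auto

lemma conn_insert_linked:
  assumes "is_mgraph G" "e \<in> edges G" "linked G A e"
  shows "conn G (insert e A) = conn G A"
proof
  obtain a b where ab: "ends G e = {a, b}" using mgraph_ends[OF assms(1,2)] by metis
  have l: "(a, b) \<in> conn G A" using assms(3) ab by (auto simp: linked_def)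
  show "conn G (insert e A) \<subseteq> conn G A"
  proof (rule subrelI)
    fix u v assume "(u, v) \<in> conn G (insert e A)"
    from conn_insert_cases[OF this ab] show "(u, v) \<in> conn G A"
      using l conn_trans conn_sym by metis
  qed
qed (simp add: conn_mono subset_insertI)

lemma conn_all_linked:
  assumes "(u, v) \<in> conn G B" "\<And>e. e \<in> B \<Longrightarrow> linked G A e"
  shows "(u, v) \<in> conn G A"
  using assms(1)
proof (induction rule: conn_induct)
  case (step w w' e)
  then show ?case using assms(2)[of e] conn_trans unfolding linked_def by metis
qed auto

lemma linked_all_linked:
  assumes "linked G B e" "\<And>e. e \<in> B \<Longrightarrow> linked G A e"
  shows "linked G A e"
  using assms conn_all_linked unfolding linked_def by metis

text \<open>The exchange property of matroid closure. The connection gained for \<open>d\<close>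
  must pass through \<open>e\<close>, so its remaining pieces and \<open>d\<close> together join the
  ends of \<open>e\<close>.\<close>

lemma linked_exchange:
  assumes G: "is_mgraph G" "e \<in> edges G" "d \<in> edges G"
    and l: "linked G (insert e A) d" and n: "\<not> linked G A d"
  shows "linked G (insert d A) e"
proof -
  obtain a b where ab: "ends G e = {a, b}" using mgraph_ends[OF G(1,2)] by metis
  obtain u v where uv: "ends G d = {u, v}" using mgraph_ends[OF G(1,3)] by metis
  have 1: "(u, v) \<in> conn G (insert e A)" using l uv by (auto simp: linked_def)
  have 2: "(u, v) \<notin> conn G A" using n uv linkedI by metis
  have s: "conn G A \<subseteq> conn G (insert d A)" by (simp add: conn_mono subset_insertI)
  have 3: "(u, v) \<in> conn G (insert d A)" using uv conn_edge by (metis insertI1)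
  from conn_insert_cases[OF 1 ab] 2
  have "((u, a) \<in> conn G (insert d A) \<and> (b, v) \<in> conn G (insert d A))
    \<or> ((u, b) \<in> conn G (insert d A) \<and> (a, v) \<in> conn G (insert d A))" using s by auto
  then have "(a, b) \<in> conn G (insert d A)" using 3 conn_trans conn_sym by metis
  then show ?thesis using linkedI[OF ab] by blast
qed

text \<open>If \<open>A\<close> does not join the ends of \<open>e\<close>, the vertices reached
  from one end through \<open>A\<close> form the side of a cut that contains \<open>e\<close> and
  misses \<open>A\<close>.\<close>

lemma not_linked_iff_cut:
  assumes G: "is_mgraph G" and A: "A \<subseteq> edges G" and e: "e \<in> edges G"
  shows "linked G A e \<longleftrightarrow> (\<nexists>U. e \<in> edge_cut G U \<and> A \<inter> edge_cut G U = {})"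
proof
  assume l: "linked G A e"
  show "\<nexists>U. e \<in> edge_cut G U \<and> A \<inter> edge_cut G U = {}"
  proof
    assume "\<exists>U. e \<in> edge_cut G U \<and> A \<inter> edge_cut G U = {}"
    then obtain U where U: "e \<in> edge_cut G U" "A \<inter> edge_cut G U = {}" by auto
    obtain a b where ab: "ends G e = {a, b}" using mgraph_ends[OF G e] by metis
    have "(a, b) \<in> conn G A" "(b, a) \<in> conn G A" using l ab conn_sym by (auto simp: linked_def)
    then have "a \<in> U \<longleftrightarrow> b \<in> U" using conn_closed[OF _ U(2) A] by metis
    then show False using U(1) ab by (auto simp: edge_cut_def)
  qed
next
  assume n: "\<nexists>U. e \<in> edge_cut G U \<and> A \<inter> edge_cut G U = {}"
  show "linked G A e"
  proof (rule ccontr)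
    assume "\<not> linked G A e"
    then obtain u v where uv: "ends G e = {u, v}" "(u, v) \<notin> conn G A" by (auto simp: linked_def)
    let ?U = "{v. (u, v) \<in> conn G A}"
    have "e \<in> edge_cut G ?U" using uv e by (auto simp: edge_cut_def)
    moreover have "A \<inter> edge_cut G ?U = {}" using cut_class[OF G A] by blast
    ultimately show False using n by blast
  qed
qed

text \<open>Built from the front: if the new start vertex already occurs on the path, everything
  before that occurrence is dropped; otherwise vertex and edge are prepended.\<close>

lemma conn_simple_path:
  assumes "(u, v) \<in> conn G A"
  shows "\<exists>es vs. distinct vs \<and> distinct es \<and> length vs = Suc (length es) \<and> set es \<subseteq> A
    \<and> vs ! 0 = u \<and> last vs = v \<and> (\<forall>i<length es. ends G (es ! i) = {vs ! i, vs ! Suc i})"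
  using assms unfolding conn_def
proof (induction rule: converse_rtrancl_induct)
  case base
  show ?case by (rule exI[of _ "[]"], rule exI[of _ "[v]"]) auto
next
  case (step u w)
  then obtain es vs where p: "distinct vs" "distinct es" "length vs = Suc (length es)" "set es \<subseteq> A"
    "vs ! 0 = w" "last vs = v" "\<forall>i<length es. ends G (es ! i) = {vs ! i, vs ! Suc i}" by auto
  from step(1) obtain e where e: "e \<in> A" "ends G e = {u, w}" by auto
  show ?case
  proof (cases "u \<in> set vs")
    case True
    then obtain j where j: "j < length vs" "vs ! j = u" by (auto simp: in_set_conv_nth)
    show ?thesis
      by (rule exI[of _ "drop j es"], rule exI[of _ "drop j vs"])
        (use p j set_drop_subset[of j es] in \<open>auto simp: less_diff_conv add.commute Suc_diff_le\<close>)
  next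
    case False
    have "e \<notin> set es"
    proof
      assume "e \<in> set es"
      then obtain i where "i < length es" "es ! i = e" by (auto simp: in_set_conv_nth)
      then have "{u, w} = {vs ! i, vs ! Suc i}" using p(7) e by auto
      then have "u \<in> set vs" using p(3) \<open>i < length es\<close> by (metis Suc_mono doubleton_eq_iff less_Suc_eq nth_mem)
      then show False using False by simp
    qed
    then show ?thesis
      by (intro exI[of _ "e # es"] exI[of _ "u # vs"])
        (use p e False in \<open>auto simp: nth_Cons split: nat.splits\<close>)
  qed
qed

lemma cycle_if_linked:
  assumes G: "is_mgraph G" and X: "X \<subseteq> edges G" "e \<in> X" and l: "linked G (X - {e}) e"
  shows "\<exists>C\<in>cycles G. C \<subseteq> X"
proof -
  obtain u v where uv: "ends G e = {u, v}" using mgraph_ends[OF G] X by (metis subsetD)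
  then have "(u, v) \<in> conn G (X - {e})" using l by (auto simp: linked_def)
  from conn_simple_path[OF this] obtain es vs where p: "distinct vs" "distinct es"
    "length vs = Suc (length es)" "set es \<subseteq> X - {e}" "vs ! 0 = u" "last vs = v"
    "\<forall>i<length es. ends G (es ! i) = {vs ! i, vs ! Suc i}" by blast
  have lv: "vs ! length es = v" using p(3,6) by (metis diff_Suc_1 last_conv_nth length_0_conv nat.simps(3))
  have "\<forall>i<length (es @ [e]). ends G ((es @ [e]) ! i) = {vs ! i, vs ! (Suc i mod length (es @ [e]))}"
  proof (intro allI impI)
    fix i assume "i < length (es @ [e])"
    then consider "i < length es" | "i = length es" by fastforce
    then show "ends G ((es @ [e]) ! i) = {vs ! i, vs ! (Suc i mod length (es @ [e]))}"
      by cases (use p(5,7) lv uv in \<open>auto simp: nth_append insert_commute\<close>)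
  qed
  then have "set (es @ [e]) \<in> cycles G"
    unfolding cycles_def mem_Collect_eq
    using p X by (intro exI[of _ "es @ [e]"] exI[of _ vs]) auto
  then show ?thesis using p(4) X by (intro bexI[of _ "set (es @ [e])"]) auto
qed

lemma cycle_linked:
  assumes "C \<in> cycles G" "e \<in> C"
  shows "linked G (C - {e}) e"
proof -
  from assms(1) obtain es vs where c: "C = set es" "es \<noteq> []" "length vs = length es" "distinct es"
    "\<forall>i<length es. ends G (es ! i) = {vs ! i, vs ! (Suc i mod length es)}"
    unfolding cycles_def by blast
  let ?n = "length es"
  obtain i where i: "i < ?n" "es ! i = e" using assms(2) c(1) by (auto simp: in_set_conv_nth)
  have "k < ?n \<Longrightarrow> (vs ! ((i + 1) mod ?n), vs ! ((i + 1 + k) mod ?n)) \<in> conn G (C - {e})" for k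
  proof (induction k)
    case (Suc k)
    let ?j = "(i + 1 + k) mod ?n"
    have jn: "?j < ?n" using i by (intro mod_less_divisor) linarith
    have "?j \<noteq> i"
    proof
      assume "?j = i"
      then have "(i + (k + 1)) mod ?n = (i + 0) mod ?n" using i by (simp add: ac_simps)
      then show False using Suc.prems i by (cases "i + 1 + k < ?n") (auto simp: mod_if split: if_splits)
    qed
    then have "es ! ?j \<in> C - {e}" using c i jn nth_eq_iff_index_eq[OF c(4) jn i(1)] by auto
    moreover have "ends G (es ! ?j) = {vs ! ?j, vs ! ((i + 1 + Suc k) mod ?n)}"
      using c(5) jn by (simp add: mod_Suc_eq)
    ultimately have "(vs ! ?j, vs ! ((i + 1 + Suc k) mod ?n)) \<in> conn G (C - {e})"
      by (rule conn_edge)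
    then show ?case using Suc conn_trans by (metis Suc_lessD)
  qed simp
  from this[of "?n - 1"] have "(vs ! ((i + 1) mod ?n), vs ! ((i + ?n) mod ?n)) \<in> conn G (C - {e})"
    using c(2) by (simp add: Suc_le_eq)
  moreover have "(i + ?n) mod ?n = i" using i by simp
  ultimately have "(vs ! ((i + 1) mod ?n), vs ! i) \<in> conn G (C - {e})" by metis
  moreover have "ends G e = {vs ! ((i + 1) mod ?n), vs ! i}" using c(5) i by (auto simp: insert_commute)
  ultimately show ?thesis using linkedI by metis
qed

lemma indep_cycle_matroid:
  assumes "is_mgraph G"
  shows "X \<in> indep (cycle_matroid G) \<longleftrightarrow> X \<subseteq> edges G \<and> (\<forall>e\<in>X. \<not> linked G (X - {e}) e)"
proof
  assume "X \<in> indep (cycle_matroid G)"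
  then have "X \<subseteq> edges G" "\<forall>C\<in>cycles G. \<not> C \<subseteq> X" by (auto simp: cycle_matroid_def)
  then show "X \<subseteq> edges G \<and> (\<forall>e\<in>X. \<not> linked G (X - {e}) e)"
    using cycle_if_linked[OF assms] by meson
next
  assume X: "X \<subseteq> edges G \<and> (\<forall>e\<in>X. \<not> linked G (X - {e}) e)"
  { fix C assume C: "C \<in> cycles G" "C \<subseteq> X"
    then have "C \<noteq> {}" unfolding cycles_def by auto
    then obtain e where "e \<in> C" by auto
    then have "linked G (X - {e}) e" using C(2) by (intro linked_mono[OF cycle_linked[OF C(1)]]) auto
    then have False using X \<open>e \<in> C\<close> C(2) by auto }
  then show "X \<in> indep (cycle_matroid G)" using X by (auto simp: cycle_matroid_def)
qed

text \<open>Some \<open>d\<close> in \<open>insert e B\<close> is spanned by the rest; if it is not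
  \<open>e\<close>, the exchange property makes \<open>e\<close> spanned by
  \<open>B\<close>.\<close>

lemma indep_insert_linked:
  assumes G: "is_mgraph G" and B: "B \<in> indep (cycle_matroid G)" and e: "e \<in> edges G" "e \<notin> B"
    and n: "insert e B \<notin> indep (cycle_matroid G)"
  shows "linked G B e"
proof -
  have B': "B \<subseteq> edges G" "\<And>d. d \<in> B \<Longrightarrow> \<not> linked G (B - {d}) d"
    using B indep_cycle_matroid[OF G] by auto
  have "insert e B \<subseteq> edges G" using B' e by simp
  then obtain d where d: "d \<in> insert e B" "linked G (insert e B - {d}) d"
    using n indep_cycle_matroid[OF G, of "insert e B"] by blast
  show ?thesis
  proof (cases "d = e")
    case True
    then show ?thesis using d e by simp
  next
    case False
    then have dB: "d \<in> B" using d by auto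
    then have eq: "insert e B - {d} = insert e (B - {d})" "insert d (B - {d}) = B" using False by auto
    show ?thesis
      using linked_exchange[OF G e(1), of d "B - {d}"] d(2) B'(2)[OF dB] dB B' eq by auto
  qed
qed

text \<open>Independence in the dual means that the complement of \<open>X\<close> spans. A basis
  that avoids \<open>X\<close> is found as a maximal independent subset of the complement.\<close>

lemma indep_cocycle_linked:
  assumes G: "is_mgraph G"
  shows "X \<in> indep (cocycle_matroid G) \<longleftrightarrow> X \<subseteq> edges G \<and> (\<forall>e\<in>edges G. linked G (edges G - X) e)"
proof
  assume "X \<in> indep (cocycle_matroid G)"
  then obtain B where B: "B \<in> bases (cycle_matroid G)" "X \<subseteq> edges G - B"
    by (auto simp: cocycle_matroid_def dual_matroid_def cycle_matroid_def)
  have Bi: "B \<in> indep (cycle_matroid G)" "\<And>I. I \<in> indep (cycle_matroid G) \<Longrightarrow> B \<subseteq> I \<Longrightarrow> I = B"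
    using B(1) by (auto simp: bases_def)
  have BE: "B \<subseteq> edges G" using Bi(1) by (auto simp: cycle_matroid_def)
  have "linked G B e" if e: "e \<in> edges G" for e
  proof (cases "e \<in> B")
    case False
    then have "insert e B \<notin> indep (cycle_matroid G)" using Bi(2) by blast
    then show ?thesis using indep_insert_linked[OF G Bi(1) e False] by simp
  qed (rule linked_mem)
  then show "X \<subseteq> edges G \<and> (\<forall>e\<in>edges G. linked G (edges G - X) e)"
    using B(2) BE linked_mono[of G B _ "edges G - X"] by blast
next
  assume X: "X \<subseteq> edges G \<and> (\<forall>e\<in>edges G. linked G (edges G - X) e)"
  let ?S = "{B \<in> indep (cycle_matroid G). B \<subseteq> edges G - X}"
  have fin: "finite (edges G)" using G by (simp add: is_mgraph_def)
  have "finite ?S" by (rule finite_subset[of _ "Pow (edges G)"]) (use fin in auto)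
  moreover have "{} \<in> ?S" by (auto simp: indep_cycle_matroid[OF G])
  ultimately obtain B where B: "B \<in> ?S" and B': "\<forall>I\<in>?S. B \<subseteq> I \<longrightarrow> B = I"
    using finite_has_maximal2[of ?S "{}"] by blast
  have l: "linked G B d" if d: "d \<in> edges G - X" for d
  proof (cases "d \<in> B")
    case False
    then have "insert d B \<notin> indep (cycle_matroid G)" using B B' d by blast
    then show ?thesis using indep_insert_linked[OF G _ _ False] B d by simp
  qed (rule linked_mem)
  have l': "linked G B e" if "e \<in> edges G" for e
    by (rule linked_all_linked[of G "edges G - X"]) (use X that l in simp_all)
  have "B \<in> bases (cycle_matroid G)"
    unfolding bases_def
  proof (intro CollectI conjI ballI impI)
    fix I assume I: "I \<in> indep (cycle_matroid G)" "B \<subseteq> I"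
    show "I = B"
    proof (rule ccontr)
      assume "I \<noteq> B"
      then obtain e where e: "e \<in> I" "e \<notin> B" using I by auto
      have "e \<in> edges G" using I e by (auto simp: cycle_matroid_def)
      then have "linked G (I - {e}) e" using l' e I by (blast intro: linked_mono[of G B])
      then show False using I e indep_cycle_matroid[OF G] by blast
    qed
  qed (use B in auto)
  then show "X \<in> indep (cocycle_matroid G)"
    using X B by (auto simp: cocycle_matroid_def dual_matroid_def cycle_matroid_def)
qed

text \<open>By \<open>not_linked_iff_cut\<close>, an edge not spanned by the complement of
  \<open>X\<close> is one that lies in a cut contained in \<open>X\<close>. The minimal nonempty
  cuts are thus the circuits.\<close>

lemma indep_cocycle_matroid:
  assumes G: "is_mgraph G"
  shows "X \<in> indep (cocycle_matroid G) \<longleftrightarrow> X \<subseteq> edges G \<and> (\<forall>U. edge_cut G U \<subseteq> X \<longrightarrow> edge_cut G U = {})"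
proof -
  have "(\<forall>e\<in>edges G. linked G (edges G - X) e) \<longleftrightarrow> (\<forall>U. edge_cut G U \<subseteq> X \<longrightarrow> edge_cut G U = {})"
  proof -
    have "(\<forall>e\<in>edges G. linked G (edges G - X) e)
      \<longleftrightarrow> (\<forall>e\<in>edges G. \<nexists>U. e \<in> edge_cut G U \<and> (edges G - X) \<inter> edge_cut G U = {})"
      by (intro ball_cong refl not_linked_iff_cut[OF G]) auto
    also have "\<dots> \<longleftrightarrow> (\<forall>U. edge_cut G U \<subseteq> X \<longrightarrow> edge_cut G U = {})"
      by (auto simp: edge_cut_def)
    finally show ?thesis .
  qed
  then show ?thesis using indep_cocycle_linked[OF G] by simp
qed

section \<open>Cycle space and cut space over the two-element field\<close>

text \<open>Addition of sets as vectors over the two-element field.\<close>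

definition symdiff :: "'a set \<Rightarrow> 'a set \<Rightarrow> 'a set" where
  "symdiff A B = (A - B) \<union> (B - A)"

lemma even_card_symdiff:
  assumes "finite A" "finite B"
  shows "even (card (symdiff A B)) \<longleftrightarrow> (even (card A) \<longleftrightarrow> even (card B))"
proof -
  have "card (symdiff A B) = card (A - B) + card (B - A)"
    unfolding symdiff_def using assms by (intro card_Un_disjoint) auto
  moreover have "card A = card (A - B) + card (A \<inter> B)" "card B = card (B - A) + card (A \<inter> B)"
    using assms by (metis card_Diff_subset_Int card_mono finite_Int inf_le1 le_add_diff_inverse2)
      (metis assms(2) card_Diff_subset_Int card_mono finite_Int inf_le1 inf_commute le_add_diff_inverse2)
  ultimately show ?thesis by auto
qed

text \<open>The cycle space of \<open>H\<close> when \<open>H\<close> has no loops; a loop would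
  count only once at its vertex.\<close>

definition even_edges :: "('v, 'e) mgraph \<Rightarrow> 'e set \<Rightarrow> bool" where
  "even_edges H S \<longleftrightarrow> S \<subseteq> edges H \<and> (\<forall>v. even (card {e \<in> S. v \<in> ends H e}))"

lemma even_edges_symdiff:
  assumes "is_mgraph H" "even_edges H S" "even_edges H T"
  shows "even_edges H (symdiff S T)"
proof -
  have f: "finite S" "finite T"
    using assms finite_subset by (auto simp: is_mgraph_def even_edges_def)
  have "{e \<in> symdiff S T. v \<in> ends H e} = symdiff {e \<in> S. v \<in> ends H e} {e \<in> T. v \<in> ends H e}" for v
    by (auto simp: symdiff_def)
  then show ?thesis using assms f by (auto simp: even_edges_def even_card_symdiff) (auto simp: symdiff_def)
qed

text \<open>The edge set of a walk modulo two: every step adds its edge by symmetric difference, so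
  repeated edges cancel and only the two ends keep odd degree.\<close>

lemma conn_join:
  assumes H: "is_mgraph H" and A: "A \<subseteq> edges H" and uv: "(u, v) \<in> conn H A"
    and loopless: "\<And>e. e \<in> edges H \<Longrightarrow> card (ends H e) = 2"
  shows "\<exists>S\<subseteq>A. \<forall>w. odd (card {e \<in> S. w \<in> ends H e}) \<longleftrightarrow> (u \<noteq> v \<and> (w = u \<or> w = v))"
  using uv
proof (induction rule: conn_induct)
  case refl
  show ?case by (rule exI[of _ "{}"]) auto
next
  case (step w w' e)
  then obtain S where S: "S \<subseteq> A" "\<And>x. odd (card {e \<in> S. x \<in> ends H e}) \<longleftrightarrow> (u \<noteq> w \<and> (x = u \<or> x = w))" by blast
  have f: "finite S" using S A H finite_subset by (metis is_mgraph_def)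
  have ww: "w \<noteq> w'" using loopless[of e] step A by auto
  have "{d \<in> symdiff S {e}. x \<in> ends H d} = symdiff {d \<in> S. x \<in> ends H d} {d \<in> {e}. x \<in> ends H d}" for x
    by (auto simp: symdiff_def)
  moreover have "card {d \<in> {e}. x \<in> ends H d} = (if x = w \<or> x = w' then 1 else 0)" for x
  proof -
    have "{d \<in> {e}. x \<in> ends H d} = (if x = w \<or> x = w' then {e} else {})" using step by auto
    then show ?thesis by simp
  qed
  ultimately have "odd (card {d \<in> symdiff S {e}. x \<in> ends H d}) \<longleftrightarrow> (u \<noteq> w' \<and> (x = u \<or> x = w'))" for x
    using S(2)[of x] f ww by (auto simp: even_card_symdiff split: if_splits)
  moreover have "symdiff S {e} \<subseteq> A" using S step by (auto simp: symdiff_def)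
  ultimately show ?case by blast
qed

text \<open>Orthogonality of cycles and cuts. The degrees in \<open>S\<close> of the vertices of
  \<open>U\<close> have an even sum, in which edges inside \<open>U\<close> count twice and edges of
  the cut once.\<close>

lemma cut_even_edges_parity:
  assumes H: "is_mgraph H" and S: "even_edges H S"
    and loopless: "\<And>e. e \<in> edges H \<Longrightarrow> card (ends H e) = 2"
  shows "even (card (S \<inter> edge_cut H U))"
proof -
  have fS: "finite S" and fV: "finite (verts H)" and SE: "S \<subseteq> edges H"
    using S H finite_subset by (auto simp: is_mgraph_def even_edges_def)
  let ?U = "U \<inter> verts H"
  have "even (\<Sum>v\<in>?U. card {e \<in> S. v \<in> ends H e})"
    using S by (auto simp: even_edges_def intro!: dvd_sum)
  also have "(\<Sum>v\<in>?U. card {e \<in> S. v \<in> ends H e}) = (\<Sum>v\<in>?U. \<Sum>e\<in>S. if v \<in> ends H e then 1 else 0)"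
    using fS by (simp add: sum.If_cases Int_def)
  also have "\<dots> = (\<Sum>e\<in>S. \<Sum>v\<in>?U. if v \<in> ends H e then 1 else 0)" by (rule sum.swap)
  also have "\<dots> = (\<Sum>e\<in>S. card (ends H e \<inter> U))"
  proof (rule sum.cong)
    fix e assume "e \<in> S"
    then have "ends H e \<subseteq> verts H" using SE H by (auto simp: is_mgraph_def)
    then have "?U \<inter> {v. v \<in> ends H e} = ends H e \<inter> U" by auto
    then show "(\<Sum>v\<in>?U. if v \<in> ends H e then 1 else 0) = card (ends H e \<inter> U)"
      using fV by (simp add: sum.If_cases)
  qed simp
  finally have ev: "even (\<Sum>e\<in>S. card (ends H e \<inter> U))" .
  have "(\<Sum>e\<in>S. card (ends H e \<inter> U)) = (\<Sum>e\<in>S \<inter> edge_cut H U. card (ends H e \<inter> U)) + (\<Sum>e\<in>S - edge_cut H U. card (ends H e \<inter> U))"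
    using fS by (metis sum.Int_Diff)
  also have "(\<Sum>e\<in>S \<inter> edge_cut H U. card (ends H e \<inter> U)) = (\<Sum>e\<in>S \<inter> edge_cut H U. 1)"
  proof (rule sum.cong)
    fix e assume "e \<in> S \<inter> edge_cut H U"
    then have "card (ends H e) = 2" "ends H e \<inter> U \<noteq> {}" "ends H e - U \<noteq> {}"
      using SE loopless by (auto simp: edge_cut_def)
    then show "card (ends H e \<inter> U) = 1" by (auto simp: card_2_iff card_1_singleton_iff)
  qed simp
  finally have 1: "(\<Sum>e\<in>S. card (ends H e \<inter> U)) = card (S \<inter> edge_cut H U) + (\<Sum>e\<in>S - edge_cut H U. card (ends H e \<inter> U))"
    by simp
  have "even (card (ends H e \<inter> U))" if "e \<in> S - edge_cut H U" for e
  proof -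
    have "card (ends H e) = 2" "ends H e \<inter> U = {} \<or> ends H e \<subseteq> U"
      using that SE loopless by (auto simp: edge_cut_def)
    then show ?thesis by (auto simp: Int_absorb2)
  qed
  then have "even (\<Sum>e\<in>S - edge_cut H U. card (ends H e \<inter> U))" by (intro dvd_sum) auto
  then show ?thesis using ev 1 by simp
qed

text \<open>A path that links the ends of \<open>e\<close> becomes even when \<open>e\<close> is
  added. Conversely, an unlinked edge of an even set would be the only edge of this set in some cut,
  against parity.\<close>

lemma indep_cycle_even:
  assumes H: "is_mgraph H" and loopless: "\<And>e. e \<in> edges H \<Longrightarrow> card (ends H e) = 2"
  shows "X \<in> indep (cycle_matroid H) \<longleftrightarrow> X \<subseteq> edges H \<and> (\<forall>S. even_edges H S \<and> S \<subseteq> X \<longrightarrow> S = {})"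
proof -
  have "(\<exists>e\<in>X. linked H (X - {e}) e) \<longleftrightarrow> (\<exists>S. even_edges H S \<and> S \<subseteq> X \<and> S \<noteq> {})" if X: "X \<subseteq> edges H"
  proof
    assume "\<exists>e\<in>X. linked H (X - {e}) e"
    then obtain e where e: "e \<in> X" "linked H (X - {e}) e" by auto
    obtain u v where uv: "ends H e = {u, v}" using mgraph_ends[OF H] X e by (metis subsetD)
    have "u \<noteq> v" using loopless[of e] uv X e by auto
    have "(u, v) \<in> conn H (X - {e})" using e uv by (auto simp: linked_def)
    from conn_join[OF H _ this loopless] X \<open>u \<noteq> v\<close> obtain S where S: "S \<subseteq> X - {e}"
      "\<And>w. odd (card {d \<in> S. w \<in> ends H d}) \<longleftrightarrow> (w = u \<or> w = v)" by blast
    have f: "finite S" using S X H finite_subset by (metis Diff_subset is_mgraph_def)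
    have "even (card {d \<in> insert e S. w \<in> ends H d})" for w
    proof (cases "w = u \<or> w = v")
      case True
      then have "{d \<in> insert e S. w \<in> ends H d} = insert e {d \<in> S. w \<in> ends H d}" using uv by auto
      moreover have "e \<notin> {d \<in> S. w \<in> ends H d}" using S by auto
      ultimately show ?thesis using f S(2)[of w] True by simp
    next
      case False
      then have "{d \<in> insert e S. w \<in> ends H d} = {d \<in> S. w \<in> ends H d}" using uv by auto
      then show ?thesis using S(2)[of w] False by simp
    qed
    then have "even_edges H (insert e S)" using S X e by (auto simp: even_edges_def)
    then show "\<exists>S. even_edges H S \<and> S \<subseteq> X \<and> S \<noteq> {}" using S e by (intro exI[of _ "insert e S"]) auto
  next
    assume "\<exists>S. even_edges H S \<and> S \<subseteq> X \<and> S \<noteq> {}"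
    then obtain S e where S: "even_edges H S" "S \<subseteq> X" "e \<in> S" by auto
    have SE: "S \<subseteq> edges H" using S X by auto
    have "linked H (S - {e}) e"
    proof (rule ccontr)
      assume "\<not> ?thesis"
      then obtain U where U: "e \<in> edge_cut H U" "(S - {e}) \<inter> edge_cut H U = {}"
        using not_linked_iff_cut[OF H, of "S - {e}" e] SE S by blast
      then have "S \<inter> edge_cut H U = {e}" using S by auto
      then show False using cut_even_edges_parity[OF H S(1) loopless, of U] by simp
    qed
    then have "linked H (X - {e}) e" by (rule linked_mono) (use S in auto)
    then show "\<exists>e\<in>X. linked H (X - {e}) e" using S by auto
  qed
  then show ?thesis unfolding indep_cycle_matroid[OF H] by blast
qed

lemma cut_symdiff:
  assumes "is_mgraph G"
  shows "edge_cut G (symdiff U W) = symdiff (edge_cut G U) (edge_cut G W)"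
proof -
  have "e \<in> edge_cut G (symdiff U W) \<longleftrightarrow> e \<in> symdiff (edge_cut G U) (edge_cut G W)" if e: "e \<in> edges G" for e
  proof -
    obtain a b where "ends G e = {a, b}" using mgraph_ends[OF assms e] by metis
    then show ?thesis by (auto simp: edge_cut_def symdiff_def)
  qed
  moreover have "e \<in> edge_cut G (symdiff U W) \<longleftrightarrow> e \<in> symdiff (edge_cut G U) (edge_cut G W)" if "e \<notin> edges G" for e
    using that by (simp add: edge_cut_def symdiff_def)
  ultimately show ?thesis by blast
qed

lemma cut_Int_verts:
  assumes "is_mgraph G"
  shows "edge_cut G (U \<inter> verts G) = edge_cut G U"
  using assms by (auto simp: edge_cut_def is_mgraph_def)

lemma cut_compl: "edge_cut G (- U) = edge_cut G U"
  by (auto simp: edge_cut_def)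

lemma cut_subset: "edge_cut G U \<subseteq> edges G"
  by (auto simp: edge_cut_def)

lemma cut_empty [simp]: "edge_cut G {} = {}"
  by (auto simp: edge_cut_def)

text \<open>Cuts are sums of vertex stars, so evenness need only be checked on stars.\<close>

lemma cuts_even_if_stars_even:
  assumes G: "is_mgraph G" and H: "is_mgraph H" and E: "edges H = edges G"
    and star: "\<And>z. z \<in> verts G \<Longrightarrow> even_edges H (edge_cut G {z})"
  shows "even_edges H (edge_cut G U)"
proof -
  have "finite W \<Longrightarrow> W \<subseteq> verts G \<Longrightarrow> even_edges H (edge_cut G W)" for W
  proof (induction rule: finite_induct)
    case empty
    show ?case by (simp add: even_edges_def)
  next
    case (insert z W)
    then have "insert z W = symdiff W {z}" by (auto simp: symdiff_def)
    moreover have "even_edges H (edge_cut G W)" "even_edges H (edge_cut G {z})" using insert star by auto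
    ultimately show ?case using cut_symdiff[OF G] even_edges_symdiff[OF H] by metis
  qed
  from this[of "U \<inter> verts G"] show ?thesis
    using G cut_Int_verts[OF G] by (auto simp: is_mgraph_def)
qed

section \<open>Rank functions and Whitney's expansion\<close>

text \<open>The rank function of a matroid in local form: unit increase, and submodularity reduced
  to the statement that an element spanned by a set is spanned by every larger set. Both conditions
  pass directly to deletions and contractions.\<close>

locale rank_function =
  fixes E :: "'e set" and \<rho> :: "'e set \<Rightarrow> nat"
  assumes fin: "finite E"
    and rank_empty: "\<rho> {} = 0"
    and rank_insert: "\<And>D e. D \<subseteq> E \<Longrightarrow> e \<in> E \<Longrightarrow> \<rho> (insert e D) = \<rho> D \<or> \<rho> (insert e D) = Suc (\<rho> D)"
    and rank_spanned: "\<And>D X e. D \<subseteq> X \<Longrightarrow> X \<subseteq> E \<Longrightarrow> e \<in> E \<Longrightarrow> \<rho> (insert e D) = \<rho> D \<Longrightarrow> \<rho> (insert e X) = \<rho> X"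

text \<open>Whitney's subset expansion of the characteristic polynomial. It makes sense in the
  presence of loops, which contractions may create.\<close>

definition rank_poly :: "'e set \<Rightarrow> ('e set \<Rightarrow> nat) \<Rightarrow> int poly" where
  "rank_poly E \<rho> = (\<Sum>D\<in>Pow E. monom ((-1) ^ card D) (\<rho> E - \<rho> D))"

context rank_function
begin

lemma rank_le_insert: "D \<subseteq> E \<Longrightarrow> e \<in> E \<Longrightarrow> \<rho> D \<le> \<rho> (insert e D)"
  using rank_insert[of D e] by auto

lemma rank_mono:
  assumes "D \<subseteq> X" "X \<subseteq> E"
  shows "\<rho> D \<le> \<rho> X"
proof -
  have "finite S \<Longrightarrow> S \<subseteq> E \<Longrightarrow> \<rho> D \<le> \<rho> (D \<union> S)" for S
  proof (induction rule: finite_induct)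
    case (insert e S)
    then have "\<rho> (D \<union> S) \<le> \<rho> (insert e (D \<union> S))" using assms by (intro rank_le_insert) auto
    then show ?case using insert by simp
  qed simp
  from this[of "X - D"] show ?thesis
    using assms finite_subset[OF _ fin, of "X - D"] by (auto simp: Un_absorb1)
qed

lemma rank_le_card:
  assumes "D \<subseteq> E"
  shows "\<rho> D \<le> card D"
proof -
  have "finite D" using assms fin finite_subset by blast
  then show ?thesis using assms
  proof (induction rule: finite_induct)
    case (insert e S)
    then show ?case using rank_insert[of S e] by auto
  qed (simp add: rank_empty)
qed

text \<open>Greedy choice: an element that raises the rank of a set also raises the rank of the
  independent subset found so far, by the contrapositive of \<open>rank_spanned\<close>.\<close>

lemma rank_basis:
  assumes "D \<subseteq> E"
  shows "\<exists>I\<subseteq>D. \<rho> I = card I \<and> card I = \<rho> D"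
proof -
  have "finite D" using assms fin finite_subset by blast
  then show ?thesis using assms
  proof (induction rule: finite_induct)
    case (insert e S)
    then obtain I where I: "I \<subseteq> S" "\<rho> I = card I" "card I = \<rho> S" by auto
    have fI: "finite I" using I(1) insert(1) finite_subset by blast
    show ?case
    proof (cases "\<rho> (insert e S) = \<rho> S")
      case False
      then have S: "\<rho> (insert e S) = Suc (\<rho> S)" using rank_insert[of S e] insert by auto
      have "\<rho> (insert e I) \<noteq> \<rho> I" using rank_spanned[of I S e] I insert False by auto
      then have "\<rho> (insert e I) = Suc (\<rho> I)" using rank_insert[of I e] I insert by auto
      moreover have "e \<notin> I" using I insert by auto
      ultimately show ?thesis using I S fI by (intro exI[of _ "insert e I"]) auto
    qed (use I in auto)
  qed (auto simp: rank_empty)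
qed

lemma Max_independent:
  assumes "D \<subseteq> E"
  shows "Max (card ` {I. \<rho> I = card I \<and> I \<subseteq> D}) = \<rho> D"
proof (rule Max_eqI)
  have "finite D" using assms fin finite_subset by blast
  then show "finite (card ` {I. \<rho> I = card I \<and> I \<subseteq> D})"
    by (intro finite_imageI) (rule finite_subset[of _ "Pow D"], auto)
next
  fix y assume "y \<in> card ` {I. \<rho> I = card I \<and> I \<subseteq> D}"
  then obtain I where "y = card I" "\<rho> I = card I" "I \<subseteq> D" by auto
  then show "y \<le> \<rho> D" using rank_mono[of I D] assms by simp
next
  obtain I where "I \<subseteq> D" "\<rho> I = card I" "card I = \<rho> D" using rank_basis[OF assms] by blast
  then show "\<rho> D \<in> card ` {I. \<rho> I = card I \<and> I \<subseteq> D}" by (intro image_eqI[of _ _ I]) auto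
qed

text \<open>Subsets with and without the loop have equal rank and opposite sign, so they cancel in
  pairs.\<close>

lemma rank_poly_loop:
  assumes e: "e \<in> E" "\<rho> {e} = 0"
  shows "rank_poly E \<rho> = 0"
proof -
  have same: "\<rho> (insert e D) = \<rho> D" if "D \<subseteq> E" for D
    using rank_spanned[of "{}" D e] e that rank_empty by auto
  have E: "E = insert e (E - {e})" using e by auto
  have f: "finite (E - {e})" using fin by auto
  have dis: "Pow (E - {e}) \<inter> insert e ` Pow (E - {e}) = {}" by auto
  have inj: "inj_on (insert e) (Pow (E - {e}))" by (auto simp: inj_on_def)
  let ?t = "\<lambda>D. monom ((-1 :: int) ^ card D) (\<rho> E - \<rho> D)"
  have "rank_poly E \<rho> = (\<Sum>D\<in>Pow (insert e (E - {e})). ?t D)"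
    unfolding rank_poly_def using E by simp
  also have "\<dots> = (\<Sum>D\<in>Pow (E - {e}). ?t D) + (\<Sum>D\<in>insert e ` Pow (E - {e}). ?t D)"
    unfolding Pow_insert using f dis by (intro sum.union_disjoint) auto
  also have "(\<Sum>D\<in>insert e ` Pow (E - {e}). ?t D) = (\<Sum>D\<in>Pow (E - {e}). ?t (insert e D))"
    using inj by (simp add: sum.reindex)
  also have "\<dots> = (\<Sum>D\<in>Pow (E - {e}). - ?t D)"
  proof (rule sum.cong)
    fix D assume D: "D \<in> Pow (E - {e})"
    then have "finite D" "e \<notin> D" "D \<subseteq> E" using fin finite_subset by auto
    then show "?t (insert e D) = - ?t D" using same by (simp add: minus_monom)
  qed simp
  finally show ?thesis by (simp add: sum_negf)
qed

lemma rank_function_delete: "rank_function (E - {e}) \<rho>"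
proof
  show "finite (E - {e})" using fin by simp
  show "\<rho> {} = 0" by (rule rank_empty)
next
  fix D d assume "D \<subseteq> E - {e}" "d \<in> E - {e}"
  then show "\<rho> (insert d D) = \<rho> D \<or> \<rho> (insert d D) = Suc (\<rho> D)" by (intro rank_insert) auto
next
  fix D X d assume "D \<subseteq> X" "X \<subseteq> E - {e}" "d \<in> E - {e}" "\<rho> (insert d D) = \<rho> D"
  then show "\<rho> (insert d X) = \<rho> X" by (intro rank_spanned[of D X d]) auto
qed

lemma rank_function_contract:
  assumes e: "e \<in> E" "\<rho> {e} \<noteq> 0"
  shows "rank_function (E - {e}) (\<lambda>D. \<rho> (insert e D) - 1)"
proof -
  have e1: "\<rho> {e} = 1" using rank_insert[of "{}" e] e rank_empty by auto
  have pos: "1 \<le> \<rho> (insert e D)" if "D \<subseteq> E" for D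
    using rank_mono[of "{e}" "insert e D"] that e e1 by auto
  show ?thesis
  proof
    fix D d assume D: "D \<subseteq> E - {e}" "d \<in> E - {e}"
    have "insert e (insert d D) = insert d (insert e D)" by auto
    then show "\<rho> (insert e (insert d D)) - 1 = \<rho> (insert e D) - 1 \<or>
       \<rho> (insert e (insert d D)) - 1 = Suc (\<rho> (insert e D) - 1)"
      using rank_insert[of "insert e D" d] pos[of D] D e by (auto simp: subset_Diff_insert)
  next
    fix D X d assume D: "D \<subseteq> X" "X \<subseteq> E - {e}" "d \<in> E - {e}"
      and r: "\<rho> (insert e (insert d D)) - 1 = \<rho> (insert e D) - 1"
    have "\<rho> (insert d (insert e D)) = \<rho> (insert e D)"
      using r pos[of D] pos[of "insert d D"] D insert_commute[of d e D] by (auto simp: subset_iff)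
    then have "\<rho> (insert d (insert e X)) = \<rho> (insert e X)"
      using rank_spanned[of "insert e D" "insert e X" d] D e by auto
    then show "\<rho> (insert e (insert d X)) - 1 = \<rho> (insert e X) - 1" by (simp add: insert_commute)
  qed (use fin e1 in auto)
qed

text \<open>The subsets are split according to whether they contain \<open>e\<close>. If
  \<open>e\<close> is a coloop, deletion and contraction have the same polynomial and the subsets
  without \<open>e\<close> gain one degree, which gives the factor \<open>x - 1\<close>.\<close>

lemma rank_poly_delete_contract:
  assumes e: "e \<in> E" "\<rho> {e} \<noteq> 0"
  shows "rank_poly E \<rho> =
    (if \<rho> (E - {e}) = \<rho> E then rank_poly (E - {e}) \<rho> - rank_poly (E - {e}) (\<lambda>D. \<rho> (insert e D) - 1)
     else [:-1, 1:] * rank_poly (E - {e}) \<rho>)"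
proof -
  have e1: "\<rho> {e} = 1" using rank_insert[of "{}" e] e rank_empty by auto
  have pos: "1 \<le> \<rho> (insert e D)" if "D \<subseteq> E" for D
    using rank_mono[of "{e}" "insert e D"] that e e1 by auto
  have E: "insert e (E - {e}) = E" using e by auto
  have f: "finite (E - {e})" using fin by auto
  have dis: "Pow (E - {e}) \<inter> insert e ` Pow (E - {e}) = {}" by auto
  have inj: "inj_on (insert e) (Pow (E - {e}))" by (auto simp: inj_on_def)
  let ?c = "\<lambda>D. \<rho> (insert e D) - 1"
  let ?t = "\<lambda>D. monom ((-1 :: int) ^ card D) (\<rho> E - \<rho> D)"
  have "rank_poly E \<rho> = (\<Sum>D\<in>Pow (insert e (E - {e})). ?t D)"
    unfolding rank_poly_def using E by simp
  also have "\<dots> = (\<Sum>D\<in>Pow (E - {e}). ?t D) + (\<Sum>D\<in>insert e ` Pow (E - {e}). ?t D)"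
    unfolding Pow_insert using f dis by (intro sum.union_disjoint) auto
  also have "(\<Sum>D\<in>insert e ` Pow (E - {e}). ?t D) = (\<Sum>D\<in>Pow (E - {e}). ?t (insert e D))"
    using inj by (simp add: sum.reindex)
  also have "\<dots> = (\<Sum>D\<in>Pow (E - {e}). - monom ((-1) ^ card D) (?c (E - {e}) - ?c D))"
  proof (rule sum.cong)
    fix D assume D: "D \<in> Pow (E - {e})"
    then have "finite D" "e \<notin> D" "D \<subseteq> E" using fin finite_subset by auto
    then show "?t (insert e D) = - monom ((-1) ^ card D) (?c (E - {e}) - ?c D)"
      using pos[of D] E by (simp add: minus_monom)
  qed simp
  also have "\<dots> = - rank_poly (E - {e}) ?c" by (simp add: rank_poly_def sum_negf)
  finally have 1: "rank_poly E \<rho> = (\<Sum>D\<in>Pow (E - {e}). ?t D) - rank_poly (E - {e}) ?c" by simp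
  show ?thesis
  proof (cases "\<rho> (E - {e}) = \<rho> E")
    case True
    then show ?thesis using 1 by (simp add: rank_poly_def)
  next
    case False
    then have r: "\<rho> E = Suc (\<rho> (E - {e}))"
      using rank_insert[OF Diff_subset e(1), of "{e}"] unfolding E by auto
    have "\<rho> (insert e D) = Suc (\<rho> D)" if D: "D \<subseteq> E - {e}" for D
    proof -
      have "\<rho> (insert e D) \<noteq> \<rho> D"
        using rank_spanned[OF D _ e(1)] False unfolding E by fastforce
      moreover have "D \<subseteq> E" using D by auto
      ultimately show ?thesis using rank_insert[OF _ e(1), of D] by blast
    qed
    then have "rank_poly (E - {e}) ?c = rank_poly (E - {e}) \<rho>"
      unfolding rank_poly_def E r by (intro sum.cong) auto
    moreover have "(\<Sum>D\<in>Pow (E - {e}). ?t D) = [:0, 1:] * rank_poly (E - {e}) \<rho>"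
      unfolding rank_poly_def sum_distrib_left
    proof (rule sum.cong)
      fix D assume D: "D \<in> Pow (E - {e})"
      interpret d: rank_function "E - {e}" \<rho> by (rule rank_function_delete)
      have "\<rho> D \<le> \<rho> (E - {e})" using d.rank_mono[of D "E - {e}"] D by auto
      then show "?t D = [:0, 1:] * monom ((-1) ^ card D) (\<rho> (E - {e}) - \<rho> D)"
        using r by (simp add: Suc_diff_le monom_Suc)
    qed simp
    ultimately show ?thesis using 1 False by (simp add: algebra_simps)
  qed
qed

end

text \<open>In deletion and contraction the two terms have the same sign after multiplication by the
  power of \<open>-1\<close>, so nothing cancels at arguments up to 0.\<close>

lemma rank_poly_sign:
  assumes "rank_function E \<rho>" "\<And>e. e \<in> E \<Longrightarrow> \<rho> {e} \<noteq> 0" "x \<le> 0"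
  shows "(-1) ^ \<rho> E * poly (rank_poly E \<rho>) x > 0"
  using assms(1,2)
proof (induction "card E" arbitrary: E \<rho>)
  case 0
  then interpret rank_function E \<rho> by simp
  have "E = {}" using 0 fin by simp
  then show ?case by (simp add: rank_poly_def rank_empty)
next
  case (Suc n)
  then interpret rank_function E \<rho> by simp
  obtain e where e: "e \<in> E" using Suc(2) by fastforce
  then have ce: "card (E - {e}) = n" using Suc(2) fin by simp
  have 1: "(-1) ^ \<rho> (E - {e}) * poly (rank_poly (E - {e}) \<rho>) x > 0"
    using Suc ce rank_function_delete by auto
  have e0: "\<rho> {e} \<noteq> 0" using Suc e by auto
  show ?case
  proof (cases "\<rho> (E - {e}) = \<rho> E")
    case True
    let ?c = "\<lambda>D. \<rho> (insert e D) - 1"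
    interpret c: rank_function "E - {e}" ?c using rank_function_contract[OF e e0] .
    \<comment> \<open>The contraction may have loops, and then its polynomial is zero. Only a weak
      inequality holds for it; the deletion supplies the strict one.\<close>
    have "(-1) ^ ?c (E - {e}) * poly (rank_poly (E - {e}) ?c) x \<ge> 0"
    proof (cases "\<exists>d\<in>E - {e}. ?c {d} = 0")
      case True
      then show ?thesis using c.rank_poly_loop by force
    next
      case False
      then show ?thesis using Suc(1)[OF ce[symmetric], of ?c] c.rank_function_axioms by force
    qed
    moreover have "insert e (E - {e}) = E" "\<rho> E \<noteq> 0" using e e0 rank_mono[of "{e}" E] by auto
    then have "(-1 :: int) ^ \<rho> E = - ((-1) ^ ?c (E - {e}))"
      by (metis One_nat_def Suc_pred bot_nat_0.not_eq_extremum mult_minus1 power_Suc)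
    ultimately show ?thesis
      using 1 True unfolding rank_poly_delete_contract[OF e e0] by (simp add: algebra_simps)
  next
    case False
    then have r: "\<rho> E = Suc (\<rho> (E - {e}))"
      using rank_insert[of "E - {e}" e] e by (auto simp: insert_absorb)
    have "(-1) ^ \<rho> E * poly (rank_poly E \<rho>) x =
      (1 - x) * ((-1) ^ \<rho> (E - {e}) * poly (rank_poly (E - {e}) \<rho>) x)"
      unfolding rank_poly_delete_contract[OF e e0] using False r by (simp add: algebra_simps)
    then show ?thesis using 1 assms(3) by simp
  qed
qed

section \<open>Closure and the Moebius function\<close>

context rank_function
begin

definition cl :: "'e set \<Rightarrow> 'e set" where
  "cl D = {e \<in> E. \<rho> (insert e D) = \<rho> D}"

lemma cl_extensive: "D \<subseteq> E \<Longrightarrow> D \<subseteq> cl D"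
  by (auto simp: cl_def insert_absorb)

lemma cl_mono: "D \<subseteq> X \<Longrightarrow> X \<subseteq> E \<Longrightarrow> cl D \<subseteq> cl X"
  unfolding cl_def by (auto intro: rank_spanned)

lemma rank_cl:
  assumes "D \<subseteq> E"
  shows "\<rho> (cl D) = \<rho> D"
proof -
  have "finite S \<Longrightarrow> S \<subseteq> cl D \<Longrightarrow> \<rho> (D \<union> S) = \<rho> D" for S
  proof (induction rule: finite_induct)
    case (insert e S)
    then have "e \<in> E" "\<rho> (insert e D) = \<rho> D" "D \<union> S \<subseteq> E"
      using assms by (auto simp: cl_def)
    then have "\<rho> (insert e (D \<union> S)) = \<rho> (D \<union> S)"
      using rank_spanned[of D "D \<union> S" e] by blast
    then show ?case using insert by simp
  qed simp
  moreover have "finite (cl D)" using fin by (simp add: cl_def)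
  moreover have "D \<union> cl D = cl D" using cl_extensive[OF assms] by auto
  ultimately show ?thesis by (metis order_refl)
qed

lemma cl_cl:
  assumes "D \<subseteq> E"
  shows "cl (cl D) = cl D"
proof
  have c: "cl D \<subseteq> E" by (auto simp: cl_def)
  show "cl (cl D) \<subseteq> cl D"
  proof
    fix e assume e: "e \<in> cl (cl D)"
    then have "\<rho> (insert e (cl D)) = \<rho> D" "e \<in> E" using rank_cl[OF assms] by (auto simp: cl_def)
    moreover have "\<rho> (insert e D) \<le> \<rho> (insert e (cl D))"
      using cl_extensive[OF assms] c \<open>e \<in> E\<close> by (intro rank_mono) auto
    moreover have "\<rho> D \<le> \<rho> (insert e D)" using rank_le_insert assms \<open>e \<in> E\<close> .
    ultimately show "e \<in> cl D" by (auto simp: cl_def)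
  qed
qed (rule cl_extensive, auto simp: cl_def)

lemma sum_alternating:
  assumes "finite X"
  shows "(\<Sum>D\<in>Pow X. (-1 :: int) ^ card D) = (if X = {} then 1 else 0)"
proof -
  have "(\<Sum>D\<in>Pow X. (-1 :: int) ^ card D) = (\<Sum>D\<in>Pow X. prod (\<lambda>_. -1) D * prod (\<lambda>_. 1) (X - D))"
    by simp
  also have "\<dots> = (\<Prod>x\<in>X. (-1 :: int) + 1)" by (rule prod_add[symmetric, OF assms])
  finally show ?thesis using assms by (auto simp: card_0_eq)
qed

text \<open>The subsets are grouped by their closure, on which rank is constant. The signed counts
  of the groups satisfy the Moebius recursion, because the signs of all subsets of a nonempty flat
  cancel.\<close>

lemma char_poly_eq_rank_poly:
  fixes M :: "'e matroid"
  assumes g: "ground M = E" and r: "\<And>D. D \<subseteq> E \<Longrightarrow> rank_of M D = \<rho> D"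
    and loopless: "\<And>e. e \<in> E \<Longrightarrow> \<rho> {e} \<noteq> 0"
  shows "char_poly M = rank_poly E \<rho>"
proof -
  have fl: "flats M = {X. X \<subseteq> E \<and> cl X = X}"
  proof -
    have "X \<in> flats M \<longleftrightarrow> X \<subseteq> E \<and> cl X = X" for X
    proof (cases "X \<subseteq> E")
      case True
      have "(\<forall>e\<in>E - X. rank_of M X < rank_of M (insert e X)) \<longleftrightarrow> (\<forall>e\<in>E - X. \<rho> (insert e X) \<noteq> \<rho> X)"
        using True r rank_le_insert[OF True] by (intro ball_cong refl) (auto simp: nat_less_le)
      also have "\<dots> \<longleftrightarrow> cl X = X" using cl_extensive[OF True] by (auto simp: cl_def)
      finally show ?thesis using True g by (simp add: flats_def)
    qed (simp add: flats_def g)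
    then show ?thesis by auto
  qed
  have finX: "finite X" if "X \<subseteq> E" for X using that fin finite_subset by auto
  have cE: "cl D \<in> flats M" if "D \<subseteq> E" for D
    using cl_cl[OF that] fl by (auto simp: cl_def)
  define g where "g X = (\<Sum>D | D \<subseteq> X \<and> cl D = X. (-1 :: int) ^ card D)" for X
  have finfl: "finite (flats M)" unfolding fl using fin by simp
  have sumg: "(\<Sum>Z | Z \<in> flats M \<and> Z \<subseteq> X. g Z) = (if X = {} then 1 else 0)" if X: "X \<in> flats M" for X
  proof -
    have XE: "X \<subseteq> E" "cl X = X" using X fl by auto
    have "(\<Sum>D\<in>Pow X. (-1 :: int) ^ card D) =
      (\<Sum>Z\<in>{Z \<in> flats M. Z \<subseteq> X}. \<Sum>D\<in>{D \<in> Pow X. cl D = Z}. (-1) ^ card D)"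
    proof (rule sum.group[symmetric])
      show "cl ` Pow X \<subseteq> {Z \<in> flats M. Z \<subseteq> X}"
        using XE cE cl_mono[of _ X] by blast
    qed (use finX[OF XE(1)] finfl in auto)
    also have "\<dots> = (\<Sum>Z\<in>{Z \<in> flats M. Z \<subseteq> X}. g Z)"
    proof (rule sum.cong)
      fix Z assume Z: "Z \<in> {Z \<in> flats M. Z \<subseteq> X}"
      have "{D \<in> Pow X. cl D = Z} = {D. D \<subseteq> Z \<and> cl D = Z}"
        using Z XE cl_extensive by blast
      then show "(\<Sum>D\<in>{D \<in> Pow X. cl D = Z}. (-1) ^ card D) = g Z" by (simp add: g_def)
    qed simp
    finally show ?thesis using sum_alternating[OF finX[OF XE(1)]] by simp
  qed
  \<comment> \<open>Without loops the empty set is a flat, so the recursion starts at the bottom of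
    the lattice.\<close>
  have clem: "cl {} = {}" using loopless rank_empty by (auto simp: cl_def)
  have mob: "mobius (flats M) {} X = g X" if "X \<in> flats M" for X
    using finX[of X] that
  proof (induction "card X" arbitrary: X rule: less_induct)
    case less
    have XE: "X \<subseteq> E" using less.prems fl by auto
    have fX: "finite X" using finX[OF XE] .
    show ?case
    proof (cases "X = {}")
      case True
      have "{D. D = {} \<and> cl D = {}} = {{}}" using clem by auto
      then show ?thesis using True by (simp add: mobius.simps g_def)
    next
      case False
      have "mobius (flats M) {} X = - (\<Sum>Z | Z \<in> flats M \<and> Z \<subset> X. mobius (flats M) {} Z)"
        using False fX by (subst mobius.simps) auto
      also have "(\<Sum>Z | Z \<in> flats M \<and> Z \<subset> X. mobius (flats M) {} Z) = (\<Sum>Z | Z \<in> flats M \<and> Z \<subset> X. g Z)"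
      proof (rule sum.cong)
        fix Z assume "Z \<in> {Z \<in> flats M. Z \<subset> X}"
        then show "mobius (flats M) {} Z = g Z"
          using less.hyps[of Z] fX psubset_card_mono[of X Z] finite_subset[of Z X] by auto
      qed simp
      also have "{Z \<in> flats M. Z \<subseteq> X} = insert X {Z \<in> flats M. Z \<subset> X}" using less.prems by auto
      then have "(\<Sum>Z | Z \<in> flats M \<and> Z \<subset> X. g Z) = - g X"
        using sumg[OF less.prems(2)] False finfl by simp
      finally show ?thesis by simp
    qed
  qed
  have mr: "matroid_rank M = \<rho> E" using g r by (simp add: matroid_rank_def)
  have "char_poly M = (\<Sum>X\<in>flats M. \<Sum>D | D \<subseteq> X \<and> cl D = X. monom ((-1) ^ card D) (\<rho> E - \<rho> D))"
    unfolding char_poly_def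
  proof (rule sum.cong)
    fix X assume X: "X \<in> flats M"
    then have XE: "X \<subseteq> E" using fl by auto
    have rX: "\<rho> D = \<rho> X" if "D \<subseteq> X" "cl D = X" for D using rank_cl[of D] that XE by auto
    have "monom (mobius (flats M) {} X) (matroid_rank M - rank_of M X) = monom (g X) (\<rho> E - \<rho> X)"
      using mob[OF X] mr r[OF XE] by simp
    also have "\<dots> = (\<Sum>D | D \<subseteq> X \<and> cl D = X. monom ((-1) ^ card D) (\<rho> E - \<rho> X))"
      unfolding g_def by (rule monom_sum)
    also have "\<dots> = (\<Sum>D | D \<subseteq> X \<and> cl D = X. monom ((-1) ^ card D) (\<rho> E - \<rho> D))"
      using rX by (intro sum.cong) auto
    finally show "monom (mobius (flats M) {} X) (matroid_rank M - rank_of M X) = \<dots>" .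
  qed simp
  also have "\<dots> = (\<Sum>X\<in>flats M. \<Sum>D\<in>{D \<in> Pow E. cl D = X}. monom ((-1) ^ card D) (\<rho> E - \<rho> D))"
  proof (intro sum.cong refl)
    fix X assume X: "X \<in> flats M"
    show "{D. D \<subseteq> X \<and> cl D = X} = {D \<in> Pow E. cl D = X}" using X fl cl_extensive by auto
  qed
  also have "\<dots> = (\<Sum>D\<in>Pow E. monom ((-1) ^ card D) (\<rho> E - \<rho> D))"
    by (rule sum.group) (use fin finfl cE in auto)
  finally show ?thesis by (simp add: rank_poly_def)
qed

end

section \<open>Components and the rank function of the cocycle matroid\<close>

definition comps :: "('v, 'e) mgraph \<Rightarrow> 'e set \<Rightarrow> 'v set set" where
  "comps G A = (\<lambda>u. conn G A `` {u}) ` verts G"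

definition kap :: "('v, 'e) mgraph \<Rightarrow> 'e set \<Rightarrow> nat" where
  "kap G A = card (comps G A)"

text \<open>The dual rank formula: with \<open>card (verts G) - kap G A\<close> as the rank of
  \<open>A\<close> in the cycle matroid, it is \<open>card D\<close> plus the rank of
  \<open>edges G - D\<close> minus the rank of \<open>edges G\<close>. By
  \<open>kap_delete_le\<close> the subtraction is not truncated.\<close>

definition grank :: "('v, 'e) mgraph \<Rightarrow> 'e set \<Rightarrow> nat" where
  "grank G D = card D + kap G (edges G) - kap G (edges G - D)"

lemma conn_class_eq: "conn G A `` {u} = conn G A `` {v} \<longleftrightarrow> (u, v) \<in> conn G A"
proof
  assume "conn G A `` {u} = conn G A `` {v}"
  then have "v \<in> conn G A `` {u}" using conn_refl by fastforce
  then show "(u, v) \<in> conn G A" by simp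
next
  assume uv: "(u, v) \<in> conn G A"
  have "(u, w) \<in> conn G A \<longleftrightarrow> (v, w) \<in> conn G A" for w
    using uv conn_trans conn_sym by metis
  then show "conn G A `` {u} = conn G A `` {v}" by auto
qed

text \<open>An unlinked edge merges exactly the classes of its two ends and leaves the others
  alone.\<close>

lemma kap_insert:
  assumes G: "is_mgraph G" and e: "e \<in> edges G"
  shows "kap G A = (if linked G A e then kap G (insert e A) else Suc (kap G (insert e A)))"
proof (cases "linked G A e")
  case True
  then show ?thesis using conn_insert_linked[OF G e] by (simp add: kap_def comps_def)
next
  case False
  obtain a b where ab: "ends G e = {a, b}" "a \<in> verts G" "b \<in> verts G"
    using mgraph_ends[OF G e] by metis
  let ?C = "\<lambda>u. conn G A `` {u}"
  have n: "(a, b) \<notin> conn G A" using False linkedI[OF ab(1)] by auto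
  have s: "conn G A \<subseteq> conn G (insert e A)" by (simp add: conn_mono subset_insertI)
  have abc: "(a, b) \<in> conn G (insert e A)" using ab(1) conn_edge by (metis insertI1)
  have cls: "conn G (insert e A) `` {u} = (if u \<in> ?C a \<union> ?C b then ?C a \<union> ?C b else ?C u)" for u
  proof -
    have T: "\<And>x y z. (x, y) \<in> conn G A \<Longrightarrow> (y, z) \<in> conn G A \<Longrightarrow> (x, z) \<in> conn G A"
      and S: "\<And>x y. (x, y) \<in> conn G A \<longleftrightarrow> (y, x) \<in> conn G A"
      using conn_trans conn_sym by metis+
    have T': "\<And>x y z. (x, y) \<in> conn G (insert e A) \<Longrightarrow> (y, z) \<in> conn G (insert e A) \<Longrightarrow> (x, z) \<in> conn G (insert e A)"
      and S': "\<And>x y. (x, y) \<in> conn G (insert e A) \<longleftrightarrow> (y, x) \<in> conn G (insert e A)"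
      using conn_trans conn_sym by metis+
    have sub: "\<And>x y. (x, y) \<in> conn G A \<Longrightarrow> (x, y) \<in> conn G (insert e A)" using s by auto
    have "(u, v) \<in> conn G (insert e A) \<longleftrightarrow>
      (if (a, u) \<in> conn G A \<or> (b, u) \<in> conn G A then (a, v) \<in> conn G A \<or> (b, v) \<in> conn G A else (u, v) \<in> conn G A)" for v
    proof
      assume "(u, v) \<in> conn G (insert e A)"
      from conn_insert_cases[OF this ab(1)]
      show "if (a, u) \<in> conn G A \<or> (b, u) \<in> conn G A then (a, v) \<in> conn G A \<or> (b, v) \<in> conn G A else (u, v) \<in> conn G A"
        using T S by (smt (verit))
    next
      assume h: "if (a, u) \<in> conn G A \<or> (b, u) \<in> conn G A then (a, v) \<in> conn G A \<or> (b, v) \<in> conn G A else (u, v) \<in> conn G A"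
      show "(u, v) \<in> conn G (insert e A)"
      proof (cases "(a, u) \<in> conn G A \<or> (b, u) \<in> conn G A")
        case True
        then have "(a, u) \<in> conn G (insert e A)" using sub abc T' by metis
        moreover have "(a, v) \<in> conn G (insert e A)" using h True sub abc T' by metis
        ultimately show ?thesis using T' S' by metis
      qed (use h sub in auto)
    qed
    then have "conn G (insert e A) `` {u} = {v. if (a, u) \<in> conn G A \<or> (b, u) \<in> conn G A
      then (a, v) \<in> conn G A \<or> (b, v) \<in> conn G A else (u, v) \<in> conn G A}"
      unfolding Image_singleton by presburger
    then show ?thesis by (simp add: Un_def Image_def)
  qed
  have fin: "finite (verts G)" using G by (simp add: is_mgraph_def)
  have C: "comps G A = ?C ` verts G" by (simp add: comps_def)
  have Cab: "?C a \<noteq> ?C b" using n conn_class_eq by metis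
  have C': "comps G (insert e A) = insert (?C a \<union> ?C b) (comps G A - {?C a, ?C b})"
  proof (intro equalityI subsetI)
    fix X assume "X \<in> comps G (insert e A)"
    then obtain u where u: "u \<in> verts G" "X = conn G (insert e A) `` {u}" by (auto simp: comps_def)
    show "X \<in> insert (?C a \<union> ?C b) (comps G A - {?C a, ?C b})"
    proof (cases "u \<in> ?C a \<union> ?C b")
      case False
      then have "?C u \<noteq> ?C a" "?C u \<noteq> ?C b" using conn_refl by (metis Image_singleton_iff UnI1 UnI2)+
      then show ?thesis using u cls[of u] False C by auto
    qed (use u cls[of u] in simp)
  next
    fix X assume X: "X \<in> insert (?C a \<union> ?C b) (comps G A - {?C a, ?C b})"
    show "X \<in> comps G (insert e A)"
    proof (cases "X = ?C a \<union> ?C b")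
      case True
      then have "X = conn G (insert e A) `` {a}" using cls[of a] by simp
      then show ?thesis using ab by (simp add: comps_def)
    next
      case False
      then obtain u where u: "u \<in> verts G" "X = ?C u" "?C u \<noteq> ?C a" "?C u \<noteq> ?C b" using X C by auto
      then have "u \<notin> ?C a \<union> ?C b" using conn_class_eq conn_sym by (metis Image_singleton_iff Un_iff)
      then have "X = conn G (insert e A) `` {u}" using cls[of u] u by simp
      then show ?thesis using u by (simp add: comps_def)
    qed
  qed
  have "?C a \<union> ?C b \<notin> comps G A"
  proof
    assume "?C a \<union> ?C b \<in> comps G A"
    then obtain u where u: "?C a \<union> ?C b = ?C u" using C by auto
    have "a \<in> ?C a \<union> ?C b" "b \<in> ?C a \<union> ?C b" by simp_all
    then have "(u, a) \<in> conn G A" "(u, b) \<in> conn G A" unfolding u by simp_all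
    then show False using n conn_trans conn_sym by metis
  qed
  then have "card (comps G (insert e A)) = Suc (card (comps G A - {?C a, ?C b}))"
    unfolding C' using fin C by simp
  also have "card (comps G A - {?C a, ?C b}) = card (comps G A) - 2"
    using Cab C ab fin by (subst card_Diff_subset) auto
  finally have "card (comps G (insert e A)) = Suc (card (comps G A) - 2)" .
  moreover have "card {?C a, ?C b} \<le> card (comps G A)"
    using C ab fin by (intro card_mono) auto
  ultimately show ?thesis using False Cab by (simp add: kap_def)
qed

lemma kap_antimono:
  assumes G: "is_mgraph G" and "A \<subseteq> B" "B \<subseteq> edges G"
  shows "kap G B \<le> kap G A"
proof -
  have "finite S \<Longrightarrow> S \<subseteq> edges G \<Longrightarrow> kap G (A \<union> S) \<le> kap G A" for S
  proof (induction rule: finite_induct)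
    case (insert e S)
    then show ?case using kap_insert[OF G, of e "A \<union> S"] by (auto split: if_splits)
  qed simp
  from this[of "B - A"] show ?thesis
    using assms finite_subset[of "B - A" "edges G"] by (auto simp: is_mgraph_def Un_absorb1)
qed

lemma kap_delete_le:
  assumes G: "is_mgraph G" and D: "D \<subseteq> edges G"
  shows "kap G (edges G - D) \<le> card D + kap G (edges G)"
proof -
  have "finite D" using assms finite_subset by (auto simp: is_mgraph_def)
  then show ?thesis using D
  proof (induction rule: finite_induct)
    case (insert e D)
    then have "edges G - D = insert e (edges G - insert e D)" by auto
    then show ?case using insert kap_insert[OF G, of e "edges G - insert e D"]
      by (auto split: if_splits)
  qed simp
qed

text \<open>The rank grows exactly when \<open>e\<close> is not a bridge of the graph that remains
  after deleting \<open>D\<close>.\<close>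

lemma grank_insert:
  assumes G: "is_mgraph G" and D: "D \<subseteq> edges G" and e: "e \<in> edges G - D"
  shows "grank G (insert e D) = (if linked G (edges G - insert e D) e then Suc (grank G D) else grank G D)"
proof -
  have f: "finite D" using assms finite_subset by (auto simp: is_mgraph_def)
  have 1: "insert e (edges G - insert e D) = edges G - D" using e by auto
  have 2: "kap G (edges G - insert e D) =
    (if linked G (edges G - insert e D) e then kap G (edges G - D) else Suc (kap G (edges G - D)))"
    using kap_insert[OF G, of e "edges G - insert e D"] e unfolding 1 by blast
  show ?thesis
    using 2 kap_delete_le[OF G D] kap_delete_le[OF G, of "insert e D"] e D f
    by (auto simp: grank_def)
qed

lemma rank_function_grank:
  assumes G: "is_mgraph G"
  shows "rank_function (edges G) (grank G)"
proof
  fix D e assume De: "D \<subseteq> edges G" "e \<in> edges G"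
  then show "grank G (insert e D) = grank G D \<or> grank G (insert e D) = Suc (grank G D)"
    using grank_insert[OF G De(1), of e] by (cases "e \<in> D") (auto simp: insert_absorb)
next
  fix D X e assume DX: "D \<subseteq> X" "X \<subseteq> edges G" "e \<in> edges G" "grank G (insert e D) = grank G D"
  show "grank G (insert e X) = grank G X"
  proof (cases "e \<in> X")
    case False
    have "e \<in> edges G - D" using False DX by auto
    then have n: "\<not> linked G (edges G - insert e D) e"
      using DX(4) grank_insert[OF G subset_trans[OF DX(1,2)], of e] by (auto split: if_splits)
    have "\<not> linked G (edges G - insert e X) e"
    proof
      assume "linked G (edges G - insert e X) e"
      then have "linked G (edges G - insert e D) e" by (rule linked_mono) (use DX in auto)
      then show False using n by simp
    qed
    then show ?thesis using grank_insert[OF G, of X e] DX False by auto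
  qed (simp add: insert_absorb)
qed (use G in \<open>auto simp: is_mgraph_def grank_def\<close>)

lemma indep_cocycle_grank:
  assumes G: "is_mgraph G"
  shows "X \<in> indep (cocycle_matroid G) \<longleftrightarrow> X \<subseteq> edges G \<and> grank G X = card X"
proof -
  have "(\<forall>e\<in>edges G. linked G (edges G - X) e) \<longleftrightarrow> grank G X = card X" if X: "X \<subseteq> edges G"
  proof
    assume l: "\<forall>e\<in>edges G. linked G (edges G - X) e"
    have "conn G (edges G - X) = conn G (edges G)"
    proof
      show "conn G (edges G) \<subseteq> conn G (edges G - X)"
        using conn_all_linked[of _ _ G "edges G" "edges G - X"] l by auto
    qed (simp add: conn_mono)
    then show "grank G X = card X" by (simp add: grank_def kap_def comps_def)
  next
    assume r: "grank G X = card X"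
    show "\<forall>e\<in>edges G. linked G (edges G - X) e"
    proof (rule ccontr)
      assume "\<not> ?thesis"
      then obtain e where e: "e \<in> edges G" "\<not> linked G (edges G - X) e" by auto
      then have "kap G (edges G - X) = Suc (kap G (insert e (edges G - X)))"
        using kap_insert[OF G e(1), of "edges G - X"] by simp
      moreover have "kap G (edges G) \<le> kap G (insert e (edges G - X))"
        using e by (intro kap_antimono[OF G]) auto
      moreover have "e \<in> X" using e linked_mem by (metis DiffI)
      then have "card X > 0" using X G finite_subset by (fastforce simp: is_mgraph_def card_gt_0_iff)
      ultimately show False using r by (simp add: grank_def)
    qed
  qed
  then show ?thesis using indep_cocycle_linked[OF G] by auto
qed

text \<open>Defined through the cocycle matroid, so that neither orientations nor groups are
  needed.\<close>

definition flow_poly :: "('v, 'e) mgraph \<Rightarrow> int poly" where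
  "flow_poly G = rank_poly (edges G) (grank G)"

lemma rank_poly_bij:
  assumes b: "bij_betw \<phi> E F" and r: "\<And>D. D \<subseteq> E \<Longrightarrow> \<rho> D = \<sigma> (\<phi> ` D)"
  shows "rank_poly E \<rho> = rank_poly F \<sigma>"
  unfolding rank_poly_def
proof -
  have im: "\<phi> ` E = F" and inj: "inj_on \<phi> E" using b by (auto simp: bij_betw_def)
  have "(\<Sum>D\<in>Pow F. monom ((- 1 :: int) ^ card D) (\<sigma> F - \<sigma> D)) =
    (\<Sum>D\<in>Pow E. monom ((- 1) ^ card (\<phi> ` D)) (\<sigma> F - \<sigma> (\<phi> ` D)))"
    by (rule sum.reindex_bij_betw[OF bij_betw_Pow[OF b], symmetric])
  also have "\<dots> = (\<Sum>D\<in>Pow E. monom ((- 1) ^ card D) (\<rho> E - \<rho> D))"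
  proof (rule sum.cong)
    fix D assume D: "D \<in> Pow E"
    then have "card (\<phi> ` D) = card D" using inj by (meson PowD card_image inj_on_subset)
    then show "monom ((- 1 :: int) ^ card (\<phi> ` D)) (\<sigma> F - \<sigma> (\<phi> ` D)) = monom ((- 1) ^ card D) (\<rho> E - \<rho> D)"
      using D r im by simp
  qed simp
  finally show "(\<Sum>D\<in>Pow E. monom ((- 1 :: int) ^ card D) (\<rho> E - \<rho> D)) =
    (\<Sum>D\<in>Pow F. monom ((- 1) ^ card D) (\<sigma> F - \<sigma> D))" by simp
qed

text \<open>The isomorphism carries the rank function to \<open>M\<close>; absence of loops is what
  identifies the Moebius sum with the subset expansion.\<close>

lemma char_poly_iso_cocycle:
  fixes M :: "'a matroid" and G :: "('v, 'e) mgraph"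
  assumes M: "is_matroid M" and G: "is_mgraph G" and iso: "matroid_iso M (cocycle_matroid G)"
    and loopless: "\<nexists>e. is_loop M e"
  shows "char_poly M = flow_poly G"
proof -
  obtain \<phi> where b: "bij_betw \<phi> (ground M) (edges G)"
    and i: "\<And>X. X \<subseteq> ground M \<Longrightarrow> X \<in> indep M \<longleftrightarrow> \<phi> ` X \<in> indep (cocycle_matroid G)"
    using iso by (auto simp: matroid_iso_def cocycle_matroid_def dual_matroid_def cycle_matroid_def)
  interpret g: rank_function "edges G" "grank G" using rank_function_grank[OF G] .
  have inj: "inj_on \<phi> (ground M)" and im: "\<phi> ` ground M = edges G" using b by (auto simp: bij_betw_def)
  let ?r = "\<lambda>D. grank G (\<phi> ` D)"
  interpret r: rank_function "ground M" ?r
  proof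
    show "finite (ground M)" using M by (simp add: is_matroid_def)
    show "?r {} = 0" by (simp add: g.rank_empty)
  next
    fix D e assume "D \<subseteq> ground M" "e \<in> ground M"
    then show "?r (insert e D) = ?r D \<or> ?r (insert e D) = Suc (?r D)"
      using g.rank_insert[of "\<phi> ` D" "\<phi> e"] im by auto
  next
    fix D X e assume "D \<subseteq> X" "X \<subseteq> ground M" "e \<in> ground M" "?r (insert e D) = ?r D"
    then show "?r (insert e X) = ?r X"
      using g.rank_spanned[of "\<phi> ` D" "\<phi> ` X" "\<phi> e"] im by (auto simp: image_mono)
  qed
  have ind: "I \<in> indep M \<longleftrightarrow> ?r I = card I" if "I \<subseteq> ground M" for I
    using i[OF that] indep_cocycle_grank[OF G, of "\<phi> ` I"] that im inj card_image[of \<phi> I]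
      inj_on_subset by (metis image_mono)
  have "rank_of M D = ?r D" if D: "D \<subseteq> ground M" for D
  proof -
    have "{I \<in> indep M. I \<subseteq> D} = {I. ?r I = card I \<and> I \<subseteq> D}" using ind D by blast
    then show ?thesis unfolding rank_of_def using r.Max_independent[OF D] by simp
  qed
  moreover have "?r {e} \<noteq> 0" if e: "e \<in> ground M" for e
    using loopless e ind[of "{e}"] by (auto simp: is_loop_def)
  ultimately have "char_poly M = rank_poly (ground M) ?r"
    by (intro r.char_poly_eq_rank_poly) auto
  then show ?thesis unfolding flow_poly_def using rank_poly_bij[OF b, of ?r "grank G"] by simp
qed

section \<open>The Potts model form of the flow polynomial\<close>

definition monochromatic :: "('v \<Rightarrow> nat) \<Rightarrow> 'v set \<Rightarrow> bool" where
  "monochromatic f S \<longleftrightarrow> (\<forall>u\<in>S. \<forall>v\<in>S. f u = f v)"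

text \<open>This is \<open>k\<close> times the indicator of equal colours, minus one: the sum of the
  nontrivial characters of an abelian group of order \<open>k\<close> at the colour
  difference.\<close>

definition wt :: "nat \<Rightarrow> ('v \<Rightarrow> nat) \<Rightarrow> 'v set \<Rightarrow> int" where
  "wt k f S = (if monochromatic f S then int k - 1 else - 1)"

text \<open>By Fourier inversion this is \<open>k ^ card (verts G)\<close> times the number of
  nowhere-zero flows with values in an abelian group of order \<open>k\<close>.\<close>

definition potts :: "('v, 'e) mgraph \<Rightarrow> nat \<Rightarrow> int" where
  "potts G k = (\<Sum>f\<in>verts G \<rightarrow>\<^sub>E {..<k}. \<Prod>e\<in>edges G. wt k f (ends G e))"

definition w2 :: "nat \<Rightarrow> nat \<Rightarrow> nat \<Rightarrow> int" where
  "w2 k i j = (if i = j then int k - 1 else - 1)"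

lemma wt_pair: "wt k f {u, v} = w2 k (f u) (f v)"
  by (auto simp: wt_def w2_def monochromatic_def)

lemma wt_cong: "(\<And>v. v \<in> S \<Longrightarrow> f v = g v) \<Longrightarrow> wt k f S = wt k g S"
  by (auto simp: wt_def monochromatic_def)

text \<open>Such colourings are the functions on the components of \<open>A\<close>; this is how
  component numbers enter the expansion.\<close>

lemma card_colourings:
  assumes G: "is_mgraph G" and A: "A \<subseteq> edges G"
  shows "card {f \<in> verts G \<rightarrow>\<^sub>E {..<k}. \<forall>e\<in>A. monochromatic f (ends G e)} = k ^ kap G A"
proof -
  let ?C = "\<lambda>u. conn G A `` {u}"
  let ?F = "{f \<in> verts G \<rightarrow>\<^sub>E {..<k}. \<forall>e\<in>A. monochromatic f (ends G e)}"
  have finV: "finite (verts G)" using G by (simp add: is_mgraph_def)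
  have const: "f u = f v" if f: "f \<in> ?F" and uv: "(u, v) \<in> conn G A" for f u v
    using uv
  proof (induction rule: conn_induct)
    case (step w w' e)
    then show ?case using f by (auto simp: monochromatic_def)
  qed simp
  define \<Phi> where "\<Phi> g = (\<lambda>u\<in>verts G. g (?C u))" for g :: "'a set \<Rightarrow> nat"
  have "bij_betw \<Phi> (comps G A \<rightarrow>\<^sub>E {..<k}) ?F"
  proof (rule bij_betw_imageI)
    show "inj_on \<Phi> (comps G A \<rightarrow>\<^sub>E {..<k})"
    proof (rule inj_onI)
      fix g g' assume g: "g \<in> comps G A \<rightarrow>\<^sub>E {..<k}" "g' \<in> comps G A \<rightarrow>\<^sub>E {..<k}" "\<Phi> g = \<Phi> g'"
      show "g = g'"
      proof (rule PiE_ext[OF g(1,2)])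
        fix X assume "X \<in> comps G A"
        then obtain u where u: "u \<in> verts G" "X = ?C u" by (auto simp: comps_def)
        from g(3) have "\<Phi> g u = \<Phi> g' u" by simp
        then show "g X = g' X" using u by (simp add: \<Phi>_def)
      qed
    qed
    show "\<Phi> ` (comps G A \<rightarrow>\<^sub>E {..<k}) = ?F"
    proof (intro equalityI subsetI)
      fix f assume "f \<in> \<Phi> ` (comps G A \<rightarrow>\<^sub>E {..<k})"
      then obtain g where g: "g \<in> comps G A \<rightarrow>\<^sub>E {..<k}" "f = \<Phi> g" by auto
      have "g (?C u) < k" if "u \<in> verts G" for u using g(1) that by (auto simp: comps_def)
      moreover have "monochromatic f (ends G e)" if e: "e \<in> A" for e
      proof -
        obtain a b where ab: "ends G e = {a, b}" "a \<in> verts G" "b \<in> verts G"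
          using mgraph_ends[OF G] e A by (metis subsetD)
        then have "?C a = ?C b" using conn_class_eq conn_edge[OF e] by metis
        then show ?thesis using ab g(2) by (auto simp: monochromatic_def \<Phi>_def)
      qed
      ultimately show "f \<in> ?F" using g(2) by (auto simp: \<Phi>_def)
    next
      fix f assume f: "f \<in> ?F"
      let ?g = "\<lambda>X\<in>comps G A. f (SOME u. u \<in> verts G \<and> ?C u = X)"
      have s: "(SOME v. v \<in> verts G \<and> ?C v = ?C u) \<in> verts G \<and> ?C (SOME v. v \<in> verts G \<and> ?C v = ?C u) = ?C u"
        if "u \<in> verts G" for u
        by (rule someI[of "\<lambda>v. v \<in> verts G \<and> ?C v = ?C u" u]) (use that in auto)
      have "f = \<Phi> ?g"
      proof (rule ext)
        fix u show "f u = \<Phi> ?g u"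
        proof (cases "u \<in> verts G")
          case True
          have "((SOME v. v \<in> verts G \<and> ?C v = ?C u), u) \<in> conn G A"
            using s[OF True] by (simp flip: conn_class_eq)
          then have "f (SOME v. v \<in> verts G \<and> ?C v = ?C u) = f u" by (rule const[OF f])
          moreover have "?C u \<in> comps G A" using True by (simp add: comps_def)
          ultimately show ?thesis using True by (simp add: \<Phi>_def)
        next
          case False
          then show ?thesis using f by (auto simp: \<Phi>_def PiE_def extensional_def)
        qed
      qed
      moreover have "?g \<in> comps G A \<rightarrow>\<^sub>E {..<k}"
        using f s by (auto simp: comps_def)
      ultimately show "f \<in> \<Phi> ` (comps G A \<rightarrow>\<^sub>E {..<k})" by (rule image_eqI)
    qed
  qed
  then have "card ?F = card (comps G A \<rightarrow>\<^sub>E {..<k})" by (rule bij_betw_same_card[symmetric])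
  also have "\<dots> = k ^ kap G A"
    using finV by (simp add: card_PiE comps_def kap_def)
  finally show ?thesis .
qed

lemma kap_empty: "is_mgraph G \<Longrightarrow> kap G {} = card (verts G)"
proof -
  have "conn G {} `` {u} = {u}" for u by (auto simp: conn_def)
  then show ?thesis by (simp add: kap_def comps_def card_image)
qed

text \<open>Each weight is \<open>k\<close> times an indicator minus one. Expanding the product over
  the edges leaves, for every edge set \<open>A\<close>, the number of colourings constant on its
  components.\<close>

lemma flow_poly_potts:
  assumes G: "is_mgraph G"
  shows "poly (flow_poly G) (int k) * int k ^ card (verts G) = potts G k"
proof -
  let ?E = "edges G"
  let ?F = "verts G \<rightarrow>\<^sub>E {..<k}"
  let ?m = "\<lambda>f e. monochromatic f (ends G e)"
  have fE: "finite ?E" "finite (verts G)" using G by (auto simp: is_mgraph_def)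
  then have fF: "finite ?F" by (simp add: finite_PiE)
  have "potts G k = (\<Sum>f\<in>?F. \<Prod>e\<in>?E. (if ?m f e then int k else 0) + (- 1))"
    unfolding potts_def wt_def by (intro sum.cong prod.cong) auto
  also have "\<dots> = (\<Sum>f\<in>?F. \<Sum>A\<in>Pow ?E. (\<Prod>e\<in>A. if ?m f e then int k else 0) * (\<Prod>e\<in>?E - A. - 1))"
    by (intro sum.cong refl prod_add fE)
  also have "\<dots> = (\<Sum>A\<in>Pow ?E. \<Sum>f\<in>?F. (\<Prod>e\<in>A. if ?m f e then int k else 0) * (\<Prod>e\<in>?E - A. - 1))"
    by (rule sum.swap)
  also have "\<dots> = (\<Sum>A\<in>Pow ?E. (-1) ^ card (?E - A) * int k ^ (card A + kap G A))"
  proof (rule sum.cong)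
    fix A assume "A \<in> Pow ?E"
    then have A: "A \<subseteq> ?E" "finite A" using fE finite_subset by auto
    have "(\<Sum>f\<in>?F. (\<Prod>e\<in>A. if ?m f e then int k else 0) * (\<Prod>e\<in>?E - A. - 1 :: int)) =
      (\<Sum>f\<in>?F. if \<forall>e\<in>A. ?m f e then (-1) ^ card (?E - A) * int k ^ card A else 0)"
      using A(2) by (intro sum.cong) (auto simp: prod_zero_iff)
    also have "\<dots> = int (card {f \<in> ?F. \<forall>e\<in>A. ?m f e}) * ((-1) ^ card (?E - A) * int k ^ card A)"
      using fF by (simp add: sum.If_cases Int_def)
    also have "\<dots> = (-1) ^ card (?E - A) * int k ^ (card A + kap G A)"
      using card_colourings[OF G A(1), of k] by (simp add: power_add)
    finally show "(\<Sum>f\<in>?F. (\<Prod>e\<in>A. if ?m f e then int k else 0) * (\<Prod>e\<in>?E - A. - 1)) = \<dots>" .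
  qed simp
  \<comment> \<open>Passing to the complement gives the sign of the subset expansion and the
    component numbers that occur in \<open>grank\<close>.\<close>
  also have "\<dots> = (\<Sum>D\<in>Pow ?E. (-1) ^ card D * int k ^ (card (?E - D) + kap G (?E - D)))"
    by (rule sum.reindex_bij_witness[of _ "\<lambda>D. ?E - D" "\<lambda>A. ?E - A"]) (auto simp: double_diff)
  also have "\<dots> = (\<Sum>D\<in>Pow ?E. poly (monom ((-1) ^ card D) (grank G ?E - grank G D)) (int k) * int k ^ card (verts G))"
  proof (rule sum.cong)
    fix D assume "D \<in> Pow ?E"
    then have D: "D \<subseteq> ?E" "finite D" using fE finite_subset by auto
    have c: "card (?E - D) + card D = card ?E"
      using D fE by (metis add.commute card_Diff_subset card_mono le_add_diff_inverse)
    have v: "card (verts G) \<le> card ?E + kap G ?E"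
      using kap_delete_le[OF G order_refl] kap_empty[OF G] by simp
    have v': "card (verts G) \<le> card (?E - D) + kap G (?E - D)"
    proof -
      have fD: "finite (?E - D)" using fE by auto
      have "finite S \<Longrightarrow> S \<subseteq> ?E \<Longrightarrow> kap G {} \<le> card S + kap G S" for S
      proof (induction rule: finite_induct)
        case (insert e S)
        then show ?case using kap_insert[OF G, of e S] by (auto split: if_splits)
      qed simp
      then show ?thesis using fD kap_empty[OF G] by (metis Diff_subset)
    qed
    have "grank G ?E - grank G D + card (verts G) = card (?E - D) + kap G (?E - D)"
      using c v v' kap_delete_le[OF G D(1)] kap_empty[OF G] by (simp add: grank_def)
    then show "(-1) ^ card D * int k ^ (card (?E - D) + kap G (?E - D)) =
      poly (monom ((-1) ^ card D) (grank G ?E - grank G D)) (int k) * int k ^ card (verts G)"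
      by (metis (no_types) poly_monom mult.assoc power_add)
  qed simp
  also have "\<dots> = poly (flow_poly G) (int k) * int k ^ card (verts G)"
    by (simp add: flow_poly_def rank_poly_def poly_sum sum_distrib_right)
  finally show ?thesis by simp
qed

text \<open>From three colours on, the factors \<open>k\<close>, \<open>k - 1\<close> and
  \<open>k - 2\<close> are nonzero and may be cancelled.\<close>

lemma poly_eq_if_nat:
  fixes p q :: "int poly"
  assumes "\<And>k :: nat. k \<ge> 3 \<Longrightarrow> poly p (int k) = poly q (int k)"
  shows "p = q"
proof (rule ccontr)
  assume "p \<noteq> q"
  then have "finite {x. poly (p - q) x = 0}" by (intro poly_roots_finite) simp
  moreover have "int ` {3..} \<subseteq> {x. poly (p - q) x = 0}" using assms by auto
  moreover have "infinite (int ` {3..})"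
    using finite_imageD[of int "{3..}"] infinite_Ici by (auto simp: inj_on_def)
  ultimately show False using finite_subset by blast
qed

lemma w2_bool: "w2 k i j = int k * of_bool (i = j) - 1"
  by (simp add: w2_def)

lemma sum_of_bool: "(j :: nat) < k \<Longrightarrow> (\<Sum>m<k. of_bool (m = j) :: int) = 1"
proof -
  assume "j < k"
  then have "(\<Sum>m<k. of_bool (m = j) :: int) = (\<Sum>m\<in>{j}. 1)"
    by (intro sum.mono_neutral_cong_right) auto
  then show ?thesis by simp
qed

lemma sum_w2:
  assumes "j < k"
  shows "(\<Sum>m<k. w2 k m j) = 0"
  using sum_of_bool[OF assms] by (simp add: w2_bool sum_subtractf flip: sum_distrib_left)

lemma sum_w2_w2:
  assumes "i < k" "j < k"
  shows "(\<Sum>m<k. w2 k m i * w2 k m j) = int k * w2 k i j"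
proof -
  have "(\<Sum>m<k. w2 k m i * w2 k m j) = (\<Sum>m<k. int k * (of_bool (m = i) * w2 k i j) - w2 k m j)"
    by (intro sum.cong) (auto simp: w2_bool algebra_simps)
  also have "\<dots> = int k * ((\<Sum>m<k. of_bool (m = i)) * w2 k i j) - (\<Sum>m<k. w2 k m j)"
    by (simp only: sum_subtractf sum_distrib_left sum_distrib_right)
  finally show ?thesis unfolding sum_w2[OF assms(2)] sum_of_bool[OF assms(1)] by simp
qed

text \<open>The square of a weight is \<open>k - 2\<close> times the weight plus
  \<open>k - 1\<close>; so two parallel edges act like one edge, up to a constant that vanishes on
  summation.\<close>

lemma sum_w2_sq_w2:
  assumes "i < k" "j < k"
  shows "(\<Sum>m<k. w2 k m i * w2 k m i * w2 k m j) = (int k - 2) * int k * w2 k i j"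
proof -
  have "(\<Sum>m<k. w2 k m i * w2 k m i * w2 k m j) =
    (\<Sum>m<k. (int k - 2) * (w2 k m i * w2 k m j) + (int k - 1) * w2 k m j)"
    by (intro sum.cong) (auto simp: w2_def algebra_simps)
  also have "\<dots> = (int k - 2) * (\<Sum>m<k. w2 k m i * w2 k m j) + (int k - 1) * (\<Sum>m<k. w2 k m j)"
    by (simp add: sum.distrib sum_distrib_left)
  finally show ?thesis using sum_w2[OF assms(2)] sum_w2_w2[OF assms] by simp
qed

section \<open>Reduction of the flow polynomial at a loop and at an ear\<close>

definition del_edges :: "('v, 'e) mgraph \<Rightarrow> 'e set \<Rightarrow> ('v, 'e) mgraph" where
  "del_edges G S = \<lparr>verts = verts G, edges = edges G - S, ends = ends G\<rparr>"

lemma mgraph_del_edges: "is_mgraph G \<Longrightarrow> is_mgraph (del_edges G S)"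
  by (auto simp: is_mgraph_def del_edges_def)

lemma flow_poly_del_loop:
  assumes G: "is_mgraph G" and e: "e \<in> edges G" "ends G e = {h}"
  shows "flow_poly G = [:- 1, 1:] * flow_poly (del_edges G {e})"
proof (rule poly_eq_if_nat)
  fix k :: nat assume k: "k \<ge> 3"
  have fE: "finite (edges G)" using G by (simp add: is_mgraph_def)
  have "potts G k = (int k - 1) * potts (del_edges G {e}) k"
  proof -
    have "wt k f (ends G e) = int k - 1" for f using e by (simp add: wt_def monochromatic_def)
    then have "(\<Prod>d\<in>edges G. wt k f (ends G d)) = (int k - 1) * (\<Prod>d\<in>edges G - {e}. wt k f (ends G d))" for f
      using prod.remove[OF fE e(1), of "\<lambda>d. wt k f (ends G d)"] by simp
    then show ?thesis by (simp add: potts_def del_edges_def sum_distrib_left)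
  qed
  then have "int k ^ card (verts G) * poly (flow_poly G) (int k) =
    int k ^ card (verts G) * ((int k - 1) * poly (flow_poly (del_edges G {e})) (int k))"
    using flow_poly_potts[OF G, of k] flow_poly_potts[OF mgraph_del_edges[OF G], of "{e}" k]
    by (simp add: del_edges_def algebra_simps)
  then have "poly (flow_poly G) (int k) = (int k - 1) * poly (flow_poly (del_edges G {e})) (int k)"
    using k by simp
  then show "poly (flow_poly G) (int k) = poly ([:- 1, 1:] * flow_poly (del_edges G {e})) (int k)"
    by (simp add: algebra_simps)
qed

text \<open>The local configuration of a degree three vertex with two parallel edges, dual to a vertex
  of degree two on a triangle, and the graph obtained by removing it.\<close>

definition ear :: "('v, 'e) mgraph \<Rightarrow> 'v \<Rightarrow> 'v \<Rightarrow> 'v \<Rightarrow> 'e \<Rightarrow> 'e \<Rightarrow> 'e \<Rightarrow> bool" where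
  "ear G x h y e f g \<longleftrightarrow> x \<in> verts G \<and> x \<noteq> h \<and> x \<noteq> y \<and> e \<noteq> f \<and> e \<noteq> g \<and> f \<noteq> g \<and>
     {d \<in> edges G. x \<in> ends G d} = {e, f, g} \<and>
     ends G e = {x, y} \<and> ends G f = {x, h} \<and> ends G g = {x, h}"

definition remove_ear :: "('v, 'e) mgraph \<Rightarrow> 'v \<Rightarrow> 'v \<Rightarrow> 'v \<Rightarrow> 'e \<Rightarrow> 'e \<Rightarrow> 'e \<Rightarrow> ('v, 'e) mgraph" where
  "remove_ear G x h y e f g =
     \<lparr>verts = verts G - {x}, edges = edges G - {f, g}, ends = (ends G)(e := {h, y})\<rparr>"

lemma ear_verts:
  assumes "is_mgraph G" "ear G x h y e f g"
  shows "e \<in> edges G" "f \<in> edges G" "g \<in> edges G" "h \<in> verts G - {x}" "y \<in> verts G - {x}"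
proof -
  have "e \<in> edges G \<and> f \<in> edges G \<and> g \<in> edges G" using assms(2) unfolding ear_def by blast
  then show "e \<in> edges G" "f \<in> edges G" "g \<in> edges G" by auto
  then have "ends G e \<subseteq> verts G" "ends G f \<subseteq> verts G" using assms(1) by (auto simp: is_mgraph_def)
  then show "h \<in> verts G - {x}" "y \<in> verts G - {x}" using assms(2) by (auto simp: ear_def)
qed

lemma mgraph_remove_ear:
  assumes G: "is_mgraph G" and c: "ear G x h y e f g"
  shows "is_mgraph (remove_ear G x h y e f g)"
proof -
  have "ends G d \<subseteq> verts G - {x}" if "d \<in> edges G - {e, f, g}" for d
    using c G that by (auto simp: ear_def is_mgraph_def)
  moreover have "card {h, y} = 1 \<or> card {h, y} = 2" by (cases "h = y") auto
  ultimately show ?thesis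
    using G ear_verts[OF G c] unfolding is_mgraph_def remove_ear_def by auto
qed

text \<open>Summing over the colour of \<open>x\<close> turns its three edges into
  \<open>(k - 2) * k\<close> times the weight of one edge between \<open>h\<close> and
  \<open>y\<close>; the factor \<open>k\<close> belongs to the lost vertex.\<close>

lemma flow_poly_remove_ear:
  assumes G: "is_mgraph G" and c: "ear G x h y e f g"
  shows "flow_poly G = [:- 2, 1:] * flow_poly (remove_ear G x h y e f g)"
proof (rule poly_eq_if_nat)
  fix k :: nat assume k: "k \<ge> 3"
  let ?G = "remove_ear G x h y e f g"
  let ?W = "verts G - {x}"
  define R where "R = edges G - {e, f, g}"
  have fE: "finite (edges G)" "finite (verts G)" using G by (auto simp: is_mgraph_def)
  note ev = ear_verts[OF G c]
  have x: "x \<in> verts G" "insert x ?W = verts G" using c by (auto simp: ear_def)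
  have E: "edges G = insert e (insert f (insert g R))" using ev by (auto simp: R_def)
  have nx: "x \<notin> ends G d" if "d \<in> R" for d using c that by (auto simp: ear_def R_def)
  have d3: "e \<notin> insert f (insert g R)" "f \<notin> insert g R" "g \<notin> R" "finite R"
    using c fE by (auto simp: ear_def R_def)
  have pr: "(\<Prod>d\<in>edges G. wt k \<phi> (ends G d)) =
    w2 k (\<phi> x) (\<phi> y) * (w2 k (\<phi> x) (\<phi> h) * (w2 k (\<phi> x) (\<phi> h) * (\<Prod>d\<in>R. wt k \<phi> (ends G d))))" for \<phi>
  proof -
    have "(\<Prod>d\<in>edges G. wt k \<phi> (ends G d)) = (\<Prod>d\<in>insert e (insert f (insert g R)). wt k \<phi> (ends G d))"
      using E by simp
    also have "\<dots> = wt k \<phi> (ends G e) * (wt k \<phi> (ends G f) * (wt k \<phi> (ends G g) * (\<Prod>d\<in>R. wt k \<phi> (ends G d))))"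
      using d3 by simp
    finally show ?thesis using c by (simp add: ear_def wt_pair)
  qed
  have inj: "inj_on (\<lambda>(m, \<phi>). \<phi>(x := m)) ({..<k} \<times> (?W \<rightarrow>\<^sub>E {..<k}))"
    by (rule inj_combinator) simp
  have "potts G k = (\<Sum>\<phi>\<in>insert x ?W \<rightarrow>\<^sub>E {..<k}. \<Prod>d\<in>edges G. wt k \<phi> (ends G d))"
    using x by (simp add: potts_def)
  also have "\<dots> = (\<Sum>(m, \<phi>)\<in>{..<k} \<times> (?W \<rightarrow>\<^sub>E {..<k}). \<Prod>d\<in>edges G. wt k (\<phi>(x := m)) (ends G d))"
    unfolding PiE_insert_eq by (subst sum.reindex[OF inj]) (simp add: case_prod_unfold)
  also have "\<dots> = (\<Sum>m<k. \<Sum>\<phi>\<in>?W \<rightarrow>\<^sub>E {..<k}. \<Prod>d\<in>edges G. wt k (\<phi>(x := m)) (ends G d))"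
    by (rule sum.cartesian_product[symmetric])
  also have "\<dots> = (\<Sum>\<phi>\<in>?W \<rightarrow>\<^sub>E {..<k}. \<Sum>m<k. \<Prod>d\<in>edges G. wt k (\<phi>(x := m)) (ends G d))"
    by (rule sum.swap)
  also have "\<dots> = (\<Sum>\<phi>\<in>?W \<rightarrow>\<^sub>E {..<k}. \<Sum>m<k. (w2 k m (\<phi> h) * w2 k m (\<phi> h) * w2 k m (\<phi> y)) * (\<Prod>d\<in>R. wt k \<phi> (ends G d)))"
  proof (intro sum.cong refl)
    fix \<phi> m
    have hx: "h \<noteq> x" "y \<noteq> x" using c by (auto simp: ear_def)
    have "(\<Prod>d\<in>R. wt k (\<phi>(x := m)) (ends G d)) = (\<Prod>d\<in>R. wt k \<phi> (ends G d))"
    proof (rule prod.cong)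
      fix d assume "d \<in> R"
      then have "x \<notin> ends G d" by (rule nx)
      then show "wt k (\<phi>(x := m)) (ends G d) = wt k \<phi> (ends G d)" by (intro wt_cong) auto
    qed simp
    then show "(\<Prod>d\<in>edges G. wt k (\<phi>(x := m)) (ends G d)) =
      (w2 k m (\<phi> h) * w2 k m (\<phi> h) * w2 k m (\<phi> y)) * (\<Prod>d\<in>R. wt k \<phi> (ends G d))"
      unfolding pr using hx by simp
  qed
  also have "\<dots> = (\<Sum>\<phi>\<in>?W \<rightarrow>\<^sub>E {..<k}. ((int k - 2) * int k) * (w2 k (\<phi> h) (\<phi> y) * (\<Prod>d\<in>R. wt k \<phi> (ends G d))))"
  proof (rule sum.cong)
    fix \<phi> assume "\<phi> \<in> ?W \<rightarrow>\<^sub>E {..<k}"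
    then have lt: "\<phi> h < k" "\<phi> y < k" using ev by auto
    show "(\<Sum>m<k. (w2 k m (\<phi> h) * w2 k m (\<phi> h) * w2 k m (\<phi> y)) * (\<Prod>d\<in>R. wt k \<phi> (ends G d))) =
      ((int k - 2) * int k) * (w2 k (\<phi> h) (\<phi> y) * (\<Prod>d\<in>R. wt k \<phi> (ends G d)))"
      using sum_w2_sq_w2[OF lt] by (simp flip: sum_distrib_right)
  qed simp
  also have "\<dots> = ((int k - 2) * int k) * potts ?G k"
  proof -
    have "(\<Prod>d\<in>edges ?G. wt k \<phi> (ends ?G d)) = w2 k (\<phi> h) (\<phi> y) * (\<Prod>d\<in>R. wt k \<phi> (ends G d))" for \<phi>
    proof -
      have "edges ?G = insert e R" using ev c by (auto simp: remove_ear_def ear_def R_def)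
      moreover have "(\<Prod>d\<in>R. wt k \<phi> (ends ?G d)) = (\<Prod>d\<in>R. wt k \<phi> (ends G d))"
        by (intro prod.cong) (auto simp: remove_ear_def R_def)
      moreover have "e \<notin> R" "finite R" using d3 by auto
      ultimately have "(\<Prod>d\<in>edges ?G. wt k \<phi> (ends ?G d)) = wt k \<phi> (ends ?G e) * (\<Prod>d\<in>R. wt k \<phi> (ends G d))"
        by (metis prod.insert)
      then show ?thesis by (simp add: remove_ear_def wt_pair)
    qed
    then show ?thesis by (simp add: potts_def sum_distrib_left) (simp add: remove_ear_def)
  qed
  finally have 1: "potts G k = ((int k - 2) * int k) * potts ?G k" .
  have "card (verts G) = Suc (card (verts ?G))" using x fE by (simp add: remove_ear_def card_Suc_Diff1 del: card_Diff_insert)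
  then have "int k ^ card (verts G) * poly (flow_poly G) (int k) =
    int k ^ card (verts G) * ((int k - 2) * poly (flow_poly ?G) (int k))"
    using 1 flow_poly_potts[OF G, of k] flow_poly_potts[OF mgraph_remove_ear[OF G c], of k]
    by (simp add: algebra_simps)
  then have "poly (flow_poly G) (int k) = (int k - 2) * poly (flow_poly ?G) (int k)"
    using k by simp
  then show "poly (flow_poly G) (int k) = poly ([:- 2, 1:] * flow_poly ?G) (int k)"
    by (simp add: algebra_simps)
qed

section \<open>Factorisation along a three-edge cut\<close>

text \<open>Edges inside \<open>Y\<close> disappear instead of becoming loops, and the others keep
  their names, so that cuts of the contraction are cuts of \<open>G\<close>.\<close>

definition contract :: "('v, 'e) mgraph \<Rightarrow> 'v set \<Rightarrow> 'v \<Rightarrow> ('v, 'e) mgraph" where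
  "contract G Y z = \<lparr>verts = insert z (verts G - Y), edges = {e \<in> edges G. \<not> ends G e \<subseteq> Y},
     ends = (\<lambda>e. (\<lambda>v. if v \<in> Y then z else v) ` ends G e)\<rparr>"

lemma mgraph_contract:
  assumes G: "is_mgraph G"
  shows "is_mgraph (contract G Y z)"
proof -
  have "card ((\<lambda>v. if v \<in> Y then z else v) ` ends G e) = 1 \<or> card ((\<lambda>v. if v \<in> Y then z else v) ` ends G e) = 2"
    if e: "e \<in> edges G" for e
  proof -
    obtain a b where "ends G e = {a, b}" using mgraph_ends[OF G e] by metis
    then show ?thesis by (simp add: card_insert_if del: if_image_distrib)
  qed
  then show ?thesis using G by (auto simp: is_mgraph_def contract_def)
qed

definition swap_colour :: "nat \<Rightarrow> nat \<Rightarrow> nat \<Rightarrow> nat" where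
  "swap_colour p q a = (if a = p then q else if a = q then p else a)"

lemma swap_colour_less: "p < k \<Longrightarrow> q < k \<Longrightarrow> a < k \<Longrightarrow> swap_colour p q a < k"
  by (auto simp: swap_colour_def)

lemma swap_colour_simps [simp]: "swap_colour p q p = q" "swap_colour p q q = p" "swap_colour p q (swap_colour p q a) = a"
  "a \<noteq> p \<Longrightarrow> a \<noteq> q \<Longrightarrow> swap_colour p q a = a"
  by (auto simp: swap_colour_def)

lemma swap_colour_eq_iff [simp]: "swap_colour p q a = swap_colour p q b \<longleftrightarrow> a = b"
  by (auto simp: swap_colour_def)

text \<open>A function on colour triples that is invariant under colour permutations and has vanishing
  marginals is determined up to a scalar.\<close>

definition balanced :: "nat \<Rightarrow> (nat \<Rightarrow> nat \<Rightarrow> nat \<Rightarrow> int) \<Rightarrow> bool" where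
  "balanced k C \<longleftrightarrow>
     (\<forall>p<k. \<forall>q<k. \<forall>a<k. \<forall>b<k. \<forall>c<k.
        C (swap_colour p q a) (swap_colour p q b) (swap_colour p q c) = C a b c) \<and>
     (\<forall>b<k. \<forall>c<k. (\<Sum>m<k. C m b c) = 0) \<and>
     (\<forall>a<k. \<forall>c<k. (\<Sum>m<k. C a m c) = 0) \<and>
     (\<forall>a<k. \<forall>b<k. (\<Sum>m<k. C a b m) = 0)"

lemma sum_one_other:
  fixes F :: "nat \<Rightarrow> int"
  assumes "q < k" "\<And>m. m < k \<Longrightarrow> m \<noteq> q \<Longrightarrow> F m = c"
  shows "(\<Sum>m<k. F m) = F q + (int k - 1) * c"
proof -
  have "(\<Sum>m<k. F m) = F q + (\<Sum>m\<in>{..<k} - {q}. F m)" using assms(1) by (intro sum.remove) auto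
  also have "(\<Sum>m\<in>{..<k} - {q}. F m) = (\<Sum>m\<in>{..<k} - {q}. c)" using assms(2) by (intro sum.cong) auto
  finally show ?thesis using assms(1) by (simp add: of_nat_diff)
qed

lemma sum_two_others:
  fixes F :: "nat \<Rightarrow> int"
  assumes "q < k" "r < k" "q \<noteq> r" "\<And>m. m < k \<Longrightarrow> m \<noteq> q \<Longrightarrow> m \<noteq> r \<Longrightarrow> F m = c"
  shows "(\<Sum>m<k. F m) = F q + F r + (int k - 2) * c"
proof -
  have "(\<Sum>m<k. F m) = F q + (\<Sum>m\<in>{..<k} - {q}. F m)" using assms by (intro sum.remove) auto
  also have "(\<Sum>m\<in>{..<k} - {q}. F m) = F r + (\<Sum>m\<in>{..<k} - {q} - {r}. F m)"
    using assms by (intro sum.remove) auto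
  also have "(\<Sum>m\<in>{..<k} - {q} - {r}. F m) = (\<Sum>m\<in>{..<k} - {q} - {r}. c)"
    using assms by (intro sum.cong) auto
  also have "\<dots> = (int k - 2) * c"
  proof -
    have "card ({..<k} - {q} - {r}) = k - 2" using assms by (simp add: card_Diff_insert)
    moreover have "2 \<le> k" using assms by linarith
    ultimately show ?thesis by (simp add: of_nat_diff)
  qed
  finally show ?thesis by simp
qed

text \<open>Invariance makes the terms of a marginal equal as long as their coincidence pattern is
  the same, so the vanishing sums express every value by the one on the diagonal. The cases are the
  coincidence patterns of three colours.\<close>

lemma balanced_values:
  assumes C: "balanced k C" and k: "k \<ge> 3" and l: "a < k" "b < k" "c < k"
  shows "a = b \<Longrightarrow> b = c \<Longrightarrow> C a b c = C 0 0 0"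
    and "a = b \<Longrightarrow> b \<noteq> c \<Longrightarrow> (int k - 1) * C a b c = - C 0 0 0"
    and "a = c \<Longrightarrow> b \<noteq> c \<Longrightarrow> (int k - 1) * C a b c = - C 0 0 0"
    and "b = c \<Longrightarrow> a \<noteq> c \<Longrightarrow> (int k - 1) * C a b c = - C 0 0 0"
    and "a \<noteq> b \<Longrightarrow> b \<noteq> c \<Longrightarrow> a \<noteq> c \<Longrightarrow> (int k - 1) * (int k - 2) * C a b c = 2 * C 0 0 0"
proof -
  have inv: "C (swap_colour p q a) (swap_colour p q b) (swap_colour p q c) = C a b c"
    if "p < k" "q < k" "a < k" "b < k" "c < k" for p q a b c
    by (rule C[unfolded balanced_def, THEN conjunct1, rule_format]) (use that in auto)
  have m1: "(\<Sum>m<k. C m b c) = 0" if "b < k" "c < k" for b c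
    by (rule C[unfolded balanced_def, THEN conjunct2, THEN conjunct1, rule_format]) (use that in auto)
  have m2: "(\<Sum>m<k. C a m c) = 0" if "a < k" "c < k" for a c
    by (rule C[unfolded balanced_def, THEN conjunct2, THEN conjunct2, THEN conjunct1, rule_format]) (use that in auto)
  have m3: "(\<Sum>m<k. C a b m) = 0" if "a < k" "b < k" for a b
    by (rule C[unfolded balanced_def, THEN conjunct2, THEN conjunct2, THEN conjunct2, rule_format]) (use that in auto)
  have eq: "C a a a = C 0 0 0" if "a < k" for a
    using inv[of 0 a a a a] that k by simp
  have e3: "(int k - 1) * C a a c = - C 0 0 0" if "a < k" "c < k" "a \<noteq> c" for a c
  proof -
    have "(\<Sum>m<k. C a a m) = C a a a + (int k - 1) * C a a c"
    proof (rule sum_one_other)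
      fix m assume "m < k" "m \<noteq> a"
      then show "C a a m = C a a c" using inv[of m c a a m] that by simp
    qed (use that in auto)
    then show ?thesis using m3[of a a] eq[of a] that by simp
  qed
  have e2: "(int k - 1) * C a b a = - C 0 0 0" if "a < k" "b < k" "a \<noteq> b" for a b
  proof -
    have "(\<Sum>m<k. C a m a) = C a a a + (int k - 1) * C a b a"
    proof (rule sum_one_other)
      fix m assume "m < k" "m \<noteq> a"
      then show "C a m a = C a b a" using inv[of m b a m a] that by simp
    qed (use that in auto)
    then show ?thesis using m2[of a a] eq[of a] that by simp
  qed
  have e1: "(int k - 1) * C a b b = - C 0 0 0" if "a < k" "b < k" "a \<noteq> b" for a b
  proof -
    have "(\<Sum>m<k. C m b b) = C b b b + (int k - 1) * C a b b"
    proof (rule sum_one_other)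
      fix m assume "m < k" "m \<noteq> b"
      then show "C m b b = C a b b" using inv[of m a m b b] that by simp
    qed (use that in auto)
    then show ?thesis using m1[of b b] eq[of b] that by simp
  qed
  have e4: "(int k - 1) * (int k - 2) * C a b c = 2 * C 0 0 0"
    if "a < k" "b < k" "c < k" "a \<noteq> b" "b \<noteq> c" "a \<noteq> c" for a b c
  proof -
    \<comment> \<open>For distinct \<open>b\<close> and \<open>c\<close> the running colour meets
      each of them once; the remaining \<open>k - 2\<close> terms are equal.\<close>
    have "(\<Sum>m<k. C m b c) = C b b c + C c b c + (int k - 2) * C a b c"
    proof (rule sum_two_others)
      fix m assume "m < k" "m \<noteq> b" "m \<noteq> c"
      then show "C m b c = C a b c" using inv[of m a m b c] that by simp
    qed (use that in auto)
    then have "C b b c + C c b c + (int k - 2) * C a b c = 0" using m1[of b c] that by simp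
    then have "(int k - 1) * (C b b c + C c b c + (int k - 2) * C a b c) = 0" by simp
    then show ?thesis using e3[of b c] e2[of c b] that by (simp add: algebra_simps)
  qed
  show "a = b \<Longrightarrow> b = c \<Longrightarrow> C a b c = C 0 0 0" using eq[of a] l by simp
  show "a = b \<Longrightarrow> b \<noteq> c \<Longrightarrow> (int k - 1) * C a b c = - C 0 0 0" using e3 l by simp
  show "a = c \<Longrightarrow> b \<noteq> c \<Longrightarrow> (int k - 1) * C a b c = - C 0 0 0" using e2[of c b] l by simp
  show "b = c \<Longrightarrow> a \<noteq> c \<Longrightarrow> (int k - 1) * C a b c = - C 0 0 0" using e1[of a c] l by simp
  show "a \<noteq> b \<Longrightarrow> b \<noteq> c \<Longrightarrow> a \<noteq> c \<Longrightarrow> (int k - 1) * (int k - 2) * C a b c = 2 * C 0 0 0"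
    using e4 l by simp
qed

text \<open>Both functions are multiples of one pattern. The claim is cross-multiplied because a
  diagonal value may be zero.\<close>

lemma balanced_proportional:
  assumes C: "balanced k C" and T: "balanced k T" and k: "k \<ge> 3" and l: "a < k" "b < k" "c < k"
  shows "T a b c * C 0 0 0 = T 0 0 0 * C a b c"
proof -
  note vC = balanced_values[OF C k l] and vT = balanced_values[OF T k l]
  have k1: "int k - 1 \<noteq> 0" "int k - 2 \<noteq> 0" using k by auto
  have cancel: "n \<noteq> 0 \<Longrightarrow> n * T a b c = t * T 0 0 0 \<Longrightarrow> n * C a b c = t * C 0 0 0 \<Longrightarrow> ?thesis" for n t :: int
  proof -
    assume n: "n \<noteq> 0" "n * T a b c = t * T 0 0 0" "n * C a b c = t * C 0 0 0"
    have "n * (T a b c * C 0 0 0) = (n * T a b c) * C 0 0 0" by simp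
    also have "\<dots> = T 0 0 0 * (n * C a b c)" unfolding n by simp
    finally have "n * (T a b c * C 0 0 0) = n * (T 0 0 0 * C a b c)" by simp
    then show ?thesis using n(1) by simp
  qed
  consider "a = b \<and> b = c" | "a = b \<and> b \<noteq> c" | "a = c \<and> b \<noteq> c" | "b = c \<and> a \<noteq> c"
    | "a \<noteq> b \<and> b \<noteq> c \<and> a \<noteq> c" by blast
  then show ?thesis
  proof cases
    case 1
    then show ?thesis using vC(1) vT(1) by simp
  next
    case 2
    then show ?thesis using cancel[of "int k - 1" "-1"] k1 vC(2) vT(2) by simp
  next
    case 3
    then show ?thesis using cancel[of "int k - 1" "-1"] k1 vC(3) vT(3) by simp
  next
    case 4
    then show ?thesis using cancel[of "int k - 1" "-1"] k1 vC(4) vT(4) by simp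
  next
    case 5
    then show ?thesis using cancel[of "(int k - 1) * (int k - 2)" 2] k1 vC(5) vT(5) by simp
  qed
qed

lemma w2_swap_colour: "w2 k (swap_colour p q a) (swap_colour p q b) = w2 k a b"
  by (simp add: w2_def)

text \<open>The boundary state of a piece on \<open>X\<close> with half-edges at \<open>x1\<close>,
  \<open>x2\<close>, \<open>x3\<close>, whose outer ends have colours \<open>a\<close>,
  \<open>b\<close>, \<open>c\<close>. Recolouring the piece gives invariance; the marginals vanish
  because the weights of an edge sum to zero over the colour of one end.\<close>

lemma balanced_boundary:
  fixes S :: "'a \<Rightarrow> 'v set"
  assumes X: "x1 \<in> X" "x2 \<in> X" "x3 \<in> X" "finite X" and S: "\<And>d. d \<in> D \<Longrightarrow> S d \<subseteq> X"
  shows "balanced k (\<lambda>a b c. \<Sum>f\<in>X \<rightarrow>\<^sub>E {..<k}. (\<Prod>d\<in>D. wt k f (S d)) * (w2 k a (f x1) * w2 k b (f x2) * w2 k c (f x3)))"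
    (is "balanced k ?C")
  unfolding balanced_def
proof (intro conjI allI impI)
  fix p q a b c assume lt: "p < k" "q < k" "a < k" "b < k" "c < k"
  let ?t = "swap_colour p q"
  let ?i = "\<lambda>f. \<lambda>v\<in>X. ?t (f v)"
  have i: "?i f \<in> X \<rightarrow>\<^sub>E {..<k}" if "f \<in> X \<rightarrow>\<^sub>E {..<k}" for f
    using that lt swap_colour_less by (fastforce simp: PiE_iff)
  have ii: "?i (?i f) = f" if "f \<in> X \<rightarrow>\<^sub>E {..<k}" for f
    using that by (intro ext) (auto simp: PiE_iff extensional_def restrict_def)
  show "?C (?t a) (?t b) (?t c) = ?C a b c"
  proof (rule sum.reindex_bij_witness[of _ ?i ?i])
    fix f assume f: "f \<in> X \<rightarrow>\<^sub>E {..<k}"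
    have "wt k (?i f) (S d) = wt k f (S d)" if "d \<in> D" for d
    proof -
      have "monochromatic (?i f) (S d) \<longleftrightarrow> monochromatic f (S d)"
        using S[OF that] unfolding monochromatic_def by (simp add: subset_iff)
      then show ?thesis by (simp add: wt_def)
    qed
    then have "(\<Prod>d\<in>D. wt k (?i f) (S d)) = (\<Prod>d\<in>D. wt k f (S d))" by simp
    moreover have "w2 k a (?t u) = w2 k (?t a) u" for a u
      using w2_swap_colour[of k p q a "?t u"] by simp
    ultimately show "(\<Prod>d\<in>D. wt k (?i f) (S d)) * (w2 k a (?i f x1) * w2 k b (?i f x2) * w2 k c (?i f x3)) =
      (\<Prod>d\<in>D. wt k f (S d)) * (w2 k (?t a) (f x1) * w2 k (?t b) (f x2) * w2 k (?t c) (f x3))"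
      using X by simp
  qed (use i ii in auto)
next
  fix b c
  have "(\<Sum>m<k. ?C m b c) = (\<Sum>f\<in>X \<rightarrow>\<^sub>E {..<k}. \<Sum>m<k. (\<Prod>d\<in>D. wt k f (S d)) * (w2 k m (f x1) * w2 k b (f x2) * w2 k c (f x3)))"
    by (rule sum.swap)
  also have "\<dots> = (\<Sum>f\<in>X \<rightarrow>\<^sub>E {..<k}. 0)"
  proof (rule sum.cong)
    fix f assume "f \<in> X \<rightarrow>\<^sub>E {..<k}"
    then have "f x1 < k" using X by auto
    then show "(\<Sum>m<k. (\<Prod>d\<in>D. wt k f (S d)) * (w2 k m (f x1) * w2 k b (f x2) * w2 k c (f x3))) = 0"
      using sum_w2 by (simp add: mult.assoc flip: sum_distrib_left sum_distrib_right)
  qed simp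
  finally show "(\<Sum>m<k. ?C m b c) = 0" by simp
next
  fix a c
  have "(\<Sum>m<k. ?C a m c) = (\<Sum>f\<in>X \<rightarrow>\<^sub>E {..<k}. \<Sum>m<k. w2 k m (f x2) * ((\<Prod>d\<in>D. wt k f (S d)) * (w2 k a (f x1) * w2 k c (f x3))))"
    by (subst sum.swap) (simp add: mult_ac)
  also have "\<dots> = (\<Sum>f\<in>X \<rightarrow>\<^sub>E {..<k}. 0)"
  proof (rule sum.cong)
    fix f assume "f \<in> X \<rightarrow>\<^sub>E {..<k}"
    then have "f x2 < k" using X by auto
    then show "(\<Sum>m<k. w2 k m (f x2) * ((\<Prod>d\<in>D. wt k f (S d)) * (w2 k a (f x1) * w2 k c (f x3)))) = 0"
      using sum_w2 by (simp flip: sum_distrib_right)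
  qed simp
  finally show "(\<Sum>m<k. ?C a m c) = 0" by simp
next
  fix a b
  have "(\<Sum>m<k. ?C a b m) = (\<Sum>f\<in>X \<rightarrow>\<^sub>E {..<k}. \<Sum>m<k. w2 k m (f x3) * ((\<Prod>d\<in>D. wt k f (S d)) * (w2 k a (f x1) * w2 k b (f x2))))"
    by (subst sum.swap) (simp add: mult_ac)
  also have "\<dots> = (\<Sum>f\<in>X \<rightarrow>\<^sub>E {..<k}. 0)"
  proof (rule sum.cong)
    fix f assume "f \<in> X \<rightarrow>\<^sub>E {..<k}"
    then have "f x3 < k" using X by auto
    then show "(\<Sum>m<k. w2 k m (f x3) * ((\<Prod>d\<in>D. wt k f (S d)) * (w2 k a (f x1) * w2 k b (f x2)))) = 0"
      using sum_w2 by (simp flip: sum_distrib_right)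
  qed simp
  finally show "(\<Sum>m<k. ?C a b m) = 0" by simp
qed

lemma sum_PiE_Un:
  fixes F :: "('v \<Rightarrow> nat) \<Rightarrow> int"
  assumes "X \<inter> Y = {}"
  shows "(\<Sum>\<phi>\<in>X \<union> Y \<rightarrow>\<^sub>E B. F \<phi>) =
    (\<Sum>g\<in>Y \<rightarrow>\<^sub>E B. \<Sum>f\<in>X \<rightarrow>\<^sub>E B. F (\<lambda>v. if v \<in> X then f v else g v))"
proof -
  have "(\<Sum>g\<in>Y \<rightarrow>\<^sub>E B. \<Sum>f\<in>X \<rightarrow>\<^sub>E B. F (\<lambda>v. if v \<in> X then f v else g v)) =
    (\<Sum>(g, f)\<in>(Y \<rightarrow>\<^sub>E B) \<times> (X \<rightarrow>\<^sub>E B). F (\<lambda>v. if v \<in> X then f v else g v))"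
    by (rule sum.cartesian_product)
  also have "\<dots> = (\<Sum>\<phi>\<in>X \<union> Y \<rightarrow>\<^sub>E B. F \<phi>)"
    by (rule sum.reindex_bij_witness[of _ "\<lambda>\<phi>. (restrict \<phi> Y, restrict \<phi> X)"
          "\<lambda>(g, f) v. if v \<in> X then f v else g v"])
      (use assms in \<open>auto simp: PiE_iff extensional_def restrict_def fun_eq_iff split: if_splits\<close>)
  finally show ?thesis by simp
qed

text \<open>A colouring of \<open>Y\<close> sees the part on \<open>X\<close> only through its
  boundary state at the colours of \<open>y1\<close>, \<open>y2\<close>, \<open>y3\<close>.\<close>

lemma potts_split:
  assumes G: "is_mgraph G" and V: "verts G = X \<union> Y" "X \<inter> Y = {}"
    and E: "edges G = DX \<union> DY \<union> {e1, e2, e3}" "DX \<inter> DY = {}"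
    "(DX \<union> DY) \<inter> {e1, e2, e3} = {}" "e1 \<noteq> e2" "e2 \<noteq> e3" "e1 \<noteq> e3"
    and DX: "\<And>d. d \<in> DX \<Longrightarrow> ends G d \<subseteq> X" and DY: "\<And>d. d \<in> DY \<Longrightarrow> ends G d \<subseteq> Y"
    and c: "ends G e1 = {x1, y1}" "ends G e2 = {x2, y2}" "ends G e3 = {x3, y3}"
    and x: "x1 \<in> X" "x2 \<in> X" "x3 \<in> X" and y: "y1 \<in> Y" "y2 \<in> Y" "y3 \<in> Y"
  shows "potts G k = (\<Sum>g\<in>Y \<rightarrow>\<^sub>E {..<k}. (\<Prod>d\<in>DY. wt k g (ends G d)) *
    (\<Sum>f\<in>X \<rightarrow>\<^sub>E {..<k}. (\<Prod>d\<in>DX. wt k f (ends G d)) * (w2 k (g y1) (f x1) * w2 k (g y2) (f x2) * w2 k (g y3) (f x3))))"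
proof -
  have "finite (edges G)" using G by (simp add: is_mgraph_def)
  then have f: "finite DX" "finite DY" using E(1) by auto
  have w2s: "w2 k a b = w2 k b a" for a b by (auto simp: w2_def)
  show ?thesis
    unfolding potts_def V(1) sum_PiE_Un[OF V(2)] sum_distrib_left
  proof (intro sum.cong refl)
    fix g f :: "'a \<Rightarrow> nat"
    let ?h = "\<lambda>v. if v \<in> X then f v else g v"
    have "(\<Prod>d\<in>edges G. wt k ?h (ends G d)) = (\<Prod>d\<in>DX \<union> DY. wt k ?h (ends G d)) * (\<Prod>d\<in>{e1, e2, e3}. wt k ?h (ends G d))"
      unfolding E(1) using f E by (intro prod.union_disjoint) auto
    also have "(\<Prod>d\<in>DX \<union> DY. wt k ?h (ends G d)) = (\<Prod>d\<in>DX. wt k ?h (ends G d)) * (\<Prod>d\<in>DY. wt k ?h (ends G d))"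
      using f E by (intro prod.union_disjoint) auto
    also have "(\<Prod>d\<in>DX. wt k ?h (ends G d)) = (\<Prod>d\<in>DX. wt k f (ends G d))"
      using DX by (intro prod.cong refl wt_cong) auto
    also have "(\<Prod>d\<in>DY. wt k ?h (ends G d)) = (\<Prod>d\<in>DY. wt k g (ends G d))"
      using DY V(2) by (intro prod.cong refl wt_cong) auto
    also have "(\<Prod>d\<in>{e1, e2, e3}. wt k ?h (ends G d)) = w2 k (g y1) (f x1) * w2 k (g y2) (f x2) * w2 k (g y3) (f x3)"
    proof -
      have "y1 \<notin> X" "y2 \<notin> X" "y3 \<notin> X" using y V(2) by auto
      then show ?thesis using E(4-6) c x w2s by (simp add: wt_pair)
    qed
    finally show "(\<Prod>d\<in>edges G. wt k ?h (ends G d)) = (\<Prod>d\<in>DY. wt k g (ends G d)) *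
       ((\<Prod>d\<in>DX. wt k f (ends G d)) * (w2 k (g y1) (f x1) * w2 k (g y2) (f x2) * w2 k (g y3) (f x3)))"
      by simp
  qed
qed

lemma sum_PiE_single:
  fixes F :: "('v \<Rightarrow> nat) \<Rightarrow> int"
  shows "(\<Sum>g\<in>{z} \<rightarrow>\<^sub>E {..<k}. F g) = (\<Sum>m<k. F (\<lambda>v\<in>{z}. m))"
  by (rule sum.reindex_bij_witness[of _ "\<lambda>m. \<lambda>v\<in>{z}. m" "\<lambda>g. g z"])
    (auto simp: PiE_iff extensional_def restrict_def fun_eq_iff intro!: arg_cong[of _ _ F])

text \<open>The boundary state of \<open>X\<close> is proportional to that of a single vertex, so
  \<open>X\<close> may be replaced by a vertex; the factor is read off from the graph in which
  \<open>Y\<close> has become a vertex.\<close>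

lemma flow_poly_three_cut:
  assumes G: "is_mgraph G" and X: "X \<subseteq> verts G" and Y: "Y = verts G - X"
    and three: "card (edge_cut G X) = 3" and z: "z \<in> Y" "z' \<in> X"
  shows "flow_poly G * ([:- 1, 1:] * [:- 2, 1:]) = flow_poly (contract G Y z) * flow_poly (contract G X z')"
proof (rule poly_eq_if_nat)
  fix k :: nat assume k: "k \<ge> 3"
  let ?A = "contract G Y z" and ?B = "contract G X z'"
  have fin: "finite (verts G)" "finite (edges G)" using G by (auto simp: is_mgraph_def)
  have fX: "finite X" "finite Y" using X Y fin finite_subset by auto
  obtain e1 e2 e3 where C: "edge_cut G X = {e1, e2, e3}" "e1 \<noteq> e2" "e2 \<noteq> e3" "e1 \<noteq> e3"
    using three by (metis card_3_iff)
  have split: "\<exists>x y. ends G d = {x, y} \<and> x \<in> X \<and> y \<in> Y" if "d \<in> edge_cut G X" for d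
  proof -
    have dE: "d \<in> edges G" "ends G d \<inter> X \<noteq> {}" "ends G d - X \<noteq> {}" using that by (auto simp: edge_cut_def)
    obtain a b where ab: "ends G d = {a, b}" "a \<in> verts G" "b \<in> verts G" using mgraph_ends[OF G dE(1)] by metis
    then have "(a \<in> X \<and> b \<in> Y) \<or> (b \<in> X \<and> a \<in> Y)" using dE Y by auto
    then show ?thesis using ab(1) by (metis insert_commute)
  qed
  obtain x1 y1 where c1: "ends G e1 = {x1, y1}" "x1 \<in> X" "y1 \<in> Y" using split[of e1] C by auto
  obtain x2 y2 where c2: "ends G e2 = {x2, y2}" "x2 \<in> X" "y2 \<in> Y" using split[of e2] C by auto
  obtain x3 y3 where c3: "ends G e3 = {x3, y3}" "x3 \<in> X" "y3 \<in> Y" using split[of e3] C by auto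
  define DX where "DX = {d \<in> edges G. ends G d \<subseteq> X}"
  define DY where "DY = {d \<in> edges G. ends G d \<subseteq> Y}"
  have XY: "X \<inter> Y = {}" "verts G = X \<union> Y" using X Y by auto
  have nonempty: "ends G d \<noteq> {}" "ends G d \<subseteq> verts G" if "d \<in> edges G" for d
    using G that by (auto simp: is_mgraph_def)
  have E: "edges G = DX \<union> DY \<union> {e1, e2, e3}"
  proof -
    have "d \<in> DX \<union> DY \<union> edge_cut G X" if "d \<in> edges G" for d
    proof -
      have "ends G d \<subseteq> X \<union> Y" using nonempty(2)[OF that] XY(2) by simp
      then show ?thesis using that XY(1) unfolding DX_def DY_def edge_cut_def by blast
    qed
    moreover have "DX \<union> DY \<union> edge_cut G X \<subseteq> edges G" by (auto simp: DX_def DY_def edge_cut_def)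
    ultimately show ?thesis using C(1) by blast
  qed
  have dd: "DX \<inter> DY = {}" "(DX \<union> DY) \<inter> {e1, e2, e3} = {}"
  proof -
    { fix d assume "d \<in> DX" "d \<in> DY"
      then have "ends G d \<subseteq> X \<inter> Y" "d \<in> edges G" by (auto simp: DX_def DY_def)
      then have False using nonempty(1) XY(1) by simp }
    then show "DX \<inter> DY = {}" by blast
    have "(DX \<union> DY) \<inter> edge_cut G X = {}" using XY by (auto simp: DX_def DY_def edge_cut_def)
    then show "(DX \<union> DY) \<inter> {e1, e2, e3} = {}" using C by simp
  qed
  define P where "P a b c = (\<Sum>f\<in>X \<rightarrow>\<^sub>E {..<k}. (\<Prod>d\<in>DX. wt k f (ends G d)) *
    (w2 k a (f x1) * w2 k b (f x2) * w2 k c (f x3)))" for a b c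
  \<comment> \<open>The boundary state of one vertex with three half-edges and no inner
    edge.\<close>
  define T where "T a b c = (\<Sum>f\<in>{z'} \<rightarrow>\<^sub>E {..<k}. (\<Prod>d\<in>({} :: 'b set). wt k f (ends G d)) *
    (w2 k a (f z') * w2 k b (f z') * w2 k c (f z')))" for a b c
  have bP: "balanced k P" unfolding P_def
    by (rule balanced_boundary) (use c1 c2 c3 fX in \<open>auto simp: DX_def\<close>)
  have bT: "balanced k T" unfolding T_def by (rule balanced_boundary) auto
  have pG: "potts G k = (\<Sum>g\<in>Y \<rightarrow>\<^sub>E {..<k}. (\<Prod>d\<in>DY. wt k g (ends G d)) * P (g y1) (g y2) (g y3))"
    unfolding P_def
    by (rule potts_split[OF G XY(2,1) E dd C(2-4) _ _ c1(1) c2(1) c3(1)])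
      (use c1 c2 c3 in \<open>auto simp: DX_def DY_def\<close>)
  have pA: "potts ?A k = (\<Sum>g\<in>{z} \<rightarrow>\<^sub>E {..<k}. (\<Prod>d\<in>({} :: 'b set). wt k g (ends ?A d)) * P (g z) (g z) (g z))"
  proof -
    have EA: "edges ?A = DX \<union> {} \<union> {e1, e2, e3}"
    proof -
      have "\<not> ends G d \<subseteq> Y" if "d \<in> DX" for d
        using that nonempty(1)[of d] XY(1) unfolding DX_def by blast
      moreover have "\<not> ends G e1 \<subseteq> Y" "\<not> ends G e2 \<subseteq> Y" "\<not> ends G e3 \<subseteq> Y"
        using c1 c2 c3 XY(1) by auto
      moreover have "ends G d \<subseteq> Y" if "d \<in> DY" for d using that unfolding DY_def by blast
      ultimately have "{e \<in> edges G. \<not> ends G e \<subseteq> Y} = DX \<union> {e1, e2, e3}"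
        unfolding E by blast
      then show ?thesis by (simp add: contract_def)
    qed
    have endsX: "ends ?A d = ends G d" if "d \<in> DX" for d
    proof -
      have "v \<notin> Y" if "v \<in> ends G d" for v using that \<open>d \<in> DX\<close> XY by (auto simp: DX_def)
      then show ?thesis by (auto simp: contract_def)
    qed
    have "x1 \<notin> Y" "x2 \<notin> Y" "x3 \<notin> Y" using c1 c2 c3 XY by auto
    then have e: "ends ?A e1 = {x1, z}" "ends ?A e2 = {x2, z}" "ends ?A e3 = {x3, z}"
      using c1 c2 c3 by (auto simp: contract_def)
    have V: "verts ?A = X \<union> {z}" using XY z by (auto simp: contract_def)
    have "potts ?A k = (\<Sum>g\<in>{z} \<rightarrow>\<^sub>E {..<k}. (\<Prod>d\<in>({} :: 'b set). wt k g (ends ?A d)) *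
      (\<Sum>f\<in>X \<rightarrow>\<^sub>E {..<k}. (\<Prod>d\<in>DX. wt k f (ends ?A d)) * (w2 k (g z) (f x1) * w2 k (g z) (f x2) * w2 k (g z) (f x3))))"
      by (rule potts_split[OF mgraph_contract[OF G] V _ EA _ _ C(2-4) _ _ e])
        (use c1 c2 c3 z XY dd endsX in \<open>auto simp: DX_def\<close>)
    also have "(\<lambda>f. \<Prod>d\<in>DX. wt k f (ends ?A d)) = (\<lambda>f. \<Prod>d\<in>DX. wt k f (ends G d))"
      using endsX by simp
    finally show ?thesis unfolding P_def using endsX by simp
  qed
  have pB: "potts ?B k = (\<Sum>g\<in>Y \<rightarrow>\<^sub>E {..<k}. (\<Prod>d\<in>DY. wt k g (ends G d)) * T (g y1) (g y2) (g y3))"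
  proof -
    have EB: "edges ?B = {} \<union> DY \<union> {e1, e2, e3}"
    proof -
      have "\<not> ends G d \<subseteq> X" if "d \<in> DY" for d
        using that nonempty(1)[of d] XY(1) unfolding DY_def by blast
      moreover have "\<not> ends G e1 \<subseteq> X" "\<not> ends G e2 \<subseteq> X" "\<not> ends G e3 \<subseteq> X"
        using c1 c2 c3 XY(1) by auto
      moreover have "ends G d \<subseteq> X" if "d \<in> DX" for d using that unfolding DX_def by blast
      ultimately have "{e \<in> edges G. \<not> ends G e \<subseteq> X} = DY \<union> {e1, e2, e3}"
        unfolding E by blast
      then show ?thesis by (simp add: contract_def)
    qed
    have endsY: "ends ?B d = ends G d" if "d \<in> DY" for d
    proof -
      have "v \<notin> X" if "v \<in> ends G d" for v using that \<open>d \<in> DY\<close> XY by (auto simp: DY_def)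
      then show ?thesis by (auto simp: contract_def)
    qed
    have "y1 \<notin> X" "y2 \<notin> X" "y3 \<notin> X" using c1 c2 c3 XY by auto
    then have e: "ends ?B e1 = {z', y1}" "ends ?B e2 = {z', y2}" "ends ?B e3 = {z', y3}"
      using c1 c2 c3 by (auto simp: contract_def)
    have V: "verts ?B = {z'} \<union> Y" using XY z by (auto simp: contract_def)
    have "potts ?B k = (\<Sum>g\<in>Y \<rightarrow>\<^sub>E {..<k}. (\<Prod>d\<in>DY. wt k g (ends ?B d)) *
      (\<Sum>f\<in>{z'} \<rightarrow>\<^sub>E {..<k}. (\<Prod>d\<in>({} :: 'b set). wt k f (ends ?B d)) * (w2 k (g y1) (f z') * w2 k (g y2) (f z') * w2 k (g y3) (f z'))))"
      by (rule potts_split[OF mgraph_contract[OF G] V _ EB _ _ C(2-4) _ _ e])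
        (use c1 c2 c3 z XY dd endsY in \<open>auto simp: DY_def\<close>)
    then show ?thesis unfolding T_def using endsY by simp
  qed
  \<comment> \<open>The value \<open>(k - 1)^3 - (k - 1)\<close>, which is the source of the roots 1
    and 2 on the left-hand side.\<close>
  have T0: "T 0 0 0 = int k * (int k - 1) * (int k - 2)"
  proof -
    have "T 0 0 0 = (\<Sum>m<k. w2 k 0 m * w2 k 0 m * w2 k 0 m)"
      unfolding T_def sum_PiE_single by simp
    also have "\<dots> = w2 k 0 0 * w2 k 0 0 * w2 k 0 0 + (int k - 1) * (- 1)"
      by (rule sum_one_other) (use k in \<open>auto simp: w2_def\<close>)
    finally show ?thesis by (simp add: w2_def algebra_simps)
  qed
  \<comment> \<open>By invariance every colour of the contracted vertex contributes the
    same.\<close>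
  have A0: "potts ?A k = int k * P 0 0 0"
  proof -
    have "potts ?A k = (\<Sum>m<k. P m m m)" unfolding pA sum_PiE_single by simp
    also have "\<dots> = (\<Sum>m<k. P 0 0 0)"
    proof (rule sum.cong)
      fix m assume "m \<in> {..<k}"
      then show "P m m m = P 0 0 0" by (intro balanced_values(1)[OF bP k]) auto
    qed simp
    finally show ?thesis by simp
  qed
  have "potts ?A k * potts ?B k = int k * (\<Sum>g\<in>Y \<rightarrow>\<^sub>E {..<k}. (\<Prod>d\<in>DY. wt k g (ends G d)) * (T (g y1) (g y2) (g y3) * P 0 0 0))"
    unfolding A0 pB by (simp add: sum_distrib_left sum_distrib_right mult_ac)
  also have "\<dots> = int k * (\<Sum>g\<in>Y \<rightarrow>\<^sub>E {..<k}. (\<Prod>d\<in>DY. wt k g (ends G d)) * (T 0 0 0 * P (g y1) (g y2) (g y3)))"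
  proof -
    have "T (g y1) (g y2) (g y3) * P 0 0 0 = T 0 0 0 * P (g y1) (g y2) (g y3)" if "g \<in> Y \<rightarrow>\<^sub>E {..<k}" for g
      by (rule balanced_proportional[OF bP bT k]) (use that c1 c2 c3 in auto)
    then show ?thesis by simp
  qed
  also have "\<dots> = int k * T 0 0 0 * potts G k"
    unfolding pG by (simp add: sum_distrib_left mult_ac)
  finally have main: "potts ?A k * potts ?B k = int k * int k * (int k - 1) * (int k - 2) * potts G k"
    unfolding T0 by simp
  have cA: "card (verts ?A) = card X + 1" "card (verts ?B) = card Y + 1"
  proof -
    have "verts ?A = insert z X" "verts ?B = insert z' Y" using XY z by (auto simp: contract_def)
    moreover have "z \<notin> X" "z' \<notin> Y" using z XY by auto
    ultimately show "card (verts ?A) = card X + 1" "card (verts ?B) = card Y + 1" using fX by simp_all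
  qed
  have cG: "card (verts G) = card X + card Y" using XY fX by (simp add: card_Un_disjoint)
  have "int k ^ (card X + 1 + (card Y + 1)) * (poly (flow_poly ?A) (int k) * poly (flow_poly ?B) (int k)) =
    potts ?A k * potts ?B k"
    unfolding flow_poly_potts[OF mgraph_contract[OF G], symmetric] cA by (simp add: power_add mult_ac)
  also have "\<dots> = int k ^ (card X + 1 + (card Y + 1)) * (poly (flow_poly G) (int k) * ((int k - 1) * (int k - 2)))"
    unfolding main flow_poly_potts[OF G, symmetric] cG by (simp add: power_add mult_ac)
  finally have "poly (flow_poly ?A) (int k) * poly (flow_poly ?B) (int k) =
    poly (flow_poly G) (int k) * ((int k - 1) * (int k - 2))"
    using k by simp
  then show "poly (flow_poly G * ([:- 1, 1:] * [:- 2, 1:])) (int k) = poly (flow_poly ?A * flow_poly ?B) (int k)"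
    by (simp add: algebra_simps)
qed

section \<open>Integral roots and the number of three-edge cuts\<close>

text \<open>Complex roots are tested, so that a monic polynomial with this property splits into
  integral linear factors.\<close>

definition integral_roots :: "int poly \<Rightarrow> bool" where
  "integral_roots p \<longleftrightarrow> (\<forall>z :: complex. poly (map_poly of_int p) z = 0 \<longrightarrow> z \<in> \<int>)"

lemma map_poly_of_int_mult:
  "map_poly of_int (p * q) = (map_poly of_int p * map_poly of_int q :: complex poly)"
  by (rule poly_eqI) (simp add: coeff_map_poly coeff_mult)

lemma poly_map_poly_of_int: "poly (map_poly of_int p) (of_int x) = (of_int (poly p x) :: complex)"
  by (induction p) (auto simp: map_poly_pCons)

lemma integral_roots_dvd:
  assumes "p dvd q" "integral_roots q"
  shows "integral_roots p"
  using assms by (auto simp: integral_roots_def dvd_def map_poly_of_int_mult)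

lemma integral_roots_mult: "integral_roots p \<Longrightarrow> integral_roots q \<Longrightarrow> integral_roots (p * q)"
  by (auto simp: integral_roots_def map_poly_of_int_mult)

lemma integral_roots_linear: "integral_roots [:- a, 1:]"
proof -
  have "z = of_int a" if "z - of_int a = 0" for z :: complex using that by simp
  then show ?thesis by (auto simp: integral_roots_def map_poly_pCons)
qed

text \<open>A complex root exists as long as the degree is positive; being an integer, it can be
  divided off within the integral polynomials.\<close>

lemma integral_roots_split:
  assumes "lead_coeff p = 1" "integral_roots p"
  shows "\<exists>as. p = (\<Prod>a\<leftarrow>as. [:- a, 1:])"
  using assms
proof (induction "degree p" arbitrary: p)
  case 0
  then have "p = 1" using degree_eq_zeroE[of p] by (metis coeff_pCons_0 lead_coeff_pCons(2) one_pCons degree_pCons_0 lead_coeff_pCons(1))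
  then show ?case by (intro exI[of _ "[]"]) simp
next
  case (Suc n)
  let ?q = "map_poly of_int p :: complex poly"
  have "degree ?q = degree p" by (rule degree_map_poly) simp
  then have "\<not> constant (poly ?q)" using Suc(2) by (simp add: constant_degree)
  then obtain z where z: "poly ?q z = 0" using fundamental_theorem_of_algebra by blast
  then obtain a where "z = of_int a" using Suc(4) by (auto simp: integral_roots_def Ints_def)
  then have "poly p a = 0" using z by (simp add: poly_map_poly_of_int)
  then obtain q where q: "p = [:- a, 1:] * q" using poly_eq_0_iff_dvd by (metis dvdE)
  have "q \<noteq> 0" using q Suc(2) by auto
  then have "degree p = Suc (degree q)" unfolding q by (subst degree_mult_eq) auto
  moreover have "lead_coeff q = 1" using Suc(3) unfolding q lead_coeff_mult by simp
  moreover have "integral_roots q" by (rule integral_roots_dvd[OF _ Suc(4)]) (unfold q, rule dvd_triv_right)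
  ultimately obtain as where "q = (\<Prod>a\<leftarrow>as. [:- a, 1:])" using Suc(1)[of q] Suc(2) by auto
  then show ?case using q by (intro exI[of _ "a # as"]) simp
qed

lemma coeff_linear_mult:
  "coeff ([:- a, 1:] * p) m = (if m = 0 then 0 else coeff p (m - 1)) - a * coeff (p :: int poly) m"
  by (cases m) auto

text \<open>Vieta's formulas, with the second elementary symmetric function written through power
  sums. Indices are given additively, so that short lists need no truncated subtraction.\<close>

lemma coeffs_prod_linear:
  fixes as :: "int list"
  defines "P \<equiv> \<Prod>a\<leftarrow>as. [:- a, 1:]"
  shows "coeff P (length as) = 1" "\<And>m. m > length as \<Longrightarrow> coeff P m = 0"
    and "\<And>m. Suc m = length as \<Longrightarrow> coeff P m = - sum_list as"
    and "\<And>m. m + 2 = length as \<Longrightarrow> 2 * coeff P m = (sum_list as)\<^sup>2 - (\<Sum>a\<leftarrow>as. a\<^sup>2)"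
proof -
  have "coeff P (length as) = 1 \<and> (\<forall>m. m > length as \<longrightarrow> coeff P m = 0) \<and>
    (\<forall>m. Suc m = length as \<longrightarrow> coeff P m = - sum_list as) \<and>
    (\<forall>m. m + 2 = length as \<longrightarrow> 2 * coeff P m = (sum_list as)\<^sup>2 - (\<Sum>a\<leftarrow>as. a\<^sup>2))"
    unfolding P_def
  proof (induction as)
    case (Cons a as)
    let ?Q = "\<Prod>a\<leftarrow>as. [:- a, 1:]"
    have IH: "coeff ?Q (length as) = 1" "\<And>m. m > length as \<Longrightarrow> coeff ?Q m = 0"
      "\<And>m. Suc m = length as \<Longrightarrow> coeff ?Q m = - sum_list as"
      "\<And>m. m + 2 = length as \<Longrightarrow> 2 * coeff ?Q m = (sum_list as)\<^sup>2 - (\<Sum>a\<leftarrow>as. a\<^sup>2)"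
      using Cons.IH by auto
    have eq: "(\<Prod>a\<leftarrow>a # as. [:- a, 1:]) = [:- a, 1:] * ?Q" by simp
    show ?case
      unfolding eq coeff_linear_mult
    proof (intro conjI allI impI)
      fix m assume m: "Suc m = length (a # as)"
      show "(if m = 0 then 0 else coeff ?Q (m - 1)) - a * coeff ?Q m = - sum_list (a # as)"
      proof (cases m)
        case 0
        then show ?thesis using m IH(1) by simp
      next
        case (Suc l)
        then have l: "length as = Suc l" using m by simp
        then have "coeff ?Q l = - sum_list as" "coeff ?Q (Suc l) = 1" using IH(1,3) by auto
        then show ?thesis using Suc by simp
      qed
    next
      fix m assume m: "m + 2 = length (a # as)"
      then have 1: "coeff ?Q m = - sum_list as" by (intro IH(3)) simp
      show "2 * ((if m = 0 then 0 else coeff ?Q (m - 1)) - a * coeff ?Q m) =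
        (sum_list (a # as))\<^sup>2 - (\<Sum>a\<leftarrow>a # as. a\<^sup>2)"
      proof (cases m)
        case 0
        then have "length as = 1" using m by simp
        then obtain b where "as = [b]" by (auto simp: length_Suc_conv)
        then show ?thesis using 0 1 by (simp add: power2_eq_square algebra_simps)
      next
        case (Suc l)
        then have "2 * coeff ?Q l = (sum_list as)\<^sup>2 - (\<Sum>a\<leftarrow>as. a\<^sup>2)" using m by (intro IH(4)) simp
        then show ?thesis using Suc 1 by (simp add: power2_eq_square algebra_simps)
      qed
    qed (use IH(1,2) in auto)
  qed auto
  then show "coeff P (length as) = 1" "\<And>m. m > length as \<Longrightarrow> coeff P m = 0"
    "\<And>m. Suc m = length as \<Longrightarrow> coeff P m = - sum_list as"
    "\<And>m. m + 2 = length as \<Longrightarrow> 2 * coeff P m = (sum_list as)\<^sup>2 - (\<Sum>a\<leftarrow>as. a\<^sup>2)" by auto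
qed

lemma order_prod_linear: "order 1 (\<Prod>a\<leftarrow>as. [:- a, 1:]) = count_list as (1 :: int)"
proof (induction as)
  case (Cons a as)
  have nz: "(\<Prod>a\<leftarrow>bs. [:- a, 1:]) \<noteq> 0" for bs :: "int list"
    by (auto simp: prod_list_zero_iff)
  have "[:- a, 1:] * (\<Prod>a\<leftarrow>as. [:- a, 1:]) \<noteq> 0" using nz[of "a # as"] by simp
  then have "order 1 (\<Prod>a\<leftarrow>a # as. [:- a, 1:]) = order 1 [:- a, 1:] + order 1 (\<Prod>a\<leftarrow>as. [:- a, 1:])"
    by (simp only: list.map prod_list.Cons) (rule order_mult)
  moreover have "order 1 [:- a, 1:] = (if a = 1 then 1 else 0)"
    using order_power_n_n[of 1 1] order_0I[of "[:- a, 1:]" 1] by auto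
  ultimately show ?case using Cons by simp
qed simp

text \<open>A product of two consecutive integers is never negative. At the root 1 the product
  \<open>(a - 2) * (a - 3)\<close> is 2 and \<open>a - 2\<close> is \<open>-1\<close>, whence the
  counts.\<close>

lemma sum_list_root_bounds:
  assumes "\<And>a. a \<in> set as \<Longrightarrow> (a :: int) \<ge> 1"
  shows "(\<Sum>a\<leftarrow>as. a\<^sup>2) - 5 * sum_list as + 6 * int (length as) \<ge> 2 * int (count_list as 1)"
    and "sum_list as - 2 * int (length as) \<ge> - int (count_list as 1)"
proof -
  have "(\<Sum>a\<leftarrow>as. a\<^sup>2) - 5 * sum_list as + 6 * int (length as) \<ge> 2 * int (count_list as 1) \<and>
    sum_list as - 2 * int (length as) \<ge> - int (count_list as 1)"
    using assms
  proof (induction as)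
    case (Cons a as)
    have "(a - 2) * (a - 3) \<ge> 0"
      by (cases "a \<le> 2") (auto intro: mult_nonpos_nonpos mult_nonneg_nonneg)
    then have "a\<^sup>2 - 5 * a + 6 \<ge> 0" by (simp add: power2_eq_square algebra_simps)
    moreover have "a \<ge> 1" using Cons.prems by simp
    moreover have "(\<Sum>a\<leftarrow>as. a\<^sup>2) - 5 * sum_list as + 6 * int (length as) \<ge> 2 * int (count_list as 1)"
      "sum_list as - 2 * int (length as) \<ge> - int (count_list as 1)" using Cons by auto
    ultimately show ?case by (cases "a = 1") auto
  qed simp
  then show "(\<Sum>a\<leftarrow>as. a\<^sup>2) - 5 * sum_list as + 6 * int (length as) \<ge> 2 * int (count_list as 1)"
    "sum_list as - 2 * int (length as) \<ge> - int (count_list as 1)" by auto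
qed

section \<open>The first coefficients for three-edge-connected graphs\<close>

definition three_conn :: "('v, 'e) mgraph \<Rightarrow> bool" where
  "three_conn G \<longleftrightarrow> is_mgraph G \<and> verts G \<noteq> {} \<and>
     (\<forall>U. U \<inter> verts G \<noteq> {} \<and> verts G - U \<noteq> {} \<longrightarrow> 3 \<le> card (edge_cut G U))"

lemma three_connD:
  assumes "three_conn G"
  shows "is_mgraph G" "verts G \<noteq> {}" "finite (verts G)" "finite (edges G)"
  using assms by (auto simp: three_conn_def is_mgraph_def)

lemma three_conn_cut:
  assumes "three_conn G" "edge_cut G U \<noteq> {}"
  shows "3 \<le> card (edge_cut G U)"
proof -
  obtain e where e: "e \<in> edges G" "ends G e \<inter> U \<noteq> {}" "ends G e - U \<noteq> {}"
    using assms(2) by (auto simp: edge_cut_def)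
  have "ends G e \<subseteq> verts G" using three_connD(1)[OF assms(1)] e(1) by (auto simp: is_mgraph_def)
  then have "U \<inter> verts G \<noteq> {}" "verts G - U \<noteq> {}" using e by auto
  then show ?thesis using assms(1) by (auto simp: three_conn_def)
qed

lemma handshake:
  assumes G: "is_mgraph G"
  shows "(\<Sum>z\<in>verts G. card (edge_cut G {z})) = 2 * card {e \<in> edges G. card (ends G e) = 2}"
proof -
  have f: "finite (verts G)" "finite (edges G)" using G by (auto simp: is_mgraph_def)
  have "(\<Sum>z\<in>verts G. card (edge_cut G {z})) = (\<Sum>z\<in>verts G. \<Sum>e\<in>edges G. of_bool (e \<in> edge_cut G {z}))"
    using f by (intro sum.cong) (auto simp: of_bool_def sum.If_cases edge_cut_def intro!: arg_cong[of _ _ card])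
  also have "\<dots> = (\<Sum>e\<in>edges G. \<Sum>z\<in>verts G. of_bool (e \<in> edge_cut G {z}))" by (rule sum.swap)
  also have "\<dots> = (\<Sum>e\<in>edges G. if card (ends G e) = 2 then 2 else 0)"
  proof (rule sum.cong)
    fix e assume e: "e \<in> edges G"
    have sub: "ends G e \<subseteq> verts G" using G e by (auto simp: is_mgraph_def)
    have "(\<Sum>z\<in>verts G. of_bool (e \<in> edge_cut G {z}) :: nat) = card {z \<in> verts G. e \<in> edge_cut G {z}}"
      using f by (simp add: of_bool_def sum.If_cases Int_def)
    also have "{z \<in> verts G. e \<in> edge_cut G {z}} = (if card (ends G e) = 2 then ends G e else {})"
    proof -
      obtain a b where ab: "ends G e = {a, b}" using mgraph_ends[OF G e] by metis
      then show ?thesis using e sub by (cases "a = b") (auto simp: edge_cut_def)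
    qed
    finally show "(\<Sum>z\<in>verts G. of_bool (e \<in> edge_cut G {z}) :: nat) = (if card (ends G e) = 2 then 2 else 0)"
      by auto
  qed simp
  finally show ?thesis using f by (simp add: sum.If_cases Int_def)
qed

lemma three_conn_edges:
  assumes G: "three_conn G" and v: "2 \<le> card (verts G)"
  shows "3 * card (verts G) \<le> 2 * card (edges G)"
proof -
  note G' = three_connD[OF G]
  have "3 \<le> card (edge_cut G {z})" if z: "z \<in> verts G" for z
  proof -
    have "verts G - {z} \<noteq> {}"
    proof
      assume "verts G - {z} = {}"
      then have "verts G = {z}" using z by auto
      then show False using v by simp
    qed
    then show ?thesis using G z by (auto simp: three_conn_def)
  qed
  then have "(\<Sum>z\<in>verts G. 3) \<le> (\<Sum>z\<in>verts G. card (edge_cut G {z}))" by (intro sum_mono)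
  also have "\<dots> = 2 * card {e \<in> edges G. card (ends G e) = 2}" by (rule handshake[OF G'(1)])
  also have "\<dots> \<le> 2 * card (edges G)" using G'(4) by (intro mult_le_mono2 card_mono) auto
  finally show ?thesis by simp
qed

lemma three_conn_kap:
  assumes G: "three_conn G"
  shows "kap G (edges G) = 1"
proof -
  note G' = three_connD[OF G]
  have all: "verts G \<subseteq> conn G (edges G) `` {u}" if u: "u \<in> verts G" for u
  proof (rule ccontr)
    let ?U = "{v. (u, v) \<in> conn G (edges G)}"
    assume "\<not> ?thesis"
    then have "verts G - ?U \<noteq> {}" by auto
    moreover have "u \<in> ?U \<inter> verts G" using u by simp
    then have "?U \<inter> verts G \<noteq> {}" by blast
    ultimately have "3 \<le> card (edge_cut G ?U)" using G by (auto simp: three_conn_def)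
    moreover have "edge_cut G ?U = {}" using cut_class[OF G'(1) order_refl, of u] by blast
    ultimately show False by simp
  qed
  obtain u where u: "u \<in> verts G" using G'(2) by auto
  have "conn G (edges G) `` {v} = conn G (edges G) `` {u}" if "v \<in> verts G" for v
    unfolding conn_class_eq using all[OF that] u by auto
  then have "comps G (edges G) = {conn G (edges G) `` {u}}" unfolding comps_def using u by blast
  then show ?thesis by (simp add: kap_def)
qed

definition three_cuts :: "('v, 'e) mgraph \<Rightarrow> 'e set set" where
  "three_cuts G = {D. card D = 3 \<and> (\<exists>U. D = edge_cut G U)}"

text \<open>Rank at most two means at most two edges or a three-edge cut. Otherwise there would be
  four edges of which any three form a cut, and two such cuts add up to a cut of two edges.\<close>

lemma grank_small:
  assumes G: "three_conn G" and D: "D \<subseteq> edges G"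
  shows "card D \<le> 2 \<Longrightarrow> grank G D = card D"
    and "card D = 3 \<Longrightarrow> grank G D = (if D \<in> three_cuts G then 2 else 3)"
    and "4 \<le> card D \<Longrightarrow> 3 \<le> grank G D"
proof -
  note G' = three_connD[OF G]
  interpret rank_function "edges G" "grank G" by (rule rank_function_grank[OF G'(1)])
  have ind: "grank G S = card S \<longleftrightarrow> (\<forall>U. edge_cut G U \<subseteq> S \<longrightarrow> edge_cut G U = {})" if "S \<subseteq> edges G" for S
    using indep_cocycle_grank[OF G'(1), of S] indep_cocycle_matroid[OF G'(1), of S] that by blast
  have fS: "finite S" if "S \<subseteq> edges G" for S using that G'(4) finite_subset by auto
  have small: "grank G S = card S" if S: "S \<subseteq> edges G" "card S \<le> 2" for S
  proof -
    have "edge_cut G U = {}" if "edge_cut G U \<subseteq> S" for U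
    proof (rule ccontr)
      assume "edge_cut G U \<noteq> {}"
      then have "3 \<le> card (edge_cut G U)" by (rule three_conn_cut[OF G])
      also have "\<dots> \<le> card S" using that fS S by (intro card_mono) auto
      finally show False using S by simp
    qed
    then show ?thesis using ind[OF S(1)] by auto
  qed
  have three: "grank G S = (if S \<in> three_cuts G then 2 else 3)" if S: "S \<subseteq> edges G" "card S = 3" for S
  proof -
    have "2 \<le> card S" using S by simp
    then obtain T where T: "T \<subseteq> S" "card T = 2" by (rule obtain_subset_with_card_n)
    have "2 \<le> grank G S" using small[of T] T S rank_mono[of T S] by auto
    moreover have "grank G S \<le> 3" using rank_le_card[OF S(1)] S by simp
    moreover have "grank G S = 3 \<longleftrightarrow> S \<notin> three_cuts G"
    proof
      assume "grank G S = 3"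
      then have "\<forall>U. edge_cut G U \<subseteq> S \<longrightarrow> edge_cut G U = {}" using ind[OF S(1)] S by simp
      then show "S \<notin> three_cuts G" using S by (auto simp: three_cuts_def)
    next
      assume n: "S \<notin> three_cuts G"
      have "edge_cut G U = {}" if "edge_cut G U \<subseteq> S" for U
      proof (rule ccontr)
        assume "edge_cut G U \<noteq> {}"
        then have "card S \<le> card (edge_cut G U)" using three_conn_cut[OF G] S by simp
        then have "edge_cut G U = S" by (rule card_seteq[OF fS[OF S(1)] that])
        then show False using n S unfolding three_cuts_def by blast
      qed
      then show "grank G S = 3" using ind[OF S(1)] S by auto
    qed
    ultimately show ?thesis by auto
  qed
  show "card D \<le> 2 \<Longrightarrow> grank G D = card D" using small D by auto
  show "card D = 3 \<Longrightarrow> grank G D = (if D \<in> three_cuts G then 2 else 3)" using three D by auto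
  show "3 \<le> grank G D" if c: "4 \<le> card D"
  proof (rule ccontr)
    assume "\<not> ?thesis"
    then have lt: "grank G D \<le> 2" by simp
    obtain F where F: "F \<subseteq> D" "card F = 4" using c by (rule obtain_subset_with_card_n)
    then obtain a b c d where F': "F = {a, b, c, d}" "distinct [a, b, c, d]"
      by (auto simp: card_Suc_eq numeral_eq_Suc)
    have cut3: "S \<in> three_cuts G" if S: "S \<subseteq> F" "card S = 3" for S
    proof (rule ccontr)
      assume "S \<notin> three_cuts G"
      then have "grank G S = 3" using three[of S] S F D by auto
      moreover have "grank G S \<le> grank G D" using S F D by (intro rank_mono) auto
      ultimately show False using lt by simp
    qed
    have "{a, b, c} \<in> three_cuts G" "{a, b, d} \<in> three_cuts G" by (rule cut3; use F' in auto)+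
    then obtain U W where UW: "{a, b, c} = edge_cut G U" "{a, b, d} = edge_cut G W" by (auto simp: three_cuts_def)
    have "edge_cut G (symdiff U W) = {c, d}"
      unfolding cut_symdiff[OF G'(1)] UW[symmetric] using F'(2) by (auto simp: symdiff_def)
    then show False using three_conn_cut[OF G, of "symdiff U W"] F'(2) by auto
  qed
qed

text \<open>The coefficient of degree \<open>r - i\<close> collects the edge sets of rank
  \<open>i\<close>, each with the sign of its size. A three-edge cut has rank two but odd size,
  which explains its minus sign.\<close>

lemma flow_poly_coeffs:
  assumes G: "three_conn G" and v: "2 \<le> card (verts G)"
  defines "r \<equiv> card (edges G) + 1 - card (verts G)"
  shows "r \<ge> 2" "coeff (flow_poly G) r = 1" "\<And>m. m > r \<Longrightarrow> coeff (flow_poly G) m = 0"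
    and "coeff (flow_poly G) (r - 1) = - int (card (edges G))"
    and "coeff (flow_poly G) (r - 2) = int (card (edges G) choose 2) - int (card (three_cuts G))"
proof -
  note G' = three_connD[OF G]
  let ?E = "edges G"
  interpret rank_function ?E "grank G" by (rule rank_function_grank[OF G'(1)])
  have r: "grank G ?E = r"
    by (simp add: grank_def r_def kap_empty[OF G'(1)] three_conn_kap[OF G])
  show r2: "r \<ge> 2" using three_conn_edges[OF G v] v by (simp add: r_def)
  have co: "coeff (flow_poly G) m = (\<Sum>D | D \<subseteq> ?E \<and> r - grank G D = m. (-1) ^ card D)" for m
  proof -
    have "coeff (flow_poly G) m = (\<Sum>D\<in>Pow ?E. if r - grank G D = m then (-1) ^ card D else 0)"
      by (simp add: flow_poly_def rank_poly_def coeff_sum r)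
    also have "\<dots> = (\<Sum>D\<in>Pow ?E \<inter> {D. r - grank G D = m}. (-1) ^ card D)"
      using G'(4) by (simp add: sum.If_cases)
    also have "Pow ?E \<inter> {D. r - grank G D = m} = {D. D \<subseteq> ?E \<and> r - grank G D = m}" by auto
    finally show ?thesis .
  qed
  have le: "grank G D \<le> r" if "D \<subseteq> ?E" for D using rank_mono[OF that order_refl] r by simp
  have fD: "finite D" if "D \<subseteq> ?E" for D using that G'(4) finite_subset by auto
  have val: "grank G D = (if card D \<le> 2 then card D else if D \<in> three_cuts G then 2 else grank G D)"
    "card D \<ge> 3 \<Longrightarrow> D \<notin> three_cuts G \<Longrightarrow> grank G D \<ge> 3" if D: "D \<subseteq> ?E" for D
    using grank_small[OF G D] by (cases "card D \<le> 2"; cases "card D = 3"; force simp: three_cuts_def)+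
  have g0: "r - grank G D = r \<longleftrightarrow> D = {}" if D: "D \<subseteq> ?E" for D
  proof -
    have "r - grank G D = r \<longleftrightarrow> grank G D = 0" using r2 by arith
    also have "\<dots> \<longleftrightarrow> card D = 0" using val[OF D] by (auto split: if_splits)
    finally show ?thesis using fD[OF D] by simp
  qed
  have "{D. D \<subseteq> ?E \<and> r - grank G D = r} = {{}}" using g0 by auto
  then show "coeff (flow_poly G) r = 1" using co[of r] by simp
  show "coeff (flow_poly G) m = 0" if "m > r" for m
  proof -
    have "{D. D \<subseteq> ?E \<and> r - grank G D = m} = {}" using that by auto
    then show ?thesis unfolding co by (simp only: sum.empty)
  qed
  have g1: "r - grank G D = r - 1 \<longleftrightarrow> card D = 1" if D: "D \<subseteq> ?E" for D
    using val[OF D] le[OF D] r2 by (auto split: if_splits)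
  have "{D. D \<subseteq> ?E \<and> r - grank G D = r - 1} = {D. D \<subseteq> ?E \<and> card D = 1}" using g1 by auto
  then have "coeff (flow_poly G) (r - 1) = (\<Sum>D | D \<subseteq> ?E \<and> card D = 1. -1)"
    unfolding co by (intro sum.cong) auto
  also have "\<dots> = - int (card {D. D \<subseteq> ?E \<and> card D = 1})" by simp
  finally show "coeff (flow_poly G) (r - 1) = - int (card ?E)" using n_subsets[OF G'(4), of 1] by simp
  have t3: "D \<subseteq> ?E \<and> card D = 3" if "D \<in> three_cuts G" for D
    using that by (auto simp: three_cuts_def edge_cut_def)
  have g2: "r - grank G D = r - 2 \<longleftrightarrow> card D = 2 \<or> D \<in> three_cuts G" if D: "D \<subseteq> ?E" for D
    using val[OF D] le[OF D] r2 t3[of D] by (auto split: if_splits)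
  have "{D. D \<subseteq> ?E \<and> r - grank G D = r - 2} = {D. D \<subseteq> ?E \<and> card D = 2} \<union> three_cuts G" using g2 t3 by auto
  then have "coeff (flow_poly G) (r - 2) = (\<Sum>D\<in>{D. D \<subseteq> ?E \<and> card D = 2} \<union> three_cuts G. (-1) ^ card D)"
    unfolding co by simp
  also have "\<dots> = (\<Sum>D | D \<subseteq> ?E \<and> card D = 2. (-1) ^ card D) + (\<Sum>D\<in>three_cuts G. (-1) ^ card D)"
  proof (rule sum.union_disjoint)
    show "finite {D. D \<subseteq> ?E \<and> card D = 2}" using G'(4) by simp
    have "three_cuts G \<subseteq> Pow ?E" using t3 by auto
    then show "finite (three_cuts G)" using G'(4) finite_subset by blast
    show "{D. D \<subseteq> ?E \<and> card D = 2} \<inter> three_cuts G = {}" using t3 by force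
  qed
  also have "(\<Sum>D | D \<subseteq> ?E \<and> card D = 2. (-1 :: int) ^ card D) = (\<Sum>D | D \<subseteq> ?E \<and> card D = 2. 1)"
    by (intro sum.cong) auto
  also have "(\<Sum>D\<in>three_cuts G. (-1 :: int) ^ card D) = (\<Sum>D\<in>three_cuts G. -1)"
    using t3 by (intro sum.cong) auto
  finally show "coeff (flow_poly G) (r - 2) = int (card ?E choose 2) - int (card (three_cuts G))"
    using n_subsets[OF G'(4), of 2] by simp
qed

lemma flow_poly_root_1:
  assumes G: "is_mgraph G" and E: "edges G \<noteq> {}"
  shows "[:- 1, 1:] dvd flow_poly G"
proof -
  interpret rank_function "edges G" "grank G" by (rule rank_function_grank[OF G])
  have "poly (flow_poly G) 1 = (\<Sum>D\<in>Pow (edges G). (-1) ^ card D)"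
    by (simp add: flow_poly_def rank_poly_def poly_sum poly_monom)
  also have "\<dots> = 0" using sum_alternating[OF fin] E by simp
  finally show ?thesis by (simp add: poly_eq_0_iff_dvd)
qed

text \<open>The root sum is the number of edges and the sum of squares brings in the three-edge cuts;
  consider the sums of \<open>(a - 2) (a - 3)\<close> and \<open>a - 2\<close> over all roots \<open>a\<close>.\<close>

lemma flow_roots_bounds:
  assumes G: "three_conn G" and v: "2 \<le> card (verts G)" and int: "integral_roots (flow_poly G)"
  obtains c where "c \<ge> 1" "\<And>j. [:- 1, 1:] ^ j dvd flow_poly G \<Longrightarrow> j \<le> c"
    "card (three_cuts G) + card (edges G) + 3 \<ge> 3 * card (verts G) + c"
    "card (edges G) + 2 \<le> 2 * card (verts G) + c"
proof -
  note G' = three_connD[OF G]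
  let ?n = "card (edges G)" and ?v = "card (verts G)" and ?t = "card (three_cuts G)"
  let ?r = "?n + 1 - ?v"
  note co = flow_poly_coeffs[OF G v]
  have "degree (flow_poly G) = ?r"
    by (rule antisym) (use co(2,3) in \<open>auto intro: degree_le le_degree\<close>)
  then have "lead_coeff (flow_poly G) = 1" using co(2) by simp
  from integral_roots_split[OF this int] obtain as where as: "flow_poly G = (\<Prod>a\<leftarrow>as. [:- a, 1:])" by auto
  note ca = coeffs_prod_linear[where as = as, folded as]
  have len: "length as = ?r"
  proof (rule antisym)
    show "length as \<le> ?r" using ca(1) co(3)[of "length as"] by force
    show "?r \<le> length as" using co(2) ca(2)[of ?r] by force
  qed
  have s1: "sum_list as = int ?n" using ca(3)[of "?r - 1"] co(4) co(1) len by simp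
  have s2: "2 * (int (?n choose 2) - int ?t) = (int ?n)\<^sup>2 - (\<Sum>a\<leftarrow>as. a\<^sup>2)"
    using ca(4)[of "?r - 2"] co(5) co(1) len s1 by simp
  have "2 * int (?n choose 2) = int ?n * (int ?n - 1)"
  proof -
    have "even (?n * (?n - 1))" by auto
    then have "2 * (?n choose 2) = ?n * (?n - 1)" unfolding choose_two by (rule dvd_mult_div_cancel)
    then have "int (2 * (?n choose 2)) = int (?n * (?n - 1))" by simp
    then show ?thesis by (cases ?n) (simp_all add: algebra_simps)
  qed
  then have sq: "(\<Sum>a\<leftarrow>as. a\<^sup>2) = int ?n + 2 * int ?t"
    using s2 by (simp add: power2_eq_square algebra_simps)
  interpret rank_function "edges G" "grank G" by (rule rank_function_grank[OF G'(1)])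
  \<comment> \<open>At arguments up to 0 the polynomial has a definite sign, since single edges have
    rank one.\<close>
  have pos: "a \<ge> 1" if "a \<in> set as" for a
  proof (rule ccontr)
    assume "\<not> a \<ge> 1"
    then have "a \<le> 0" by simp
    moreover have "grank G {e} \<noteq> 0" if "e \<in> edges G" for e using grank_small(1)[OF G, of "{e}"] that by simp
    ultimately have "poly (flow_poly G) a \<noteq> 0"
      using rank_poly_sign[OF rank_function_axioms, of a] by (auto simp: flow_poly_def)
    moreover have "poly (flow_poly G) a = 0"
    proof -
      have "a \<in> set bs \<Longrightarrow> poly (\<Prod>a\<leftarrow>bs. [:- a, 1:]) a = 0" for bs :: "int list"
        by (induction bs) auto
      then show ?thesis using that as by simp
    qed
    ultimately show False by simp
  qed
  \<comment> \<open>The multiplicity of the root 1. It bounds every power of the linear factor that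
    divides the polynomial, and is used in that form.\<close>
  let ?c = "count_list as 1"
  have nz: "flow_poly G \<noteq> 0" using co(2) by auto
  have ord: "j \<le> ?c" if "[:- 1, 1:] ^ j dvd flow_poly G" for j
    using that nz order_prod_linear[of as, folded as] by (simp add: order_divides)
  have "edges G \<noteq> {}" using three_conn_edges[OF G v] v by auto
  then have c1: "?c \<ge> 1" using ord[of 1] flow_poly_root_1[OF G'(1)] by simp
  note b = sum_list_root_bounds[of as, OF pos]
  have ri: "int (length as) = int ?n + 1 - int ?v" using len co(1) by simp
  show thesis
  proof (rule that[OF c1 ord])
    \<comment> \<open>The data are: number of roots \<open>?n + 1 - ?v\<close>, sum of roots
      \<open>?n\<close>, sum of squares \<open>?n + 2 * ?t\<close>.\<close>
    show "?t + ?n + 3 \<ge> 3 * ?v + ?c" using b(1) sq s1 ri by linarith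
    show "?n + 2 \<le> 2 * ?v + ?c" using b(2) s1 ri by linarith
  qed
qed

section \<open>Reducible configurations\<close>

definition loopless :: "('v, 'e) mgraph \<Rightarrow> bool" where
  "loopless G \<longleftrightarrow> (\<forall>e\<in>edges G. card (ends G e) = 2)"

lemma three_connI:
  assumes "three_conn G" "a \<in> verts G" "a \<in> U" "b \<in> verts G" "b \<notin> U"
  shows "3 \<le> card (edge_cut G U)"
proof -
  have "U \<inter> verts G \<noteq> {}" "verts G - U \<noteq> {}" using assms by auto
  then show ?thesis using assms(1) by (auto simp: three_conn_def)
qed

text \<open>A side of the contraction is pulled back to a side that does not separate
  \<open>Y\<close>; hence contraction creates no smaller cuts.\<close>

lemma edge_cut_contract:
  "edge_cut (contract G Y z) U = edge_cut G {v. (if v \<in> Y then z else v) \<in> U}"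
  unfolding edge_cut_def contract_def by (auto split: if_splits)

lemma three_conn_contract:
  assumes G: "three_conn G" and Y: "Y \<subseteq> verts G" and z: "z \<in> Y"
  shows "three_conn (contract G Y z)"
  unfolding three_conn_def
proof (intro conjI allI impI)
  show "is_mgraph (contract G Y z)" using mgraph_contract three_connD(1)[OF G] .
  show "verts (contract G Y z) \<noteq> {}" by (simp add: contract_def)
next
  fix U assume U: "U \<inter> verts (contract G Y z) \<noteq> {} \<and> verts (contract G Y z) - U \<noteq> {}"
  let ?U = "{v. (if v \<in> Y then z else v) \<in> U}"
  obtain a b where ab: "a \<in> U" "a \<in> insert z (verts G - Y)" "b \<notin> U" "b \<in> insert z (verts G - Y)"
    using U by (auto simp: contract_def)
  have aU: "a \<in> ?U" "b \<notin> ?U" using ab z by auto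
  have "a \<in> verts G" "b \<in> verts G" using ab z Y by auto
  then show "3 \<le> card (edge_cut (contract G Y z) U)"
    unfolding edge_cut_contract using three_connI[OF G _ aU(1) _ aU(2)] by simp
qed

lemma edge_cut_del_loop:
  assumes "ends G e = {h}"
  shows "edge_cut (del_edges G {e}) U = edge_cut G U"
  using assms by (auto simp: edge_cut_def del_edges_def)

lemma three_conn_del_loop:
  assumes "three_conn G" "ends G e = {h}"
  shows "three_conn (del_edges G {e})"
  using assms mgraph_del_edges[of G "{e}"]
  by (simp add: three_conn_def edge_cut_del_loop[OF assms(2)]) (simp add: del_edges_def)

text \<open>With \<open>x\<close> on the side of \<open>h\<close> the double edge is not cut, and
  \<open>e\<close> is cut iff its new copy between \<open>h\<close> and \<open>y\<close> is.\<close>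

lemma edge_cut_remove_ear:
  assumes c: "ear G x h y e f g" and U: "x \<in> U \<longleftrightarrow> h \<in> U"
  shows "edge_cut (remove_ear G x h y e f g) U = edge_cut G U"
proof -
  have n: "e \<noteq> f" "e \<noteq> g" "x \<noteq> h" "x \<noteq> y" using c by (auto simp: ear_def)
  have e: "ends G e = {x, y}" "ends G f = {x, h}" "ends G g = {x, h}" using c by (auto simp: ear_def)
  have "f \<notin> edge_cut G U" "g \<notin> edge_cut G U" using e U by (auto simp: edge_cut_def)
  moreover have "d \<in> edge_cut (remove_ear G x h y e f g) U \<longleftrightarrow> d \<in> edge_cut G U" if "d \<noteq> f" "d \<noteq> g" for d
    using that e U by (cases "d = e") (auto simp: edge_cut_def remove_ear_def)
  moreover have "f \<notin> edge_cut (remove_ear G x h y e f g) U" "g \<notin> edge_cut (remove_ear G x h y e f g) U"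
    by (auto simp: edge_cut_def remove_ear_def)
  ultimately show ?thesis by (metis (no_types, lifting) subsetI subset_antisym)
qed

lemma edge_cut_remove_ear':
  assumes G: "is_mgraph G" and c: "ear G x h y e f g"
  shows "edge_cut (remove_ear G x h y e f g) U = edge_cut G (if h \<in> U then insert x U else U - {x})"
proof -
  let ?G = "remove_ear G x h y e f g" and ?U = "if h \<in> U then insert x U else U - {x}"
  have m: "is_mgraph ?G" using mgraph_remove_ear[OF G c] .
  have "?U \<inter> verts ?G = U \<inter> verts ?G" by (auto simp: remove_ear_def)
  then have "edge_cut ?G U = edge_cut ?G ?U" using cut_Int_verts[OF m] by metis
  also have "x \<noteq> h" using c by (auto simp: ear_def)
  then have "edge_cut ?G ?U = edge_cut G ?U" by (intro edge_cut_remove_ear[OF c]) auto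
  finally show ?thesis .
qed

lemma three_conn_remove_ear:
  assumes G: "three_conn G" and c: "ear G x h y e f g"
  shows "three_conn (remove_ear G x h y e f g)"
  unfolding three_conn_def
proof (intro conjI allI impI)
  note G' = three_connD[OF G]
  show "is_mgraph (remove_ear G x h y e f g)" using mgraph_remove_ear[OF G'(1) c] .
  have V: "verts (remove_ear G x h y e f g) = verts G - {x}" by (simp add: remove_ear_def)
  show "verts (remove_ear G x h y e f g) \<noteq> {}" using ear_verts[OF G'(1) c] V by auto
  fix U assume "U \<inter> verts (remove_ear G x h y e f g) \<noteq> {} \<and> verts (remove_ear G x h y e f g) - U \<noteq> {}"
  then obtain a b where ab: "a \<in> U" "a \<in> verts G - {x}" "b \<notin> U" "b \<in> verts G - {x}" using V by auto
  let ?U = "if h \<in> U then insert x U else U - {x}"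
  have "a \<in> ?U" "b \<notin> ?U" "a \<in> verts G" "b \<in> verts G" using ab by auto
  then show "3 \<le> card (edge_cut (remove_ear G x h y e f g) U)"
    unfolding edge_cut_remove_ear'[OF G'(1) c] using three_connI[OF G] by blast
qed

lemma three_conn_degree:
  assumes G: "three_conn G" and v: "2 \<le> card (verts G)" and z: "z \<in> verts G"
  shows "3 \<le> card (edge_cut G {z})"
proof -
  have "verts G - {z} \<noteq> {}"
  proof
    assume "verts G - {z} = {}"
    then have "verts G = {z}" using z by auto
    then show False using v by simp
  qed
  then show ?thesis using G z by (auto simp: three_conn_def)
qed

lemma loopless_star: "loopless G \<Longrightarrow> edge_cut G {x} = {e \<in> edges G. x \<in> ends G e}"
  by (auto simp: loopless_def edge_cut_def card_2_iff)

text \<open>The cut around both vertices is the sum of their stars; this limits the number of edges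
  between them.\<close>

lemma star_disjoint_pair:
  assumes G: "three_conn G" and v: "3 \<le> card (verts G)" and xy: "x \<in> verts G" "y \<in> verts G" "x \<noteq> y"
  shows "3 \<le> card (symdiff (edge_cut G {x}) (edge_cut G {y}))"
proof -
  have "symdiff {x} {y} = {x, y}" using xy by (auto simp: symdiff_def)
  then have "edge_cut G {x, y} = symdiff (edge_cut G {x}) (edge_cut G {y})"
    using cut_symdiff[OF three_connD(1)[OF G], of "{x}" "{y}"] by simp
  moreover have "verts G - {x, y} \<noteq> {}"
  proof
    assume "verts G - {x, y} = {}"
    then have "card (verts G) \<le> card {x, y}" by (intro card_mono) auto
    then show False using v xy by simp
  qed
  then have "3 \<le> card (edge_cut G {x, y})" using G xy by (auto simp: three_conn_def)
  ultimately show ?thesis by simp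
qed

text \<open>All three-edge cuts are stars here, so there are at most as many as vertices of degree
  three, whereas the root bounds demand at least \<open>card (verts G) - 1\<close>.\<close>

lemma degrees_if_three_cuts_trivial:
  assumes G: "three_conn G" and ll: "loopless G" and v: "3 \<le> card (verts G)"
    and int: "integral_roots (flow_poly G)"
    and triv: "\<forall>U. card (edge_cut G U) = 3 \<longrightarrow> card (U \<inter> verts G) = 1 \<or> card (verts G - U) = 1"
  obtains (cubic) "card (verts G) = 4" "\<And>x. x \<in> verts G \<Longrightarrow> card (edge_cut G {x}) = 3"
  | (hub) c h where "c \<ge> 1" "\<And>j. [:- 1, 1:] ^ j dvd flow_poly G \<Longrightarrow> j \<le> c" "h \<in> verts G"
    "card (edge_cut G {h}) \<noteq> 3" "\<And>x. x \<in> verts G \<Longrightarrow> x \<noteq> h \<Longrightarrow> card (edge_cut G {x}) = 3"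
    "card (edges G) + 1 + c \<le> card (verts G) + card (edge_cut G {h})"
proof -
  note G' = three_connD[OF G]
  let ?deg = "\<lambda>x. card (edge_cut G {x})" and ?v = "card (verts G)" and ?n = "card (edges G)"
  let ?T = "{x \<in> verts G. ?deg x = 3}"
  have v2: "2 \<le> ?v" using v by simp
  obtain c where c: "c \<ge> 1" "\<And>j. [:- 1, 1:] ^ j dvd flow_poly G \<Longrightarrow> j \<le> c"
    "card (three_cuts G) + ?n + 3 \<ge> 3 * ?v + c" "?n + 2 \<le> 2 * ?v + c"
    using flow_roots_bounds[OF G v2 int] by blast
  have "three_cuts G \<subseteq> (\<lambda>x. edge_cut G {x}) ` ?T"
  proof
    fix D assume "D \<in> three_cuts G"
    then obtain U where U: "D = edge_cut G U" "card (edge_cut G U) = 3" by (auto simp: three_cuts_def)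
    from triv[rule_format, OF U(2)] show "D \<in> (\<lambda>x. edge_cut G {x}) ` ?T"
    proof
      assume "card (U \<inter> verts G) = 1"
      then obtain x where x: "U \<inter> verts G = {x}" by (auto simp: card_1_singleton_iff)
      then have "D = edge_cut G {x}" using cut_Int_verts[OF G'(1), of U] U by simp
      then show ?thesis using x U by auto
    next
      assume "card (verts G - U) = 1"
      then obtain x where x: "verts G - U = {x}" by (auto simp: card_1_singleton_iff)
      then have "(- U) \<inter> verts G = {x}" by auto
      then have "D = edge_cut G {x}" using cut_Int_verts[OF G'(1), of "- U"] cut_compl[of G U] U by simp
      then show ?thesis using x U by auto
    qed
  qed
  then have "card (three_cuts G) \<le> card ?T"
    using G'(3) by (intro surj_card_le) auto
  then have t: "card ?T + ?n + 3 \<ge> 3 * ?v + c" using c by simp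
  have Tv: "card ?T \<le> ?v" using G'(3) by (intro card_mono) auto
  have hs: "(\<Sum>x\<in>verts G. ?deg x) = 2 * ?n"
  proof -
    have "{e \<in> edges G. card (ends G e) = 2} = edges G" using ll by (auto simp: loopless_def)
    then show ?thesis using handshake[OF G'(1)] by simp
  qed
  show thesis
  proof (cases "card ?T = ?v")
    case True
    then have "?T = verts G" using G'(3) by (intro card_subset_eq) auto
    then have all: "\<And>x. x \<in> verts G \<Longrightarrow> ?deg x = 3" by auto
    then have n: "3 * ?v = 2 * ?n" using hs by simp
    \<comment> \<open>With \<open>3 * ?v = 2 * ?n\<close> the cut bound becomes
      \<open>?v \<le> 6 - 2 * c\<close>, and three cubic vertices are excluded by parity.\<close>
    then have "?v \<le> 4" using t True c(1) by linarith
    moreover have "?v \<noteq> 3" using n by presburger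
    ultimately have "?v = 4" using v by linarith
    then show ?thesis using all by (rule cubic)
  next
    case False
    \<comment> \<open>The bounds leave room for a single exceptional vertex, and then the edge bound
      is an equality.\<close>
    then have ct: "card ?T + 1 = ?v" "?n + 2 = 2 * ?v + c" using Tv t c(4) by linarith+
    have "card (verts G - ?T) = 1" using ct G'(3) by (subst card_Diff_subset) auto
    then obtain h where h: "verts G - ?T = {h}" by (auto simp: card_1_singleton_iff)
    then have hv: "h \<in> verts G" "?deg h \<noteq> 3" by auto
    have oth: "?deg x = 3" if "x \<in> verts G" "x \<noteq> h" for x using that h by blast
    have "(\<Sum>x\<in>verts G. ?deg x) = ?deg h + (\<Sum>x\<in>verts G - {h}. ?deg x)"
      using G'(3) hv by (intro sum.remove) auto
    also have "(\<Sum>x\<in>verts G - {h}. ?deg x) = (\<Sum>x\<in>verts G - {h}. 3)" using oth by (intro sum.cong) auto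
    also have "\<dots> = 3 * (?v - 1)" using hv G'(3) by simp
    finally have "2 * ?n = ?deg h + 3 * (?v - 1)" using hs by simp
    \<comment> \<open>In other words, at most \<open>?v - 1 - c\<close> edges avoid the hub, so that
      the other vertices cannot all have two of them.\<close>
    then have "?n + 1 + c \<le> ?v + ?deg h" using ct v by linarith
    then show ?thesis using hub[OF c(1,2) hv oth] by blast
  qed
qed

text \<open>Parallel edges would violate three-edge-connectivity around their two ends, so the three
  neighbours of \<open>x\<close> are distinct and exhaust the other vertices.\<close>

lemma complete_if_cubic:
  assumes G: "three_conn G" and ll: "loopless G" and v: "card (verts G) = 4"
    and d: "\<And>x. x \<in> verts G \<Longrightarrow> card (edge_cut G {x}) = 3"
    and xy: "x \<in> verts G" "y \<in> verts G" "x \<noteq> y"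
  shows "\<exists>e\<in>edges G. ends G e = {x, y}"
proof -
  note G' = three_connD[OF G]
  let ?S = "edge_cut G {x}"
  have fS: "finite (edge_cut G {w})" for w using G'(4) cut_subset finite_subset by metis
  have "\<exists>w. w \<in> verts G - {x} \<and> ends G e = {x, w}" if "e \<in> ?S" for e
  proof -
    have e: "e \<in> edges G" "x \<in> ends G e" "card (ends G e) = 2"
      using that ll by (auto simp: loopless_def edge_cut_def)
    moreover have "ends G e \<subseteq> verts G" using G'(1) e by (auto simp: is_mgraph_def)
    ultimately show ?thesis by (auto simp: card_2_iff)
  qed
  then obtain w where w: "\<And>e. e \<in> ?S \<Longrightarrow> w e \<in> verts G - {x} \<and> ends G e = {x, w e}" by metis
  have "inj_on w ?S"
  proof (rule inj_onI, rule ccontr)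
    fix e f assume ef: "e \<in> ?S" "f \<in> ?S" "w e = w f" "e \<noteq> f"
    let ?T = "edge_cut G {w e}"
    have u: "w e \<in> verts G" "x \<noteq> w e" using w[OF ef(1)] by auto
    have "ends G e = {x, w e}" "ends G f = {x, w e}" using w ef by auto
    then have "{e, f} \<subseteq> ?T" using ef u by (auto simp: edge_cut_def)
    \<comment> \<open>Two parallel edges cancel in the cut around both ends, which leaves at most
      two edges.\<close>
    have "symdiff ?S ?T \<subseteq> (?S - {e, f}) \<union> (?T - {e, f})"
      using ef \<open>{e, f} \<subseteq> ?T\<close> by (auto simp: symdiff_def)
    then have "card (symdiff ?S ?T) \<le> card ((?S - {e, f}) \<union> (?T - {e, f}))"
      using fS by (intro card_mono) auto
    also have "\<dots> \<le> card (?S - {e, f}) + card (?T - {e, f})" by (rule card_Un_le)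
    also have "\<dots> = 2"
      using fS ef \<open>{e, f} \<subseteq> ?T\<close> d[OF xy(1)] d[OF u(1)] by (simp add: card_Diff_subset)
    finally show False using star_disjoint_pair[OF G _ xy(1) u] v by simp
  qed
  then have 1: "card (w ` ?S) = 3" using card_image d[OF xy(1)] by metis
  have 2: "w ` ?S \<subseteq> verts G - {x}" using w by blast
  have 3: "card (verts G - {x}) = 3" using v xy G'(3) by simp
  have "w ` ?S = verts G - {x}" by (rule card_subset_eq[OF _ 2]) (simp_all add: 1 3 G'(3))
  then have "y \<in> w ` ?S" using xy by simp
  then obtain e where "e \<in> ?S" "y = w e" by (rule imageE)
  then show ?thesis using w[of e] cut_subset[of G "{x}"] by auto
qed

text \<open>Three mutually adjacent vertices of degree three, dual to a vertex of degree three inside a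
  triangle: \<open>nn x\<close> is the edge opposite to \<open>x\<close> and \<open>ou x\<close> the edge leaving the triangle at \<open>x\<close>.\<close>

definition cubic_triangle :: "('v, 'e) mgraph \<Rightarrow> 'v set \<Rightarrow> ('v \<Rightarrow> 'e) \<Rightarrow> ('v \<Rightarrow> 'e) \<Rightarrow> bool" where
  "cubic_triangle G X ou nn \<longleftrightarrow> X \<subseteq> verts G \<and> card X = 3 \<and>
     (\<forall>x\<in>X. ou x \<in> edges G \<and> nn x \<in> edges G \<and> card (ends G (ou x)) = 2 \<and>
        ends G (ou x) \<inter> X = {x} \<and> ends G (nn x) = X - {x} \<and>
        {e \<in> edges G. x \<in> ends G e} = insert (ou x) (nn ` (X - {x})))"

lemma contract_ends_away:
  assumes "z \<in> Y" "z \<notin> ends (contract G Y z) e"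
  shows "ends G e = ends (contract G Y z) e"
proof -
  have "v \<notin> Y" if "v \<in> ends G e" for v
  proof
    assume "v \<in> Y"
    then have "z \<in> ends (contract G Y z) e" using that by (force simp: contract_def)
    then show False using assms by simp
  qed
  then show ?thesis by (auto simp: contract_def)
qed

lemma contract_mem_ends:
  assumes "z \<in> Y" "x \<notin> Y"
  shows "x \<in> ends (contract G Y z) e \<longleftrightarrow> x \<in> ends G e"
  using assms by (auto simp: contract_def split: if_splits)

lemma contract_star:
  assumes "z \<in> Y" "x \<notin> Y"
  shows "{e \<in> edges (contract G Y z). x \<in> ends (contract G Y z) e} = {e \<in> edges G. x \<in> ends G e}"
  unfolding contract_mem_ends[OF assms] using assms by (auto simp: contract_def)

lemma loopless_contract:
  assumes G: "is_mgraph G" and ll: "loopless G" and z: "z \<in> Y"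
  shows "loopless (contract G Y z)"
  unfolding loopless_def
proof
  fix e assume "e \<in> edges (contract G Y z)"
  then have e: "e \<in> edges G" "\<not> ends G e \<subseteq> Y" by (auto simp: contract_def)
  obtain a b where ab: "ends G e = {a, b}" using mgraph_ends[OF G e(1)] by metis
  have "a \<noteq> b" using ll e(1) ab by (auto simp: loopless_def)
  then have "(if a \<in> Y then z else a) \<noteq> (if b \<in> Y then z else b)" using ab e(2) z by auto
  then show "card (ends (contract G Y z) e) = 2" using ab by (simp add: contract_def del: if_image_distrib)
qed

text \<open>The handshake lemma in the graph without the edges at \<open>h\<close>.\<close>

lemma non_hub_degrees:
  assumes G: "is_mgraph G" and ll: "loopless G"
  shows "(\<Sum>x\<in>verts G. card {e \<in> edges G. x \<in> ends G e \<and> h \<notin> ends G e}) + 2 * card (edge_cut G {h}) = 2 * card (edges G)"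
proof -
  let ?B = "\<lparr>verts = verts G, edges = {e \<in> edges G. h \<notin> ends G e}, ends = ends G\<rparr>"
  have B: "is_mgraph ?B" "loopless ?B" using G ll by (auto simp: is_mgraph_def loopless_def)
  have "(\<Sum>x\<in>verts G. card {e \<in> edges G. x \<in> ends G e \<and> h \<notin> ends G e}) = (\<Sum>x\<in>verts ?B. card (edge_cut ?B {x}))"
    unfolding loopless_star[OF B(2)] by (intro sum.cong) (auto intro!: arg_cong[of _ _ card])
  also have "\<dots> = 2 * card {e \<in> edges ?B. card (ends ?B e) = 2}" by (rule handshake[OF B(1)])
  also have "{e \<in> edges ?B. card (ends ?B e) = 2} = edges G - edge_cut G {h}"
    unfolding loopless_star[OF ll] using ll by (auto simp: loopless_def)
  finally have *: "(\<Sum>x\<in>verts G. card {e \<in> edges G. x \<in> ends G e \<and> h \<notin> ends G e}) =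
    2 * card (edges G - edge_cut G {h})" .
  have "card (edges G - edge_cut G {h}) + card (edge_cut G {h}) = card (edges G)"
    using G by (metis card_Diff_subset card_mono cut_subset finite_subset is_mgraph_def le_add_diff_inverse2)
  then show ?thesis using * by simp
qed

text \<open>At least two of the three edges at \<open>x\<close> go to \<open>h\<close>. The third
  may go there as well; then \<open>y = h\<close>, which \<open>ear\<close> permits.\<close>

lemma ear_if_two_edges_to_hub:
  assumes G: "is_mgraph G" and ll: "loopless G" and x: "x \<in> verts G" "x \<noteq> h"
    and d: "card {e \<in> edges G. x \<in> ends G e} = 3"
    and nh: "card {e \<in> edges G. x \<in> ends G e \<and> h \<notin> ends G e} \<le> 1"
  shows "\<exists>y e f g. ear G x h y e f g"
proof -
  let ?S = "{e \<in> edges G. x \<in> ends G e}" and ?N = "{e \<in> edges G. x \<in> ends G e \<and> h \<notin> ends G e}"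
  have fS: "finite ?S" using G by (simp add: is_mgraph_def)
  have "card (?S - ?N) = card ?S - card ?N" using fS by (intro card_Diff_subset) (auto intro: finite_subset[OF _ fS])
  then have "2 \<le> card (?S - ?N)" using d nh by linarith
  then obtain P where P: "P \<subseteq> ?S - ?N" "card P = 2" by (rule obtain_subset_with_card_n)
  then obtain f g where fg: "P = {f, g}" "f \<noteq> g" by (auto simp: card_2_iff)
  have "card (?S - {f, g}) = 1" using d P fg fS by (subst card_Diff_subset) auto
  then obtain e where e: "?S - {f, g} = {e}" by (auto simp: card_1_singleton_iff)
  have two: "ends G d = {x, w}" if "d \<in> edges G" "x \<in> ends G d" "w \<in> ends G d" "w \<noteq> x" for d w
    using ll that by (auto simp: loopless_def card_2_iff)
  have "e \<in> edges G" "x \<in> ends G e" using e by auto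
  then obtain a b where "ends G e = {a, b}" "a \<noteq> b" "x \<in> {a, b}" using ll by (auto simp: loopless_def card_2_iff)
  then obtain y where y: "y \<in> ends G e" "y \<noteq> x" by auto
  have "?S = {e, f, g}" using e P fg by blast
  moreover have "ends G e = {x, y}" using two[of e y] y e by blast
  moreover have "ends G f = {x, h}" "ends G g = {x, h}" using two[of f h] two[of g h] P fg x by blast+
  moreover have "e \<noteq> f" "e \<noteq> g" using e by blast+
  ultimately have "ear G x h y e f g" unfolding ear_def using x y fg by simp
  then show ?thesis by blast
qed

text \<open>The configuration lies in a minimal side \<open>X\<close> of a three-edge cut: contracting the other side
  keeps the roots integral and leaves only trivial three-edge cuts.\<close>

lemma reducible_configuration:
  assumes G: "three_conn G" and ll: "loopless G" and v: "3 \<le> card (verts G)"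
    and int: "integral_roots (flow_poly G)"
  shows "(\<exists>x h y e f g. ear G x h y e f g) \<or> (\<exists>X ou nn. cubic_triangle G X ou nn)"
proof -
  note G' = three_connD[OF G]
  let ?P = "\<lambda>U. U \<subset> verts G \<and> 2 \<le> card U \<and> card (edge_cut G U) = 3"
  \<comment> \<open>The root bounds give at least \<open>card (verts G) - 1\<close> three-edge cuts,
    and with three vertices one side of such a cut has at least two.\<close>
  have "\<exists>U. ?P U"
  proof -
    have v2: "2 \<le> card (verts G)" using v by simp
    obtain c where c: "card (three_cuts G) + card (edges G) + 3 \<ge> 3 * card (verts G) + c"
      "card (edges G) + 2 \<le> 2 * card (verts G) + c"
      using flow_roots_bounds[OF G v2 int] by blast
    then have "card (three_cuts G) \<noteq> 0" using v by linarith
    then have "three_cuts G \<noteq> {}" by auto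
    then obtain U where U: "card (edge_cut G U) = 3" by (auto simp: three_cuts_def)
    let ?A = "U \<inter> verts G" and ?B = "verts G - U"
    have "edge_cut G ?A = edge_cut G U" by (rule cut_Int_verts[OF G'(1)])
    moreover have "edge_cut G ?B = edge_cut G U"
      using cut_Int_verts[OF G'(1), of "- U"] cut_compl[of G U] by (simp add: Diff_eq Int_commute)
    moreover have "card (verts G) = card ?A + card ?B"
      using G'(3) by (metis card_Int_Diff Int_commute)
    moreover have "?A \<noteq> verts G \<and> ?B \<noteq> verts G"
    proof -
      obtain e where "e \<in> edge_cut G U" using U by fastforce
      moreover then have "ends G e \<subseteq> verts G" using G'(1) by (auto simp: edge_cut_def is_mgraph_def)
      ultimately show ?thesis by (auto simp: edge_cut_def)
    qed
    ultimately have "?P ?A \<or> ?P ?B" using U v by auto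
    then show ?thesis by blast
  qed
  then obtain U where "?P U" by (rule exE)
  from ex_has_least_nat[of ?P, OF this, of card]
  obtain X where XX: "?P X \<and> (\<forall>U. ?P U \<longrightarrow> card X \<le> card U)" by (rule exE)
  then have X: "?P X" by (rule conjunct1)
  have min: "?P U \<Longrightarrow> card X \<le> card U" for U using XX by simp
  define Y where "Y = verts G - X"
  obtain z where z: "z \<in> Y" using X by (auto simp: Y_def)
  have "card X \<noteq> 0" using X by linarith
  then obtain z' where z': "z' \<in> X" by fastforce
  have fX: "finite X" using X G'(3) finite_subset by blast
  have XY: "Y \<subseteq> verts G" "X \<inter> Y = {}" "verts G - Y = X" using X by (auto simp: Y_def)
  define A where "A = contract G Y z"
  have VA: "verts A = insert z X" using XY by (simp add: A_def contract_def)
  have zX: "z \<notin> X" using z XY by auto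
  have A: "three_conn A" unfolding A_def by (rule three_conn_contract[OF G XY(1) z])
  note A' = three_connD[OF A]
  have llA: "loopless A" unfolding A_def by (rule loopless_contract[OF G'(1) ll z])
  have cA: "card (verts A) = Suc (card X)" using VA zX fX by simp
  then have vA: "3 \<le> card (verts A)" using X by simp
  have intA: "integral_roots (flow_poly A)"
  proof (rule integral_roots_dvd)
    show "flow_poly A dvd flow_poly G * ([:- 1, 1:] * [:- 2, 1:])"
      unfolding A_def using flow_poly_three_cut[OF G'(1) _ Y_def _ z z'] X by (metis dvd_triv_left psubset_imp_subset)
    show "integral_roots (flow_poly G * ([:- 1, 1:] * [:- 2, 1:]))"
      by (intro integral_roots_mult int integral_roots_linear)
  qed
  have cutA: "edge_cut A W = edge_cut G W" if "W \<subseteq> X" for W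
  proof -
    have "{v. (if v \<in> Y then z else v) \<in> W} = W" using that XY zX by auto
    then show ?thesis unfolding A_def edge_cut_contract by simp
  qed
  have triv: "card (U \<inter> verts A) = 1 \<or> card (verts A - U) = 1" if U: "card (edge_cut A U) = 3" for U
  proof -
    \<comment> \<open>The side of the cut away from \<open>z\<close> lies in \<open>X\<close>, where
      cuts of \<open>A\<close> are cuts of \<open>G\<close>; so minimality of \<open>X\<close>
      applies to it.\<close>
    define W where "W = (if z \<in> U then verts A - U else U \<inter> verts A)"
    have WX: "W \<subseteq> X" using VA by (auto simp: W_def)
    have "edge_cut A W = edge_cut A U"
      using cut_Int_verts[OF A'(1), of "- U"] cut_compl[of A U] cut_Int_verts[OF A'(1), of U]
      by (simp add: W_def Diff_eq Int_commute)
    then have c3: "card (edge_cut G W) = 3" using U cutA[OF WX] by simp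
    then have "W \<noteq> {}" by auto
    then have "card W \<noteq> 0" using finite_subset[OF WX fX] by simp
    have "card W = 1 \<or> verts A - W = {z}"
    proof (cases "2 \<le> card W")
      case True
      then have "card X \<le> card W" using c3 WX X by (intro min) auto
      then have "W = X" using WX fX by (intro card_seteq) auto
      then show ?thesis using VA zX by auto
    next
      case False
      then show ?thesis using \<open>card W \<noteq> 0\<close> by linarith
    qed
    moreover have "verts A - (verts A - U) = U \<inter> verts A" "verts A - U \<inter> verts A = verts A - U" by auto
    ultimately show ?thesis unfolding W_def by (simp split: if_splits) fastforce+
  qed
  have starA: "edge_cut A {x} = {e \<in> edges G. x \<in> ends G e}" if "x \<in> X" for x
    using cutA[of "{x}"] loopless_star[OF ll] that by simp
  show ?thesis
    using A llA vA intA
  proof (cases rule: degrees_if_three_cuts_trivial[case_names hyp cubic hub])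
    case hyp
    show ?case using triv by blast
  next
    \<comment> \<open>\<open>A\<close> is complete on \<open>X\<close> and \<open>z\<close>. The
      edges at \<open>z\<close> come from edges leaving \<open>X\<close>, whose outer ends in
      \<open>G\<close> may differ.\<close>
    case cubic
    have c3: "card X = 3" using cubic(1) cA by simp
    have adj: "\<exists>e\<in>edges A. ends A e = {x, y}" if "x \<in> verts A" "y \<in> verts A" "x \<noteq> y" for x y
      using complete_if_cubic[OF A llA cubic(1,2) that] .
    have "\<exists>e\<in>edges A. ends A e = {x, z}" if "x \<in> X" for x using adj[of x z] that VA zX by auto
    then obtain ou where ou: "\<And>x. x \<in> X \<Longrightarrow> ou x \<in> edges A \<and> ends A (ou x) = {x, z}" by metis
    have "\<exists>e\<in>edges A. ends A e = X - {x}" if "x \<in> X" for x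
    proof -
      have "card (X - {x}) = 2" using that c3 fX by simp
      then obtain a b where "X - {x} = {a, b}" "a \<noteq> b" by (auto simp: card_2_iff)
      then show ?thesis using adj[of a b] VA by auto
    qed
    then obtain nn where nn: "\<And>x. x \<in> X \<Longrightarrow> nn x \<in> edges A \<and> ends A (nn x) = X - {x}" by metis
    have EA: "edges A \<subseteq> edges G" by (auto simp: A_def contract_def)
    have mem: "w \<in> ends A e \<longleftrightarrow> w \<in> ends G e" if "w \<in> X" for w e
    proof -
      have "w \<notin> Y" using that XY by auto
      then show ?thesis unfolding A_def by (rule contract_mem_ends[OF z])
    qed
    have "ends G (nn x) = X - {x}" if "x \<in> X" for x
      using contract_ends_away[OF z, of G "nn x"] nn[OF that] zX unfolding A_def by auto
    moreover have "ends G (ou x) \<inter> X = {x}" if "x \<in> X" for x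
      using mem ou[OF that] that zX by auto
    moreover have "{e \<in> edges G. x \<in> ends G e} = insert (ou x) (nn ` (X - {x}))" if x: "x \<in> X" for x
    proof (rule card_seteq[symmetric])
      have "{e \<in> edges G. x \<in> ends G e} = edge_cut A {x}" using starA[OF x] by simp
      then have c: "card {e \<in> edges G. x \<in> ends G e} = 3" using cubic(2)[of x] x VA by simp
      show "finite {e \<in> edges G. x \<in> ends G e}" using G'(4) by simp
      show "insert (ou x) (nn ` (X - {x})) \<subseteq> {e \<in> edges G. x \<in> ends G e}"
        unfolding mem[OF x, symmetric] using ou nn x EA by auto
      have "inj_on nn (X - {x})"
      proof (rule inj_onI)
        fix a b assume ab: "a \<in> X - {x}" "b \<in> X - {x}" "nn a = nn b"
        then have "a \<in> X" "b \<in> X" by auto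
        then have "X - {a} = X - {b}" using nn[of a] nn[of b] ab(3) by simp
        then show "a = b" using ab by blast
      qed
      then have "card (nn ` (X - {x})) = 2" using c3 x fX by (simp add: card_image)
      moreover have "ou x \<notin> nn ` (X - {x})"
      proof
        assume "ou x \<in> nn ` (X - {x})"
        then obtain a where "a \<in> X" "ou x = nn a" by auto
        then have "{x, z} = X - {a}" using ou[OF x] nn[of a] by auto
        then show False using zX by auto
      qed
      ultimately show "card {e \<in> edges G. x \<in> ends G e} \<le> card (insert (ou x) (nn ` (X - {x})))"
        using c fX by simp
    qed
    moreover have "ou x \<in> edges G" "nn x \<in> edges G" "card (ends G (ou x)) = 2" if "x \<in> X" for x
      using ou[OF that] nn[OF that] EA ll by (auto simp: loopless_def)
    moreover have "X \<subseteq> verts G" using X by auto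
    ultimately have "cubic_triangle G X ou nn" unfolding cubic_triangle_def using c3 by simp
    then show ?thesis by blast
  next
    case (hub c h)
    have degz: "card (edge_cut A {z}) = 3"
    proof -
      have "- {z} \<inter> verts A = X" using VA zX by auto
      then have "edge_cut A {z} = edge_cut A X"
        using cut_Int_verts[OF A'(1), of "- {z}"] cut_compl[of A "{z}"] by simp
      then show ?thesis using cutA[of X] X by simp
    qed
    have hz: "h \<noteq> z" using degz hub(4) by auto
    then have hX: "h \<in> X" using hub(3) VA by auto
    let ?N = "\<lambda>x. {e \<in> edges A. x \<in> ends A e \<and> h \<notin> ends A e}"
    have sumN: "(\<Sum>x\<in>verts A. card (?N x)) + 2 * card (edge_cut A {h}) = 2 * card (edges A)"
      by (rule non_hub_degrees[OF A'(1) llA])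
    \<comment> \<open>The vertex must differ from the artificial vertex \<open>z\<close>. If all
      vertices of \<open>X\<close> except \<open>h\<close> had two edges avoiding \<open>h\<close>,
      the hub bound would force \<open>c = 1\<close> and leave no such edge at
      \<open>z\<close>.\<close>
    have "\<exists>x\<in>X - {h}. card (?N x) \<le> 1"
    proof (rule ccontr)
      assume "\<not> ?thesis"
      then have ge: "2 \<le> card (?N x)" if "x \<in> X - {h}" for x using that by force
      have "(\<Sum>x\<in>verts A. card (?N x)) = card (?N z) + (\<Sum>x\<in>X. card (?N x))"
        using VA zX fX by simp
      also have "(\<Sum>x\<in>X. card (?N x)) = card (?N h) + (\<Sum>x\<in>X - {h}. card (?N x))"
        using fX hX by (intro sum.remove) auto
      finally have "(\<Sum>x\<in>verts A. card (?N x)) \<ge> card (?N z) + (\<Sum>x\<in>X - {h}. 2)"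
        using sum_mono[of "X - {h}" "\<lambda>_. 2" "\<lambda>x. card (?N x)", OF ge] by linarith
      moreover have "(\<Sum>x\<in>X - {h}. 2) = 2 * (card X - 1)" using fX hX by simp
      ultimately have le: "card (?N z) + 2 * (card X - 1) + 2 * card (edge_cut A {h}) \<le> 2 * card (edges A)"
        using sumN by linarith
      have X2: "2 \<le> card X" using X by simp
      then have "card (?N z) = 0" "c = 1" using le hub(1,6) cA by linarith+
      then have Nz: "?N z = {}" using A'(4) by simp
      have "card {e \<in> edges A. z \<in> ends A e} = 3" using degz loopless_star[OF llA] by simp
      moreover have "card (?N z) \<le> 1" unfolding Nz by simp
      ultimately obtain y e f g where er: "ear A z h y e f g"
        using ear_if_two_edges_to_hub[OF A'(1) llA, of z h] VA hz by auto
      have ee: "e \<in> edges A" "ends A e = {z, y}" using ear_verts[OF A'(1) er] er by (auto simp: ear_def)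
      have yh: "y = h"
      proof -
        have "h \<in> ends A e" using Nz ee by blast
        then show ?thesis using ee hz by auto
      qed
      \<comment> \<open>All three edges at \<open>z\<close> go to \<open>h\<close>, so removing this
        ear makes \<open>e\<close> a loop at \<open>h\<close> and splits off a factor
        \<open>x - 1\<close>. An edge remains after that and gives a second such factor, against
        \<open>c = 1\<close>.\<close>
      let ?R = "remove_ear A z h y e f g"
      have R: "is_mgraph ?R" using mgraph_remove_ear[OF A'(1) er] .
      have eR: "e \<in> edges ?R" "ends ?R e = {h}" using ee er yh by (auto simp: remove_ear_def ear_def)
      have "edges (del_edges ?R {e}) \<noteq> {}"
      proof -
        have "X - {h} \<noteq> {}"
        proof
          assume "X - {h} = {}"
          then have "X = {h}" using hX by auto
          then show False using X2 by simp
        qed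
        then obtain x where "x \<in> X - {h}" by blast
        then have "card (?N x) \<noteq> 0" using ge[of x] by linarith
        then have "?N x \<noteq> {}" by (metis card.empty)
        then obtain d where d: "d \<in> edges A" "h \<notin> ends A d" by blast
        then have "d \<noteq> e" "d \<noteq> f" "d \<noteq> g" using er yh by (auto simp: ear_def)
        then have "d \<in> edges (del_edges ?R {e})" using d by (simp add: del_edges_def remove_ear_def)
        then show ?thesis by blast
      qed
      then have "[:- 1, 1:] dvd flow_poly (del_edges ?R {e})"
        by (rule flow_poly_root_1[OF mgraph_del_edges[OF R]])
      then have "[:- 1, 1:] * [:- 1, 1:] dvd [:- 1, 1:] * flow_poly (del_edges ?R {e})" by (rule mult_dvd_mono[OF dvd_refl])
      then have "[:- 1, 1:] * [:- 1, 1:] dvd [:- 2, 1:] * ([:- 1, 1:] * flow_poly (del_edges ?R {e}))" by (rule dvd_mult)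
      then have "[:- 1, 1:] ^ 2 dvd flow_poly A"
        unfolding flow_poly_remove_ear[OF A'(1) er] flow_poly_del_loop[OF R eR] power2_eq_square .
      then show False using hub(2)[of 2] \<open>c = 1\<close> by simp
    qed
    then obtain x where x: "x \<in> X" "x \<noteq> h" "card (?N x) \<le> 1" by blast
    have xY: "x \<notin> Y" "h \<notin> Y" using x hX XY by auto
    have "card {e \<in> edges G. x \<in> ends G e} = 3" using hub(5)[of x] starA[OF x(1)] x VA by simp
    moreover have "{e \<in> edges G. x \<in> ends G e \<and> h \<notin> ends G e} = ?N x"
      using contract_star[OF z xY(1), of G] contract_mem_ends[OF z xY(2), of G] unfolding A_def by blast
    moreover have "x \<in> verts G" using x X by auto
    ultimately have "\<exists>y e f g. ear G x h y e f g"
      using ear_if_two_edges_to_hub[OF G'(1) ll, of x h] x by simp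
    then show ?thesis by blast
  qed
qed

section \<open>Stacked spheres\<close>

text \<open>The faces of a stacked triangulation of the sphere. They are triples of vertices, with a mark
  that tells apart the two sides of the initial triangle.\<close>

definition new_face :: "nat \<Rightarrow> nat set \<Rightarrow> nat \<Rightarrow> nat set \<times> bool" where
  "new_face x T u = (insert x (T - {u}), False)"

definition stack :: "(nat set \<times> bool) set \<Rightarrow> nat set \<times> bool \<Rightarrow> nat \<Rightarrow> (nat set \<times> bool) set" where
  "stack F P x = F - {P} \<union> new_face x (fst P) ` fst P"

inductive stacked_sphere :: "nat set \<Rightarrow> (nat set \<times> bool) set \<Rightarrow> bool" where
  base: "card T = 3 \<Longrightarrow> stacked_sphere T {(T, False), (T, True)}"
| step: "stacked_sphere V F \<Longrightarrow> P \<in> F \<Longrightarrow> x \<notin> V \<Longrightarrow> stacked_sphere (insert x V) (stack F P x)"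

lemma sphere_facts:
  assumes "stacked_sphere V F"
  shows "finite V \<and> finite F \<and> (\<forall>P\<in>F. card (fst P) = 3 \<and> fst P \<subseteq> V)"
  using assms
proof (induction rule: stacked_sphere.induct)
  case (base T)
  then show ?case by (auto intro: card_ge_0_finite)
next
  case (step V F Q x)
  have Q: "card (fst Q) = 3" "fst Q \<subseteq> V" using step by auto
  then have fQ: "finite (fst Q)" using card_ge_0_finite by force
  have xQ: "x \<notin> fst Q" using Q(2) step(3) by blast
  have c: "card (fst (new_face x (fst Q) u)) = 3 \<and> fst (new_face x (fst Q) u) \<subseteq> insert x V"
    if "u \<in> fst Q" for u using that Q fQ xQ by (auto simp: new_face_def)
  show ?case
  proof (intro conjI ballI)
    show "finite (insert x V)" "finite (stack F Q x)" using step fQ by (auto simp: stack_def)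
    fix P assume "P \<in> stack F Q x"
    then have "(P \<in> F) \<or> (\<exists>u\<in>fst Q. P = new_face x (fst Q) u)" by (auto simp: stack_def)
    then show "card (fst P) = 3" "fst P \<subseteq> insert x V" using step.IH c by auto
  qed
qed

lemma sphere_finite: "stacked_sphere V F \<Longrightarrow> finite V" "stacked_sphere V F \<Longrightarrow> finite F"
  using sphere_facts by auto

lemma sphere_face: "stacked_sphere V F \<Longrightarrow> P \<in> F \<Longrightarrow> card (fst P) = 3" "stacked_sphere V F \<Longrightarrow> P \<in> F \<Longrightarrow> fst P \<subseteq> V"
  using sphere_facts by auto

lemma card_2_subset_3:
  assumes "card T = 3" "card d = 2" "d \<subseteq> T"
  obtains u where "u \<in> T" "d = T - {u}"
proof -
  have "finite T" using assms(1) card_ge_0_finite by force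
  then have "card (T - d) = 1" using assms by (subst card_Diff_subset) (auto intro: finite_subset)
  then obtain u where "T - d = {u}" by (auto simp: card_1_singleton_iff)
  then show thesis using that[of u] assms(3) by blast
qed

lemma Collect_image_filter: "{y \<in> f ` A. Q y} = f ` {a \<in> A. Q (f a)}"
  by auto

lemma image_remove: "a \<in> A \<Longrightarrow> f ` A = insert (f a) (f ` (A - {a}))"
  by auto

locale stacking =
  fixes V :: "nat set" and F :: "(nat set \<times> bool) set" and P :: "nat set \<times> bool" and x :: nat
  assumes sph: "stacked_sphere V F" and PF: "P \<in> F" and xV: "x \<notin> V"
begin

abbreviation "T \<equiv> fst P"
abbreviation "N \<equiv> new_face x T"

lemma T3: "card T = 3" "T \<subseteq> V" "finite T" "x \<notin> T"
  using sphere_face[OF sph PF] xV finite_subset[OF _ sphere_finite(1)[OF sph]] by auto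

lemma old_face: "Q \<in> F \<Longrightarrow> x \<notin> fst Q"
  using sphere_face(2)[OF sph] xV by blast

lemma new_not_old: "N u \<notin> F"
  using old_face by (force simp: new_face_def)

lemma inj_new: "inj_on N T"
proof (rule inj_onI)
  fix u v assume "u \<in> T" "v \<in> T" "N u = N v"
  then have "insert x (T - {u}) = insert x (T - {v})" by (simp add: new_face_def)
  then have "T - {u} = T - {v}" using T3(4) by (metis Diff_iff insert_ident)
  then show "u = v" using \<open>u \<in> T\<close> \<open>v \<in> T\<close> by blast
qed

text \<open>If \<open>d\<close> is a side of the subdivided face, that face is replaced by the one
  new face over \<open>d\<close>; otherwise nothing changes at \<open>d\<close>.\<close>

lemma faces_old:
  assumes d: "card d = 2" "d \<subseteq> V"
  shows "{Q \<in> stack F P x. d \<subseteq> fst Q} = {Q \<in> F. d \<subseteq> fst Q} - {P} \<union> {N u |u. u \<in> T \<and> d = T - {u}}"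
proof -
  have cl: "d \<subseteq> fst (N u) \<longleftrightarrow> d = T - {u}" if u: "u \<in> T" for u
  proof
    assume "d \<subseteq> fst (N u)"
    then have "d \<subseteq> T - {u}" using d(2) xV by (auto simp: new_face_def)
    moreover have "card (T - {u}) = 2" using u T3 by simp
    ultimately show "d = T - {u}" using d(1) T3(3) by (intro card_subset_eq) auto
  qed (auto simp: new_face_def)
  have "{Q \<in> stack F P x. d \<subseteq> fst Q} = ({Q \<in> F. d \<subseteq> fst Q} - {P}) \<union> {Q \<in> N ` T. d \<subseteq> fst Q}"
    unfolding stack_def by (rule set_eqI) (simp only: Un_iff Diff_iff mem_Collect_eq, blast)
  also have "{Q \<in> N ` T. d \<subseteq> fst Q} = N ` {u \<in> T. d \<subseteq> fst (N u)}"
    by (rule Collect_image_filter)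
  also have "{u \<in> T. d \<subseteq> fst (N u)} = {u \<in> T. d = T - {u}}"
    by (rule Collect_cong) (simp only: cl cong: conj_cong)
  also have "N ` {u \<in> T. d = T - {u}} = {N u |u. u \<in> T \<and> d = T - {u}}" by (rule image_Collect)
  finally show ?thesis .
qed

lemma faces_new:
  assumes u: "u \<in> T"
  shows "{Q \<in> stack F P x. {x, u} \<subseteq> fst Q} = N ` (T - {u})"
proof -
  have "{x, u} \<subseteq> fst (N v) \<longleftrightarrow> v \<noteq> u" if "v \<in> T" for v
    using that u T3(4) by (auto simp: new_face_def)
  moreover have "\<not> {x, u} \<subseteq> fst Q" if "Q \<in> F" for Q using old_face[OF that] by auto
  ultimately show ?thesis unfolding stack_def by blast
qed

text \<open>If the new face over \<open>d\<close> inherits the label of \<open>P\<close>, the labels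
  around \<open>d\<close> do not change. This transfers incidences of old edges through a stacking
  step.\<close>

lemma image_faces_old:
  assumes d: "card d = 2" "d \<subseteq> V"
    and p: "\<And>Q. Q \<in> F \<Longrightarrow> Q \<noteq> P \<Longrightarrow> \<pi>' Q = \<pi> Q" "\<And>u. u \<in> T \<Longrightarrow> d = T - {u} \<Longrightarrow> \<pi>' (N u) = \<pi> P"
  shows "\<pi>' ` {Q \<in> stack F P x. d \<subseteq> fst Q} = \<pi> ` {Q \<in> F. d \<subseteq> fst Q}"
proof (cases "d \<subseteq> T")
  case True
  obtain u where u: "u \<in> T" "d = T - {u}" using card_2_subset_3[OF T3(1) d(1) True] by blast
  have "{N v |v. v \<in> T \<and> d = T - {v}} = {N u}" using u by blast
  moreover have "\<pi> ` {Q \<in> F. d \<subseteq> fst Q} = insert (\<pi> P) (\<pi> ` ({Q \<in> F. d \<subseteq> fst Q} - {P}))"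
    using True PF by (intro image_remove) simp
  moreover have "\<pi>' ` ({Q \<in> F. d \<subseteq> fst Q} - {P}) = \<pi> ` ({Q \<in> F. d \<subseteq> fst Q} - {P})"
    using p(1) by (intro image_cong) auto
  ultimately show ?thesis unfolding faces_old[OF d] using p(2)[OF u] by (simp add: image_Un)
next
  case False
  then have "{N v |v. v \<in> T \<and> d = T - {v}} = {}" by blast
  moreover have "{Q \<in> F. d \<subseteq> fst Q} - {P} = {Q \<in> F. d \<subseteq> fst Q}" using False by blast
  ultimately have eq: "{Q \<in> stack F P x. d \<subseteq> fst Q} = {Q \<in> F. d \<subseteq> fst Q}"
    unfolding faces_old[OF d] by (simp only: Un_empty_right)
  show ?thesis unfolding eq
  proof (rule image_cong)
    fix Q assume "Q \<in> {Q \<in> F. d \<subseteq> fst Q}"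
    then show "\<pi>' Q = \<pi> Q" using p(1) False by blast
  qed simp
qed

end

text \<open>The closed-surface property. Stacking replaces one of the two faces at an old edge, and
  each new edge lies in the two new faces that meet there.\<close>

lemma sphere_two_faces:
  assumes "stacked_sphere V F" "P \<in> F" "d \<subseteq> fst P" "card d = 2"
  shows "card {Q \<in> F. d \<subseteq> fst Q} = 2"
  using assms
proof (induction arbitrary: P d rule: stacked_sphere.induct)
  case (base T)
  then have "{Q \<in> {(T, False), (T, True)}. d \<subseteq> fst Q} = {(T, False), (T, True)}" by auto
  then show ?case by (simp add: card_insert_if)
next
  case (step V F Q x)
  interpret stacking V F Q x using step by unfold_locales
  have f: "finite F" using sphere_finite sph by auto
  show ?case
  proof (cases "x \<in> d")
    case True
    then have "P \<notin> F" using step.prems(2) old_face[of P] by blast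
    then obtain v where v: "v \<in> T" "P = N v" using step.prems by (auto simp: stack_def)
    have "d - {x} \<subseteq> T" using v step.prems by (auto simp: new_face_def)
    moreover have "card (d - {x}) = 1" using True step.prems by simp
    ultimately obtain u where "u \<in> T" "d - {x} = {u}" by (auto simp: card_1_singleton_iff)
    then have u: "u \<in> T" "d = {x, u}" using True by blast+
    have "card (N ` (T - {u})) = card (T - {u})"
      by (rule card_image) (rule inj_on_subset[OF inj_new], auto)
    also have "\<dots> = 2" using u T3 by simp
    finally show ?thesis using faces_new[OF u(1)] u by simp
  next
    case False
    have dV: "d \<subseteq> V" using sphere_face(2)[OF stacked_sphere.step[OF step.hyps(1-3)] step.prems(1)] step.prems(2) False by blast
    show ?thesis
    proof (cases "d \<subseteq> T")
      case True
      obtain u where u: "u \<in> T" "d = T - {u}" using card_2_subset_3[OF T3(1) step.prems(3) True] by blast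
      have "{N v |v. v \<in> T \<and> d = T - {v}} = {N u}" using u by blast
      then have "{R \<in> stack F Q x. d \<subseteq> fst R} = insert (N u) ({R \<in> F. d \<subseteq> fst R} - {Q})"
        unfolding faces_old[OF step.prems(3) dV] by auto
      moreover have "card {R \<in> F. d \<subseteq> fst R} = 2" using step.IH[OF PF True step.prems(3)] .
      ultimately show ?thesis using f new_not_old True PF by simp
    next
      case False
      then have "{N v |v. v \<in> T \<and> d = T - {v}} = {}" "Q \<notin> {R \<in> F. d \<subseteq> fst R}" by auto
      then have eq: "{R \<in> stack F Q x. d \<subseteq> fst R} = {R \<in> F. d \<subseteq> fst R}"
        unfolding faces_old[OF step.prems(3) dV] by auto
      then have "P \<in> F" using step.prems by blast
      then show ?thesis using eq step.IH step.prems by simp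
    qed
  qed
qed

section \<open>Chordality and duality under extension by a vertex\<close>

text \<open>An induced cycle of length greater than three through \<open>x\<close> would have a
  chord between the two cycle neighbours of \<open>x\<close>, as these lie in the clique
  \<open>K\<close>.\<close>

lemma chordal_add_simplicial:
  assumes H': "is_mgraph H'" "chordal H'"
    and V: "verts H = insert x (verts H')" "x \<notin> verts H'"
    and E: "edges H' \<subseteq> edges H" "\<And>d. d \<in> edges H' \<Longrightarrow> ends H d = ends H' d"
    and new: "\<And>d. d \<in> edges H - edges H' \<Longrightarrow> \<exists>u\<in>K. ends H d = {x, u}"
    and clique: "\<And>u v. u \<in> K \<Longrightarrow> v \<in> K \<Longrightarrow> u \<noteq> v \<Longrightarrow> adjacent H' u v" and K: "K \<subseteq> verts H'"
  shows "chordal H"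
  unfolding chordal_def
proof
  assume "\<exists>vs. induced_cycle H vs \<and> 3 < length vs"
  then obtain vs where vs: "induced_cycle H vs" "3 < length vs" by auto
  let ?n = "length vs"
  have ic: "distinct vs" "set vs \<subseteq> verts H"
    "\<And>i j. i < ?n \<Longrightarrow> j < ?n \<Longrightarrow> adjacent H (vs ! i) (vs ! j) \<longleftrightarrow> j = Suc i mod ?n \<or> i = Suc j mod ?n"
    using vs by (auto simp: induced_cycle_def)
  have adj: "adjacent H u v \<longleftrightarrow> adjacent H' u v" if "u \<noteq> x" "v \<noteq> x" for u v
    unfolding adjacent_def using that E new by (metis Diff_iff doubleton_eq_iff subsetD)
  show False
  proof (cases "x \<in> set vs")
    case False
    have "induced_cycle H' vs"
      unfolding induced_cycle_def
    proof (intro conjI allI impI)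
      show "3 \<le> ?n" "distinct vs" using vs ic by auto
      show "set vs \<subseteq> verts H'" using ic V False by auto
      fix i j assume ij: "i < ?n" "j < ?n"
      then have "vs ! i \<noteq> x" "vs ! j \<noteq> x" using False by auto
      then show "adjacent H' (vs ! i) (vs ! j) \<longleftrightarrow> j = Suc i mod ?n \<or> i = Suc j mod ?n"
        using ic(3)[OF ij] adj by simp
    qed
    then show False using H'(2) vs by (auto simp: chordal_def)
  next
    case True
    then obtain i where i: "i < ?n" "vs ! i = x" by (auto simp: in_set_conv_nth)
    define j where "j = (if Suc i = ?n then 0 else Suc i)"
    define l where "l = (if i = 0 then ?n - 1 else i - 1)"
    have j: "j < ?n" "j = Suc i mod ?n" "j \<noteq> i" using i vs by (auto simp: j_def mod_Suc)
    have l: "l < ?n" "i = Suc l mod ?n" "l \<noteq> i" using i vs by (auto simp: l_def mod_Suc)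
    have jl: "j \<noteq> l" "j \<noteq> Suc l mod ?n" "l \<noteq> Suc j mod ?n" using i vs by (auto simp: j_def l_def mod_Suc split: if_splits)
    have nb: "vs ! m \<in> K" if m: "m < ?n" "m \<noteq> i" "adjacent H x (vs ! m)" for m
    proof -
      obtain d where d: "d \<in> edges H" "ends H d = {x, vs ! m}" using m(3) unfolding adjacent_def by blast
      have "d \<notin> edges H'"
      proof
        assume "d \<in> edges H'"
        then have "x \<in> verts H'" using H'(1) d E by (auto simp: is_mgraph_def)
        then show False using V by simp
      qed
      then obtain u where "u \<in> K" "{x, u} = {x, vs ! m}" using new[of d] d by (metis DiffI)
      moreover have "vs ! m \<noteq> x" using m i nth_eq_iff_index_eq[OF ic(1)] by auto
      ultimately show ?thesis by (metis doubleton_eq_iff)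
    qed
    have "vs ! j \<in> K" using nb[of j] j ic(3)[OF i(1) j(1)] i by auto
    moreover have "vs ! l \<in> K" using nb[of l] l ic(3)[OF i(1) l(1)] i by auto
    moreover have "vs ! j \<noteq> vs ! l" using jl j l nth_eq_iff_index_eq[OF ic(1)] by auto
    ultimately have "adjacent H' (vs ! j) (vs ! l)" using clique by simp
    moreover have "vs ! j \<noteq> x" "vs ! l \<noteq> x" using i j l nth_eq_iff_index_eq[OF ic(1)] by auto
    ultimately have "adjacent H (vs ! j) (vs ! l)" using adj by simp
    then show False using ic(3)[OF j(1) l(1)] jl by auto
  qed
qed

text \<open>One induction step of the duality. Cuts are even because stars are; conversely, an even
  set is freed of new edges by adding a cut, is then even in \<open>H'\<close>, and so is a cut of
  \<open>G'\<close>, which lifts to \<open>G\<close>.\<close>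

lemma even_iff_cut_extend:
  assumes G: "is_mgraph G" and H: "is_mgraph H" and E: "edges H = edges G"
    and dual: "\<And>S. even_edges H' S \<Longrightarrow> \<exists>U. S = edge_cut G' U"
    and star: "\<And>z. z \<in> verts G \<Longrightarrow> even_edges H (edge_cut G {z})"
    and reduce: "\<And>S. even_edges H S \<Longrightarrow> \<exists>U. even_edges H' (symdiff S (edge_cut G U))"
    and lift: "\<And>U. \<exists>W. edge_cut G' U = edge_cut G W"
  shows "even_edges H S \<longleftrightarrow> (\<exists>U. S = edge_cut G U)"
proof
  assume "even_edges H S"
  then obtain U where "even_edges H' (symdiff S (edge_cut G U))" using reduce by blast
  then obtain W where W: "symdiff S (edge_cut G U) = edge_cut G W" using dual lift by metis
  have "S = symdiff (symdiff S (edge_cut G U)) (edge_cut G U)" by (auto simp: symdiff_def)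
  then have "S = edge_cut G (symdiff W U)" using W cut_symdiff[OF G] by simp
  then show "\<exists>U. S = edge_cut G U" ..
next
  assume "\<exists>U. S = edge_cut G U"
  then show "even_edges H S" using cuts_even_if_stars_even[OF G H E star] by auto
qed

definition hgraph :: "nat set \<Rightarrow> 'e set \<Rightarrow> ('e \<Rightarrow> nat set) \<Rightarrow> (nat, 'e) mgraph" where
  "hgraph V E \<epsilon> = \<lparr>verts = V, edges = E, ends = \<epsilon>\<rparr>"

text \<open>\<open>\<epsilon>\<close> embeds the edges of \<open>G\<close> in the edges of the triangulation, and \<open>\<pi>\<close> maps its faces to the
  vertices of \<open>G\<close>; the faces over one vertex will be merged by deleting unused edges. The clause
  on vertices of degree three allows to stack a new vertex on the corresponding face.\<close>

definition represents ::
  "nat set \<Rightarrow> (nat set \<times> bool) set \<Rightarrow> ('e \<Rightarrow> nat set) \<Rightarrow> (nat set \<times> bool \<Rightarrow> 'v) \<Rightarrow> ('v, 'e) mgraph \<Rightarrow> bool" where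
  "represents V F \<epsilon> \<pi> G \<longleftrightarrow> stacked_sphere V F \<and> inj_on \<epsilon> (edges G) \<and> (\<forall>e\<in>edges G. card (\<epsilon> e) = 2) \<and>
     \<pi> ` F = verts G \<and> (\<forall>e\<in>edges G. \<pi> ` {P \<in> F. \<epsilon> e \<subseteq> fst P} = ends G e) \<and>
     (\<forall>z\<in>verts G. card {e \<in> edges G. z \<in> ends G e} = 3 \<and> (\<forall>e\<in>edges G. ends G e \<noteq> {z}) \<longrightarrow>
        (\<exists>P\<in>F. \<pi> P = z \<and> (\<forall>e\<in>edges G. z \<in> ends G e \<longrightarrow> \<epsilon> e \<subseteq> fst P))) \<and>
     (\<forall>S. even_edges (hgraph V (edges G) \<epsilon>) S \<longleftrightarrow> (\<exists>U. S = edge_cut G U)) \<and>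
     chordal (hgraph V (edges G) \<epsilon>)"

lemma representsD:
  assumes "represents V F \<epsilon> \<pi> G"
  shows "stacked_sphere V F" "inj_on \<epsilon> (edges G)" "\<And>e. e \<in> edges G \<Longrightarrow> card (\<epsilon> e) = 2" "\<pi> ` F = verts G"
    "\<And>e. e \<in> edges G \<Longrightarrow> \<pi> ` {P \<in> F. \<epsilon> e \<subseteq> fst P} = ends G e"
    "\<And>z. z \<in> verts G \<Longrightarrow> card {e \<in> edges G. z \<in> ends G e} = 3 \<Longrightarrow> \<forall>e\<in>edges G. ends G e \<noteq> {z} \<Longrightarrow>
        \<exists>P\<in>F. \<pi> P = z \<and> (\<forall>e\<in>edges G. z \<in> ends G e \<longrightarrow> \<epsilon> e \<subseteq> fst P)"
    "\<And>S. even_edges (hgraph V (edges G) \<epsilon>) S \<longleftrightarrow> (\<exists>U. S = edge_cut G U)"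
    "chordal (hgraph V (edges G) \<epsilon>)"
  using assms unfolding represents_def by simp_all

lemma represents_mgraph:
  assumes R: "represents V F \<epsilon> \<pi> G" and G: "is_mgraph G"
  shows "is_mgraph (hgraph V (edges G) \<epsilon>)" "\<And>e. e \<in> edges G \<Longrightarrow> \<epsilon> e \<subseteq> V"
proof -
  note r = representsD[OF R]
  show sub: "\<epsilon> e \<subseteq> V" if e: "e \<in> edges G" for e
  proof -
    have "ends G e \<noteq> {}" using G e by (auto simp: is_mgraph_def)
    then have "{P \<in> F. \<epsilon> e \<subseteq> fst P} \<noteq> {}" using r(5)[OF e] by (metis image_is_empty)
    then obtain P where "P \<in> F" "\<epsilon> e \<subseteq> fst P" by blast
    then show ?thesis using sphere_face(2)[OF r(1)] by blast
  qed
  show "is_mgraph (hgraph V (edges G) \<epsilon>)"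
    using sub r(3) sphere_finite(1)[OF r(1)] G by (auto simp: is_mgraph_def hgraph_def)
qed

lemma even_edges_hgraph_old:
  assumes "S \<subseteq> E'" "E' \<subseteq> E" "\<And>d. d \<in> E' \<Longrightarrow> \<epsilon> d = \<epsilon>' d"
  shows "even_edges (hgraph V E \<epsilon>) S \<longleftrightarrow> even_edges (hgraph V' E' \<epsilon>') S"
proof -
  have "{e \<in> S. v \<in> \<epsilon> e} = {e \<in> S. v \<in> \<epsilon>' e}" for v using assms by auto
  then show ?thesis using assms by (auto simp: even_edges_def hgraph_def)
qed

lemma even_edges_at:
  "even_edges (hgraph V E \<epsilon>) S \<Longrightarrow> even (card {e \<in> S. v \<in> \<epsilon> e})"
  by (simp add: even_edges_def hgraph_def)

section \<open>Base cases and the inverses of the reductions\<close>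

lemma represents_single:
  assumes "verts G = {a}" "edges G = {}"
  shows "\<exists>V F \<epsilon> \<pi>. represents V F \<epsilon> \<pi> (G :: ('v, 'e) mgraph)"
proof (intro exI)
  let ?T = "{0, 1, 2 :: nat}"
  have "card ?T = 3" by simp
  then have s: "stacked_sphere ?T {(?T, False), (?T, True)}" by (rule stacked_sphere.base)
  have ch: "chordal (hgraph ?T (edges G) \<epsilon>)" for \<epsilon>
    using assms by (auto simp: chordal_def induced_cycle_def adjacent_def hgraph_def)
      (metis Suc_lessD less_trans_Suc mod_less_divisor nat_neq_iff numeral_3_eq_3 zero_less_Suc not_less_eq_eq order_less_le_trans gr0I not_numeral_le_zero)
  show "represents ?T {(?T, False), (?T, True)} (\<lambda>_. {}) (\<lambda>_. a) G"
    unfolding represents_def using s ch assms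
    by (auto simp: even_edges_def hgraph_def edge_cut_def)
qed

text \<open>Three parallel edges are dual to a triangle, whose two sides are the two
  vertices.\<close>

lemma represents_theta:
  fixes G :: "('v, 'e) mgraph"
  assumes V: "verts G = {a, b}" "a \<noteq> b" and E: "card (edges G) = 3" "\<And>e. e \<in> edges G \<Longrightarrow> ends G e = {a, b}"
  shows "\<exists>V F \<epsilon> \<pi>. represents V F \<epsilon> \<pi> G"
proof -
  define T where "T = {0, 1, 2 :: nat}"
  have T: "card T = 3" "finite T" by (auto simp: T_def)
  let ?F = "{(T, False), (T, True)}"
  have fE: "finite (edges G)" using E(1) card_ge_0_finite by force
  obtain \<beta> where \<beta>: "bij_betw \<beta> (edges G) T" using finite_same_card_bij[OF fE T(2)] E T by auto
  \<comment> \<open>An edge becomes the side of the triangle opposite to its vertex under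
    \<open>\<beta>\<close>.\<close>
  let ?\<epsilon> = "\<lambda>e. T - {\<beta> e}"
  have bT: "\<beta> e \<in> T" if "e \<in> edges G" for e using \<beta> that by (auto simp: bij_betw_def)
  have inj: "inj_on \<beta> (edges G)" using \<beta> by (simp add: bij_betw_def)
  let ?H = "hgraph T (edges G) ?\<epsilon>"
  have cuts: "(\<exists>U. S = edge_cut G U) \<longleftrightarrow> S = {} \<or> S = edges G" for S
  proof
    assume "\<exists>U. S = edge_cut G U"
    then show "S = {} \<or> S = edges G" using E(2) by (auto simp: edge_cut_def)
  next
    assume "S = {} \<or> S = edges G"
    moreover have "edge_cut G {a} = edges G" using E(2) V by (auto simp: edge_cut_def)
    ultimately show "\<exists>U. S = edge_cut G U" by (metis cut_empty)
  qed
  have even: "even_edges ?H S \<longleftrightarrow> S = {} \<or> S = edges G" for S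
  proof
    assume ev: "even_edges ?H S"
    then have S: "S \<subseteq> edges G" by (simp add: even_edges_def hgraph_def)
    have fS: "finite S" using S fE finite_subset by auto
    \<comment> \<open>At the vertex opposite to \<open>e\<close> all edges of \<open>S\<close>
      except \<open>e\<close> meet, so membership of \<open>e\<close> fixes the parity of
      \<open>card S\<close>; hence \<open>S\<close> is all or nothing.\<close>
    have inS: "odd (card S)" if "e \<in> S" for e
    proof -
      have "{d \<in> S. \<beta> e \<in> ?\<epsilon> d} = S - {e}" using that S inj bT by (auto simp: inj_on_def)
      then have "even (card (S - {e}))" using even_edges_at[OF ev, of "\<beta> e"] by simp
      moreover have "card S = Suc (card (S - {e}))" using that fS by (metis card.remove)
      ultimately show ?thesis by simp
    qed
    have outS: "even (card S)" if "e \<in> edges G - S" for e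
    proof -
      have "{d \<in> S. \<beta> e \<in> ?\<epsilon> d} = S" using that S inj bT by (auto simp: inj_on_def)
      then show ?thesis using even_edges_at[OF ev, of "\<beta> e"] by simp
    qed
    show "S = {} \<or> S = edges G" using inS outS S by blast
  next
    have "even (card {e \<in> edges G. v \<in> ?\<epsilon> e})" for v
    proof (cases "v \<in> T")
      case True
      then obtain e where e: "e \<in> edges G" "\<beta> e = v" using \<beta> by (auto simp: bij_betw_def)
      then have "{d \<in> edges G. v \<in> ?\<epsilon> d} = edges G - {e}" using True inj by (auto simp: inj_on_def)
      then show ?thesis using E e fE by simp
    qed simp
    then show "S = {} \<or> S = edges G \<Longrightarrow> even_edges ?H S" by (auto simp: even_edges_def hgraph_def)
  qed
  have ch: "chordal ?H"
  proof -
    have "length vs \<le> 3" if "distinct vs" "set vs \<subseteq> T" for vs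
      using that T card_mono[of T "set vs"] by (simp add: distinct_card)
    then show ?thesis by (force simp: chordal_def induced_cycle_def hgraph_def)
  qed
  have "represents T ?F ?\<epsilon> (\<lambda>P. if snd P then b else a) G"
    unfolding represents_def
  proof (intro conjI ballI allI impI)
    show "stacked_sphere T ?F" using T by (intro stacked_sphere.base)
    show "inj_on ?\<epsilon> (edges G)"
      using inj bT unfolding inj_on_def by (metis Diff_insert_absorb insert_Diff insert_absorb insert_iff singletonD Diff_iff)
    show "card (?\<epsilon> e) = 2" if "e \<in> edges G" for e using T bT[OF that] by simp
    show "(\<lambda>P. if snd P then b else a) ` ?F = verts G" using V by auto
    show "(\<lambda>P. if snd P then b else a) ` {P \<in> ?F. ?\<epsilon> e \<subseteq> fst P} = ends G e" if "e \<in> edges G" for e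
    proof -
      have "{P \<in> ?F. ?\<epsilon> e \<subseteq> fst P} = ?F" by auto
      then show ?thesis using E(2)[OF that] by auto
    qed
    show "\<exists>P\<in>?F. (if snd P then b else a) = z \<and> (\<forall>e\<in>edges G. z \<in> ends G e \<longrightarrow> ?\<epsilon> e \<subseteq> fst P)"
      if "z \<in> verts G" for z using that V by auto
    show "even_edges ?H S = (\<exists>U. S = edge_cut G U)" for S using even cuts by simp
    show "chordal ?H" by (rule ch)
  qed
  then show ?thesis by blast
qed

lemma inj_on_extend:
  assumes "inj_on \<epsilon> A" "\<And>d. d \<in> A \<Longrightarrow> \<epsilon>' d = \<epsilon> d" "inj_on \<epsilon>' B"
    and "\<And>d. d \<in> A \<Longrightarrow> x \<notin> \<epsilon> d" "\<And>d. d \<in> B \<Longrightarrow> x \<in> \<epsilon>' d"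
  shows "inj_on \<epsilon>' (A \<union> B)"
proof (rule inj_onI)
  fix c d assume cd: "c \<in> A \<union> B" "d \<in> A \<union> B" "\<epsilon>' c = \<epsilon>' d"
  have "x \<in> \<epsilon>' b \<longleftrightarrow> b \<notin> A" if "b \<in> A \<union> B" for b
    using assms(2)[of b] assms(4)[of b] assms(5)[of b] that by auto
  then have "c \<in> A \<longleftrightarrow> d \<in> A" using cd by metis
  then consider "c \<in> A" "d \<in> A" | "c \<in> B" "d \<in> B" using cd by blast
  then show "c = d"
  proof cases
    case 1
    then show ?thesis using assms(1,2) cd(3) by (metis inj_on_def)
  next
    case 2
    then show ?thesis using assms(3) cd(3) by (metis inj_on_def)
  qed
qed

text \<open>A loop is dual to a bridge: \<open>x\<close> is stacked on a face over \<open>h\<close>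
  and joined to one corner only. The new faces stay over \<open>h\<close>, and as \<open>e\<close>
  is the only edge at \<open>x\<close>, no even set contains it.\<close>

lemma represents_loop:
  fixes G :: "('v, 'e) mgraph"
  assumes G: "is_mgraph G" and e: "e \<in> edges G" "ends G e = {h}"
    and R: "represents V F \<epsilon> \<pi> (del_edges G {e})"
  shows "\<exists>V F \<epsilon> \<pi>. represents V F \<epsilon> \<pi> G"
proof -
  let ?G = "del_edges G {e}"
  note r = representsD[OF R] and rm = represents_mgraph[OF R mgraph_del_edges[OF G]]
  have E: "edges ?G = edges G - {e}" "verts ?G = verts G" "ends ?G = ends G" by (auto simp: del_edges_def)
  have "h \<in> verts G" using G e by (auto simp: is_mgraph_def)
  then have "h \<in> \<pi> ` F" using r(4) E by simp
  then obtain P where P: "P \<in> F" "\<pi> P = h" by (metis imageE)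
  obtain x where x: "x \<notin> V" using sphere_finite(1)[OF r(1)] ex_new_if_finite infinite_UNIV_nat by blast
  interpret stacking V F P x using r(1) P x by unfold_locales
  obtain u where u: "u \<in> T" using T3(1) by fastforce
  have xu: "x \<noteq> u" using u T3(4) by auto
  define \<epsilon>' where "\<epsilon>' = \<epsilon>(e := {x, u})"
  define \<pi>' where "\<pi>' = (\<lambda>Q. if x \<in> fst Q then h else \<pi> Q)"
  have p1: "\<pi>' Q = \<pi> Q" if "Q \<in> F" for Q using old_face[OF that] by (simp add: \<pi>'_def)
  have p2: "\<pi>' (N v) = h" for v by (simp add: \<pi>'_def new_face_def)
  have e1: "\<epsilon>' d = \<epsilon> d" if "d \<in> edges ?G" for d using that E by (auto simp: \<epsilon>'_def)
  have e2: "\<epsilon>' e = {x, u}" by (simp add: \<epsilon>'_def)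
  have xe: "x \<notin> \<epsilon> d" if "d \<in> edges ?G" for d using rm(2)[OF that] x by auto
  have cut: "edge_cut G U = edge_cut ?G U" for U using edge_cut_del_loop[OF e(2), of U] by simp
  let ?H = "hgraph (insert x V) (edges G) \<epsilon>'"
  have "represents (insert x V) (stack F P x) \<epsilon>' \<pi>' G"
    unfolding represents_def
  proof (intro conjI ballI allI impI)
    show "stacked_sphere (insert x V) (stack F P x)" using r(1) P x by (intro stacked_sphere.step)
    show "inj_on \<epsilon>' (edges G)"
    proof -
      have "inj_on \<epsilon>' (edges ?G \<union> {e})"
        by (rule inj_on_extend[OF r(2) e1 _ xe]) (simp_all add: e2)
      moreover have "edges ?G \<union> {e} = edges G" using E e by auto
      ultimately show ?thesis by (simp only:)
    qed
    show c2: "card (\<epsilon>' d) = 2" if "d \<in> edges G" for d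
      using that e1 e2 r(3) E xu by (cases "d = e") auto
    have "P \<in> F" by (rule P)
    have "\<pi>' ` stack F P x = \<pi> ` F"
    proof -
      have "\<pi>' ` stack F P x = \<pi> ` (F - {P}) \<union> {h}"
      proof -
        have "\<pi>' ` (F - {P}) = \<pi> ` (F - {P})" using p1 by (intro image_cong refl) simp
        moreover have "\<pi>' ` new_face x (fst P) ` fst P = {h}" unfolding image_image p2 using u by blast
        ultimately show ?thesis unfolding stack_def image_Un by simp
      qed
      also have "\<dots> = \<pi> ` F" using P by auto
      finally show ?thesis .
    qed
    then show "\<pi>' ` stack F P x = verts G" using r(4) E by simp
    show "\<pi>' ` {Q \<in> stack F P x. \<epsilon>' d \<subseteq> fst Q} = ends G d" if d: "d \<in> edges G" for d
    proof (cases "d = e")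
      case True
      have "T - {u} \<noteq> {}"
      proof
        assume "T - {u} = {}"
        then have "card T = card {u}" using u by (metis insert_Diff)
        then show False using T3(1) by simp
      qed
      then have "\<pi>' ` N ` (T - {u}) = {h}" unfolding image_image p2 by blast
      then show ?thesis using True e2 faces_new[OF u] e by simp
    next
      case False
      then have d': "d \<in> edges ?G" using d E by simp
      have "\<pi>' ` {Q \<in> stack F P x. \<epsilon> d \<subseteq> fst Q} = \<pi> ` {Q \<in> F. \<epsilon> d \<subseteq> fst Q}"
        using r(3)[OF d'] rm(2)[OF d'] p1 p2 P(2) by (intro image_faces_old) auto
      then show ?thesis using r(5)[OF d'] e1[OF d'] E by simp
    qed
    show "\<exists>Q\<in>stack F P x. \<pi>' Q = z \<and> (\<forall>d\<in>edges G. z \<in> ends G d \<longrightarrow> \<epsilon>' d \<subseteq> fst Q)"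
      if z: "z \<in> verts G" "card {d \<in> edges G. z \<in> ends G d} = 3 \<and> (\<forall>d\<in>edges G. ends G d \<noteq> {z})" for z
    proof -
      \<comment> \<open>Vertices with loops are exempt from the degree-three clause, so nothing is
        asked at \<open>h\<close>, whose face was subdivided.\<close>
      have zh: "z \<noteq> h" using z e by auto
      then have "{d \<in> edges ?G. z \<in> ends ?G d} = {d \<in> edges G. z \<in> ends G d}" using e E by auto
      then obtain Q where Q: "Q \<in> F" "\<pi> Q = z" "\<forall>d\<in>edges ?G. z \<in> ends ?G d \<longrightarrow> \<epsilon> d \<subseteq> fst Q"
        using r(6)[of z] z E by auto
      have "Q \<noteq> P" using Q P zh by auto
      then have "Q \<in> stack F P x" using Q by (simp add: stack_def)
      moreover have "\<epsilon>' d \<subseteq> fst Q" if "d \<in> edges G" "z \<in> ends G d" for d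
      proof -
        have "d \<noteq> e" using that e zh by auto
        then show ?thesis using that Q(3) E e1[of d] by auto
      qed
      moreover have "\<pi>' Q = z" using p1[OF Q(1)] Q(2) by simp
      ultimately show ?thesis by blast
    qed
    have xat: "{d \<in> S. x \<in> \<epsilon>' d} = S \<inter> {e}" if "S \<subseteq> edges G" for S
    proof -
      have "x \<in> \<epsilon>' d \<longleftrightarrow> d = e" if "d \<in> edges G" for d using that e1[of d] e2 xe[of d] E by auto
      then show ?thesis using that by auto
    qed
    have mH: "is_mgraph ?H"
    proof -
      have "\<epsilon>' d \<subseteq> insert x V" if "d \<in> edges G" for d
        using that e1[of d] e2 rm(2)[of d] E u T3(2) by (cases "d = e") auto
      then show ?thesis using c2 G sphere_finite(1)[OF sph] by (auto simp: is_mgraph_def hgraph_def)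
    qed
    show "even_edges ?H S \<longleftrightarrow> (\<exists>U. S = edge_cut G U)" for S
    proof
      assume ev: "even_edges ?H S"
      then have S: "S \<subseteq> edges G" by (simp add: even_edges_def hgraph_def)
      have "even (card (S \<inter> {e}))" using even_edges_at[OF ev, of x] xat[OF S] by simp
      then have "e \<notin> S" by auto
      then have S': "S \<subseteq> edges ?G" using S E by auto
      have "even_edges (hgraph V (edges ?G) \<epsilon>) S"
        using even_edges_hgraph_old[OF S', of "edges G" \<epsilon>' \<epsilon>] e1 E ev by blast
      then show "\<exists>U. S = edge_cut G U" using r(7) cut by auto
    next
      assume "\<exists>U. S = edge_cut G U"
      then obtain U where U: "S = edge_cut ?G U" using cut by auto
      then have S': "S \<subseteq> edges ?G" using cut_subset by metis
      have "even_edges (hgraph V (edges ?G) \<epsilon>) S" using U r(7) by auto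
      then show "even_edges ?H S"
        using even_edges_hgraph_old[OF S', of "edges G" \<epsilon>' \<epsilon>] e1 E by blast
    qed
    show "chordal ?H"
    proof (rule chordal_add_simplicial[where K = "{u}", OF rm(1) r(8)])
      show "\<exists>v\<in>{u}. ends ?H d = {x, v}" if "d \<in> edges ?H - edges (hgraph V (edges ?G) \<epsilon>)" for d
        using that e2 E by (auto simp: hgraph_def)
    qed (use x e1 E u T3 in \<open>auto simp: hgraph_def\<close>)
  qed
  then show ?thesis by blast
qed

lemma card_2_other:
  assumes "card A = 2" "P \<in> A"
  obtains R where "A = {P, R}" "R \<noteq> P"
proof -
  obtain a b where "A = {a, b}" "a \<noteq> b" using assms(1) by (auto simp: card_2_iff)
  then show thesis using that[of a] that[of b] assms(2) by (auto simp: insert_commute)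
qed

text \<open>Dual to adding a vertex of degree two at the edge \<open>\<epsilon> e\<close>:
  \<open>x\<close> is stacked on the face over \<open>h\<close> at that edge and joined to its two
  ends. The new face that keeps this edge goes to \<open>a\<close>, the other two remain with
  \<open>h\<close>.\<close>

lemma represents_ear:
  fixes G :: "('v, 'e) mgraph"
  assumes tc: "three_conn G" and v3: "3 \<le> card (verts G)" and c: "ear G a h y e f g"
    and R: "represents V F \<epsilon> \<pi> (remove_ear G a h y e f g)"
  shows "\<exists>V F \<epsilon> \<pi>. represents V F \<epsilon> \<pi> G"
proof -
  let ?G = "remove_ear G a h y e f g"
  note G = three_connD(1)[OF tc] and fE = three_connD(3,4)[OF tc]
  have G': "is_mgraph ?G" using mgraph_remove_ear[OF G c] .
  note r = representsD[OF R] and rm = represents_mgraph[OF R G']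
  note ev = ear_verts[OF G c]
  have n: "e \<noteq> f" "e \<noteq> g" "f \<noteq> g" "a \<noteq> h" "a \<noteq> y" "a \<in> verts G"
    and en: "ends G e = {a, y}" "ends G f = {a, h}" "ends G g = {a, h}"
    and st: "{d \<in> edges G. a \<in> ends G d} = {e, f, g}" using c by (auto simp: ear_def)
  have E: "edges ?G = edges G - {f, g}" "verts ?G = verts G - {a}" "ends ?G e = {h, y}"
    "\<And>d. d \<noteq> e \<Longrightarrow> ends ?G d = ends G d" by (auto simp: remove_ear_def)
  have eG: "e \<in> edges ?G" using ev n E by simp
  have EU: "edges ?G \<union> {f, g} = edges G" using E ev by auto
  have img: "\<pi> ` {Q \<in> F. \<epsilon> e \<subseteq> fst Q} = {h, y}" using r(5)[OF eG] E(3) by simp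
  then have "h \<in> \<pi> ` {Q \<in> F. \<epsilon> e \<subseteq> fst Q}" by simp
  then obtain P where P: "P \<in> F" "\<epsilon> e \<subseteq> fst P" "\<pi> P = h" by auto
  obtain x where x: "x \<notin> V" using sphere_finite(1)[OF r(1)] ex_new_if_finite infinite_UNIV_nat by blast
  interpret stacking V F P x using r(1) P x by unfold_locales
  obtain u0 where u0: "u0 \<in> T" "\<epsilon> e = T - {u0}" using card_2_subset_3[OF T3(1) r(3)[OF eG] P(2)] by blast
  obtain u1 u2 where u12: "\<epsilon> e = {u1, u2}" "u1 \<noteq> u2" using r(3)[OF eG] by (auto simp: card_2_iff)
  have T: "T = {u0, u1, u2}" "u0 \<noteq> u1" "u0 \<noteq> u2" using u0 u12 by auto
  have xT: "x \<noteq> u0" "x \<noteq> u1" "x \<noteq> u2" using T3(4) T(1) by auto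
  have "card {Q \<in> F. \<epsilon> e \<subseteq> fst Q} = 2" using sphere_two_faces[OF r(1) P(1,2) r(3)[OF eG]] .
  \<comment> \<open>The face across \<open>\<epsilon> e\<close>; it lies over \<open>y\<close>, also
    in the case \<open>y = h\<close>.\<close>
  then obtain R' where R': "{Q \<in> F. \<epsilon> e \<subseteq> fst Q} = {P, R'}" "R' \<noteq> P"
    by (rule card_2_other[of _ P]) (use P in auto)
  have piR: "\<pi> R' = y"
  proof -
    have "{h, \<pi> R'} = {h, y}" using img R' P(3) by simp
    then show ?thesis by (metis doubleton_eq_iff)
  qed
  define \<epsilon>' where "\<epsilon>' = \<epsilon>(f := {x, u1}, g := {x, u2})"
  define \<pi>' where "\<pi>' = (\<lambda>Q. if x \<in> fst Q then (if u0 \<in> fst Q then h else a) else \<pi> Q)"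
  have p1: "\<pi>' Q = \<pi> Q" if "Q \<in> F" for Q using old_face[OF that] by (simp add: \<pi>'_def)
  have p2: "\<pi>' (N u0) = a" "\<pi>' (N u1) = h" "\<pi>' (N u2) = h"
    using T xT by (auto simp: \<pi>'_def new_face_def)
  have e1: "\<epsilon>' d = \<epsilon> d" if "d \<in> edges ?G" for d using that E by (auto simp: \<epsilon>'_def)
  have e2: "\<epsilon>' f = {x, u1}" "\<epsilon>' g = {x, u2}" using n by (auto simp: \<epsilon>'_def)
  have xe: "x \<notin> \<epsilon> d" if "d \<in> edges ?G" for d using rm(2)[OF that] x by auto
  have star_other: "edge_cut G {z} = edge_cut ?G {z}" if "z \<noteq> h" "z \<noteq> a" for z
    using edge_cut_remove_ear'[OF G c, of "{z}"] that by simp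
  have star_a: "edge_cut G {a} = {e, f, g}"
    using st n en unfolding edge_cut_def by auto
  have star_h: "edge_cut G {h} = symdiff (edge_cut ?G {h}) {e, f, g}"
  proof -
    have "edge_cut ?G {h} = edge_cut G {a, h}" using edge_cut_remove_ear'[OF G c, of "{h}"] by simp
    moreover have "{h} = symdiff {a, h} {a}" using n by (auto simp: symdiff_def)
    ultimately show ?thesis using cut_symdiff[OF G, of "{a, h}" "{a}"] star_a by simp
  qed
  let ?H = "hgraph (insert x V) (edges G) \<epsilon>'"
  have "represents (insert x V) (stack F P x) \<epsilon>' \<pi>' G"
    unfolding represents_def
  proof (intro conjI ballI allI impI)
    show "stacked_sphere (insert x V) (stack F P x)" using r(1) P x by (intro stacked_sphere.step)
    show "inj_on \<epsilon>' (edges G)"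
    proof -
      have "inj_on \<epsilon>' {f, g}" using e2 u12 xT by (auto simp: doubleton_eq_iff)
      then have "inj_on \<epsilon>' (edges ?G \<union> {f, g})"
        by (intro inj_on_extend[OF r(2), where x = x]) (use e1 e2 xe in auto)
      then show ?thesis using EU by (simp only:)
    qed
    show c2: "card (\<epsilon>' d) = 2" if "d \<in> edges G" for d
    proof -
      have "d \<in> edges ?G \<or> d = f \<or> d = g" using that E by auto
      then show ?thesis using e1[of d] r(3)[of d] e2 xT by auto
    qed
    show "\<pi>' ` stack F P x = verts G"
    proof -
      have "fn ` T = {fn u0, fn u1, fn u2}" for fn :: "nat \<Rightarrow> 'v" using T(1) by simp
      from this[of "\<lambda>u. \<pi>' (N u)"] have "\<pi>' ` N ` T = {a, h}" using p2 by (simp add: image_image)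
      moreover have "\<pi>' ` (F - {P}) = \<pi> ` (F - {P})" using p1 by (intro image_cong) auto
      ultimately have "\<pi>' ` stack F P x = \<pi> ` (F - {P}) \<union> {a, h}"
        unfolding stack_def image_Un by simp
      also have "\<dots> = insert a (\<pi> ` F)" using P by auto
      finally show ?thesis using r(4) E n by auto
    qed
    show "\<pi>' ` {Q \<in> stack F P x. \<epsilon>' d \<subseteq> fst Q} = ends G d" if d: "d \<in> edges G" for d
    proof -
      consider "d = e" | "d = f" | "d = g" | "d \<in> edges ?G" "d \<noteq> e" using d E by auto
      then show ?thesis
      proof cases
        case 1
        have "{N u |u. u \<in> T \<and> \<epsilon> e = T - {u}} = {N u0}" using u0 T by auto
        moreover have "{Q \<in> F. \<epsilon> e \<subseteq> fst Q} - {P} = {R'}" using R' by auto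
        ultimately have "{Q \<in> stack F P x. \<epsilon> e \<subseteq> fst Q} = {R', N u0}"
          using faces_old[OF r(3)[OF eG] rm(2)[OF eG]] by auto
        moreover have "R' \<in> F" using R' by auto
        ultimately show ?thesis using 1 e1[OF eG] p1 p2 piR en by auto
      next
        case 2
        have "T - {u1} = {u0, u2}" using T u12 by auto
        then show ?thesis using 2 e2 faces_new[of u1] T p2 en by simp
      next
        case 3
        have "T - {u2} = {u0, u1}" using T u12 by auto
        then show ?thesis using 3 e2 faces_new[of u2] T p2 en by simp
      next
        case 4
        have "\<pi>' ` {Q \<in> stack F P x. \<epsilon> d \<subseteq> fst Q} = \<pi> ` {Q \<in> F. \<epsilon> d \<subseteq> fst Q}"
        proof (rule image_faces_old[OF r(3)[OF 4(1)] rm(2)[OF 4(1)]])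
          fix u assume u: "u \<in> T" "\<epsilon> d = T - {u}"
          have "u \<noteq> u0"
          proof
            assume "u = u0"
            then have "\<epsilon> d = \<epsilon> e" using u u0 by simp
            then show False using r(2) 4 eG by (auto simp: inj_on_def)
          qed
          then show "\<pi>' (N u) = \<pi> P" using u T p2 P by auto
        qed (rule p1)
        then show ?thesis using r(5)[OF 4(1)] e1[OF 4(1)] E(4)[OF 4(2)] by simp
      qed
    qed
    show "\<exists>Q\<in>stack F P x. \<pi>' Q = z \<and> (\<forall>d\<in>edges G. z \<in> ends G d \<longrightarrow> \<epsilon>' d \<subseteq> fst Q)"
      if z: "z \<in> verts G" "card {d \<in> edges G. z \<in> ends G d} = 3 \<and> (\<forall>d\<in>edges G. ends G d \<noteq> {z})" for z
    proof -
      consider "z = a" | "z = h" | "z \<noteq> a" "z \<noteq> h" by blast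
      then show ?thesis
      proof cases
        case 1
        have N0: "N u0 = (insert x {u1, u2}, False)" using T u12 by (auto simp: new_face_def)
        have "\<epsilon>' d \<subseteq> fst (N u0)" if "d \<in> edges G" "a \<in> ends G d" for d
        proof -
          have "d = e \<or> d = f \<or> d = g" using that st by auto
          then show ?thesis using e1[OF eG] e2 u12 N0 by auto
        qed
        moreover have "N u0 \<in> stack F P x" using u0 by (simp add: stack_def)
        ultimately show ?thesis using 1 p2 by auto
      next
        case 2
        \<comment> \<open>In the reduced graph \<open>h\<close> has degree at least three. In
          \<open>G\<close> it can lose only \<open>e\<close> and gains \<open>f\<close> and
          \<open>g\<close>, so its degree exceeds three and the clause is vacuous.\<close>
        have tcG: "three_conn ?G" using three_conn_remove_ear[OF tc c] .
        have "2 \<le> card (verts ?G)" using v3 E(2) n(6) fE by simp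
        moreover have "h \<in> verts ?G" using ev E by simp
        ultimately have "3 \<le> card (edge_cut ?G {h})" by (rule three_conn_degree[OF tcG])
        moreover have fc: "finite (edge_cut ?G {h})" using three_connD(4)[OF tcG] cut_subset finite_subset by metis
        ultimately have "2 \<le> card (edge_cut ?G {h} - {e})" by (auto simp: card_Diff_singleton_if)
        moreover have "f \<notin> edge_cut ?G {h}" "g \<notin> edge_cut ?G {h}" using E by (auto simp: edge_cut_def)
        ultimately have "4 \<le> card (insert f (insert g (edge_cut ?G {h} - {e})))" using n fc by simp
        also have "\<dots> \<le> card {d \<in> edges G. h \<in> ends G d}"
        proof (rule card_mono)
          have "d \<in> edges G \<and> h \<in> ends G d" if "d \<in> edge_cut ?G {h} - {e}" for d
            using that E by (auto simp: edge_cut_def)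
          then show "insert f (insert g (edge_cut ?G {h} - {e})) \<subseteq> {d \<in> edges G. h \<in> ends G d}"
            using en ev by auto
        qed (use fE in simp)
        finally show ?thesis using z 2 by simp
      next
        case 3
        have inc: "z \<in> ends ?G d \<longleftrightarrow> z \<in> ends G d" if "d \<in> edges ?G" for d
          using E(3) E(4)[of d] en 3 by (cases "d = e") auto
        have notfg: "z \<notin> ends G f" "z \<notin> ends G g" using en 3 by auto
        have "{d \<in> edges ?G. z \<in> ends ?G d} = {d \<in> edges G. z \<in> ends G d}" using inc notfg EU by blast
        moreover have "ends ?G d \<noteq> {z}" if "d \<in> edges ?G" for d
          using that z(2) E 3 by (cases "d = e") auto
        ultimately obtain Q where Q: "Q \<in> F" "\<pi> Q = z" "\<forall>d\<in>edges ?G. z \<in> ends ?G d \<longrightarrow> \<epsilon> d \<subseteq> fst Q"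
          using r(6)[of z] z E(2) 3 by auto
        have "Q \<noteq> P" using Q P 3 by auto
        then have "Q \<in> stack F P x" using Q by (simp add: stack_def)
        moreover have "\<epsilon>' d \<subseteq> fst Q" if "d \<in> edges G" "z \<in> ends G d" for d
        proof -
          have "d \<in> edges ?G" using that notfg E by auto
          then show ?thesis using that Q(3) inc e1 by simp
        qed
        moreover have "\<pi>' Q = z" using p1[OF Q(1)] Q(2) by simp
        ultimately show ?thesis by blast
      qed
    qed
    have mH: "is_mgraph ?H"
    proof -
      have "\<epsilon>' d \<subseteq> insert x V" if "d \<in> edges G" for d
      proof -
        have "d \<in> edges ?G \<or> d = f \<or> d = g" using that E by auto
        then show ?thesis using e1[of d] e2 rm(2)[of d] T3(2) T(1) by auto
      qed
      then show ?thesis using c2 fE sphere_finite(1)[OF sph] by (auto simp: is_mgraph_def hgraph_def)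
    qed
    have old: "even_edges ?H S \<longleftrightarrow> even_edges (hgraph V (edges ?G) \<epsilon>) S" if "S \<subseteq> edges ?G" for S
      using even_edges_hgraph_old[OF that, of "edges G" \<epsilon>' \<epsilon>] e1 E by blast
    have ev_a: "even_edges ?H {e, f, g}"
    proof -
      have e3: "\<epsilon>' e = {u1, u2}" using e1[OF eG] u12 by simp
      have "even (card {d \<in> {e, f, g}. v \<in> \<epsilon>' d})" for v
      proof -
        have "{d \<in> {e, f, g}. v \<in> \<epsilon>' d} = (if v = x then {f, g} else if v = u1 then {e, f} else if v = u2 then {e, g} else {})"
          using e2 e3 xT u12(2) by auto
        then show ?thesis using n by simp
      qed
      then show ?thesis using ev by (auto simp: even_edges_def hgraph_def)
    qed
    show "even_edges ?H S \<longleftrightarrow> (\<exists>U. S = edge_cut G U)" for S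
    proof (rule even_iff_cut_extend[OF G mH, where G' = ?G and H' = "hgraph V (edges ?G) \<epsilon>"])
      show "edges ?H = edges G" by (simp add: hgraph_def)
      show "\<exists>U. S = edge_cut ?G U" if "even_edges (hgraph V (edges ?G) \<epsilon>) S" for S using that r(7) by auto
      show "even_edges ?H (edge_cut G {z})" if "z \<in> verts G" for z
      proof -
        have o: "even_edges ?H (edge_cut ?G {w})" for w
          using old[OF cut_subset] r(7) by auto
        consider "z = a" | "z = h" | "z \<noteq> a" "z \<noteq> h" by blast
        then show ?thesis
          using star_a ev_a star_h star_other[of z] o even_edges_symdiff[OF mH o[of h] ev_a] by cases auto
      qed
      show "\<exists>W. edge_cut ?G U = edge_cut G W" for U using edge_cut_remove_ear'[OF G c] by blast
      show "\<exists>U. even_edges (hgraph V (edges ?G) \<epsilon>) (symdiff S (edge_cut G U))" if evS: "even_edges ?H S" for S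
      proof -
        have S: "S \<subseteq> edges G" using evS by (simp add: even_edges_def hgraph_def)
        \<comment> \<open>Only \<open>f\<close> and \<open>g\<close> meet \<open>x\<close>, so an
          even set has both or none; both are removed by adding the star of
          \<open>a\<close>.\<close>
        have "x \<in> \<epsilon>' d \<longleftrightarrow> d = f \<or> d = g" if "d \<in> edges G" for d
          using that e1[of d] e2 xe[of d] E by auto
        then have "{d \<in> S. x \<in> \<epsilon>' d} = S \<inter> {f, g}" using S by auto
        then have "even (card (S \<inter> {f, g}))" using even_edges_at[OF evS, of x] by simp
        then have fg: "f \<in> S \<longleftrightarrow> g \<in> S" using n by (cases "f \<in> S"; cases "g \<in> S") auto
        show ?thesis
        proof (cases "f \<in> S")
          case True
          then have "symdiff S {e, f, g} \<subseteq> edges ?G" using fg S E ev n by (auto simp: symdiff_def)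
          then have "even_edges (hgraph V (edges ?G) \<epsilon>) (symdiff S (edge_cut G {a}))"
            using old even_edges_symdiff[OF mH evS ev_a] star_a by simp
          then show ?thesis ..
        next
          case False
          then have "S \<subseteq> edges ?G" using fg S E by auto
          moreover have "symdiff S (edge_cut G {}) = S" by (simp add: symdiff_def)
          ultimately show ?thesis using old evS by metis
        qed
      qed
    qed
    show "chordal ?H"
    proof (rule chordal_add_simplicial[where K = "{u1, u2}", OF rm(1) r(8)])
      show "\<exists>v\<in>{u1, u2}. ends ?H d = {x, v}" if "d \<in> edges ?H - edges (hgraph V (edges ?G) \<epsilon>)" for d
        using that e2 E by (auto simp: hgraph_def)
      show "adjacent (hgraph V (edges ?G) \<epsilon>) u v" if "u \<in> {u1, u2}" "v \<in> {u1, u2}" "u \<noteq> v" for u v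
      proof -
        have "{u, v} = \<epsilon> e" using that u12 by auto
        then show ?thesis using eG by (auto simp: adjacent_def hgraph_def)
      qed
      show "{u1, u2} \<subseteq> verts (hgraph V (edges ?G) \<epsilon>)" using T T3(2) by (auto simp: hgraph_def)
    qed (use x e1 E in \<open>auto simp: hgraph_def\<close>)
  qed
  then show ?thesis by blast
qed

text \<open>Dual to adding a vertex of degree three: the triangle that carries the three edges of
  the contracted vertex is subdivided, \<open>x\<close> is joined to all corners, and the new face
  at the edge of \<open>ou w\<close> goes to \<open>w\<close>.\<close>

lemma represents_cubic_triangle:
  fixes G :: "('v, 'e) mgraph"
  assumes tc: "three_conn G" and ll: "loopless G" and c: "cubic_triangle G X ou nn" and z0: "z0 \<in> X"
    and R: "represents V F \<epsilon> \<pi> (contract G X z0)"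
  shows "\<exists>V F \<epsilon> \<pi>. represents V F \<epsilon> \<pi> G"
proof -
  let ?G = "contract G X z0"
  note G = three_connD(1)[OF tc] and fE = three_connD(3,4)[OF tc]
  have G': "is_mgraph ?G" using mgraph_contract[OF G] .
  have llG: "loopless ?G" using loopless_contract[OF G ll z0] .
  note r = representsD[OF R] and rm = represents_mgraph[OF R G']
  have X: "X \<subseteq> verts G" "card X = 3" "finite X"
    using c fE finite_subset by (auto simp: cubic_triangle_def)
  have ou: "\<And>w. w \<in> X \<Longrightarrow> ou w \<in> edges G" "\<And>w. w \<in> X \<Longrightarrow> card (ends G (ou w)) = 2"
    "\<And>w. w \<in> X \<Longrightarrow> ends G (ou w) \<inter> X = {w}"
    and nn: "\<And>w. w \<in> X \<Longrightarrow> nn w \<in> edges G" "\<And>w. w \<in> X \<Longrightarrow> ends G (nn w) = X - {w}"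
    and st: "\<And>w. w \<in> X \<Longrightarrow> {d \<in> edges G. w \<in> ends G d} = insert (ou w) (nn ` (X - {w}))"
    using c by (auto simp: cubic_triangle_def)
  have oinj: "inj_on ou X"
  proof (rule inj_onI)
    fix w w' assume w: "w \<in> X" "w' \<in> X" "ou w = ou w'"
    then have "{w} = {w'}" using ou(3) by metis
    then show "w = w'" by simp
  qed
  have ninj: "inj_on nn X"
  proof (rule inj_onI)
    fix w w' assume w: "w \<in> X" "w' \<in> X" "nn w = nn w'"
    then have "X - {w} = X - {w'}" using nn(2) by metis
    then show "w = w'" using w by blast
  qed
  have E: "edges ?G = edges G - nn ` X"
  proof -
    have "d \<in> nn ` X" if d: "d \<in> edges G" "ends G d \<subseteq> X" for d
    proof -
      obtain p q where "ends G d = {p, q}" using mgraph_ends[OF G d(1)] by metis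
      then obtain w where w: "w \<in> ends G d" "w \<in> X" using d(2) by auto
      then have "d = ou w \<or> d \<in> nn ` (X - {w})" using st[OF w(2)] d(1) by auto
      moreover have "d \<noteq> ou w"
      proof
        assume "d = ou w"
        then have "ends G d = {w}" using ou(3)[OF w(2)] d(2) by auto
        then show False using ou(2)[OF w(2)] \<open>d = ou w\<close> by simp
      qed
      ultimately show ?thesis by auto
    qed
    moreover have "ends G (nn w) \<subseteq> X" if "w \<in> X" for w using nn(2)[OF that] by auto
    ultimately show ?thesis unfolding contract_def by auto
  qed
  have EU: "edges ?G \<union> nn ` X = edges G" using E nn(1) by auto
  have Vv: "verts ?G = insert z0 (verts G - X)" by (simp add: contract_def)
  have ouG: "ou w \<in> edges ?G" if w: "w \<in> X" for w
  proof -
    have "ou w \<noteq> nn w'" if "w' \<in> X" for w'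
    proof
      assume "ou w = nn w'"
      then have "{w} = X - {w'}" using ou(3)[OF w] nn(2)[OF that] by auto
      then have "card (X - {w'}) = 1" by (metis card_1_singleton_iff One_nat_def)
      then show False using that X by simp
    qed
    then show ?thesis using E ou(1)[OF w] by auto
  qed
  have oend: "\<exists>y. y \<notin> X \<and> ends G (ou w) = {w, y} \<and> ends ?G (ou w) = {z0, y}" if w: "w \<in> X" for w
  proof -
    obtain p q where pq: "ends G (ou w) = {p, q}" "p \<noteq> q" using ou(2)[OF w] by (auto simp: card_2_iff)
    moreover have "w \<in> ends G (ou w)" using ou(3)[OF w] by blast
    ultimately obtain y where y: "ends G (ou w) = {w, y}" "y \<noteq> w"
      using card_2_other[OF ou(2)[OF w]] by metis
    then have "y \<notin> X" using ou(3)[OF w] by auto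
    then show ?thesis using y w by (auto simp: contract_def)
  qed
  have star_z0: "{d \<in> edges ?G. z0 \<in> ends ?G d} = ou ` X"
  proof (intro equalityI subsetI)
    fix d assume "d \<in> {d \<in> edges ?G. z0 \<in> ends ?G d}"
    then have d: "d \<in> edges ?G" "z0 \<in> ends ?G d" by auto
    then obtain w where w: "w \<in> ends G d" "w \<in> X" using z0 by (auto simp: contract_def split: if_splits)
    then have "d = ou w \<or> d \<in> nn ` (X - {w})" using st[OF w(2)] d(1) E by auto
    then show "d \<in> ou ` X" using d(1) E w by auto
  next
    fix d assume "d \<in> ou ` X"
    then show "d \<in> {d \<in> edges ?G. z0 \<in> ends ?G d}" using ouG oend by fastforce
  qed
  \<comment> \<open>In the contracted graph \<open>z0\<close> is loopless of degree three, so the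
    degree-three clause provides this triangle.\<close>
  obtain P where P: "P \<in> F" "\<pi> P = z0" "\<And>w. w \<in> X \<Longrightarrow> \<epsilon> (ou w) \<subseteq> fst P"
  proof -
    have "card {d \<in> edges ?G. z0 \<in> ends ?G d} = 3" unfolding star_z0 using oinj X card_image by metis
    moreover have "\<forall>d\<in>edges ?G. ends ?G d \<noteq> {z0}" using llG by (auto simp: loopless_def)
    moreover have "z0 \<in> verts ?G" using Vv by simp
    ultimately obtain P where "P \<in> F" "\<pi> P = z0" "\<forall>d\<in>edges ?G. z0 \<in> ends ?G d \<longrightarrow> \<epsilon> d \<subseteq> fst P"
      using r(6) by blast
    then show thesis using that star_z0 by blast
  qed
  obtain x where x: "x \<notin> V" using sphere_finite(1)[OF r(1)] ex_new_if_finite infinite_UNIV_nat by blast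
  interpret stacking V F P x using r(1) P x by unfold_locales
  have "\<exists>u. u \<in> T \<and> \<epsilon> (ou w) = T - {u}" if w: "w \<in> X" for w
    by (rule card_2_subset_3[OF T3(1) r(3)[OF ouG[OF w]] P(3)[OF w]]) (rule exI, rule conjI)
  \<comment> \<open>The corner of the triangle opposite to the edge of \<open>ou w\<close>; the edge
    \<open>nn w\<close> will join it to \<open>x\<close>.\<close>
  then obtain \<tau> where \<tau>: "\<And>w. w \<in> X \<Longrightarrow> \<tau> w \<in> T \<and> \<epsilon> (ou w) = T - {\<tau> w}" by metis
  have tinj: "inj_on \<tau> X"
  proof (rule inj_onI)
    fix w w' assume w: "w \<in> X" "w' \<in> X" "\<tau> w = \<tau> w'"
    then have "\<epsilon> (ou w) = \<epsilon> (ou w')" using \<tau> by metis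
    then have "ou w = ou w'" using r(2) ouG w by (metis inj_on_def)
    then show "w = w'" using oinj w by (metis inj_on_def)
  qed
  have tim: "\<tau> ` X = T"
    using \<tau> T3 X tinj by (intro card_subset_eq) (auto simp: card_image)
  let ?\<sigma> = "the_inv_into X \<tau>"
  have sig: "?\<sigma> (\<tau> w) = w" if "w \<in> X" for w using the_inv_into_f_f[OF tinj that] .
  let ?m = "the_inv_into X nn"
  have mn: "?m (nn w) = w" if "w \<in> X" for w using the_inv_into_f_f[OF ninj that] .
  define \<epsilon>' where "\<epsilon>' = (\<lambda>d. if d \<in> nn ` X then {x, \<tau> (?m d)} else \<epsilon> d)"
  \<comment> \<open>The choice inverts the injective map \<open>N\<close>, so the new face without
    the corner \<open>\<tau> w\<close> is sent to \<open>w\<close>.\<close>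
  define \<pi>' where "\<pi>' = (\<lambda>Q. if x \<in> fst Q then ?\<sigma> (SOME u. u \<in> T \<and> Q = N u) else \<pi> Q)"
  have p1: "\<pi>' Q = \<pi> Q" if "Q \<in> F" for Q using old_face[OF that] by (simp add: \<pi>'_def)
  have p2: "\<pi>' (N (\<tau> w)) = w" if w: "w \<in> X" for w
  proof -
    have "(SOME u. u \<in> T \<and> N (\<tau> w) = N u) = \<tau> w"
      using inj_new \<tau>[OF w] by (intro some_equality) (auto simp: inj_on_def)
    then show ?thesis using sig[OF w] by (simp add: \<pi>'_def new_face_def)
  qed
  have e1: "\<epsilon>' d = \<epsilon> d" if "d \<in> edges ?G" for d using that E by (auto simp: \<epsilon>'_def)
  have e2: "\<epsilon>' (nn w) = {x, \<tau> w}" if "w \<in> X" for w using that mn by (simp add: \<epsilon>'_def)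
  have xe: "x \<notin> \<epsilon> d" if "d \<in> edges ?G" for d using rm(2)[OF that] x by auto
  have xt: "x \<noteq> \<tau> w" if "w \<in> X" for w using \<tau>[OF that] T3(4) by auto
  have tdiff: "T - {\<tau> w} = \<tau> ` (X - {w})" if "w \<in> X" for w
    using inj_on_image_set_diff[OF tinj, of X "{w}"] tim that by auto
  have cont: "edge_cut ?G U = edge_cut G {v. (if v \<in> X then z0 else v) \<in> U}" for U
    by (rule edge_cut_contract)
  have star_w: "edge_cut G {w} = insert (ou w) (nn ` (X - {w}))" if "w \<in> X" for w
    using loopless_star[OF ll] st[OF that] by simp
  let ?H = "hgraph (insert x V) (edges G) \<epsilon>'"
  have "represents (insert x V) (stack F P x) \<epsilon>' \<pi>' G"
    unfolding represents_def
  proof (intro conjI ballI allI impI)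
    show "stacked_sphere (insert x V) (stack F P x)" using r(1) P x by (intro stacked_sphere.step)
    show "inj_on \<epsilon>' (edges G)"
    proof -
      have "inj_on \<epsilon>' (nn ` X)"
      proof (rule inj_onI)
        fix c d assume "c \<in> nn ` X" "d \<in> nn ` X" "\<epsilon>' c = \<epsilon>' d"
        then obtain w w' where w: "c = nn w" "d = nn w'" "w \<in> X" "w' \<in> X" "{x, \<tau> w} = {x, \<tau> w'}"
          using e2 by auto
        then have "\<tau> w = \<tau> w'" using xt by (metis doubleton_eq_iff)
        then show "c = d" using w tinj by (metis inj_on_def)
      qed
      then have "inj_on \<epsilon>' (edges ?G \<union> nn ` X)"
        by (intro inj_on_extend[OF r(2), where x = x]) (use e1 e2 xe in auto)
      then show ?thesis using EU by (simp only:)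
    qed
    show c2: "card (\<epsilon>' d) = 2" if "d \<in> edges G" for d
    proof -
      have "d \<in> edges ?G \<or> (\<exists>w\<in>X. d = nn w)" using that EU by auto
      then show ?thesis using e1[of d] r(3)[of d] e2 xt by auto
    qed
    show "\<pi>' ` stack F P x = verts G"
    proof -
      have "fn ` T = (\<lambda>w. fn (\<tau> w)) ` X" for fn :: "nat \<Rightarrow> 'v" using tim by (simp add: image_image flip: tim)
      from this[of "\<lambda>u. \<pi>' (N u)"] have "\<pi>' ` N ` T = X" using p2 by (simp add: image_image)
      then have "\<pi>' ` stack F P x = \<pi>' ` (F - {P}) \<union> X" unfolding stack_def image_Un by simp
      also have "\<pi>' ` (F - {P}) = \<pi> ` (F - {P})" using p1 by (intro image_cong) auto
      also have "\<pi> ` (F - {P}) \<union> X = \<pi> ` F \<union> X" using P z0 by auto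
      also have "\<dots> = verts G" using r(4) Vv X z0 by auto
      finally show ?thesis .
    qed
    show "\<pi>' ` {Q \<in> stack F P x. \<epsilon>' d \<subseteq> fst Q} = ends G d" if d: "d \<in> edges G" for d
    proof -
      consider w where "w \<in> X" "d = nn w" | w where "w \<in> X" "d = ou w" | "d \<in> edges ?G" "d \<notin> ou ` X"
        using d EU by blast
      then show ?thesis
      proof cases
        case (1 w)
        have "\<pi>' ` {Q \<in> stack F P x. {x, \<tau> w} \<subseteq> fst Q} = \<pi>' ` N ` \<tau> ` (X - {w})"
          using faces_new[of "\<tau> w"] \<tau>[OF 1(1)] tdiff[OF 1(1)] by simp
        also have "\<dots> = X - {w}" unfolding image_image using p2 by simp
        finally show ?thesis using 1 e2 nn(2) by simp
      next
        case (2 w)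
        note oG = ouG[OF 2(1)]
        obtain y where y: "y \<notin> X" "ends G (ou w) = {w, y}" "ends ?G (ou w) = {z0, y}" using oend[OF 2(1)] by blast
        have "card {Q \<in> F. \<epsilon> (ou w) \<subseteq> fst Q} = 2" using sphere_two_faces[OF r(1) P(1) P(3)[OF 2(1)] r(3)[OF oG]] .
        then obtain R' where R': "{Q \<in> F. \<epsilon> (ou w) \<subseteq> fst Q} = {P, R'}" "R' \<noteq> P"
          by (rule card_2_other[of _ P]) (use P(1) P(3)[OF 2(1)] in auto)
        have "{z0, \<pi> R'} = {z0, y}" using r(5)[OF oG] R' P(2) y(3) by simp
        then have piR: "\<pi> R' = y" by (metis doubleton_eq_iff)
        have "{N u |u. u \<in> T \<and> \<epsilon> (ou w) = T - {u}} = {N (\<tau> w)}" using \<tau>[OF 2(1)] by auto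
        moreover have "{Q \<in> F. \<epsilon> (ou w) \<subseteq> fst Q} - {P} = {R'}" using R' by auto
        ultimately have "{Q \<in> stack F P x. \<epsilon> (ou w) \<subseteq> fst Q} = {R', N (\<tau> w)}"
          using faces_old[OF r(3)[OF oG] rm(2)[OF oG]] by auto
        moreover have "R' \<in> F" using R' by auto
        ultimately show ?thesis using 2 e1[OF oG] p1 p2 piR y by auto
      next
        case 3
        have "\<pi>' ` {Q \<in> stack F P x. \<epsilon> d \<subseteq> fst Q} = \<pi> ` {Q \<in> F. \<epsilon> d \<subseteq> fst Q}"
        proof (rule image_faces_old[OF r(3)[OF 3(1)] rm(2)[OF 3(1)]])
          fix u assume u: "u \<in> T" "\<epsilon> d = T - {u}"
          then obtain w where w: "w \<in> X" "u = \<tau> w" using tim by auto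
          then have "\<epsilon> d = \<epsilon> (ou w)" using \<tau> u by simp
          then have "d = ou w" using r(2) 3(1) ouG[OF w(1)] by (auto simp: inj_on_def)
          then show "\<pi>' (N u) = \<pi> P" using 3(2) w by auto
        qed (rule p1)
        moreover have "ends G d = ends ?G d"
        proof (rule contract_ends_away[OF z0])
          show "z0 \<notin> ends ?G d" using 3 star_z0 by blast
        qed
        ultimately show ?thesis using r(5)[OF 3(1)] e1[OF 3(1)] by simp
      qed
    qed
    show "\<exists>Q\<in>stack F P x. \<pi>' Q = z \<and> (\<forall>d\<in>edges G. z \<in> ends G d \<longrightarrow> \<epsilon>' d \<subseteq> fst Q)"
      if z: "z \<in> verts G" "card {d \<in> edges G. z \<in> ends G d} = 3 \<and> (\<forall>d\<in>edges G. ends G d \<noteq> {z})" for z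
    proof (cases "z \<in> X")
      case True
      have NF: "fst (N (\<tau> z)) = insert x (T - {\<tau> z})" by (simp add: new_face_def)
      have "\<epsilon>' d \<subseteq> fst (N (\<tau> z))" if d: "d \<in> edges G" "z \<in> ends G d" for d
      proof -
        have "d \<in> insert (ou z) (nn ` (X - {z}))" using st[OF True] d by blast
        then consider "d = ou z" | w where "w \<in> X - {z}" "d = nn w" by blast
        then show ?thesis
        proof cases
          case 1
          then show ?thesis using e1[OF ouG[OF True]] \<tau>[OF True] NF by auto
        next
          case (2 w)
          then have "\<tau> w \<in> T - {\<tau> z}" using tdiff[OF True] by simp
          then show ?thesis using 2 e2[of w] NF by auto
        qed
      qed
      moreover have "N (\<tau> z) \<in> stack F P x" using \<tau>[OF True] by (simp add: stack_def)
      ultimately show ?thesis using p2[OF True] by auto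
    next
      case False
      then have zz: "z \<noteq> z0" using z0 by auto
      have same: "{d \<in> edges ?G. z \<in> ends ?G d} = {d \<in> edges G. z \<in> ends G d}"
        by (rule contract_star[OF z0 False])
      have "ends ?G d \<noteq> {z}" if "d \<in> edges ?G" for d
        using llG that by (auto simp: loopless_def)
      then obtain Q where Q: "Q \<in> F" "\<pi> Q = z" "\<forall>d\<in>edges ?G. z \<in> ends ?G d \<longrightarrow> \<epsilon> d \<subseteq> fst Q"
        using r(6)[of z] z same Vv False by auto
      have "Q \<noteq> P" using Q P zz by auto
      then have "Q \<in> stack F P x" using Q by (simp add: stack_def)
      moreover have "\<epsilon>' d \<subseteq> fst Q" if d: "d \<in> edges G" "z \<in> ends G d" for d
      proof -
        have "d \<in> {d \<in> edges ?G. z \<in> ends ?G d}" unfolding same using d by simp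
        then show ?thesis using Q(3) e1 by auto
      qed
      moreover have "\<pi>' Q = z" using p1[OF Q(1)] Q(2) by simp
      ultimately show ?thesis by blast
    qed
    have mH: "is_mgraph ?H"
    proof -
      have "\<epsilon>' d \<subseteq> insert x V" if "d \<in> edges G" for d
      proof -
        have "d \<in> edges ?G \<or> (\<exists>w\<in>X. d = nn w)" using that EU by auto
        then show ?thesis using e1[of d] e2 rm(2)[of d] T3(2) \<tau> by fastforce
      qed
      then show ?thesis using c2 fE sphere_finite(1)[OF sph] by (auto simp: is_mgraph_def hgraph_def)
    qed
    have old: "even_edges ?H S \<longleftrightarrow> even_edges (hgraph V (edges ?G) \<epsilon>) S" if "S \<subseteq> edges ?G" for S
      using even_edges_hgraph_old[OF that, of "edges G" \<epsilon>' \<epsilon>] e1 E by blast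
    have ev_w: "even_edges ?H (edge_cut G {w})" if w: "w \<in> X" for w
    proof -
      have "card (X - {w}) = 2" using w X by simp
      then obtain p q where pq: "X - {w} = {p, q}" "p \<noteq> q" by (auto simp: card_2_iff)
      have pX: "p \<in> X" "q \<in> X" using pq by blast+
      have eo: "\<epsilon>' (ou w) = {\<tau> p, \<tau> q}" using e1[OF ouG[OF w]] \<tau>[OF w] tdiff[OF w] pq by simp
      have tpq: "\<tau> p \<noteq> \<tau> q" using tinj pX pq(2) by (auto simp: inj_on_def)
      have dn: "ou w \<noteq> nn p" "ou w \<noteq> nn q" "nn p \<noteq> nn q"
        using ouG[OF w] E pX ninj pq(2) by (auto simp: inj_on_def)
      have "even (card {d \<in> {ou w, nn p, nn q}. v \<in> \<epsilon>' d})" for v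
      proof -
        have "{d \<in> {ou w, nn p, nn q}. v \<in> \<epsilon>' d} =
          (if v = x then {nn p, nn q} else if v = \<tau> p then {ou w, nn p} else if v = \<tau> q then {ou w, nn q} else {})"
          using e2[OF pX(1)] e2[OF pX(2)] eo xt[OF pX(1)] xt[OF pX(2)] tpq by auto
        then show ?thesis using dn by simp
      qed
      moreover have "edge_cut G {w} = {ou w, nn p, nn q}" using star_w[OF w] pq by simp
      ultimately show ?thesis using cut_subset[of G "{w}"] by (simp add: even_edges_def hgraph_def)
    qed
    show "even_edges ?H S \<longleftrightarrow> (\<exists>U. S = edge_cut G U)" for S
    proof (rule even_iff_cut_extend[OF G mH, where G' = ?G and H' = "hgraph V (edges ?G) \<epsilon>"])
      show "edges ?H = edges G" by (simp add: hgraph_def)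
      show "\<exists>U. S = edge_cut ?G U" if "even_edges (hgraph V (edges ?G) \<epsilon>) S" for S using that r(7) by auto
      show "even_edges ?H (edge_cut G {z})" if "z \<in> verts G" for z
      proof (cases "z \<in> X")
        case False
        then have "{v. (if v \<in> X then z0 else v) \<in> {z}} = {z}" using z0 by auto
        then have "edge_cut G {z} = edge_cut ?G {z}" using cont[of "{z}"] by simp
        then show ?thesis using old[OF cut_subset] r(7) by auto
      qed (rule ev_w)
      show "\<exists>W. edge_cut ?G U = edge_cut G W" for U using cont by blast
      show "\<exists>U. even_edges (hgraph V (edges ?G) \<epsilon>) (symdiff S (edge_cut G U))" if evS: "even_edges ?H S" for S
      proof -
        have S: "S \<subseteq> edges G" using evS by (simp add: even_edges_def hgraph_def)
        \<comment> \<open>Evenness at \<open>x\<close> leaves none or two of the edges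
          \<open>nn w\<close> in \<open>S\<close>. In the latter case the star of the third vertex
          of \<open>X\<close> contains just these two of them.\<close>
        let ?A = "{w \<in> X. nn w \<in> S}"
        have "x \<in> \<epsilon>' d \<longleftrightarrow> d \<in> nn ` X" if "d \<in> edges G" for d
        proof (cases "d \<in> nn ` X")
          case True
          then show ?thesis using e2 by auto
        next
          case False
          then have "d \<in> edges ?G" using that E by simp
          then show ?thesis using False e1[of d] xe[of d] by simp
        qed
        then have "{d \<in> S. x \<in> \<epsilon>' d} = nn ` ?A" using S by auto
        then have "even (card (nn ` ?A))" using even_edges_at[OF evS, of x] by simp
        then have evA: "even (card ?A)" using ninj by (subst (asm) card_image) (auto intro: inj_on_subset)
        have "card ?A \<le> 3" using X card_mono[of X ?A] by auto
        with evA have "card ?A = 0 \<or> card ?A = 2" by (auto simp: le_Suc_eq numeral_3_eq_3)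
        then show ?thesis
        proof
          assume "card ?A = 0"
          then have "?A = {}" using X by simp
          then have "S \<subseteq> edges ?G" using S E by auto
          moreover have "symdiff S (edge_cut G {}) = S" by (simp add: symdiff_def)
          ultimately show ?thesis using old evS by metis
        next
          assume "card ?A = 2"
          then obtain w where w: "w \<in> X" "?A = X - {w}" using card_2_subset_3[OF X(2), of ?A] by blast
          have "nn w \<notin> S" using w by auto
          moreover have "nn w' \<in> S" if "w' \<in> X - {w}" for w' using that w by auto
          ultimately have "symdiff S (edge_cut G {w}) \<subseteq> edges ?G"
            unfolding star_w[OF w(1)] using S E ouG[OF w(1)] by (auto simp: symdiff_def)
          then have "even_edges (hgraph V (edges ?G) \<epsilon>) (symdiff S (edge_cut G {w}))"
            using old even_edges_symdiff[OF mH evS ev_w[OF w(1)]] by simp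
          then show ?thesis ..
        qed
      qed
    qed
    show "chordal ?H"
    proof (rule chordal_add_simplicial[where K = T, OF rm(1) r(8)])
      show "\<exists>v\<in>T. ends ?H d = {x, v}" if "d \<in> edges ?H - edges (hgraph V (edges ?G) \<epsilon>)" for d
      proof -
        have "d \<in> nn ` X" using that EU by (auto simp: hgraph_def)
        then obtain w where "w \<in> X" "d = nn w" by auto
        then show ?thesis using e2[of w] \<tau>[of w] by (auto simp: hgraph_def)
      qed
      show "adjacent (hgraph V (edges ?G) \<epsilon>) u v" if uv: "u \<in> T" "v \<in> T" "u \<noteq> v" for u v
      proof -
        have "card {u, v} = 2" "{u, v} \<subseteq> T" using uv by auto
        then obtain t where t: "t \<in> T" "{u, v} = T - {t}" using card_2_subset_3[OF T3(1)] by metis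
        then obtain w where "w \<in> X" "t = \<tau> w" using tim by auto
        then have "{u, v} = \<epsilon> (ou w)" "ou w \<in> edges ?G" using t \<tau> ouG by auto
        then show ?thesis by (auto simp: adjacent_def hgraph_def)
      qed
      show "T \<subseteq> verts (hgraph V (edges ?G) \<epsilon>)" using T3(2) by (simp add: hgraph_def)
    qed (use x e1 E in \<open>auto simp: hgraph_def\<close>)
  qed
  then show ?thesis by blast
qed

theorem represents_exists:
  fixes G :: "('v, 'e) mgraph"
  assumes "three_conn G" "integral_roots (flow_poly G)"
  shows "\<exists>V F \<epsilon> \<pi>. represents V F \<epsilon> \<pi> G"
  using assms
proof (induction "card (edges G)" arbitrary: G rule: less_induct)
  case less
  note tc = less.prems(1) and int = less.prems(2)
  note G = three_connD[OF tc]
  consider (none) "edges G = {}" | (loop) e where "e \<in> edges G" "card (ends G e) \<noteq> 2"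
    | (loopless) "loopless G" "edges G \<noteq> {}" by (auto simp: loopless_def)
  then show ?case
  proof cases
    case none
    have "\<exists>a. verts G = {a}"
    proof -
      obtain a where a: "a \<in> verts G" using G(2) by auto
      have "b = a" if "b \<in> verts G" for b
      proof (rule ccontr)
        assume "b \<noteq> a"
        then have "3 \<le> card (edge_cut G {a})" using three_connI[OF tc a, of "{a}" b] that by simp
        then show False using none by (simp add: edge_cut_def)
      qed
      then show ?thesis using a by blast
    qed
    then show ?thesis using represents_single none by metis
  next
    case (loop e)
    then have "card (ends G e) = 1" using G(1) by (auto simp: is_mgraph_def)
    then obtain h where h: "ends G e = {h}" by (auto simp: card_1_singleton_iff)
    let ?G = "del_edges G {e}"
    have "integral_roots (flow_poly ?G)"
      by (rule integral_roots_dvd[OF _ int]) (simp only: flow_poly_del_loop[OF G(1) loop(1) h] dvd_triv_right)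
    moreover have "card (edges ?G) < card (edges G)"
      using card_Diff1_less[OF G(4) loop(1)] by (simp only: del_edges_def mgraph.select_convs)
    ultimately obtain V F \<epsilon> \<pi> where "represents V F \<epsilon> \<pi> ?G"
      using less.hyps[of ?G] three_conn_del_loop[OF tc h] by blast
    then show ?thesis using represents_loop[OF G(1) loop(1) h] by blast
  next
    case loopless
    obtain d where d: "d \<in> edges G" using loopless by auto
    have "ends G d \<subseteq> verts G" "card (ends G d) = 2" using d G(1) loopless by (auto simp: is_mgraph_def loopless_def)
    then have v2: "2 \<le> card (verts G)" using G(3) card_mono by metis
    show ?thesis
    proof (cases "card (verts G) = 2")
      case True
      then obtain a b where ab: "verts G = {a, b}" "a \<noteq> b" by (auto simp: card_2_iff)
      have all: "ends G e = {a, b}" if "e \<in> edges G" for e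
      proof -
        have "ends G e \<subseteq> {a, b}" "card (ends G e) = card {a, b}"
          using that G(1) loopless ab by (auto simp: is_mgraph_def loopless_def)
        then show ?thesis by (intro card_subset_eq) auto
      qed
      have cuts: "edge_cut G U = {} \<or> edge_cut G U = edges G" for U
        using all by (auto simp: edge_cut_def)
      \<comment> \<open>The two bounds together give at least one three-edge cut; every nonempty cut
        consists of all edges, so there are three.\<close>
      obtain c where c: "card (three_cuts G) + card (edges G) + 3 \<ge> 3 * card (verts G) + c"
        "card (edges G) + 2 \<le> 2 * card (verts G) + c"
        using flow_roots_bounds[OF tc v2 int] by blast
      have "card (edges G) = 3"
      proof (rule ccontr)
        assume n3: "card (edges G) \<noteq> 3"
        then have "card (edge_cut G U) \<noteq> 3" for U using cuts[of U] by auto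
        then have "three_cuts G = {}" by (auto simp: three_cuts_def)
        then show False using c True by simp
      qed
      then show ?thesis using represents_theta[OF ab _ all] by blast
    next
      case False
      then have v3: "3 \<le> card (verts G)" using v2 by simp
      from reducible_configuration[OF tc loopless(1) v3 int] show ?thesis
      proof
        assume "\<exists>x h y e f g. ear G x h y e f g"
        then obtain x h y e f g where c: "ear G x h y e f g" by blast
        let ?G = "remove_ear G x h y e f g"
        have "integral_roots (flow_poly ?G)"
          by (rule integral_roots_dvd[OF _ int]) (simp only: flow_poly_remove_ear[OF G(1) c] dvd_triv_right)
        moreover have "card (edges ?G) < card (edges G)"
          using ear_verts[OF G(1) c] G(4) by (auto simp: remove_ear_def intro!: psubset_card_mono)
        ultimately obtain V F \<epsilon> \<pi> where "represents V F \<epsilon> \<pi> ?G"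
          using less.hyps[of ?G] three_conn_remove_ear[OF tc c] by blast
        then show ?thesis using represents_ear[OF tc v3 c] by blast
      next
        assume "\<exists>X ou nn. cubic_triangle G X ou nn"
        then obtain X ou nn where c: "cubic_triangle G X ou nn" by blast
        have X: "X \<subseteq> verts G" "card X = 3" using c by (auto simp: cubic_triangle_def)
        then obtain z0 where z0: "z0 \<in> X" by fastforce
        let ?G = "contract G X z0"
        have nz: "nn z0 \<in> edges G" "ends G (nn z0) = X - {z0}" and oz: "card (ends G (ou z0)) = 2"
          "ends G (ou z0) \<inter> X = {z0}" "ou z0 \<in> edges G"
          using c z0 by (auto simp: cubic_triangle_def)
        have "ends G (ou z0) \<subseteq> verts G" using oz(3) G(1) by (auto simp: is_mgraph_def)
        moreover have "\<not> ends G (ou z0) \<subseteq> X"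
        proof
          assume "ends G (ou z0) \<subseteq> X"
          then have "ends G (ou z0) = {z0}" using oz(2) by auto
          then show False using oz(1) by simp
        qed
        ultimately obtain z where z: "z \<in> verts G - X" by blast
        have cut: "edge_cut G X = ou ` X"
        proof (intro equalityI subsetI)
          fix d assume "d \<in> edge_cut G X"
          then obtain w where w: "d \<in> edges G" "w \<in> ends G d" "w \<in> X" "\<not> ends G d \<subseteq> X" by (auto simp: edge_cut_def)
          then have "d \<in> {d \<in> edges G. w \<in> ends G d}" by simp
          also have "\<dots> = insert (ou w) (nn ` (X - {w}))" using c w(3) by (auto simp: cubic_triangle_def)
          finally have "d = ou w \<or> (\<exists>w'\<in>X. d = nn w')" by auto
          moreover have "ends G (nn w') \<subseteq> X" if "w' \<in> X" for w' using c that by (auto simp: cubic_triangle_def)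
          ultimately show "d \<in> ou ` X" using w by auto
        next
          fix d assume "d \<in> ou ` X"
          then obtain w where w: "w \<in> X" "d = ou w" by auto
          have o: "ou w \<in> edges G" "card (ends G (ou w)) = 2" "ends G (ou w) \<inter> X = {w}"
            using c w by (auto simp: cubic_triangle_def)
          have "\<not> ends G (ou w) \<subseteq> X"
          proof
            assume "ends G (ou w) \<subseteq> X"
            then have "ends G (ou w) = {w}" using o(3) by auto
            then show False using o(2) by simp
          qed
          then show "d \<in> edge_cut G X" using o w by (auto simp: edge_cut_def)
        qed
        have "inj_on ou X"
        proof (rule inj_onI)
          fix w w' assume "w \<in> X" "w' \<in> X" "ou w = ou w'"
          then have "{w} = {w'}" using c unfolding cubic_triangle_def by metis
          then show "w = w'" by simp
        qed
        then have three: "card (edge_cut G X) = 3" unfolding cut using X card_image by metis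
        \<comment> \<open>The edges leaving the triangle form a three-edge cut, so contraction adds
          at most the roots 1 and 2.\<close>
        have "flow_poly G * ([:- 1, 1:] * [:- 2, 1:]) = flow_poly (contract G (verts G - X) z) * flow_poly ?G"
          by (rule flow_poly_three_cut[OF G(1) X(1) refl three z z0])
        then have "flow_poly ?G dvd flow_poly G * ([:- 1, 1:] * [:- 2, 1:])" by (metis dvd_triv_right)
        then have "integral_roots (flow_poly ?G)"
          by (rule integral_roots_dvd) (intro integral_roots_mult int integral_roots_linear)
        moreover have "card (edges ?G) < card (edges G)"
          using nz G(4) by (auto simp: contract_def intro!: psubset_card_mono)
        ultimately obtain V F \<epsilon> \<pi> where "represents V F \<epsilon> \<pi> ?G"
          using less.hyps[of ?G] three_conn_contract[OF tc X(1) z0] by blast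
        then show ?thesis using represents_cubic_triangle[OF tc loopless(1) c z0] by blast
      qed
    qed
  qed
qed

section \<open>Re-rooting a stacked sphere\<close>

text \<open>The outer face \<open>R\<close> is not among the faces, so it is never subdivided.\<close>

inductive stacked_disc :: "nat set \<Rightarrow> nat set \<Rightarrow> nat set set \<Rightarrow> bool" for R where
  base: "card R = 3 \<Longrightarrow> stacked_disc R R {R}"
| step: "stacked_disc R V \<Phi> \<Longrightarrow> T \<in> \<Phi> \<Longrightarrow> x \<notin> V \<Longrightarrow>
    stacked_disc R (insert x V) (\<Phi> - {T} \<union> (\<lambda>u. insert x (T - {u})) ` T)"

lemma stacked_disc_facts:
  assumes "stacked_disc R V \<Phi>"
  shows "finite V \<and> finite \<Phi> \<and> R \<subseteq> V \<and> card R = 3 \<and> (\<forall>T\<in>\<Phi>. card T = 3 \<and> T \<subseteq> V)"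
  using assms
proof (induction rule: stacked_disc.induct)
  case base
  then show ?case by (auto intro: card_ge_0_finite)
next
  case (step V \<Phi> T x)
  then have T: "card T = 3" "T \<subseteq> V" by auto
  then have fT: "finite T" using card_ge_0_finite by force
  have xT: "x \<notin> T" using T(2) step(3) by blast
  have "card (insert x (T - {u})) = 3 \<and> insert x (T - {u}) \<subseteq> insert x V" if "u \<in> T" for u
    using that T fT xT by auto
  then show ?case using step fT by auto
qed

text \<open>The stackings of the inner disc are replayed inside the face \<open>T\<close>; the
  hypothesis on common vertices keeps the stacked ones fresh.\<close>

lemma stacked_disc_graft:
  assumes "stacked_disc T W \<Psi>" "stacked_disc R V \<Phi>" "T \<in> \<Phi>" "V \<inter> W \<subseteq> T"
  shows "stacked_disc R (V \<union> W) (\<Phi> - {T} \<union> \<Psi>)"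
  using assms
proof (induction rule: stacked_disc.induct)
  case base
  have "T \<subseteq> V" using stacked_disc_facts[OF base(2)] base(3) by blast
  then have "V \<union> T = V" "\<Phi> - {T} \<union> {T} = \<Phi>" using base(3) by auto
  then show ?case using base(2) by simp
next
  case (step W \<Psi> T' x)
  note fV = stacked_disc_facts[OF step.prems(1)] and fW = stacked_disc_facts[OF step.hyps(1)]
  have TT: "T \<subseteq> W" "T' \<subseteq> W" "card T = 3" "card T' = 3" using fW step.hyps(2) by auto
  have IH: "stacked_disc R (V \<union> W) (\<Phi> - {T} \<union> \<Psi>)" using step.IH step.prems by blast
  have xV: "x \<notin> V \<union> W" using step.prems(3) step.hyps(3) TT(1) by blast
  have "T' \<notin> \<Phi> - {T}"
  proof
    assume "T' \<in> \<Phi> - {T}"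
    then have "T' \<subseteq> V" "T' \<noteq> T" using fV by auto
    then have "T' \<subseteq> T" using TT step.prems(3) by blast
    then have "T' = T" using TT card_ge_0_finite[of T] by (intro card_subset_eq) auto
    then show False using \<open>T' \<noteq> T\<close> by simp
  qed
  then have "(\<Phi> - {T} \<union> \<Psi>) - {T'} = \<Phi> - {T} \<union> (\<Psi> - {T'})" by blast
  moreover have "stacked_disc R (insert x (V \<union> W)) ((\<Phi> - {T} \<union> \<Psi>) - {T'} \<union> (\<lambda>u. insert x (T' - {u})) ` T')"
    by (rule stacked_disc.step[OF IH _ xV]) (use step.hyps in blast)
  ultimately show ?case by (simp add: Un_assoc)
qed

text \<open>Only the initial triangle occurs with both marks, and stacking or the choice of the
  outer face removes one copy, so the inner faces are determined by their triples.\<close>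

lemma sphere_reroot:
  assumes "stacked_sphere V F" "P \<in> F"
  shows "stacked_disc (fst P) V (fst ` (F - {P})) \<and> inj_on fst (F - {P})"
  using assms
proof (induction arbitrary: P rule: stacked_sphere.induct)
  case (base T)
  then have "{(T, False), (T, True)} - {P} = {(T, \<not> snd P)}" "fst P = T" by auto
  then show ?case using stacked_disc.base[OF base(1)] by simp
next
  case (step V F Q x)
  interpret stacking V F Q x using step by unfold_locales
  have NT: "fst (N u) = insert x (T - {u})" for u by (simp add: new_face_def)
  have fN: "fst ` N ` A = (\<lambda>u. insert x (T - {u})) ` A" for A by (simp add: image_image NT)
  have inj: "inj_on fst (F' \<union> N ` A)" if F': "F' \<subseteq> F" "inj_on fst F'" and A: "A \<subseteq> T" for F' A
  proof -
    have "inj_on fst (N ` A)" by (auto simp: inj_on_def new_face_def)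
    moreover have "fst ` F' \<inter> fst ` N ` A = {}" unfolding fN using old_face F'(1) by auto
    ultimately show ?thesis using F'(2) by (auto simp: inj_on_Un)
  qed
  show ?case
  proof (cases "P \<in> F")
    case True
    have PN: "P \<notin> N ` T" using True new_not_old by auto
    then have PQ: "P \<noteq> Q" using step.prems by (auto simp: stack_def)
    note IH = step.IH[OF True]
    have "stack F Q x - {P} = (F - {P} - {Q}) \<union> N ` T" using PN by (auto simp: stack_def)
    moreover have "fst ` (F - {P} - {Q}) = fst ` (F - {P}) - {T}"
      using IH PQ PF inj_on_image_set_diff[of fst "F - {P}" "F - {P}" "{Q}"] by auto
    ultimately have "fst ` (stack F Q x - {P}) = fst ` (F - {P}) - {T} \<union> (\<lambda>u. insert x (T - {u})) ` T"
      using fN by (simp add: image_Un)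
    moreover have "stacked_disc (fst P) (insert x V) (fst ` (F - {P}) - {T} \<union> (\<lambda>u. insert x (T - {u})) ` T)"
      by (rule stacked_disc.step[OF conjunct1[OF IH] _ xV]) (use PF PQ in auto)
    moreover have "inj_on fst (stack F Q x - {P})"
      unfolding \<open>stack F Q x - {P} = (F - {P} - {Q}) \<union> N ` T\<close>
      by (rule inj) (use IH in \<open>auto intro: inj_on_subset\<close>)
    ultimately show ?thesis by simp
  next
    case False
    then obtain w where w: "w \<in> T" "P = N w" using step.prems by (auto simp: stack_def)
    note IH = step.IH[OF PF]
    \<comment> \<open>The outer face is a new one. Stacking the missing corner \<open>w\<close>
      inside it creates \<open>T\<close> and the other two new faces; the old disc with outer face
      \<open>T\<close> is then grafted onto \<open>T\<close>.\<close>
    let ?R = "insert x (T - {w})"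
    have R3: "card ?R = 3" using T3 w by simp
    have wR: "w \<notin> ?R" using w T3(4) by auto
    have "stacked_disc ?R (insert w ?R) ({?R} - {?R} \<union> (\<lambda>u. insert w (?R - {u})) ` ?R)"
      by (rule stacked_disc.step[OF stacked_disc.base[OF R3] _ wR]) simp
    moreover have "(\<lambda>u. insert w (?R - {u})) ` ?R = insert T ((\<lambda>u. insert x (T - {u})) ` (T - {w}))"
    proof -
      have "insert w (?R - {x}) = T" using w T3(4) by auto
      moreover have "insert w (?R - {u}) = insert x (T - {u})" if "u \<in> T - {w}" for u
        using that w T3(4) by auto
      ultimately show ?thesis by auto
    qed
    ultimately have d: "stacked_disc ?R (insert w ?R) (insert T ((\<lambda>u. insert x (T - {u})) ` (T - {w})))"
      by simp
    have "insert w ?R \<inter> V \<subseteq> T" using w T3 xV by auto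
    then have "stacked_disc ?R (insert w ?R \<union> V)
      (insert T ((\<lambda>u. insert x (T - {u})) ` (T - {w})) - {T} \<union> fst ` (F - {Q}))"
      by (intro stacked_disc_graft[OF conjunct1[OF IH] d]) simp_all
    moreover have "insert w ?R \<union> V = insert x V" using w T3 by auto
    moreover have "insert T ((\<lambda>u. insert x (T - {u})) ` (T - {w})) - {T} \<union> fst ` (F - {Q}) =
      fst ` (stack F Q x - {P})"
    proof -
      have "T \<notin> (\<lambda>u. insert x (T - {u})) ` (T - {w})" using T3(4) by auto
      moreover have "N ` T - {N w} = N ` (T - {w})" using inj_on_image_set_diff[OF inj_new, of T "{w}"] w by auto
      then have "stack F Q x - {P} = (F - {Q}) \<union> N ` (T - {w})"
        using w new_not_old by (auto simp: stack_def)
      then have "fst ` (stack F Q x - {P}) = fst ` (F - {Q}) \<union> (\<lambda>u. insert x (T - {u})) ` (T - {w})"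
        using fN by (simp add: image_Un)
      ultimately show ?thesis by auto
    qed
    moreover have "inj_on fst (stack F Q x - {P})"
    proof -
      have "N ` T - {N w} = N ` (T - {w})" using inj_on_image_set_diff[OF inj_new, of T "{w}"] w by auto
      then have "stack F Q x - {P} = (F - {Q}) \<union> N ` (T - {w})"
        using w new_not_old by (auto simp: stack_def)
      moreover have "inj_on fst ((F - {Q}) \<union> N ` (T - {w}))" by (rule inj) (use IH in auto)
      ultimately show ?thesis by simp
    qed
    ultimately show ?thesis using w NT by simp
  qed
qed

section \<open>Duality for the full triangulation\<close>

definition sphere_edges :: "(nat set \<times> bool) set \<Rightarrow> nat set set" where
  "sphere_edges F = {d. card d = 2 \<and> (\<exists>P\<in>F. d \<subseteq> fst P)}"

definition sphere_dual :: "(nat set \<times> bool) set \<Rightarrow> (nat set \<times> bool, nat set) mgraph" where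
  "sphere_dual F = \<lparr>verts = F, edges = sphere_edges F, ends = (\<lambda>d. {P \<in> F. d \<subseteq> fst P})\<rparr>"

lemma sphere_edges_finite:
  assumes "stacked_sphere V F"
  shows "finite (sphere_edges F)" "\<And>d. d \<in> sphere_edges F \<Longrightarrow> d \<subseteq> V \<and> card d = 2"
proof -
  show sub: "d \<subseteq> V \<and> card d = 2" if "d \<in> sphere_edges F" for d
    using that sphere_face(2)[OF assms] by (auto simp: sphere_edges_def)
  have "sphere_edges F \<subseteq> Pow V" using sub by auto
  then show "finite (sphere_edges F)" using sphere_finite(1)[OF assms] finite_subset by auto
qed

lemma mgraph_sphere:
  assumes "stacked_sphere V F"
  shows "is_mgraph (hgraph V (sphere_edges F) id)" "is_mgraph (sphere_dual F)"
proof -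
  show "is_mgraph (hgraph V (sphere_edges F) id)"
    using sphere_edges_finite[OF assms] sphere_finite[OF assms] by (auto simp: is_mgraph_def hgraph_def)
  have "card {P \<in> F. d \<subseteq> fst P} = 2" if "d \<in> sphere_edges F" for d
    using that sphere_two_faces[OF assms] by (auto simp: sphere_edges_def)
  then show "is_mgraph (sphere_dual F)"
    using sphere_edges_finite(1)[OF assms] sphere_finite[OF assms] by (simp add: is_mgraph_def sphere_dual_def)
qed

lemma even_triangle:
  assumes T: "card T = 3"
  shows "even (card {d. card d = 2 \<and> d \<subseteq> T \<and> v \<in> d})"
proof (cases "v \<in> T")
  case True
  have fT: "finite T" using T card_ge_0_finite by force
  have "{d. card d = 2 \<and> d \<subseteq> T \<and> v \<in> d} = (\<lambda>u. {v, u}) ` (T - {v})"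
  proof (intro equalityI subsetI)
    fix d assume "d \<in> {d. card d = 2 \<and> d \<subseteq> T \<and> v \<in> d}"
    then obtain w where "d = {v, w}" "w \<noteq> v" "d \<subseteq> T" using card_2_other[of d v] by blast
    then show "d \<in> (\<lambda>u. {v, u}) ` (T - {v})" by auto
  qed (use True in auto)
  moreover have "inj_on (\<lambda>u. {v, u}) (T - {v})" by (auto simp: inj_on_def doubleton_eq_iff)
  ultimately have "card {d. card d = 2 \<and> d \<subseteq> T \<and> v \<in> d} = card (T - {v})" by (simp add: card_image)
  then show ?thesis using True T fT by simp
next
  case False
  then have "{d. card d = 2 \<and> d \<subseteq> T \<and> v \<in> d} = {}" by auto
  then show ?thesis by (simp only: card.empty) simp
qed

text \<open>Across each side of \<open>z\<close> lies a second face, so the star of \<open>z\<close>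
  in the dual is its boundary.\<close>

lemma sphere_dual_star:
  assumes s: "stacked_sphere V F" and z: "z \<in> F"
  shows "edge_cut (sphere_dual F) {z} = {d. card d = 2 \<and> d \<subseteq> fst z}"
proof -
  have "\<exists>Q\<in>F. d \<subseteq> fst Q \<and> Q \<noteq> z" if d: "card d = 2" "d \<subseteq> fst z" for d
  proof -
    have "card {Q \<in> F. d \<subseteq> fst Q} = 2" using sphere_two_faces[OF s z d(2,1)] .
    then obtain R where "{Q \<in> F. d \<subseteq> fst Q} = {z, R}" "R \<noteq> z"
      by (rule card_2_other[of _ z]) (use z d in auto)
    then show ?thesis by blast
  qed
  then show ?thesis using z by (auto simp: edge_cut_def sphere_dual_def sphere_edges_def)
qed

text \<open>The boundaries of the faces generate the cycle space: vanishing first homology of the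
  sphere modulo two. In a stacking step an even set has no or two edges at \<open>x\<close>, and the
  boundary of the new face containing both removes them.\<close>

theorem sphere_even_iff_cut:
  assumes "stacked_sphere V F"
  shows "even_edges (hgraph V (sphere_edges F) id) S \<longleftrightarrow> (\<exists>U. S = edge_cut (sphere_dual F) U)"
  using assms
proof (induction arbitrary: S rule: stacked_sphere.induct)
  case (base T)
  let ?F = "{(T, False), (T, True)}"
  have s: "stacked_sphere T ?F" using base by (rule stacked_sphere.base)
  have fT: "finite T" using base card_ge_0_finite by force
  have E: "sphere_edges ?F = {d. card d = 2 \<and> d \<subseteq> T}" by (auto simp: sphere_edges_def)
  have Eu: "d \<in> sphere_edges ?F \<longleftrightarrow> (\<exists>u\<in>T. d = T - {u})" for d
  proof
    assume "d \<in> sphere_edges ?F"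
    then show "\<exists>u\<in>T. d = T - {u}" unfolding E using card_2_subset_3[OF base] by blast
  next
    assume "\<exists>u\<in>T. d = T - {u}"
    then show "d \<in> sphere_edges ?F" unfolding E using base fT by auto
  qed
  define D where "D = sphere_dual ?F"
  have ED: "edges D = sphere_edges ?F" by (simp add: D_def sphere_dual_def)
  have "ends D d = ?F" if "d \<in> edges D" for d
    using that unfolding ED E by (auto simp: D_def sphere_dual_def)
  then have "edge_cut D U = {d \<in> edges D. ?F \<inter> U \<noteq> {} \<and> ?F - U \<noteq> {}}" for U
    unfolding edge_cut_def by (rule_tac Collect_cong) (simp only: cong: conj_cong)
  then have "edge_cut (sphere_dual ?F) U = {} \<or> edge_cut (sphere_dual ?F) U = sphere_edges ?F" for U
    unfolding ED[symmetric] D_def[symmetric]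
    by (cases "?F \<inter> U \<noteq> {} \<and> ?F - U \<noteq> {}") (simp_all only: simp_thms Collect_mem_eq, simp_all)
  moreover have "edge_cut (sphere_dual ?F) {(T, False)} = sphere_edges ?F"
    using sphere_dual_star[OF s, of "(T, False)"] E by simp
  ultimately have cuts: "(\<exists>U. S = edge_cut (sphere_dual ?F) U) \<longleftrightarrow> S = {} \<or> S = sphere_edges ?F" for S
    by (metis cut_empty)
  show ?case
    unfolding cuts
  proof
    assume ev: "even_edges (hgraph T (sphere_edges ?F) id) S"
    then have S: "S \<subseteq> sphere_edges ?F" by (simp add: even_edges_def hgraph_def)
    have fS: "finite S" using S sphere_edges_finite(1)[OF s] finite_subset by blast
    have at: "even (card (S - {T - {v}}))" if v: "v \<in> T" for v
    proof -
      have "v \<in> d \<longleftrightarrow> d \<noteq> T - {v}" if "d \<in> S" for d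
        using that S Eu[of d] v by auto
      then have "{d \<in> S. v \<in> id d} = S - {T - {v}}" by auto
      then show ?thesis using even_edges_at[OF ev, of v] by simp
    qed
    have "odd (card S)" if "d \<in> S" for d
    proof -
      have "d \<in> sphere_edges ?F" using that S by (rule subsetD[rotated])
      from Eu[THEN iffD1, OF this] obtain v where "v \<in> T" "d = T - {v}" by (rule bexE)
      then have "even (card (S - {d}))" using at by simp
      moreover have "card S = Suc (card (S - {d}))" using that fS by (metis card.remove)
      ultimately show ?thesis by simp
    qed
    moreover have "even (card S)" if "d \<in> sphere_edges ?F - S" for d
    proof -
      from Eu[THEN iffD1, OF DiffD1[OF that]] obtain v where "v \<in> T" "d = T - {v}" by (rule bexE)
      then show ?thesis using at[of v] that by simp
    qed
    ultimately show "S = {} \<or> S = sphere_edges ?F" using S by blast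
  next
    assume "S = {} \<or> S = sphere_edges ?F"
    moreover have "{d \<in> sphere_edges ?F. v \<in> id d} = {d. card d = 2 \<and> d \<subseteq> T \<and> v \<in> d}" for v
      unfolding E by auto
    ultimately show "even_edges (hgraph T (sphere_edges ?F) id) S"
      using even_triangle[OF base] by (auto simp: even_edges_def hgraph_def)
  qed
next
  case (step V F P x)
  interpret stacking V F P x using step by unfold_locales
  have s': "stacked_sphere (insert x V) (stack F P x)" using step.hyps by (rule stacked_sphere.step)
  let ?F = "stack F P x"
  let ?H = "hgraph (insert x V) (sphere_edges ?F) id" and ?H' = "hgraph V (sphere_edges F) id"
  note mH = mgraph_sphere(1)[OF s'] and mG = mgraph_sphere(2)[OF s']
  have xd: "x \<notin> d" if "d \<in> sphere_edges F" for d using that sphere_edges_finite(2)[OF sph] xV by blast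
  have E: "sphere_edges ?F = sphere_edges F \<union> (\<lambda>u. {x, u}) ` T"
  proof (intro equalityI subsetI)
    fix d assume "d \<in> sphere_edges ?F"
    then obtain Q where d: "card d = 2" "Q \<in> ?F" "d \<subseteq> fst Q" by (auto simp: sphere_edges_def)
    show "d \<in> sphere_edges F \<union> (\<lambda>u. {x, u}) ` T"
    proof (cases "Q \<in> F")
      case True
      then show ?thesis using d by (auto simp: sphere_edges_def)
    next
      case False
      then obtain w where w: "w \<in> T" "Q = N w" using d by (auto simp: stack_def)
      then have dw: "d \<subseteq> insert x (T - {w})" using d by (simp add: new_face_def)
      show ?thesis
      proof (cases "x \<in> d")
        case True
        obtain u where "d = {x, u}" "u \<noteq> x" using card_2_other[OF d(1) True] by blast
        then show ?thesis using dw by auto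
      next
        case False
        then have "d \<subseteq> T" using dw by auto
        then show ?thesis using d(1) PF by (auto simp: sphere_edges_def)
      qed
    qed
  next
    fix d assume "d \<in> sphere_edges F \<union> (\<lambda>u. {x, u}) ` T"
    then show "d \<in> sphere_edges ?F"
    proof
      assume d: "d \<in> sphere_edges F"
      then obtain Q where Q: "card d = 2" "Q \<in> F" "d \<subseteq> fst Q" by (auto simp: sphere_edges_def)
      show ?thesis
      proof (cases "Q = P")
        case True
        obtain u where "u \<in> T" "d = T - {u}" using card_2_subset_3[OF T3(1) Q(1)] Q True by blast
        then have "N u \<in> ?F" "d \<subseteq> fst (N u)" by (auto simp: stack_def new_face_def)
        then show ?thesis using Q by (auto simp: sphere_edges_def)
      next
        case False
        then show ?thesis using Q by (auto simp: sphere_edges_def stack_def)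
      qed
    next
      assume "d \<in> (\<lambda>u. {x, u}) ` T"
      then obtain u where u: "u \<in> T" "d = {x, u}" by auto
      have "card (T - {u}) = 2" using u T3 by simp
      then have "T - {u} \<noteq> {}" by (metis card.empty zero_neq_numeral)
      then obtain w where w: "w \<in> T - {u}" by blast
      then have "N w \<in> ?F" "d \<subseteq> fst (N w)" using u by (auto simp: stack_def new_face_def)
      moreover have "x \<noteq> u" using u T3(4) by auto
      then have "card d = 2" using u by simp
      ultimately show ?thesis by (auto simp: sphere_edges_def)
    qed
  qed
  have star: "edge_cut (sphere_dual ?F) {z} = {d. card d = 2 \<and> d \<subseteq> fst z}" if "z \<in> ?F" for z
    using sphere_dual_star[OF s' that] .
  have evz: "even_edges ?H (edge_cut (sphere_dual ?F) {z})" if z: "z \<in> ?F" for z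
  proof -
    have "{d \<in> {d. card d = 2 \<and> d \<subseteq> fst z}. v \<in> id d} = {d. card d = 2 \<and> d \<subseteq> fst z \<and> v \<in> d}" for v by auto
    moreover have "{d. card d = 2 \<and> d \<subseteq> fst z} \<subseteq> sphere_edges ?F" using z by (auto simp: sphere_edges_def)
    ultimately show ?thesis
      unfolding star[OF z] even_edges_def using even_triangle[OF sphere_face(1)[OF s' z]] by (simp add: hgraph_def)
  qed
  have old: "even_edges ?H S \<longleftrightarrow> even_edges ?H' S" if "S \<subseteq> sphere_edges F" for S
    using even_edges_hgraph_old[OF that, of "sphere_edges ?F" id id] E by blast
  show ?case
  proof (rule even_iff_cut_extend[OF mG mH, where G' = "sphere_dual F" and H' = ?H'])
    show "edges ?H = edges (sphere_dual ?F)" by (simp add: hgraph_def sphere_dual_def)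
    show "\<exists>U. S = edge_cut (sphere_dual F) U" if "even_edges ?H' S" for S using that step.IH by auto
    show "even_edges ?H (edge_cut (sphere_dual ?F) {z})" if "z \<in> verts (sphere_dual ?F)" for z
      using that evz by (simp add: sphere_dual_def)
    show "\<exists>W. edge_cut (sphere_dual F) U = edge_cut (sphere_dual ?F) W" for U
    proof -
      let ?W = "{Q. (if x \<in> fst Q then P else Q) \<in> U}"
      have xN: "x \<in> fst (N u)" for u by (simp add: new_face_def)
      \<comment> \<open>New faces are sent to the subdivided face, so that a side of a cut in the
        old dual can be pulled back.\<close>
      define \<pi>' where "\<pi>' = (\<lambda>Q. if x \<in> fst Q then P else Q)"
      have p: "\<And>Q. Q \<in> F \<Longrightarrow> \<pi>' Q = Q" "\<And>u. \<pi>' (N u) = P" using old_face xN by (auto simp: \<pi>'_def)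
      have im: "\<pi>' ` {Q \<in> ?F. d \<subseteq> fst Q} = {Q \<in> F. d \<subseteq> fst Q}" if d: "d \<in> sphere_edges F" for d
        using image_faces_old[of d \<pi>' "\<lambda>Q. Q"] sphere_edges_finite(2)[OF sph d] p by simp
      have cutim: "A \<inter> {Q. \<pi>' Q \<in> U} \<noteq> {} \<and> A - {Q. \<pi>' Q \<in> U} \<noteq> {} \<longleftrightarrow>
        \<pi>' ` A \<inter> U \<noteq> {} \<and> \<pi>' ` A - U \<noteq> {}" for A by auto
      have "d \<in> edge_cut (sphere_dual ?F) {Q. \<pi>' Q \<in> U} \<longleftrightarrow> d \<in> edge_cut (sphere_dual F) U" for d
      proof -
        consider "d \<in> sphere_edges F" | u where "u \<in> T" "d = {x, u}" | "d \<notin> sphere_edges ?F" "d \<notin> sphere_edges F"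
          using E by blast
        then show ?thesis
        proof cases
          case 1
          then have "d \<in> sphere_edges ?F" using E by blast
          then show ?thesis using 1 cutim[of "{Q \<in> ?F. d \<subseteq> fst Q}"] unfolding im[OF 1]
            by (simp add: edge_cut_def sphere_dual_def)
        next
          case (2 u)
          have "\<pi>' ` {Q \<in> ?F. d \<subseteq> fst Q} \<subseteq> {P}" using faces_new[OF 2(1)] 2(2) p(2) by auto
          moreover have "\<not> (A \<inter> U \<noteq> {} \<and> A - U \<noteq> {})" if "A \<subseteq> {P}" for A using that by blast
          ultimately have "\<not> (\<pi>' ` {Q \<in> ?F. d \<subseteq> fst Q} \<inter> U \<noteq> {} \<and> \<pi>' ` {Q \<in> ?F. d \<subseteq> fst Q} - U \<noteq> {})" by simp
          then have "d \<notin> edge_cut (sphere_dual ?F) {Q. \<pi>' Q \<in> U}"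
            using cutim[of "{Q \<in> ?F. d \<subseteq> fst Q}"] by (simp add: edge_cut_def sphere_dual_def)
          moreover have "d \<notin> sphere_edges F" using xd 2 by auto
          then have "d \<notin> edge_cut (sphere_dual F) U" by (simp add: edge_cut_def sphere_dual_def)
          ultimately show ?thesis by simp
        next
          case 3
          then show ?thesis by (simp add: edge_cut_def sphere_dual_def)
        qed
      qed
      then show ?thesis by blast
    qed
    show "\<exists>U. even_edges ?H' (symdiff S (edge_cut (sphere_dual ?F) U))" if ev: "even_edges ?H S" for S
    proof -
      have S: "S \<subseteq> sphere_edges ?F" using ev by (simp add: even_edges_def hgraph_def)
      let ?A = "{u \<in> T. {x, u} \<in> S}"
      have "{d \<in> S. x \<in> id d} = (\<lambda>u. {x, u}) ` ?A" using S E xd by auto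
      moreover have "inj_on (\<lambda>u. {x, u}) ?A" by (auto simp: inj_on_def doubleton_eq_iff)
      ultimately have evA: "even (card ?A)" using even_edges_at[OF ev, of x] by (simp add: card_image)
      have "card ?A \<le> 3" using T3 card_mono[of T ?A] by auto
      with evA have "card ?A = 0 \<or> card ?A = 2" by (auto simp: le_Suc_eq numeral_3_eq_3)
      then show ?thesis
      proof
        assume "card ?A = 0"
        then have "?A = {}" using T3 by simp
        then have "S \<subseteq> sphere_edges F" using S E by auto
        moreover have "symdiff S (edge_cut (sphere_dual ?F) {}) = S" by (simp add: symdiff_def)
        ultimately show ?thesis using old ev by metis
      next
        assume "card ?A = 2"
        then obtain w where w: "w \<in> T" "?A = T - {w}" using card_2_subset_3[OF T3(1), of ?A] by blast
        have zF: "N w \<in> ?F" using w by (simp add: stack_def)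
        have st: "edge_cut (sphere_dual ?F) {N w} = {d. card d = 2 \<and> d \<subseteq> insert x (T - {w})}"
          using star[OF zF] by (simp add: new_face_def)
        have "symdiff S (edge_cut (sphere_dual ?F) {N w}) \<subseteq> sphere_edges F"
        proof
          fix d assume d: "d \<in> symdiff S (edge_cut (sphere_dual ?F) {N w})"
          have dE: "d \<in> sphere_edges ?F"
            using d S cut_subset[of "sphere_dual ?F" "{N w}"] by (auto simp: symdiff_def sphere_dual_def)
          show "d \<in> sphere_edges F"
          proof (rule ccontr)
            assume "d \<notin> sphere_edges F"
            then obtain u where u: "u \<in> T" "d = {x, u}" using dE E by blast
            have "x \<noteq> u" using u T3(4) by auto
            then have c: "card d = 2" using u by simp
            have "d \<in> S \<longleftrightarrow> u \<noteq> w" using u w(2) by blast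
            moreover have "d \<subseteq> insert x (T - {w}) \<longleftrightarrow> u \<noteq> w" using u T3(4) by auto
            ultimately show False using d c unfolding st by (auto simp: symdiff_def)
          qed
        qed
        then have "even_edges ?H' (symdiff S (edge_cut (sphere_dual ?F) {N w}))"
          using old even_edges_symdiff[OF mH ev evz[OF zF]] by simp
        then show ?thesis ..
      qed
    qed
  qed
qed

section \<open>Straight-line drawings\<close>

lemma vertex_in_hull:
  assumes "\<not> affine_dependent A" "S \<subseteq> A" "a \<in> A" "a \<in> convex hull S"
  shows "a \<in> S"
proof (rule ccontr)
  assume "a \<notin> S"
  then have "convex hull S \<subseteq> affine hull (A - {a})"
    using assms(2) convex_hull_subset_affine_hull[of S] hull_mono[of S "A - {a}" affine] by blast
  then show False using assms by (auto simp: affine_dependent_def)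
qed

text \<open>A face of a simplex meets a convex subset in a face of that subset, and a face of the
  hull of finitely many points is spanned by those of the points that it contains.\<close>

lemma hull_Int_face:
  fixes A :: "complex set"
  assumes A: "\<not> affine_dependent A" and S: "S \<subseteq> A" and B: "finite B" "B \<subseteq> convex hull A"
  shows "convex hull B \<inter> convex hull S = convex hull (B \<inter> convex hull S)"
proof
  have "convex hull S face_of convex hull A"
    using face_of_convex_hull_affine_independent[OF A] S by blast
  then have "(convex hull S \<inter> convex hull B) face_of (convex hull A \<inter> convex hull B)"
    by (rule face_of_slice) (rule convex_convex_hull)
  moreover have "convex hull A \<inter> convex hull B = convex hull B"
    using B(2) by (simp add: Int_absorb1 hull_minimal)
  ultimately obtain B' where B': "B' \<subseteq> B" "convex hull S \<inter> convex hull B = convex hull B'"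
    using face_of_convex_hull_subset[OF finite_imp_compact[OF B(1)]] by metis
  have "B' \<subseteq> convex hull S" using B'(2) hull_subset[of B' convex] by blast
  then have "convex hull B' \<subseteq> convex hull (B \<inter> convex hull S)" using B'(1) by (intro hull_mono) blast
  then show "convex hull B \<inter> convex hull S \<subseteq> convex hull (B \<inter> convex hull S)" using B'(2) by blast
  have "convex hull (B \<inter> convex hull S) \<subseteq> convex hull B" by (rule hull_mono) blast
  moreover have "convex hull (B \<inter> convex hull S) \<subseteq> convex hull S" by (rule hull_minimal) auto
  ultimately show "convex hull (B \<inter> convex hull S) \<subseteq> convex hull B \<inter> convex hull S" by blast
qed

lemma hull_Int_subsets:
  fixes A :: "complex set"
  assumes A: "\<not> affine_dependent A" and S: "S \<subseteq> A" "S' \<subseteq> A"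
  shows "convex hull S \<inter> convex hull S' = convex hull (S \<inter> S')"
proof -
  have "finite S" using aff_independent_finite[OF A] S(1) finite_subset by blast
  moreover have "S \<subseteq> convex hull A" using S(1) hull_subset[of A convex] by blast
  ultimately have "convex hull S \<inter> convex hull S' = convex hull (S \<inter> convex hull S')"
    by (rule hull_Int_face[OF A S(2)])
  also have "S \<inter> convex hull S' = S \<inter> S'"
    using vertex_in_hull[OF A S(2)] S(1) hull_subset[of S' convex] by blast
  finally show ?thesis .
qed

lemma frontier_hull_triangle:
  fixes A :: "complex set"
  assumes "\<not> affine_dependent A" "card A = 3"
  shows "frontier (convex hull A) = (\<Union>u\<in>A. convex hull (A - {u}))"
  using frontier_convex_hull_cases[OF assms(1)] assms(2) by auto

locale triangle_point =
  fixes A :: "complex set" and q :: complex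
  assumes A: "\<not> affine_dependent A" "card A = 3" and q: "q \<in> interior (convex hull A)"
begin

lemma q_hull: "q \<in> convex hull A"
  using q interior_subset by blast

lemma q_not_side: "S \<subset> A \<Longrightarrow> q \<notin> convex hull S"
proof
  assume S: "S \<subset> A" "q \<in> convex hull S"
  then obtain u where u: "u \<in> A" "S \<subseteq> A - {u}" by blast
  then have "q \<in> convex hull (A - {u})" using S(2) hull_mono[of S "A - {u}" convex] by blast
  then have "q \<in> frontier (convex hull A)" using u frontier_hull_triangle[OF A] by blast
  then show False using q by (simp add: frontier_def)
qed

lemma q_not_vertex: "q \<notin> A"
proof
  assume "q \<in> A"
  moreover have "{q} \<noteq> A" using A(2) by auto
  ultimately show False using q_not_side[of "{q}"] by auto
qed

lemma independent_new:
  assumes "u \<in> A"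
  shows "\<not> affine_dependent (insert q (A - {u}))"
proof (rule affine_independent_insert)
  show "\<not> affine_dependent (A - {u})" using affine_independent_subset[OF A(1)] by blast
  show "q \<notin> affine hull (A - {u})"
    using affine_independent_convex_affine_hull[OF A(1), of "A - {u}"] q_hull q_not_side[of "A - {u}"] assms by blast
qed

text \<open>The interior point \<open>q\<close> is on no proper side, so the common part is spanned
  by common corners.\<close>

lemma new_Int_side:
  assumes "S \<subset> A"
  shows "convex hull (insert q (A - {u})) \<inter> convex hull S = convex hull ((A - {u}) \<inter> S)"
proof -
  have f: "finite (insert q (A - {u}))" using A(2) card_ge_0_finite[of A] by simp
  have "insert q (A - {u}) \<subseteq> convex hull A" using q_hull hull_subset[of A convex] by blast
  then have "convex hull (insert q (A - {u})) \<inter> convex hull S = convex hull (insert q (A - {u}) \<inter> convex hull S)"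
    using assms by (intro hull_Int_face[OF A(1) _ f]) auto
  also have "insert q (A - {u}) \<inter> convex hull S = (A - {u}) \<inter> S"
    using q_not_side[OF assms] vertex_in_hull[OF A(1), of S] assms hull_subset[of S convex] by blast
  finally show ?thesis .
qed

end

text \<open>A straight-line triangulation of the triangle of \<open>R\<close>, as a simplicial
  complex. The clauses on \<open>R\<close> control the outer face, which is not listed separately in
  \<open>\<Phi>\<close>.\<close>

definition geometric :: "nat set \<Rightarrow> nat set \<Rightarrow> nat set set \<Rightarrow> (nat \<Rightarrow> complex) \<Rightarrow> bool" where
  "geometric R V \<Phi> p \<longleftrightarrow>
     inj_on p R \<and> \<not> affine_dependent (p ` R) \<and>
     (\<forall>T\<in>\<Phi>. inj_on p T \<and> \<not> affine_dependent (p ` T)) \<and>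
     convex hull (p ` R) = (\<Union>T\<in>\<Phi>. convex hull (p ` T)) \<and>
     (\<forall>T\<in>\<Phi>. \<forall>T'\<in>\<Phi>. convex hull (p ` T) \<inter> convex hull (p ` T') = convex hull (p ` (T \<inter> T'))) \<and>
     p ` (V - R) \<subseteq> interior (convex hull (p ` R)) \<and>
     \<Union>\<Phi> = V \<and> (\<forall>d\<subseteq>R. card d = 2 \<longrightarrow> (\<exists>T\<in>\<Phi>. d \<subseteq> T))"

lemma geometricD:
  assumes "geometric R V \<Phi> p"
  shows "inj_on p R" "\<not> affine_dependent (p ` R)"
    "\<And>T. T \<in> \<Phi> \<Longrightarrow> inj_on p T" "\<And>T. T \<in> \<Phi> \<Longrightarrow> \<not> affine_dependent (p ` T)"
    "convex hull (p ` R) = (\<Union>T\<in>\<Phi>. convex hull (p ` T))"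
    "\<And>T T'. T \<in> \<Phi> \<Longrightarrow> T' \<in> \<Phi> \<Longrightarrow> convex hull (p ` T) \<inter> convex hull (p ` T') = convex hull (p ` (T \<inter> T'))"
    "p ` (V - R) \<subseteq> interior (convex hull (p ` R))" "\<Union>\<Phi> = V"
    "\<And>d. d \<subseteq> R \<Longrightarrow> card d = 2 \<Longrightarrow> \<exists>T\<in>\<Phi>. d \<subseteq> T"
proof -
  note g = assms[unfolded geometric_def]
  note c = g[THEN conjunct1] g[THEN conjunct2, THEN conjunct1] g[THEN conjunct2, THEN conjunct2, THEN conjunct1]
  note g' = g[THEN conjunct2, THEN conjunct2, THEN conjunct2]
  note c' = g'[THEN conjunct1] g'[THEN conjunct2, THEN conjunct1] g'[THEN conjunct2, THEN conjunct2]
  show "inj_on p R" "\<not> affine_dependent (p ` R)" by (rule c(1), rule c(2))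
  show "inj_on p T" "\<not> affine_dependent (p ` T)" if "T \<in> \<Phi>" for T
    by (rule bspec[OF c(3) that, THEN conjunct1], rule bspec[OF c(3) that, THEN conjunct2])
  show "convex hull (p ` R) = (\<Union>T\<in>\<Phi>. convex hull (p ` T))" by (rule c'(1))
  show "convex hull (p ` T) \<inter> convex hull (p ` T') = convex hull (p ` (T \<inter> T'))" if "T \<in> \<Phi>" "T' \<in> \<Phi>" for T T'
    by (rule bspec[OF bspec[OF c'(2) that(1)] that(2)])
  show "p ` (V - R) \<subseteq> interior (convex hull (p ` R))" by (rule c'(3)[THEN conjunct1])
  show "\<Union>\<Phi> = V" by (rule c'(3)[THEN conjunct2, THEN conjunct1])
  show "\<exists>T\<in>\<Phi>. d \<subseteq> T" if "d \<subseteq> R" "card d = 2" for d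
    using c'(3)[THEN conjunct2, THEN conjunct2] that by simp
qed

lemma triangle_positions:
  assumes "card (R :: nat set) = 3"
  shows "\<exists>p :: nat \<Rightarrow> complex. inj_on p R \<and> \<not> affine_dependent (p ` R)"
proof -
  have "0 \<noteq> (1 :: complex)" "\<i> \<noteq> (0 :: complex)" "\<i> \<noteq> (1 :: complex)" by (auto simp: complex_eq_iff)
  have ind: "\<not> affine_dependent {0, 1, \<i>}"
  proof -
    have "\<i> \<notin> affine hull {0, 1 :: complex}"
      by (auto simp: affine_hull_2 complex_eq_iff)
    then have "\<not> affine_dependent (insert \<i> {0, 1 :: complex})"
      by (intro affine_independent_insert affine_independent_2)
    then show ?thesis by (simp add: insert_commute)
  qed
  have "card {0, 1, \<i>} = 3" by (auto simp: complex_eq_iff)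
  moreover have "finite R" using assms card_ge_0_finite by force
  ultimately obtain p where "bij_betw p R {0, 1, \<i>}"
    using finite_same_card_bij[of R "{0, 1, \<i>}"] assms by auto
  then show ?thesis using ind by (auto simp: bij_betw_def)
qed

text \<open>The stacked vertex may be placed at any interior point of its triangle: the three new
  triangles cover the old one and meet all others in common sides.\<close>

lemma geometric_exists:
  assumes "stacked_disc R V \<Phi>"
  shows "\<exists>p. geometric R V \<Phi> p"
  using assms
proof (induction rule: stacked_disc.induct)
  case base
  then obtain p :: "nat \<Rightarrow> complex" where "inj_on p R" "\<not> affine_dependent (p ` R)"
    using triangle_positions by blast
  then have "geometric R R {R} p" by (auto simp: geometric_def)
  then show ?case by (rule exI[of _ p])
next
  case (step V \<Phi> T x)
  then obtain p where g: "geometric R V \<Phi> p" by blast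
  note facts = stacked_disc_facts[OF step.hyps(1)]
  have R: "R \<subseteq> V" "card R = 3" and TV: "\<And>T. T \<in> \<Phi> \<Longrightarrow> card T = 3 \<and> T \<subseteq> V" using facts by auto
  have T: "card T = 3" "T \<subseteq> V" "x \<notin> T" "T \<in> \<Phi>" using TV step.hyps by auto
  have fT: "finite T" using T(1) card_ge_0_finite by force
  have gR: "inj_on p R" "\<not> affine_dependent (p ` R)"
    and gT: "\<And>T. T \<in> \<Phi> \<Longrightarrow> inj_on p T" "\<And>T. T \<in> \<Phi> \<Longrightarrow> \<not> affine_dependent (p ` T)"
    and gU: "convex hull (p ` R) = (\<Union>T\<in>\<Phi>. convex hull (p ` T))"
    and gI: "\<And>T T'. T \<in> \<Phi> \<Longrightarrow> T' \<in> \<Phi> \<Longrightarrow> convex hull (p ` T) \<inter> convex hull (p ` T') = convex hull (p ` (T \<inter> T'))"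
    and gi: "p ` (V - R) \<subseteq> interior (convex hull (p ` R))" and gV: "\<Union>\<Phi> = V"
    and ge: "\<And>d. d \<subseteq> R \<Longrightarrow> card d = 2 \<Longrightarrow> \<exists>T\<in>\<Phi>. d \<subseteq> T"
    by (rule geometricD[OF g], assumption?, assumption?)+
  have A3: "card (p ` T) = 3" using gT(1)[OF T(4)] T(1) by (simp add: card_image)
  have "interior (convex hull (p ` T)) \<noteq> {}"
    using interior_convex_hull_eq_empty[of "p ` T"] A3 gT(2)[OF T(4)] by simp
  then obtain q where q: "q \<in> interior (convex hull (p ` T))" by blast
  interpret triangle_point "p ` T" q using gT(2)[OF T(4)] A3 q by unfold_locales
  define p' where "p' = p(x := q)"
  have p': "\<And>S. S \<subseteq> V \<Longrightarrow> p' ` S = p ` S" "p' x = q" using step.hyps(3) by (auto simp: p'_def)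
  have injp': "inj_on p' S" if "inj_on p S" "S \<subseteq> V" for S
    using that step.hyps(3) by (auto simp: inj_on_def p'_def)
  let ?M = "\<lambda>u. insert x (T - {u})"
  have pd: "p ` (T - S) = p ` T - p ` S" if "S \<subseteq> T" for S
    using inj_on_image_set_diff[OF gT(1)[OF T(4)], of T S] that by auto
  have pM: "p' ` ?M u = insert q (p ` T - {p u})" if "u \<in> T" for u
    using p'(1)[of "T - {u}"] p'(2) pd[of "{u}"] T(2) that by auto
  let ?\<Phi> = "\<Phi> - {T} \<union> ?M ` T"
  have hT: "convex hull (p ` T) = (\<Union>u\<in>T. convex hull (p' ` ?M u))"
    using convex_hull_exchange_Union[OF q_hull] pM by simp
  have old_new: "convex hull (p' ` ?M u) \<inter> convex hull (p' ` T') = convex hull (p' ` (?M u \<inter> T'))"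
    if u: "u \<in> T" and T': "T' \<in> \<Phi> - {T}" for u T'
  proof -
    have T'V: "T' \<subseteq> V" "card T' = 3" using TV T' by auto
    have ss: "T \<inter> T' \<subset> T"
    proof -
      have "T \<inter> T' \<noteq> T"
      proof
        assume "T \<inter> T' = T"
        then have "T = T'" using T(1) T'V card_ge_0_finite[of T'] by (intro card_subset_eq) auto
        then show False using T' by simp
      qed
      then show ?thesis by blast
    qed
    have "p ` (T \<inter> T') \<noteq> p ` T"
      using inj_on_image_eq_iff[OF gT(1)[OF T(4)], of "T \<inter> T'" T] ss by blast
    then have pss: "p ` (T \<inter> T') \<subset> p ` T" by blast
    \<comment> \<open>Inside \<open>T\<close> another old face is visible only through the side that
      it shares with \<open>T\<close>, which is proper.\<close>
    have sub: "convex hull (p' ` ?M u) \<subseteq> convex hull (p ` T)" using hT u by blast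
    then have "convex hull (p' ` ?M u) \<inter> convex hull (p' ` T') =
      convex hull (p' ` ?M u) \<inter> (convex hull (p ` T) \<inter> convex hull (p ` T'))"
      using p'(1)[OF T'V(1)] by auto
    also have "\<dots> = convex hull (insert q (p ` T - {p u})) \<inter> convex hull (p ` (T \<inter> T'))"
      using gI[OF T(4), of T'] T' pM[OF u] by simp
    also have "\<dots> = convex hull ((p ` T - {p u}) \<inter> p ` (T \<inter> T'))" by (rule new_Int_side[OF pss])
    also have "(p ` T - {p u}) \<inter> p ` (T \<inter> T') = p' ` (?M u \<inter> T')"
    proof -
      have "?M u \<inter> T' = (T - {u}) \<inter> (T \<inter> T')" using T'V step.hyps(3) by auto
      moreover have "p' ` ((T - {u}) \<inter> (T \<inter> T')) = p ` ((T - {u}) \<inter> (T \<inter> T'))"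
        using T(2) by (intro p'(1)) auto
      moreover have "p ` ((T - {u}) \<inter> (T \<inter> T')) = p ` (T - {u}) \<inter> p ` (T \<inter> T')"
        by (rule inj_on_image_Int[OF gT(1)[OF T(4)]]) auto
      ultimately show ?thesis using pd[of "{u}"] u by simp
    qed
    finally show ?thesis .
  qed
  have new_new: "convex hull (p' ` ?M u) \<inter> convex hull (p' ` ?M v) = convex hull (p' ` (?M u \<inter> ?M v))"
    if uv: "u \<in> T" "v \<in> T" for u v
  proof -
    have "convex hull (p' ` ?M u) \<inter> convex hull (p' ` ?M v) =
      convex hull (insert q ((p ` T - {p u}) \<inter> (p ` T - {p v})))"
      unfolding pM[OF uv(1)] pM[OF uv(2)] by (rule convex_hull_exchange_Int[OF A(1) q_hull]) auto
    also have "(p ` T - {p u}) \<inter> (p ` T - {p v}) = p ` (T - {u, v})" using pd[of "{u, v}"] uv by auto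
    also have "insert q (p ` (T - {u, v})) = p' ` insert x (T - {u, v})"
      using p'(1)[of "T - {u, v}"] p'(2) T(2) by auto
    also have "insert x (T - {u, v}) = ?M u \<inter> ?M v" using T(3) by auto
    finally show ?thesis .
  qed
  have "geometric R (insert x V) ?\<Phi> p'"
    unfolding geometric_def
  proof (intro conjI)
    show "inj_on p' R" "\<not> affine_dependent (p' ` R)" using injp' gR R p' by auto
    show "\<forall>S\<in>?\<Phi>. inj_on p' S \<and> \<not> affine_dependent (p' ` S)"
    proof
      fix S assume "S \<in> ?\<Phi>"
      then consider "S \<in> \<Phi>" | u where "u \<in> T" "S = ?M u" by blast
      then show "inj_on p' S \<and> \<not> affine_dependent (p' ` S)"
      proof cases
        case 1
        then show ?thesis using gT[OF 1] TV[OF 1] injp' p'(1) by simp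
      next
        case (2 u)
        have "inj_on p' (T - {u})"
          using T(2) inj_on_subset[OF gT(1)[OF T(4)]] by (intro injp') auto
        moreover have "q \<notin> p' ` (T - {u})" using q_not_vertex p'(1)[of "T - {u}"] T(2) by auto
        ultimately have "inj_on p' (?M u)" using p'(2) T(3) by simp
        moreover have "\<not> affine_dependent (p' ` ?M u)" unfolding pM[OF 2(1)] using 2(1) by (intro independent_new) auto
        ultimately show ?thesis using 2 by simp
      qed
    qed
    show "convex hull (p' ` R) = (\<Union>S\<in>?\<Phi>. convex hull (p' ` S))"
    proof -
      have "(\<Union>S\<in>?\<Phi>. convex hull (p' ` S)) = (\<Union>S\<in>\<Phi> - {T}. convex hull (p' ` S)) \<union> (\<Union>u\<in>T. convex hull (p' ` ?M u))"
        by (simp add: UN_Un)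
      also have "(\<Union>S\<in>\<Phi> - {T}. convex hull (p' ` S)) = (\<Union>S\<in>\<Phi> - {T}. convex hull (p ` S))"
        using p'(1) TV by (intro SUP_cong) auto
      also have "\<dots> \<union> (\<Union>u\<in>T. convex hull (p' ` ?M u)) = (\<Union>S\<in>\<Phi>. convex hull (p ` S))"
        unfolding hT[symmetric] using T(4) by blast
      finally show ?thesis using gU p'(1)[OF R(1)] by simp
    qed
    show "\<forall>S\<in>?\<Phi>. \<forall>S'\<in>?\<Phi>. convex hull (p' ` S) \<inter> convex hull (p' ` S') = convex hull (p' ` (S \<inter> S'))"
    proof (intro ballI)
      fix S S' assume S: "S \<in> ?\<Phi>" "S' \<in> ?\<Phi>"
      have c: "X \<in> \<Phi> - {T} \<or> (\<exists>u\<in>T. X = ?M u)" if "X \<in> ?\<Phi>" for X using that by blast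
      consider (old) "S \<in> \<Phi> - {T}" | (new) u where "u \<in> T" "S = ?M u" using c[OF S(1)] by (elim disjE bexE)
      then show "convex hull (p' ` S) \<inter> convex hull (p' ` S') = convex hull (p' ` (S \<inter> S'))"
      proof cases
        case old
        consider "S' \<in> \<Phi> - {T}" | v where "v \<in> T" "S' = ?M v" using c[OF S(2)] by (elim disjE bexE)
        then show ?thesis
        proof cases
          case 1
          then have "S \<subseteq> V" "S' \<subseteq> V" "S \<in> \<Phi>" "S' \<in> \<Phi>" using old TV by auto
          then show ?thesis using p'(1)[of S] p'(1)[of S'] p'(1)[of "S \<inter> S'"] gI[of S S'] by (simp add: le_infI1)
        next
          case (2 v)
          then show ?thesis using old_new[of v S] old by (simp only: Int_commute)
        qed
      next
        case (new u)
        consider "S' \<in> \<Phi> - {T}" | v where "v \<in> T" "S' = ?M v" using c[OF S(2)] by (elim disjE bexE)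
        then show ?thesis
        proof cases
          case 1
          then show ?thesis using old_new new by simp
        next
          case (2 v)
          then show ?thesis using new_new new by simp
        qed
      qed
    qed
    show "p' ` (insert x V - R) \<subseteq> interior (convex hull (p' ` R))"
    proof -
      have "convex hull (p ` T) \<subseteq> convex hull (p ` R)" using gU T(4) by blast
      then have "q \<in> interior (convex hull (p ` R))" using q interior_mono by blast
      moreover have "insert x V - R = insert x (V - R)" using R(1) step.hyps(3) by auto
      ultimately show ?thesis using gi p'(1)[of "V - R"] p'(1)[OF R(1)] p'(2) by auto
    qed
    show "\<Union>?\<Phi> = insert x V"
    proof -
      have "\<exists>u\<in>T. w \<in> ?M u" if "w \<in> T" for w
      proof -
        have "\<not> T \<subseteq> {w}"
        proof
          assume "T \<subseteq> {w}"
          then have "card T \<le> card {w}" by (intro card_mono) auto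
          then show False using T(1) by simp
        qed
        then obtain u where "u \<in> T" "u \<noteq> w" by blast
        then show ?thesis using that by (intro bexI[of _ u]) auto
      qed
      moreover have "T \<noteq> {}" using T(1) by auto
      ultimately have "T \<subseteq> \<Union>(?M ` T)" "x \<in> \<Union>(?M ` T)" by blast+
      moreover have "\<Union>(?M ` T) \<subseteq> insert x T" by blast
      ultimately have "\<Union>(?M ` T) = insert x T" by blast
      then have "\<Union>?\<Phi> = \<Union>(\<Phi> - {T}) \<union> insert x T" by simp
      then show ?thesis using gV T(4) by auto
    qed
    show "\<forall>d\<subseteq>R. card d = 2 \<longrightarrow> (\<exists>S\<in>?\<Phi>. d \<subseteq> S)"
    proof (intro allI impI)
      fix d assume d: "d \<subseteq> R" "card d = 2"
      obtain S where S: "S \<in> \<Phi>" "d \<subseteq> S" using ge[OF d] by blast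
      show "\<exists>S\<in>?\<Phi>. d \<subseteq> S"
      proof (cases "S = T")
        case True
        obtain u where "u \<in> T" "d = T - {u}" using card_2_subset_3[OF T(1) d(2)] S True by blast
        then have "?M u \<in> ?\<Phi>" "d \<subseteq> ?M u" by blast+
        then show ?thesis by blast
      qed (use S in blast)
    qed
  qed
  then show ?case by (rule exI[of _ p'])
qed

text \<open>The region of the face \<open>Q\<close> when the face \<open>P\<close> is the unbounded one.\<close>

definition region :: "(nat \<Rightarrow> complex) \<Rightarrow> nat set \<times> bool \<Rightarrow> nat set \<times> bool \<Rightarrow> complex set" where
  "region p P Q = (if Q = P then - (convex hull (p ` fst P)) else interior (convex hull (p ` fst Q)))"

text \<open>The order of the vertex numbers merely fixes an orientation.\<close>

definition segment_path :: "(nat \<Rightarrow> complex) \<Rightarrow> nat set \<Rightarrow> real \<Rightarrow> complex" where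
  "segment_path p d = linepath (p (Min d)) (p (Max d))"

lemma segment_path_pair:
  assumes "a < b"
  shows "segment_path p {a, b} = linepath (p a) (p b)"
proof -
  have "Min {a, b} = a" "Max {a, b} = b" using assms by auto
  then show ?thesis by (simp add: segment_path_def)
qed

lemma card_2_less:
  assumes "card (d :: nat set) = 2"
  obtains a b where "d = {a, b}" "a < b"
proof -
  obtain a b where "d = {a, b}" "a \<noteq> b" using assms by (auto simp: card_2_iff)
  then show thesis using that[of a b] that[of b a] by (cases "a < b") (auto simp: insert_commute)
qed

lemma path_image_segment_path:
  assumes "card d = 2"
  shows "path_image (segment_path p d) = convex hull (p ` d)"
proof -
  obtain a b where "d = {a, b}" "a < b" using card_2_less[OF assms] .
  then show ?thesis by (simp add: segment_path_pair segment_convex_hull)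
qed

section \<open>Faces and incidences of the straight-line drawing\<close>

locale drawn_sphere =
  fixes V :: "nat set" and F :: "(nat set \<times> bool) set" and P :: "nat set \<times> bool" and p :: "nat \<Rightarrow> complex"
  assumes sph: "stacked_sphere V F" and PF: "P \<in> F" and geo: "geometric (fst P) V (fst ` (F - {P})) p"
begin

abbreviation "\<Phi> \<equiv> fst ` (F - {P})"
abbreviation "h \<equiv> \<lambda>S. convex hull (p ` S)"
abbreviation "H \<equiv> hgraph V (sphere_edges F) id"
abbreviation "\<gamma> \<equiv> segment_path p"

lemma facts:
  "inj_on p (fst P)" "\<not> affine_dependent (p ` fst P)"
  "\<And>T. T \<in> \<Phi> \<Longrightarrow> inj_on p T" "\<And>T. T \<in> \<Phi> \<Longrightarrow> \<not> affine_dependent (p ` T)"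
  "h (fst P) = (\<Union>T\<in>\<Phi>. h T)"
  "\<And>T T'. T \<in> \<Phi> \<Longrightarrow> T' \<in> \<Phi> \<Longrightarrow> h T \<inter> h T' = h (T \<inter> T')"
  "p ` (V - fst P) \<subseteq> interior (h (fst P))" "\<Union>\<Phi> = V"
  "\<And>d. d \<subseteq> fst P \<Longrightarrow> card d = 2 \<Longrightarrow> \<exists>T\<in>\<Phi>. d \<subseteq> T"
  by (rule geometricD[OF geo], assumption?, assumption?)+

lemma face3: "T \<in> \<Phi> \<Longrightarrow> card T = 3" "T \<in> \<Phi> \<Longrightarrow> T \<subseteq> V" "T \<in> \<Phi> \<Longrightarrow> finite T"
  "card (fst P) = 3" "fst P \<subseteq> V"
proof -
  have *: "card T = 3 \<and> T \<subseteq> V" if T: "T \<in> \<Phi>" for T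
  proof -
    obtain Q where Q: "T = fst Q" "Q \<in> F - {P}" using T by (rule imageE)
    have "Q \<in> F" using Q(2) by simp
    from sphere_face[OF sph this] show ?thesis unfolding Q(1) by simp
  qed
  show "card T = 3" "T \<subseteq> V" if "T \<in> \<Phi>" using *[OF that] by auto
  show "finite T" if "T \<in> \<Phi>" using *[OF that] card_ge_0_finite[of T] by simp
qed (use sphere_face[OF sph PF] in auto)

text \<open>Everything can be cut down to the common side of the two faces, and within one simplex
  hulls of corners meet in the hull of the common corners.\<close>

lemma hull_Int:
  assumes T: "T \<in> \<Phi>" "T' \<in> \<Phi>" and S: "S \<subseteq> T" "S' \<subseteq> T'"
  shows "h S \<inter> h S' = h (S \<inter> S')"
proof -
  have sub: "h A \<inter> h B = h (A \<inter> B)" if "Q \<in> \<Phi>" "A \<subseteq> Q" "B \<subseteq> Q" for A B Q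
  proof -
    have "h A \<inter> h B = convex hull (p ` A \<inter> p ` B)"
      by (rule hull_Int_subsets[OF facts(4)[OF that(1)]]) (use that in auto)
    then show ?thesis using inj_on_image_Int[OF facts(3)[OF that(1)] that(2,3)] by simp
  qed
  have "h S \<subseteq> h T" "h S' \<subseteq> h T'"
    by (rule hull_mono[OF image_mono[OF S(1)]], rule hull_mono[OF image_mono[OF S(2)]])
  then have "h S \<inter> h S' = (h S \<inter> h (T \<inter> T')) \<inter> (h S' \<inter> h (T \<inter> T'))"
    unfolding facts(6)[OF T, symmetric] by blast
  also have "h S \<inter> h (T \<inter> T') = h (S \<inter> (T \<inter> T'))" by (rule sub[OF T(1) S(1)]) blast
  also have "h S' \<inter> h (T \<inter> T') = h (S' \<inter> (T \<inter> T'))" by (rule sub[OF T(2) S(2)]) blast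
  also have "h (S \<inter> (T \<inter> T')) \<inter> h (S' \<inter> (T \<inter> T')) = h ((S \<inter> (T \<inter> T')) \<inter> (S' \<inter> (T \<inter> T')))"
    by (rule sub[OF T(1)]) (use S in auto)
  also have "(S \<inter> (T \<inter> T')) \<inter> (S' \<inter> (T \<inter> T')) = S \<inter> S'" using S by blast
  finally show ?thesis .
qed

lemma edge_face:
  assumes "d \<in> sphere_edges F"
  obtains T where "T \<in> \<Phi>" "d \<subseteq> T" "card d = 2"
proof -
  obtain Q where Q: "Q \<in> F" "d \<subseteq> fst Q" "card d = 2" using assms by (auto simp: sphere_edges_def)
  show thesis
  proof (cases "Q = P")
    case True
    then obtain T where "T \<in> \<Phi>" "d \<subseteq> T" using facts(9)[of d] Q by blast
    then show ?thesis using that Q(3) by blast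
  next
    case False
    then show ?thesis using that[of "fst Q"] Q by blast
  qed
qed

lemma face_edge: "T \<in> \<Phi> \<Longrightarrow> d \<subseteq> T \<Longrightarrow> card d = 2 \<Longrightarrow> d \<in> sphere_edges F"
  by (auto simp: sphere_edges_def)

lemma vertex_face: "v \<in> V \<Longrightarrow> \<exists>T\<in>\<Phi>. v \<in> T"
  using facts(8) by blast

lemma inj_p: "inj_on p V"
proof (rule inj_onI)
  fix a b assume ab: "a \<in> V" "b \<in> V" "p a = p b"
  obtain T where T1: "T \<in> \<Phi>" "a \<in> T" using vertex_face[OF ab(1)] by blast
  obtain T' where T2: "T' \<in> \<Phi>" "b \<in> T'" using vertex_face[OF ab(2)] by blast
  note T = T1 T2
  have "h {a} \<inter> h {b} = h ({a} \<inter> {b})" by (rule hull_Int[OF T(1,3)]) (use T in auto)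
  then show "a = b" using ab(3) by (cases "a = b") auto
qed

lemma vertex_on_hull:
  assumes "v \<in> V" "T \<in> \<Phi>" "S \<subseteq> T" "p v \<in> h S"
  shows "v \<in> S"
proof (rule ccontr)
  assume "v \<notin> S"
  obtain T' where T': "T' \<in> \<Phi>" "v \<in> T'" using assms(1) vertex_face by blast
  have "h {v} \<inter> h S = h ({v} \<inter> S)" by (rule hull_Int[OF T'(1) assms(2)]) (use T' assms in auto)
  then show False using assms(4) \<open>v \<notin> S\<close> by simp
qed

lemma small_hull:
  assumes "card S \<le> 1" "finite S"
  shows "h S \<subseteq> p ` S"
proof (cases "S = {}")
  case False
  then have "card S = 1" using assms by (metis One_nat_def card_0_eq le_Suc_eq le_zero_eq)
  then obtain a where "S = {a}" by (auto simp: card_1_singleton_iff)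
  then show ?thesis by simp
qed simp

text \<open>Distinct edges share at most one vertex, and their segments meet in the hull of what
  they share.\<close>

lemma drawing: "plane_drawing H p \<gamma>"
  unfolding plane_drawing_def
proof (intro conjI ballI impI)
  show "inj_on p (verts H)" using inj_p by (simp add: hgraph_def)
  fix d assume "d \<in> edges H"
  then have dE: "d \<in> sphere_edges F" by (simp add: hgraph_def)
  obtain T where T: "T \<in> \<Phi>" "d \<subseteq> T" "card d = 2" using edge_face[OF dE] .
  obtain a b where ab: "d = {a, b}" "a < b" using card_2_less[OF T(3)] .
  have "p a \<noteq> p b" using facts(3)[OF T(1)] T(2) ab by (auto simp: inj_on_def)
  then show "simple_path (\<gamma> d)" using ab by (simp add: segment_path_pair simple_path_linepath)
  show "{pathstart (\<gamma> d), pathfinish (\<gamma> d)} = p ` ends H d" using ab by (simp add: segment_path_pair hgraph_def)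
  show "path_image (\<gamma> d) \<inter> p ` verts H = p ` ends H d"
    unfolding path_image_segment_path[OF T(3)]
  proof (intro equalityI subsetI)
    fix y assume "y \<in> h d \<inter> p ` verts H"
    then obtain v where v: "v \<in> V" "y = p v" "p v \<in> h d" by (auto simp: hgraph_def)
    then show "y \<in> p ` ends H d" using vertex_on_hull[OF v(1) T(1,2)] by (simp add: hgraph_def)
  next
    fix y assume "y \<in> p ` ends H d"
    then show "y \<in> h d \<inter> p ` verts H"
      using T(2) face3(2)[OF T(1)] hull_subset[of "p ` d" convex] by (auto simp: hgraph_def)
  qed
next
  fix d e assume de: "d \<in> edges H" "e \<in> edges H" "d \<noteq> e"
  obtain T where T: "T \<in> \<Phi>" "d \<subseteq> T" "card d = 2" using edge_face[of d] de by (auto simp: hgraph_def)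
  obtain T' where T': "T' \<in> \<Phi>" "e \<subseteq> T'" "card e = 2" using edge_face[of e] de by (auto simp: hgraph_def)
  have fd: "finite d" "finite e" using T(3) T'(3) card_ge_0_finite by force+
  have "card (d \<inter> e) \<le> 1"
  proof (rule ccontr)
    assume "\<not> ?thesis"
    then have "card d \<le> card (d \<inter> e)" "card e \<le> card (d \<inter> e)" using T(3) T'(3) by auto
    then have "d \<inter> e = d" "d \<inter> e = e"
      using card_seteq[OF fd(1) Int_lower1] card_seteq[OF fd(2) Int_lower2] by auto
    then show False using de by simp
  qed
  then have "h (d \<inter> e) \<subseteq> p ` (d \<inter> e)" using fd by (intro small_hull) auto
  then show "path_image (\<gamma> d) \<inter> path_image (\<gamma> e) \<subseteq> p ` verts H"
    unfolding path_image_segment_path[OF T(3)] path_image_segment_path[OF T'(3)] hull_Int[OF T(1) T'(1) T(2) T'(2)]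
    using T(2) face3(2)[OF T(1)] by (simp add: hgraph_def) blast
qed

lemma face_region:
  assumes T: "T \<in> \<Phi>"
  shows "frontier (h T) = (\<Union>u\<in>T. h (T - {u}))" "interior (h T) \<noteq> {}" "closed (h T)"
    "closure (interior (h T)) = h T" "frontier (interior (h T)) = frontier (h T)"
proof -
  have c3: "card (p ` T) = 3" using facts(3)[OF T] face3(1)[OF T] by (simp add: card_image)
  have "p ` (T - {u}) = p ` T - {p u}" if "u \<in> T" for u
    using inj_on_image_set_diff[OF facts(3)[OF T], of T "{u}"] that by auto
  then show "frontier (h T) = (\<Union>u\<in>T. h (T - {u}))"
    using frontier_hull_triangle[OF facts(4)[OF T] c3] by simp
  show i: "interior (h T) \<noteq> {}"
    using interior_convex_hull_eq_empty[of "p ` T"] c3 facts(4)[OF T] by simp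
  show cl: "closed (h T)"
    using face3(3)[OF T] by (intro compact_imp_closed finite_imp_compact_convex_hull finite_imageI)
  then show c: "closure (interior (h T)) = h T" using convex_closure_interior[OF convex_convex_hull i] by simp
  show "frontier (interior (h T)) = frontier (h T)" using c cl by (simp add: frontier_def)
qed

text \<open>A common point would be in the hull of a proper subset of \<open>T\<close> and hence on
  its boundary.\<close>

lemma interior_Int_hull:
  assumes T: "T \<in> \<Phi>" "T' \<in> \<Phi>" and S: "S \<subseteq> T'" "\<not> T \<subseteq> S"
  shows "interior (h T) \<inter> h S = {}"
proof (rule ccontr)
  assume "interior (h T) \<inter> h S \<noteq> {}"
  then obtain y where y: "y \<in> interior (h T)" "y \<in> h S" by blast
  obtain u where u: "u \<in> T" "u \<notin> S" using S by blast
  have "y \<in> h T \<inter> h S" using y interior_subset by blast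
  then have "y \<in> h (T \<inter> S)" using hull_Int[OF T order_refl S(1)] by simp
  also have "h (T \<inter> S) \<subseteq> h (T - {u})" using u by (intro hull_mono image_mono) auto
  finally have "y \<in> frontier (h T)" using face_region(1)[OF T(1)] u by blast
  then show False using y by (simp add: frontier_def)
qed

lemma faces_distinct: "T \<in> \<Phi> \<Longrightarrow> T' \<in> \<Phi> \<Longrightarrow> T \<noteq> T' \<Longrightarrow> \<not> T \<subseteq> T'"
  using face3 by (metis card_subset_eq)

lemma face_not_edge: "T \<in> \<Phi> \<Longrightarrow> card d = 2 \<Longrightarrow> \<not> T \<subseteq> d"
proof
  assume T: "T \<in> \<Phi>" "card d = 2" "T \<subseteq> d"
  then have "card T \<le> card d" using card_ge_0_finite[of d] by (intro card_mono) auto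
  then show False using face3(1)[OF T(1)] T(2) by simp
qed

lemma outer_region:
  "closed (h (fst P))" "bounded (h (fst P))" "interior (h (fst P)) \<noteq> {}"
  "closure (- h (fst P)) = - interior (h (fst P))" "frontier (- h (fst P)) = frontier (h (fst P))"
proof -
  have f: "finite (fst P)" using face3(4) card_ge_0_finite by force
  have comp: "compact (h (fst P))" using f by (intro finite_imp_compact_convex_hull finite_imageI)
  then show "closed (h (fst P))" "bounded (h (fst P))" using compact_imp_closed compact_imp_bounded by auto
  have "card (p ` fst P) = 3" using facts(1) face3(4) by (simp add: card_image)
  then show "interior (h (fst P)) \<noteq> {}"
    using interior_convex_hull_eq_empty[of "p ` fst P"] facts(2) by simp
  show "closure (- h (fst P)) = - interior (h (fst P))" by (simp add: closure_complement)
  show "frontier (- h (fst P)) = frontier (h (fst P))" by (rule frontier_complement)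
qed

lemma region_outer: "region p P P = - h (fst P)" by (simp add: region_def)
lemma region_inner: "Q \<noteq> P \<Longrightarrow> region p P Q = interior (h (fst Q))" by (simp add: region_def)

lemma outer_frontier_sides: "frontier (h (fst P)) = (\<Union>u\<in>fst P. h (fst P - {u}))"
proof -
  have "card (p ` fst P) = 3" using facts(1) face3(4) by (simp add: card_image)
  moreover have "p ` (fst P - {u}) = p ` fst P - {p u}" if "u \<in> fst P" for u
    using inj_on_image_set_diff[OF facts(1), of "fst P" "{u}"] that by auto
  ultimately show ?thesis using frontier_hull_triangle[OF facts(2)] by simp
qed

lemma edge_in_hull: "d \<in> sphere_edges F \<Longrightarrow> h d \<subseteq> h (fst P)"
proof -
  assume "d \<in> sphere_edges F"
  then obtain T where T: "T \<in> \<Phi>" "d \<subseteq> T" using edge_face by metis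
  then have "h d \<subseteq> h T" by (intro hull_mono image_mono)
  then show ?thesis using facts(5) T(1) by blast
qed

lemma regions_disjoint:
  assumes "Q \<in> F" "Q' \<in> F" "Q \<noteq> Q'" "inj_on fst (F - {P})"
  shows "region p P Q \<inter> region p P Q' = {}"
proof -
  have inner: "region p P Q \<subseteq> h (fst P)" if "Q \<in> F" "Q \<noteq> P" for Q
  proof -
    have "fst Q \<in> \<Phi>" using that by blast
    then have "h (fst Q) \<subseteq> h (fst P)" using facts(5) by blast
    then show ?thesis using that region_inner interior_subset by blast
  qed
  consider "Q = P" | "Q' = P" | "Q \<noteq> P" "Q' \<noteq> P" by blast
  then show ?thesis
  proof cases
    case 1
    then show ?thesis using inner[of Q'] assms region_outer by blast
  next
    case 2
    then show ?thesis using inner[of Q] assms region_outer by blast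
  next
    case 3
    then have T: "fst Q \<in> \<Phi>" "fst Q' \<in> \<Phi>" "fst Q \<noteq> fst Q'" using assms by (auto simp: inj_on_def)
    have "interior (h (fst Q)) \<inter> h (fst Q') = {}"
      using interior_Int_hull[OF T(1,2) order_refl] faces_distinct[OF T] by blast
    then show ?thesis using 3 region_inner interior_subset by blast
  qed
qed

text \<open>A point off the drawing but in a closed face is not on its boundary, because all sides
  are drawn edges.\<close>

lemma regions_cover:
  "\<Union>(region p P ` F) = - (p ` verts H \<union> (\<Union>e\<in>edges H. path_image (\<gamma> e)))"
proof -
  let ?K = "p ` verts H \<union> (\<Union>e\<in>edges H. path_image (\<gamma> e))"
  have K: "?K = (\<Union>d\<in>sphere_edges F. h d)"
  proof -
    have "(\<Union>e\<in>edges H. path_image (\<gamma> e)) = (\<Union>d\<in>sphere_edges F. h d)"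
      using sphere_edges_finite(2)[OF sph] path_image_segment_path by (auto simp: hgraph_def)
    moreover have "p ` verts H \<subseteq> (\<Union>d\<in>sphere_edges F. h d)"
    proof
      fix y assume "y \<in> p ` verts H"
      then obtain v where v: "v \<in> V" "y = p v" by (auto simp: hgraph_def)
      obtain T where T: "T \<in> \<Phi>" "v \<in> T" using vertex_face[OF v(1)] by blast
      have "card (T - {v}) = 2" using T face3(1)[OF T(1)] face3(3)[OF T(1)] by simp
      then obtain w where w: "w \<in> T - {v}" by (metis card.empty ex_in_conv zero_neq_numeral)
      then have "{v, w} \<in> sphere_edges F" using T by (intro face_edge[OF T(1)]) auto
      moreover have "y \<in> h {v, w}" using v hull_subset[of "p ` {v, w}" convex] by auto
      ultimately show "y \<in> (\<Union>d\<in>sphere_edges F. h d)" by blast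
    qed
    ultimately show ?thesis by blast
  qed
  have "y \<in> \<Union>(region p P ` F) \<longleftrightarrow> y \<notin> ?K" for y
  proof
    assume "y \<in> \<Union>(region p P ` F)"
    then obtain Q where Q: "Q \<in> F" "y \<in> region p P Q" by blast
    have "y \<notin> h d" if d: "d \<in> sphere_edges F" for d
    proof (cases "Q = P")
      case True
      then show ?thesis using Q region_outer edge_in_hull[OF d] by blast
    next
      case False
      then have T: "fst Q \<in> \<Phi>" using Q by blast
      obtain T' where T': "T' \<in> \<Phi>" "d \<subseteq> T'" "card d = 2" using edge_face[OF d] .
      have "interior (h (fst Q)) \<inter> h d = {}"
        by (rule interior_Int_hull[OF T T'(1,2) face_not_edge[OF T T'(3)]])
      then show ?thesis using Q False region_inner by blast
    qed
    then show "y \<notin> ?K" unfolding K by blast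
  next
    assume y: "y \<notin> ?K"
    show "y \<in> \<Union>(region p P ` F)"
    proof (cases "y \<in> h (fst P)")
      case False
      then show ?thesis using PF region_outer by blast
    next
      case True
      then obtain Q where Q: "Q \<in> F" "Q \<noteq> P" "y \<in> h (fst Q)" using facts(5) by blast
      then have T: "fst Q \<in> \<Phi>" by blast
      have "y \<notin> frontier (h (fst Q))"
      proof
        assume "y \<in> frontier (h (fst Q))"
        then obtain u where u: "u \<in> fst Q" "y \<in> h (fst Q - {u})" using face_region(1)[OF T] by blast
        have "card (fst Q - {u}) = 2" using u face3(1)[OF T] face3(3)[OF T] by simp
        then have "fst Q - {u} \<in> sphere_edges F" by (intro face_edge[OF T]) auto
        then show False using y u K by blast
      qed
      then have "y \<in> interior (h (fst Q))"
        using Q(3) closure_subset[of "h (fst Q)"] by (auto simp: frontier_def)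
      then show ?thesis using Q region_inner by blast
    qed
  qed
  then show ?thesis by blast
qed

lemma region_connected:
  assumes "Q \<in> F"
  shows "open (region p P Q)" "connected (region p P Q)" "region p P Q \<noteq> {}"
proof -
  have "open (region p P Q) \<and> connected (region p P Q) \<and> region p P Q \<noteq> {}"
  proof (cases "Q = P")
    case True
    have "connected (- h (fst P))"
      by (rule connected_complement_bounded_convex) (use outer_region in auto)
    moreover have "- h (fst P) \<noteq> {}"
    proof
      assume "- h (fst P) = {}"
      then have "h (fst P) = UNIV" by blast
      then show False using outer_region(2) not_bounded_UNIV by metis
    qed
    ultimately show ?thesis using True region_outer outer_region(1) by (simp add: open_Compl)
  next
    case False
    then have T: "fst Q \<in> \<Phi>" using assms by blast
    have "connected (interior (h (fst Q)))" by (intro convex_connected convex_interior convex_convex_hull)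
    then show ?thesis using False region_inner face_region(2)[OF T] by simp
  qed
  then show "open (region p P Q)" "connected (region p P Q)" "region p P Q \<noteq> {}" by auto
qed

text \<open>Disjoint nonempty connected open sets that fill the complement are its components, so no
  Jordan curve argument is needed.\<close>

lemma faces_eq:
  assumes "inj_on fst (F - {P})"
  shows "faces H p \<gamma> = region p P ` F" "inj_on (region p P) F"
proof -
  have dis: "region p P Q \<inter> region p P Q' = {}" if "Q \<in> F" "Q' \<in> F" "Q \<noteq> Q'" for Q Q'
    using regions_disjoint[OF that assms] .
  show "inj_on (region p P) F"
  proof (rule inj_onI, rule ccontr)
    fix Q Q' assume Q: "Q \<in> F" "Q' \<in> F" "region p P Q = region p P Q'" "Q \<noteq> Q'"
    then show False using dis[OF Q(1,2,4)] region_connected(3)[OF Q(1)] by simp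
  qed
  show "faces H p \<gamma> = region p P ` F"
    unfolding faces_def
  proof (rule components_open_unique)
    show "pairwise disjnt (region p P ` F)"
    proof (rule pairwiseI)
      fix X Y assume "X \<in> region p P ` F" "Y \<in> region p P ` F" and n: "X \<noteq> Y"
      then obtain Q Q' where "Q \<in> F" "X = region p P Q" "Q' \<in> F" "Y = region p P Q'" by (elim imageE)
      then show "disjnt X Y" using dis[of Q Q'] n unfolding disjnt_def by blast
    qed
    show "\<Union>(region p P ` F) = - (p ` verts H \<union> (\<Union>e\<in>edges H. path_image (\<gamma> e)))" by (rule regions_cover)
  qed (use region_connected in auto)
qed

text \<open>The first claim is tested at the ends of \<open>d\<close>. The second makes incidence
  all or nothing: an edge not on the boundary of a face touches its closure at most in
  vertices.\<close>

lemma incidence: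
  assumes d: "d \<in> sphere_edges F" and Q: "Q \<in> F"
  shows "path_image (\<gamma> d) \<subseteq> frontier (region p P Q) \<longleftrightarrow> d \<subseteq> fst Q"
    and "\<not> d \<subseteq> fst Q \<Longrightarrow> (path_image (\<gamma> d) - p ` V) \<inter> closure (region p P Q) = {}"
proof -
  obtain T where T: "T \<in> \<Phi>" "d \<subseteq> T" "card d = 2" using edge_face[OF d] .
  have fd: "finite d" using T(3) card_ge_0_finite by force
  have pd: "p v \<in> h d" if "v \<in> d" for v using that hull_subset[of "p ` d" convex] by blast
  have dV: "d \<subseteq> V" using T face3(2) by blast
  note pi = path_image_segment_path[OF T(3), of p]
  have sides: "h d \<subseteq> frontier (h X)" if X: "card X = 3" "d \<subseteq> X" "frontier (h X) = (\<Union>u\<in>X. h (X - {u}))" for X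
  proof -
    obtain u where "u \<in> X" "d = X - {u}" using card_2_subset_3[OF X(1) T(3) X(2)] by blast
    then show ?thesis using X(3) by blast
  qed
  show "path_image (\<gamma> d) \<subseteq> frontier (region p P Q) \<longleftrightarrow> d \<subseteq> fst Q"
  proof (cases "Q = P")
    case True
    show ?thesis
    proof
      assume sub: "path_image (\<gamma> d) \<subseteq> frontier (region p P Q)"
      show "d \<subseteq> fst Q"
      proof
        fix v assume v: "v \<in> d"
        then have "p v \<in> frontier (h (fst P))" using sub pd pi True region_outer outer_region(5) by auto
        then have "p v \<notin> interior (h (fst P))" by (simp add: frontier_def)
        then show "v \<in> fst Q" using facts(7) v dV True by blast
      qed
    next
      assume "d \<subseteq> fst Q"
      then show "path_image (\<gamma> d) \<subseteq> frontier (region p P Q)"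
        using sides[OF face3(4) _ outer_frontier_sides] True region_outer outer_region(5) pi by simp
    qed
  next
    case False
    then have TQ: "fst Q \<in> \<Phi>" using Q by blast
    show ?thesis
    proof
      assume sub: "path_image (\<gamma> d) \<subseteq> frontier (region p P Q)"
      show "d \<subseteq> fst Q"
      proof
        fix v assume v: "v \<in> d"
        then have "p v \<in> frontier (h (fst Q))" using sub pd pi False region_inner face_region(5)[OF TQ] by auto
        then have "p v \<in> h (fst Q)" using face_region(3)[OF TQ] by (auto simp: frontier_def)
        then show "v \<in> fst Q" using vertex_on_hull[OF _ TQ order_refl] v dV by blast
      qed
    next
      assume "d \<subseteq> fst Q"
      then show "path_image (\<gamma> d) \<subseteq> frontier (region p P Q)"
        using sides[OF face3(1)[OF TQ] _ face_region(1)[OF TQ]] False region_inner face_region(5)[OF TQ] pi by simp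
    qed
  qed
  show "(path_image (\<gamma> d) - p ` V) \<inter> closure (region p P Q) = {}" if n: "\<not> d \<subseteq> fst Q"
  proof (cases "Q = P")
    case True
    obtain a b where ab: "d = {a, b}" "a \<notin> fst P"
    proof -
      obtain a where a: "a \<in> d" "a \<notin> fst P" using n True by blast
      obtain b where "d = {a, b}" using card_2_other[OF T(3) a(1)] by blast
      then show thesis using that a by blast
    qed
    \<comment> \<open>An end of \<open>d\<close> off the outer triangle is interior, hence so is the
      open segment, and it avoids the closure of the outer region.\<close>
    have "p a \<in> interior (h (fst P))" using facts(7) ab dV by blast
    moreover have "p b \<in> closure (h (fst P))"
      using edge_in_hull[OF d] pd[of b] ab closure_subset[of "h (fst P)"] by blast
    ultimately have "open_segment (p a) (p b) \<subseteq> interior (h (fst P))"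
      by (rule in_interior_closure_convex_segment[OF convex_convex_hull])
    moreover have "h d - p ` V \<subseteq> open_segment (p a) (p b)"
      using ab dV by (auto simp: open_segment_def segment_convex_hull)
    ultimately show ?thesis using True region_outer outer_region(4) pi by auto
  next
    case False
    then have TQ: "fst Q \<in> \<Phi>" using Q by blast
    have "card (d \<inter> fst Q) \<le> 1"
    proof (rule ccontr)
      assume "\<not> ?thesis"
      then have "card d \<le> card (d \<inter> fst Q)" using T(3) by simp
      then have "d \<inter> fst Q = d" using fd by (intro card_seteq) auto
      then show False using n by blast
    qed
    then have "h (d \<inter> fst Q) \<subseteq> p ` (d \<inter> fst Q)" using fd by (intro small_hull) auto
    then have "h d \<inter> h (fst Q) \<subseteq> p ` V" using hull_Int[OF T(1) TQ T(2) order_refl] dV by blast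
    then show ?thesis using False region_inner face_region(4)[OF TQ] pi by auto
  qed
qed

end

section \<open>Deleting edges of a drawing\<close>

text \<open>The members of \<open>N\<close> have \<open>A\<close> in their closure and so are
  connected through it. The closures of the remaining components miss \<open>A\<close>, which makes
  the merged set open.\<close>

lemma components_merge:
  fixes K :: "complex set"
  assumes K: "closed K" "closed (K - A)" "A \<subseteq> K" and A: "connected A" "A \<noteq> {}"
    and fin: "finite (components (- K))" and N: "N \<subseteq> components (- K)" "N \<noteq> {}"
    and near: "\<And>F. F \<in> N \<Longrightarrow> A \<subseteq> closure F"
    and far: "\<And>F. F \<in> components (- K) - N \<Longrightarrow> A \<inter> closure F = {}"
  shows "components (- (K - A)) = insert (\<Union>N \<union> A) (components (- K) - N)"
    and "open (\<Union>N \<union> A)" "closure (\<Union>N \<union> A) = (\<Union>F\<in>N. closure F)" "\<Union>N \<union> A \<notin> components (- K) - N"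
proof -
  let ?C = "components (- K)" and ?S = "\<Union>N \<union> A"
  have op: "open F" if "F \<in> ?C" for F using open_components[OF _ that] K(1) by (simp add: open_Compl)
  have dj: "F \<inter> F' = {}" if "F \<in> ?C" "F' \<in> ?C" "F \<noteq> F'" for F F'
    using components_nonoverlap[OF that(1,2)] that(3) by blast
  have un: "\<Union>?C = - K" by (rule Union_components)
  have finN: "finite N" using fin N(1) finite_subset by blast
  have djc: "F \<inter> closure F' = {}" if "F \<in> ?C" "F' \<in> ?C" "F \<noteq> F'" for F F'
    using open_Int_closure_eq_empty[OF op[OF that(1)], of F'] dj[OF that] by blast
  \<comment> \<open>This exhibits the merged set as open, since finitely many closures have a closed
    union.\<close>
  have S_eq: "?S = - (K - A) \<inter> - (\<Union>F\<in>?C - N. closure F)"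
  proof (intro equalityI subsetI)
    fix x assume x: "x \<in> ?S"
    have "x \<notin> closure F" if F: "F \<in> ?C - N" for F
    proof (cases "x \<in> A")
      case True
      then show ?thesis using far[OF F] by blast
    next
      case False
      then obtain F' where F': "F' \<in> N" "x \<in> F'" using x by blast
      then have "F' \<inter> closure F = {}" using djc[of F' F] N(1) F by blast
      then show ?thesis using F'(2) by blast
    qed
    moreover have "x \<notin> K - A"
    proof (cases "x \<in> A")
      case False
      then obtain F' where "F' \<in> N" "x \<in> F'" using x by blast
      then have "x \<in> \<Union>?C" using N(1) by blast
      then show ?thesis using un by blast
    qed simp
    ultimately show "x \<in> - (K - A) \<inter> - (\<Union>F\<in>?C - N. closure F)" by blast
  next
    fix x assume x: "x \<in> - (K - A) \<inter> - (\<Union>F\<in>?C - N. closure F)"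
    show "x \<in> ?S"
    proof (cases "x \<in> A")
      case False
      then have "x \<in> \<Union>?C" using x un by blast
      then obtain F where F: "F \<in> ?C" "x \<in> F" by blast
      have "F \<in> N"
      proof (rule ccontr)
        assume "F \<notin> N"
        then have "x \<in> (\<Union>F\<in>?C - N. closure F)" using F closure_subset[of F] by blast
        then show False using x by blast
      qed
      then show ?thesis using F(2) by blast
    qed simp
  qed
  have "closed (\<Union>F\<in>?C - N. closure F)" using fin by (intro closed_UN) auto
  then show opS: "open ?S" unfolding S_eq using K(2) by (intro open_Int open_Compl)
  have conS: "connected ?S"
  proof -
    have "?S = \<Union>((\<lambda>F. F \<union> A) ` N)" using N(2) by blast
    moreover have "connected (\<Union>((\<lambda>F. F \<union> A) ` N))"
    proof (rule connected_Union)
      fix X assume "X \<in> (\<lambda>F. F \<union> A) ` N"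
      then obtain F where F: "F \<in> N" "X = F \<union> A" by blast
      have "connected F" using F(1) N(1) in_components_connected by blast
      then have "connected (F \<union> A)"
        by (rule connected_intermediate_closure) (use near[OF F(1)] closure_subset[of F] in auto)
      then show "connected X" using F(2) by simp
    next
      have "A \<subseteq> \<Inter>((\<lambda>F. F \<union> A) ` N)" by blast
      then show "\<Inter>((\<lambda>F. F \<union> A) ` N) \<noteq> {}" using A(2) by blast
    qed
    ultimately show ?thesis by simp
  qed
  have djS: "?S \<inter> F = {}" if "F \<in> ?C - N" for F using S_eq that closure_subset[of F] by blast
  show "?S \<notin> ?C - N" using djS[of ?S] A(2) by blast
  show "closure ?S = (\<Union>F\<in>N. closure F)"
  proof -
    obtain F where F: "F \<in> N" using N(2) by blast
    have "\<Union>N \<subseteq> (\<Union>F\<in>N. closure F)" using closure_subset by blast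
    moreover have "A \<subseteq> (\<Union>F\<in>N. closure F)" using near[OF F] F by blast
    moreover have "closed (\<Union>F\<in>N. closure F)" using finN by (intro closed_UN) auto
    ultimately have "closure ?S \<subseteq> (\<Union>F\<in>N. closure F)" by (intro closure_minimal Un_least)
    moreover have "closure F \<subseteq> closure ?S" if "F \<in> N" for F using that by (intro closure_mono) blast
    ultimately show ?thesis by blast
  qed
  show "components (- (K - A)) = insert ?S (?C - N)"
  proof (rule components_open_unique)
    show "pairwise disjnt (insert ?S (?C - N))"
    proof (rule pairwiseI)
      fix X Y assume XY: "X \<in> insert ?S (?C - N)" "Y \<in> insert ?S (?C - N)" "X \<noteq> Y"
      consider "X = ?S" "Y \<in> ?C - N" | "Y = ?S" "X \<in> ?C - N" | "X \<in> ?C - N" "Y \<in> ?C - N" using XY by blast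
      then have "X \<inter> Y = {}"
      proof cases
        case 1
        then show ?thesis using djS[of Y] by simp
      next
        case 2
        then show ?thesis using djS[of X] by (simp add: Int_commute)
      next
        case 3
        then show ?thesis using dj[of X Y] XY(3) by simp
      qed
      then show "disjnt X Y" by (simp add: disjnt_def)
    qed
    have "\<Union>(insert ?S (?C - N)) = \<Union>?C \<union> A" using N(1) by blast
    also have "\<dots> = - (K - A)" unfolding un using K(3) by blast
    finally show "\<Union>(insert ?S (?C - N)) = - (K - A)" .
    fix X assume X: "X \<in> insert ?S (?C - N)"
    show "open X \<and> connected X \<and> X \<noteq> {}"
    proof (cases "X = ?S")
      case True
      then show ?thesis using opS conS A(2) by blast
    next
      case False
      then have "X \<in> ?C" using X by blast
      then show ?thesis using op in_components_connected in_components_nonempty by blast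
    qed
  qed
qed

section \<open>Deletion in the drawing as contraction in the dual\<close>

definition face_dual ::
    "('v, 'e) mgraph \<Rightarrow> ('v \<Rightarrow> complex) \<Rightarrow> ('e \<Rightarrow> real \<Rightarrow> complex) \<Rightarrow> (complex set, 'e) mgraph" where
  "face_dual H p \<gamma> = \<lparr>verts = faces H p \<gamma>, edges = edges H,
     ends = (\<lambda>e. {F \<in> faces H p \<gamma>. path_image (\<gamma> e) \<subseteq> frontier F})\<rparr>"

text \<open>The facts on drawings that hold for all finite plane graphs, but here are only needed for
  those that arise from a straight-line triangulation by deleting edges.\<close>

definition regular_drawing :: "('v, 'e) mgraph \<Rightarrow> ('v \<Rightarrow> complex) \<Rightarrow> ('e \<Rightarrow> real \<Rightarrow> complex) \<Rightarrow> bool" where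
  "regular_drawing H p \<gamma> \<longleftrightarrow> is_mgraph H \<and> plane_drawing H p \<gamma> \<and> is_mgraph (face_dual H p \<gamma>) \<and>
     (\<forall>e\<in>edges H. \<forall>F\<in>faces H p \<gamma>.
        path_image (\<gamma> e) \<subseteq> frontier F \<or> (path_image (\<gamma> e) - p ` verts H) \<inter> closure F = {}) \<and>
     (\<forall>S. even_edges H S \<longleftrightarrow> (\<exists>U. S = edge_cut (face_dual H p \<gamma>) U))"

lemma regular_drawingD:
  assumes "regular_drawing H p \<gamma>"
  shows "is_mgraph H" "plane_drawing H p \<gamma>" "is_mgraph (face_dual H p \<gamma>)"
    "\<And>e F. e \<in> edges H \<Longrightarrow> F \<in> faces H p \<gamma> \<Longrightarrow>
       path_image (\<gamma> e) \<subseteq> frontier F \<or> (path_image (\<gamma> e) - p ` verts H) \<inter> closure F = {}"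
    "\<And>S. even_edges H S \<longleftrightarrow> (\<exists>U. S = edge_cut (face_dual H p \<gamma>) U)"
  using assms unfolding regular_drawing_def by simp_all

text \<open>Merging the ends of \<open>e\<close> is contraction, and the cuts that survive it are
  those that avoid \<open>e\<close>.\<close>

lemma cuts_of_merge:
  assumes G: "is_mgraph G" and e: "e \<in> edges G" and E: "edges G' = edges G - {e}"
    and en: "\<And>d. d \<in> edges G - {e} \<Longrightarrow> ends G' d = \<pi> ` ends G d"
    and \<pi>: "\<And>x y. x \<in> verts G \<Longrightarrow> y \<in> verts G \<Longrightarrow> \<pi> x = \<pi> y \<longleftrightarrow> x = y \<or> (x \<in> ends G e \<and> y \<in> ends G e)"
  shows "(\<exists>U. S = edge_cut G' U) \<longleftrightarrow> (\<exists>U. S = edge_cut G U) \<and> e \<notin> S"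
proof -
  have sub: "ends G d \<subseteq> verts G" if "d \<in> edges G" for d using G that by (auto simp: is_mgraph_def)
  have pull: "edge_cut G' U = edge_cut G (\<pi> -` U)" for U
  proof -
    have "e \<notin> edge_cut G (\<pi> -` U)"
    proof
      assume "e \<in> edge_cut G (\<pi> -` U)"
      then obtain x y where xy: "x \<in> ends G e" "\<pi> x \<in> U" "y \<in> ends G e" "\<pi> y \<notin> U" by (auto simp: edge_cut_def)
      then have "\<pi> x = \<pi> y" using \<pi>[of x y] sub[OF e] by blast
      then show False using xy by simp
    qed
    moreover have "d \<in> edge_cut G' U \<longleftrightarrow> d \<in> edge_cut G (\<pi> -` U)" if d: "d \<in> edges G - {e}" for d
      unfolding edge_cut_def using d E en[OF d] by auto
    moreover have "edge_cut G' U \<subseteq> edges G - {e}" using cut_subset[of G'] E by simp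
    moreover have "edge_cut G (\<pi> -` U) \<subseteq> edges G" by (rule cut_subset)
    ultimately show ?thesis by blast
  qed
  show ?thesis
  proof
    assume "\<exists>U. S = edge_cut G' U"
    then obtain U where U: "S = edge_cut G' U" by blast
    then have "S = edge_cut G (\<pi> -` U)" using pull by simp
    moreover have "e \<notin> S" using U E by (simp add: edge_cut_def)
    ultimately show "(\<exists>U. S = edge_cut G U) \<and> e \<notin> S" by blast
  next
    assume a: "(\<exists>U. S = edge_cut G U) \<and> e \<notin> S"
    then obtain U where U: "S = edge_cut G U" by blast
    have c: "ends G e \<inter> U = {} \<or> ends G e \<subseteq> U" using a U e by (auto simp: edge_cut_def)
    \<comment> \<open>Both ends of \<open>e\<close> are on the same side of \<open>U\<close>, so
      passing to images loses no information.\<close>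
    let ?W = "\<pi> ` (U \<inter> verts G)"
    have mem: "\<pi> x \<in> ?W \<longleftrightarrow> x \<in> U" if x: "x \<in> verts G" for x
    proof
      assume "\<pi> x \<in> ?W"
      then obtain y where y: "y \<in> U" "y \<in> verts G" "\<pi> x = \<pi> y" by blast
      then show "x \<in> U" using \<pi>[OF x y(2)] c by blast
    next
      assume "x \<in> U"
      then show "\<pi> x \<in> ?W" using x by blast
    qed
    have "\<pi> -` ?W \<inter> verts G = U \<inter> verts G" using mem by blast
    then have "edge_cut G (\<pi> -` ?W) = edge_cut G U" using cut_Int_verts[OF G] by metis
    then have "S = edge_cut G' ?W" using pull[of ?W] U by simp
    then show "\<exists>U. S = edge_cut G' U" by blast
  qed
qed

text \<open>Removing the open edge merges the faces that border it, which contracts \<open>e\<close>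
  in the dual; on the other side, the even sets that remain are those that avoid
  \<open>e\<close>.\<close>

lemma regular_drawing_delete:
  fixes H :: "('v, 'e) mgraph"
  assumes R: "regular_drawing H p \<gamma>" and e: "e \<in> edges H"
  shows "regular_drawing (del_edges H {e}) p \<gamma>"
proof -
  note r = regular_drawingD[OF R]
  let ?D = "face_dual H p \<gamma>" and ?H = "del_edges H {e}" and ?P = "p ` verts H"
  let ?D' = "face_dual ?H p \<gamma>"
  define K where "K = ?P \<union> (\<Union>d\<in>edges H. path_image (\<gamma> d))"
  define A where "A = path_image (\<gamma> e) - ?P"
  define N where "N = ends ?D e"
  define Z where "Z = \<Union>N \<union> A"
  have fin: "finite (verts H)" "finite (edges H)" using r(1) by (auto simp: is_mgraph_def)
  have dr: "simple_path (\<gamma> d)" "{pathstart (\<gamma> d), pathfinish (\<gamma> d)} = p ` ends H d"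
    "path_image (\<gamma> d) \<inter> ?P = p ` ends H d" if "d \<in> edges H" for d
    using r(2) that unfolding plane_drawing_def by blast+
  have cross: "path_image (\<gamma> d) \<inter> path_image (\<gamma> d') \<subseteq> ?P" if "d \<in> edges H" "d' \<in> edges H" "d \<noteq> d'" for d d'
    using r(2) that unfolding plane_drawing_def by blast
  have cl: "closed (path_image (\<gamma> d))" if "d \<in> edges H" for d
    using dr(1)[OF that] by (intro closed_path_image simple_path_imp_path)
  have inside: "path_image (\<gamma> d) - ?P = path_image (\<gamma> d) - {pathstart (\<gamma> d), pathfinish (\<gamma> d)}" if d: "d \<in> edges H" for d
    using dr(2,3)[OF d] by blast
  have ne: "path_image (\<gamma> d) - ?P \<noteq> {}" if d: "d \<in> edges H" for d
    unfolding inside[OF d] by (rule nonempty_simple_path_endless[OF dr(1)[OF d]])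
  have A: "connected A" "A \<noteq> {}"
    unfolding A_def using ne[OF e] connected_simple_path_endless[OF dr(1)[OF e]] inside[OF e] by simp_all
  have KA: "K - A = ?P \<union> (\<Union>d\<in>edges ?H. path_image (\<gamma> d))"
  proof (intro equalityI subsetI)
    fix x assume x: "x \<in> K - A"
    show "x \<in> ?P \<union> (\<Union>d\<in>edges ?H. path_image (\<gamma> d))"
    proof (cases "x \<in> ?P")
      case False
      then obtain d where d: "d \<in> edges H" "x \<in> path_image (\<gamma> d)" using x by (auto simp: K_def)
      then have "d \<noteq> e" using x False by (auto simp: A_def)
      then show ?thesis using d by (auto simp: del_edges_def)
    qed simp
  next
    fix x assume x: "x \<in> ?P \<union> (\<Union>d\<in>edges ?H. path_image (\<gamma> d))"
    show "x \<in> K - A"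
    proof (cases "x \<in> ?P")
      case True
      then show ?thesis by (simp add: K_def A_def)
    next
      case False
      then obtain d where d: "d \<in> edges H" "d \<noteq> e" "x \<in> path_image (\<gamma> d)" using x by (auto simp: del_edges_def)
      then have "x \<notin> path_image (\<gamma> e)" using cross[OF d(1) e d(2)] False by blast
      then show ?thesis using d by (auto simp: K_def A_def)
    qed
  qed
  have cP: "closed ?P" using fin(1) by (intro finite_imp_closed finite_imageI)
  have closed: "closed K" "closed (K - A)"
  proof -
    show "closed K" unfolding K_def using cP fin(2) cl by (intro closed_Un closed_UN) auto
    show "closed (K - A)" unfolding KA using cP fin(2) cl
      by (intro closed_Un closed_UN) (auto simp: del_edges_def)
  qed
  have faces: "faces H p \<gamma> = components (- K)" by (simp add: faces_def K_def)
  have finC: "finite (components (- K))" using r(3) by (simp add: is_mgraph_def face_dual_def faces)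
  have N_eq: "N = {F \<in> components (- K). path_image (\<gamma> e) \<subseteq> frontier F}" by (simp add: N_def face_dual_def faces)
  \<comment> \<open>If a single face borders \<open>e\<close>, then \<open>Z\<close> is just this
    face with the open edge added.\<close>
  have "card N = 1 \<or> card N = 2" using r(3) e by (auto simp: is_mgraph_def face_dual_def N_def)
  then have N0: "N \<noteq> {}" by auto
  have near: "A \<subseteq> closure F" if "F \<in> N" for F using that by (auto simp: N_eq A_def frontier_def)
  have far: "A \<inter> closure F = {}" if "F \<in> components (- K) - N" for F
    using r(4)[OF e, of F] that unfolding faces A_def N_eq by blast
  have "A \<subseteq> K" using e by (auto simp: A_def K_def)
  note merge = components_merge[OF closed this A finC _ N0 near far, folded Z_def]
  have NC: "N \<subseteq> components (- K)" by (auto simp: N_eq)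
  note merge = merge[OF NC]
  have faces': "faces ?H p \<gamma> = insert Z (components (- K) - N)"
    using merge(1) KA by (simp add: faces_def del_edges_def)
  have sub: "path_image (\<gamma> d) \<inter> Z = {}" if d: "d \<in> edges H" "d \<noteq> e" for d
  proof -
    have "Z \<subseteq> - (K - A)"
      using Union_components[of "- (K - A)"] merge(1) by blast
    moreover have "path_image (\<gamma> d) \<subseteq> K - A" unfolding KA using d by (auto simp: del_edges_def)
    ultimately show ?thesis by blast
  qed
  have frZ: "frontier Z = (\<Union>F\<in>N. closure F) - Z"
    using merge(2,3) by (simp add: frontier_def interior_open)
  have Z_near: "path_image (\<gamma> d) \<subseteq> frontier Z" if d: "d \<in> edges H" "d \<noteq> e" and F: "F \<in> N" "path_image (\<gamma> d) \<subseteq> frontier F" for d F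
  proof -
    have "path_image (\<gamma> d) \<subseteq> closure F" using F(2) by (auto simp: frontier_def)
    then show ?thesis unfolding frZ using F(1) sub[OF d] by blast
  qed
  have Z_far: "(path_image (\<gamma> d) - ?P) \<inter> closure Z = {}"
    if d: "d \<in> edges H" and F: "\<And>F. F \<in> N \<Longrightarrow> \<not> path_image (\<gamma> d) \<subseteq> frontier F" for d
  proof -
    have n: "(path_image (\<gamma> d) - ?P) \<inter> closure F' = {}" if "F' \<in> N" for F'
      using r(4)[OF d, of F'] F[OF that] that NC unfolding faces by blast
    show ?thesis
    proof (rule equals0I)
      fix x assume x: "x \<in> (path_image (\<gamma> d) - ?P) \<inter> closure Z"
      then have "x \<in> (\<Union>F\<in>N. closure F)" using merge(3) by auto
      then obtain F' where F': "F' \<in> N" "x \<in> closure F'" by (rule UN_E)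
      show False using n[OF F'(1)] F'(2) x by blast
    qed
  qed
  have Z_iff: "path_image (\<gamma> d) \<subseteq> frontier Z \<longleftrightarrow> (\<exists>F\<in>N. path_image (\<gamma> d) \<subseteq> frontier F)"
    if d: "d \<in> edges H" "d \<noteq> e" for d
  proof
    assume s: "path_image (\<gamma> d) \<subseteq> frontier Z"
    show "\<exists>F\<in>N. path_image (\<gamma> d) \<subseteq> frontier F"
    proof (rule ccontr)
      assume "\<not> ?thesis"
      then have "(path_image (\<gamma> d) - ?P) \<inter> closure Z = {}" using Z_far[OF d(1)] by blast
      moreover have "path_image (\<gamma> d) \<subseteq> closure Z" using s by (auto simp: frontier_def)
      ultimately show False using ne[OF d(1)] by blast
    qed
  qed (use Z_near[OF d] in blast)
  \<comment> \<open>The contraction map of the dual.\<close>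
  define \<pi> where "\<pi> F = (if F \<in> N then Z else F)" for F
  have ends': "ends ?D' d = \<pi> ` ends ?D d" if d: "d \<in> edges H - {e}" for d
  proof -
    have d': "d \<in> edges H" "d \<noteq> e" using d by auto
    have "ends ?D' d = {F \<in> insert Z (components (- K) - N). path_image (\<gamma> d) \<subseteq> frontier F}"
      by (simp add: face_dual_def faces')
    also have "\<dots> = \<pi> ` {F \<in> components (- K). path_image (\<gamma> d) \<subseteq> frontier F}"
    proof (intro equalityI subsetI)
      fix F assume F: "F \<in> {F \<in> insert Z (components (- K) - N). path_image (\<gamma> d) \<subseteq> frontier F}"
      show "F \<in> \<pi> ` {F \<in> components (- K). path_image (\<gamma> d) \<subseteq> frontier F}"
      proof (cases "F = Z")
        case True
        then obtain F' where F': "F' \<in> N" "path_image (\<gamma> d) \<subseteq> frontier F'" using F Z_iff[OF d'] by blast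
        then have "F = \<pi> F'" using True by (simp add: \<pi>_def)
        then show ?thesis using F' NC by blast
      next
        case False
        then have "F = \<pi> F" using F by (auto simp: \<pi>_def)
        moreover have "F \<in> {F \<in> components (- K). path_image (\<gamma> d) \<subseteq> frontier F}" using F False by blast
        ultimately show ?thesis by (rule image_eqI)
      qed
    next
      fix X assume "X \<in> \<pi> ` {F \<in> components (- K). path_image (\<gamma> d) \<subseteq> frontier F}"
      then obtain F where F: "X = \<pi> F" "F \<in> components (- K)" "path_image (\<gamma> d) \<subseteq> frontier F" by blast
      show "X \<in> {F \<in> insert Z (components (- K) - N). path_image (\<gamma> d) \<subseteq> frontier F}"
      proof (cases "F \<in> N")
        case True
        then show ?thesis using F Z_near[OF d' True] by (simp add: \<pi>_def)
      next
        case False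
        then show ?thesis using F by (simp add: \<pi>_def)
      qed
    qed
    also have "{F \<in> components (- K). path_image (\<gamma> d) \<subseteq> frontier F} = ends ?D d"
      by (simp add: face_dual_def faces)
    finally show ?thesis .
  qed
  have mD': "is_mgraph ?D'"
    unfolding is_mgraph_def
  proof (intro conjI ballI)
    show "finite (verts ?D')" using finC by (simp add: face_dual_def faces')
    show "finite (edges ?D')" using fin(2) by (simp add: face_dual_def del_edges_def)
    fix d assume "d \<in> edges ?D'"
    then have d: "d \<in> edges H - {e}" by (simp add: face_dual_def del_edges_def)
    show "ends ?D' d \<subseteq> verts ?D'" by (auto simp: face_dual_def)
    have c: "card (ends ?D d) = 1 \<or> card (ends ?D d) = 2"
      using r(3) d by (auto simp: is_mgraph_def face_dual_def)
    then have f: "finite (ends ?D d)" "ends ?D d \<noteq> {}" using card_ge_0_finite[of "ends ?D d"] by auto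
    have "card (\<pi> ` ends ?D d) \<le> card (ends ?D d)" by (rule card_image_le[OF f(1)])
    moreover have "card (\<pi> ` ends ?D d) \<noteq> 0" using f by simp
    ultimately show "card (ends ?D' d) = 1 \<or> card (ends ?D' d) = 2" unfolding ends'[OF d] using c by linarith
  qed
  have \<pi>: "\<pi> x = \<pi> y \<longleftrightarrow> x = y \<or> (x \<in> ends ?D e \<and> y \<in> ends ?D e)" if "x \<in> verts ?D" "y \<in> verts ?D" for x y
  proof -
    have "x \<in> components (- K)" "y \<in> components (- K)" using that by (simp_all add: face_dual_def faces)
    then have "x \<notin> N \<Longrightarrow> x \<noteq> Z" "y \<notin> N \<Longrightarrow> y \<noteq> Z" using merge(4) by blast+
    then show ?thesis unfolding \<pi>_def N_def[symmetric] by auto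
  qed
  have cuts: "(\<exists>U. S = edge_cut ?D' U) \<longleftrightarrow> (\<exists>U. S = edge_cut ?D U) \<and> e \<notin> S" for S
  proof (rule cuts_of_merge[where \<pi> = \<pi>])
    show "is_mgraph ?D" by (rule r(3))
    show "e \<in> edges ?D" using e by (simp add: face_dual_def)
    show "edges ?D' = edges ?D - {e}" by (simp add: face_dual_def del_edges_def)
    show "ends ?D' d = \<pi> ` ends ?D d" if "d \<in> edges ?D - {e}" for d
      using ends'[of d] that by (simp add: face_dual_def)
  qed (rule \<pi>)
  have ev: "even_edges ?H S \<longleftrightarrow> even_edges H S \<and> e \<notin> S" for S
    by (auto simp: even_edges_def del_edges_def)
  show ?thesis
    unfolding regular_drawing_def
  proof (intro conjI allI ballI)
    show "is_mgraph ?H" by (rule mgraph_del_edges[OF r(1)])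
    show "plane_drawing ?H p \<gamma>" using r(2) by (simp add: plane_drawing_def del_edges_def)
    show "is_mgraph ?D'" by (rule mD')
    show "even_edges ?H S \<longleftrightarrow> (\<exists>U. S = edge_cut ?D' U)" for S unfolding ev cuts r(5) ..
    fix d F assume "d \<in> edges ?H" and F: "F \<in> faces ?H p \<gamma>"
    then have d: "d \<in> edges H" "d \<noteq> e" by (auto simp: del_edges_def)
    have V: "verts ?H = verts H" by (simp add: del_edges_def)
    show "path_image (\<gamma> d) \<subseteq> frontier F \<or> (path_image (\<gamma> d) - p ` verts ?H) \<inter> closure F = {}"
    proof (cases "F = Z")
      case True
      then show ?thesis using Z_iff[OF d] Z_far[OF d(1)] unfolding V by blast
    next
      case False
      then have "F \<in> faces H p \<gamma>" using F faces' faces by blast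
      then show ?thesis using r(4)[OF d(1)] unfolding V by blast
    qed
  qed
qed

lemma regular_drawing_delete_set:
  assumes "finite S" "S \<subseteq> edges H" "regular_drawing H p \<gamma>"
  shows "regular_drawing (del_edges H S) p \<gamma>"
  using assms
proof (induction S rule: finite_induct)
  case empty
  have "del_edges H {} = H" by (simp add: del_edges_def)
  then show ?case using empty by simp
next
  case (insert e S)
  then have "regular_drawing (del_edges H S) p \<gamma>" "e \<in> edges (del_edges H S)" by (auto simp: del_edges_def)
  then have "regular_drawing (del_edges (del_edges H S) {e}) p \<gamma>" by (rule regular_drawing_delete)
  moreover have "del_edges (del_edges H S) {e} = del_edges H (insert e S)" by (auto simp: del_edges_def)
  ultimately show ?case by simp
qed

lemma cuts_of_bij:
  assumes "bij_betw f (verts G) (verts G')" "is_mgraph G" "is_mgraph G'" "edges G' = edges G"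
    and en: "\<And>e. e \<in> edges G \<Longrightarrow> ends G' e = f ` ends G e"
  shows "(\<exists>U. S = edge_cut G' U) \<longleftrightarrow> (\<exists>U. S = edge_cut G U)"
proof -
  have inj: "inj_on f (verts G)" and im: "f ` verts G = verts G'" using assms(1) by (auto simp: bij_betw_def)
  have sub: "ends G e \<subseteq> verts G" if "e \<in> edges G" for e using assms(2) that by (auto simp: is_mgraph_def)
  have pull: "edge_cut G' U = edge_cut G (f -` U)" for U
  proof -
    have "e \<in> edge_cut G' U \<longleftrightarrow> e \<in> edge_cut G (f -` U)" if e: "e \<in> edges G" for e
      unfolding edge_cut_def using e en[OF e] assms(4) by auto
    then show ?thesis using assms(4) by (auto simp: edge_cut_def)
  qed
  have "edge_cut G U = edge_cut G' (f ` (U \<inter> verts G))" for U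
  proof -
    have "f -` (f ` (U \<inter> verts G)) \<inter> verts G = U \<inter> verts G" using inj by (auto simp: inj_on_def)
    then show ?thesis unfolding pull using cut_Int_verts[OF assms(2)] by metis
  qed
  then show ?thesis using pull by metis
qed

theorem sphere_regular_drawing:
  assumes sph: "stacked_sphere V F"
  shows "\<exists>p. regular_drawing (hgraph V (sphere_edges F) id) p (segment_path p)"
proof -
  have "F \<noteq> {}" using sph
  proof (cases rule: stacked_sphere.cases)
    case (step V' F' P x)
    have "card (fst P) = 3" using sphere_face(1) step by blast
    then have "fst P \<noteq> {}" by auto
    then show ?thesis using step by (simp add: stack_def)
  qed simp
  \<comment> \<open>Any face may serve as the unbounded one.\<close>
  then obtain P where PF: "P \<in> F" by blast
  have rr: "stacked_disc (fst P) V (fst ` (F - {P}))" "inj_on fst (F - {P})"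
    using sphere_reroot[OF sph PF] by auto
  obtain p where "geometric (fst P) V (fst ` (F - {P})) p" using geometric_exists[OF rr(1)] by blast
  then interpret drawn_sphere V F P p using sph PF by unfold_locales
  note fe = faces_eq[OF rr(2)]
  let ?D = "face_dual H p \<gamma>"
  have sE: "edges H = sphere_edges F" by (simp add: hgraph_def)
  have en: "ends ?D d = region p P ` ends (sphere_dual F) d" if d: "d \<in> sphere_edges F" for d
  proof -
    have "ends ?D d = {X \<in> region p P ` F. path_image (\<gamma> d) \<subseteq> frontier X}" by (simp add: face_dual_def fe(1))
    also have "\<dots> = region p P ` {Q \<in> F. d \<subseteq> fst Q}" using incidence(1)[OF d] by blast
    finally show ?thesis by (simp add: sphere_dual_def)
  qed
  have mD: "is_mgraph ?D"
    unfolding is_mgraph_def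
  proof (intro conjI ballI)
    show "finite (verts ?D)" using sphere_finite(2)[OF sph] by (simp add: face_dual_def fe(1))
    show "finite (edges ?D)" using sphere_edges_finite(1)[OF sph] by (simp add: face_dual_def sE)
    fix d assume "d \<in> edges ?D"
    then have d: "d \<in> sphere_edges F" by (simp add: face_dual_def sE)
    show "ends ?D d \<subseteq> verts ?D" by (auto simp: face_dual_def)
    have e: "ends (sphere_dual F) d \<subseteq> F" by (auto simp: sphere_dual_def)
    have "card (ends ?D d) = card (ends (sphere_dual F) d)"
      unfolding en[OF d] using inj_on_subset[OF fe(2) e] by (rule card_image)
    moreover have "card (ends (sphere_dual F) d) = 1 \<or> card (ends (sphere_dual F) d) = 2"
      using mgraph_sphere(2)[OF sph] d by (auto simp: is_mgraph_def sphere_dual_def)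
    ultimately show "card (ends ?D d) = 1 \<or> card (ends ?D d) = 2" by simp
  qed
  have "regular_drawing H p \<gamma>"
    unfolding regular_drawing_def
  proof (intro conjI allI ballI)
    show "is_mgraph H" by (rule mgraph_sphere(1)[OF sph])
    show "plane_drawing H p \<gamma>" by (rule drawing)
    show "is_mgraph ?D" by (rule mD)
    fix S
    have "(\<exists>U. S = edge_cut ?D U) \<longleftrightarrow> (\<exists>U. S = edge_cut (sphere_dual F) U)"
    proof (rule cuts_of_bij[where f = "region p P"])
      show "bij_betw (region p P) (verts (sphere_dual F)) (verts ?D)"
        using fe by (simp add: bij_betw_def sphere_dual_def face_dual_def)
      show "edges ?D = edges (sphere_dual F)" by (simp add: face_dual_def sphere_dual_def sE)
      show "ends ?D d = region p P ` ends (sphere_dual F) d" if "d \<in> edges (sphere_dual F)" for d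
        using en[of d] that by (simp add: sphere_dual_def)
    qed (rule mgraph_sphere(2)[OF sph], rule mD)
    then show "even_edges H S \<longleftrightarrow> (\<exists>U. S = edge_cut ?D U)" using sphere_even_iff_cut[OF sph] by simp
  next
    fix d X assume "d \<in> edges H" "X \<in> faces H p \<gamma>"
    then obtain Q where Q: "d \<in> sphere_edges F" "Q \<in> F" "X = region p P Q" unfolding sE fe(1) by blast
    have "verts H = V" by (simp add: hgraph_def)
    then show "path_image (\<gamma> d) \<subseteq> frontier X \<or> (path_image (\<gamma> d) - p ` verts H) \<inter> closure X = {}"
      using incidence[OF Q(1,2)] Q(3) by auto
  qed
  then show ?thesis by blast
qed

section \<open>The theorem\<close>

lemma cocycle_matroid_verts:
  "edges G' = edges G \<Longrightarrow> ends G' = ends G \<Longrightarrow> cocycle_matroid G' = cocycle_matroid G"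
  by (simp add: cocycle_matroid_def dual_matroid_def cycle_matroid_def cycles_def bases_def)

lemma ground_cocycle_matroid: "ground (cocycle_matroid G) = edges G"
  by (simp add: cocycle_matroid_def dual_matroid_def cycle_matroid_def)

lemma cocycle_matroid_same_cuts:
  assumes "is_mgraph G" "is_mgraph G'" "edges G' = edges G"
    and "\<And>S. (\<exists>U. S = edge_cut G' U) \<longleftrightarrow> (\<exists>U. S = edge_cut G U)"
  shows "cocycle_matroid G' = cocycle_matroid G"
proof (rule matroid.equality)
  show "ground (cocycle_matroid G') = ground (cocycle_matroid G)" by (simp add: ground_cocycle_matroid assms(3))
  have *: "(\<forall>U. edge_cut K U \<subseteq> X \<longrightarrow> edge_cut K U = {}) \<longleftrightarrow> (\<forall>S. (\<exists>U. S = edge_cut K U) \<longrightarrow> S \<subseteq> X \<longrightarrow> S = {})"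
    for K :: "('x, 'y) mgraph" and X by blast
  show "indep (cocycle_matroid G') = indep (cocycle_matroid G)"
    by (intro set_eqI) (simp only: indep_cocycle_matroid[OF assms(1)] indep_cocycle_matroid[OF assms(2)] * assms(3,4))
qed simp

text \<open>No edge leaves \<open>U\<close>, so identifying a vertex in \<open>U\<close> with one
  outside glues two separate parts at a point. Every cut still occurs, after complementing its side
  on one part if necessary.\<close>

lemma identify_components:
  assumes G: "is_mgraph G" and U: "edge_cut G U = {}" and u: "u \<in> verts G" "u \<in> U" and w: "w \<in> verts G" "w \<notin> U"
  obtains G' where "is_mgraph G'" "verts G' = verts G - {w}" "cocycle_matroid G' = cocycle_matroid G"
proof -
  define f where "f x = (if x = w then u else x)" for x
  define G' where "G' = \<lparr>verts = verts G - {w}, edges = edges G, ends = (\<lambda>e. f ` ends G e)\<rparr>"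
  have uw: "u \<noteq> w" using u w by blast
  have m: "is_mgraph G'"
    unfolding is_mgraph_def
  proof (intro conjI ballI)
    show "finite (verts G')" "finite (edges G')" using G by (auto simp: G'_def is_mgraph_def)
    fix e assume "e \<in> edges G'"
    then have e: "ends G e \<subseteq> verts G" "card (ends G e) = 1 \<or> card (ends G e) = 2"
      using G by (auto simp: G'_def is_mgraph_def)
    show "ends G' e \<subseteq> verts G'" using e(1) u(1) uw by (auto simp: G'_def f_def)
    have fin: "finite (ends G e)" "ends G e \<noteq> {}" using e(2) card_ge_0_finite[of "ends G e"] by auto
    have "card (f ` ends G e) \<le> card (ends G e)" by (rule card_image_le[OF fin(1)])
    moreover have "card (f ` ends G e) \<noteq> 0" using fin by simp
    ultimately show "card (ends G' e) = 1 \<or> card (ends G' e) = 2" using e(2) by (simp add: G'_def) linarith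
  qed
  have pull: "edge_cut G' W = edge_cut G (f -` W)" for W by (auto simp: edge_cut_def G'_def)
  have "\<exists>W'. edge_cut G W = edge_cut G' W'" for W
  proof -
    obtain W' where W': "edge_cut G W' = edge_cut G W" "u \<in> W' \<longleftrightarrow> w \<in> W'"
    proof (cases "u \<in> W \<longleftrightarrow> w \<in> W")
      case False
      \<comment> \<open>Adding \<open>U\<close> does not change the cut, but brings \<open>u\<close>
        and \<open>w\<close> to the same side.\<close>
      have "edge_cut G (symdiff W U) = edge_cut G W" unfolding cut_symdiff[OF G] U by (simp add: symdiff_def)
      moreover have "u \<in> symdiff W U \<longleftrightarrow> w \<in> symdiff W U" using False u w by (auto simp: symdiff_def)
      ultimately show thesis by (rule that)
    qed (use that in blast)
    have "f -` W' = W'" using W'(2) by (auto simp: f_def split: if_splits)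
    then show ?thesis using W'(1) pull[of W'] by metis
  qed
  then have "cocycle_matroid G' = cocycle_matroid G"
    using pull by (intro cocycle_matroid_same_cuts[OF G m]) (auto simp: G'_def)
  then show thesis using that[OF m] by (simp add: G'_def)
qed

lemma three_conn_cographic:
  assumes M: "simple_matroid M" "cographic M"
  obtains G :: "(nat, nat) mgraph" where "three_conn G" "matroid_iso M (cocycle_matroid G)"
proof -
  define Q where "Q G \<longleftrightarrow> is_mgraph G \<and> verts G \<noteq> {} \<and> matroid_iso M (cocycle_matroid G)" for G :: "(nat, nat) mgraph"
  obtain G0 :: "(nat, nat) mgraph" where G0: "is_mgraph G0" "matroid_iso M (cocycle_matroid G0)"
    using M(2) by (auto simp: cographic_def)
  \<comment> \<open>\<open>G0\<close> may have no vertices at all; an additional isolated vertex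
    does not affect the matroid.\<close>
  have "Q (G0\<lparr>verts := insert 0 (verts G0)\<rparr>)"
    using G0 cocycle_matroid_verts[of "G0\<lparr>verts := insert 0 (verts G0)\<rparr>" G0]
    by (auto simp: Q_def is_mgraph_def)
  then obtain G where G: "Q G" and min: "\<And>G'. Q G' \<Longrightarrow> card (verts G) \<le> card (verts G')"
    using exists_least_iff[of "\<lambda>n. \<exists>G. Q G \<and> card (verts G) = n"] by (metis not_le)
  have m: "is_mgraph G" "verts G \<noteq> {}" "matroid_iso M (cocycle_matroid G)" using G by (auto simp: Q_def)
  obtain \<phi> where b: "bij_betw \<phi> (ground M) (edges G)"
    and i: "\<And>X. X \<subseteq> ground M \<Longrightarrow> X \<in> indep M \<longleftrightarrow> \<phi> ` X \<in> indep (cocycle_matroid G)"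
    using m(3) by (auto simp: matroid_iso_def ground_cocycle_matroid)
  have big: "3 \<le> card (edge_cut G U)" if U: "edge_cut G U \<noteq> {}" for U
  proof (rule ccontr)
    assume n: "\<not> 3 \<le> card (edge_cut G U)"
    have fin: "finite (edge_cut G U)" using m(1) cut_subset[of G U] finite_subset by (auto simp: is_mgraph_def)
    obtain X where X: "X \<subseteq> ground M" "\<phi> ` X = edge_cut G U"
      using cut_subset[of G U] b by (metis bij_betw_imp_surj_on subset_imageE)
    have dep: "Y \<notin> indep M" if "X \<subseteq> Y" "Y \<subseteq> ground M" for Y
    proof -
      have "edge_cut G U \<subseteq> \<phi> ` Y" unfolding X(2)[symmetric] by (rule image_mono[OF that(1)])
      then have "\<phi> ` Y \<notin> indep (cocycle_matroid G)" using indep_cocycle_matroid[OF m(1), of "\<phi> ` Y"] U by auto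
      then show ?thesis using i[OF that(2)] by simp
    qed
    have "inj_on \<phi> X" using b X(1) inj_on_subset by (auto simp: bij_betw_def)
    then have cX: "card X = card (edge_cut G U)" and "finite X"
      using X(2) card_image[of \<phi> X] fin finite_imageD[of \<phi> X] by auto
    moreover have "card (edge_cut G U) \<noteq> 0" using U fin by simp
    ultimately have "card X = 1 \<or> card X = 2" using n by linarith
    then obtain x y where xy: "X = {x, y}" by (auto simp: card_1_singleton_iff card_2_iff)
    have nl: "\<not> is_loop M e" for e using M(1) by (simp add: simple_matroid_def)
    show False
    proof (cases "x = y")
      case True
      then have "is_loop M x" using xy X(1) dep[of "{x}"] by (auto simp: is_loop_def)
      then show False using nl by blast
    next
      case False
      then have "are_parallel M x y" using xy X(1) dep[of "{x, y}"] nl by (auto simp: are_parallel_def)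
      then show False using M(1) by (auto simp: simple_matroid_def)
    qed
  qed
  have "edge_cut G U \<noteq> {}" if U: "U \<inter> verts G \<noteq> {}" "verts G - U \<noteq> {}" for U
  proof
    assume e: "edge_cut G U = {}"
    obtain u w where uw: "u \<in> verts G" "u \<in> U" "w \<in> verts G" "w \<notin> U" using U by blast
    obtain G' where G': "is_mgraph G'" "verts G' = verts G - {w}" "cocycle_matroid G' = cocycle_matroid G"
      using identify_components[OF m(1) e uw] .
    have "Q G'" using G' m(3) uw by (auto simp: Q_def)
    moreover have "card (verts G') < card (verts G)"
      unfolding G'(2) using m(1) uw(3) by (intro card_Diff1_less) (simp_all add: is_mgraph_def)
    ultimately show False using min[of G'] by simp
  qed
  then have "three_conn G" using m big by (auto simp: three_conn_def)
  then show thesis using that m(3) by blast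
qed

lemma even_edges_relabel:
  assumes "inj_on \<delta> (edges H)" "\<And>e. e \<in> edges H \<Longrightarrow> ends H e = ends H' (\<delta> e)" "\<delta> ` edges H = edges H'"
    and S: "S \<subseteq> edges H"
  shows "even_edges H S \<longleftrightarrow> even_edges H' (\<delta> ` S)"
proof -
  have "card {d \<in> \<delta> ` S. v \<in> ends H' d} = card {e \<in> S. v \<in> ends H e}" for v
  proof -
    have "ends H e = ends H' (\<delta> e)" if "e \<in> S" for e using assms(2) S that by blast
    then have "{d \<in> \<delta> ` S. v \<in> ends H' d} = \<delta> ` {e \<in> S. v \<in> ends H e}" by auto
    moreover have "inj_on \<delta> {e \<in> S. v \<in> ends H e}" by (rule inj_on_subset[OF assms(1)]) (use S in blast)
    ultimately show ?thesis by (simp add: card_image)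
  qed
  moreover have "\<delta> ` S \<subseteq> edges H'" using S assms(3) by blast
  ultimately show ?thesis using S by (simp add: even_edges_def)
qed

lemma chordal_relabel:
  assumes "\<And>u v. adjacent H u v \<longleftrightarrow> adjacent H' u v" "verts H = verts H'"
  shows "chordal H \<longleftrightarrow> chordal H'"
  using assms by (simp add: chordal_def induced_cycle_def)

text \<open>The faces are numbered so that the dual has vertices in \<open>nat\<close>, and drawn
  edges are renamed by the edges of \<open>H\<close>.\<close>

lemma relabelled_dual:
  fixes H :: "(nat, 'e) mgraph"
  assumes R: "regular_drawing K p \<gamma>" and \<delta>: "bij_betw \<delta> (edges H) (edges K)"
    and en: "\<And>e. e \<in> edges H \<Longrightarrow> ends H e = ends K (\<delta> e)" and V: "verts H = verts K"
  obtains G :: "(nat, 'e) mgraph" where "is_mgraph H" "is_mgraph G" "planar H" "planar_dual H G"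
    "\<And>S. even_edges H S \<longleftrightarrow> (\<exists>U. S = edge_cut G U)"
proof -
  note r = regular_drawingD[OF R]
  let ?D = "face_dual K p \<gamma>" and ?\<gamma> = "\<lambda>e. \<gamma> (\<delta> e)"
  have inj: "inj_on \<delta> (edges H)" and im: "\<delta> ` edges H = edges K" using \<delta> by (auto simp: bij_betw_def)
  have dK: "\<delta> e \<in> edges K" if "e \<in> edges H" for e using im that by blast
  have fin: "finite (faces K p \<gamma>)" using r(3) by (simp add: is_mgraph_def face_dual_def)
  obtain \<psi> where \<psi>: "bij_betw \<psi> {..<card (faces K p \<gamma>)} (faces K p \<gamma>)"
    using ex_bij_betw_nat_finite[OF fin] by (auto simp: atLeast0LessThan)
  let ?n = "card (faces K p \<gamma>)"
  define G where "G = \<lparr>verts = {..<?n}, edges = edges H, ends = (\<lambda>e. {i \<in> {..<?n}. path_image (?\<gamma> e) \<subseteq> frontier (\<psi> i)})\<rparr>"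
  have \<psi>i: "inj_on \<psi> {..<?n}" and \<psi>m: "\<psi> ` {..<?n} = faces K p \<gamma>" using \<psi> by (auto simp: bij_betw_def)
  have dual: "\<psi> ` ends G e = {F \<in> faces K p \<gamma>. path_image (?\<gamma> e) \<subseteq> frontier F}" for e
  proof (intro equalityI subsetI)
    fix F assume F: "F \<in> {F \<in> faces K p \<gamma>. path_image (?\<gamma> e) \<subseteq> frontier F}"
    then have "F \<in> \<psi> ` {..<?n}" using \<psi>m by simp
    then obtain i where "i \<in> {..<?n}" "F = \<psi> i" by blast
    then show "F \<in> \<psi> ` ends G e" using F by (simp add: G_def)
  qed (use \<psi>m in \<open>auto simp: G_def\<close>)
  have dual': "\<psi> ` ends G e = ends ?D (\<delta> e)" for e unfolding dual by (simp add: face_dual_def)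
  have finH: "finite (edges H)" using r(1) im inj finite_imageD[of \<delta> "edges H"] by (simp add: is_mgraph_def)
  have mH: "is_mgraph H"
    using r(1) finH en dK V by (simp add: is_mgraph_def)
  have mG: "is_mgraph G"
    unfolding is_mgraph_def
  proof (intro conjI ballI)
    show "finite (verts G)" "finite (edges G)" using finH by (simp_all add: G_def)
    fix e assume "e \<in> edges G"
    then have e: "e \<in> edges H" by (simp add: G_def)
    show s: "ends G e \<subseteq> verts G" by (auto simp: G_def)
    then have "inj_on \<psi> (ends G e)" by (intro inj_on_subset[OF \<psi>i]) (simp add: G_def)
    then have "card (ends G e) = card (ends ?D (\<delta> e))" using card_image dual' by metis
    then show "card (ends G e) = 1 \<or> card (ends G e) = 2"
      using r(3) dK[OF e] by (simp add: is_mgraph_def face_dual_def)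
  qed
  have Un: "(\<Union>e\<in>edges H. path_image (?\<gamma> e)) = (\<Union>d\<in>edges K. path_image (\<gamma> d))" unfolding im[symmetric] by simp
  have faces: "faces H p ?\<gamma> = faces K p \<gamma>" unfolding faces_def Un V ..
  have drawing: "plane_drawing H p ?\<gamma>"
    unfolding plane_drawing_def
  proof (intro conjI ballI impI)
    note d = r(2)[unfolded plane_drawing_def]
    show "inj_on p (verts H)" using d V by simp
    fix e assume e: "e \<in> edges H"
    show "simple_path (?\<gamma> e)" "{pathstart (?\<gamma> e), pathfinish (?\<gamma> e)} = p ` ends H e"
      "path_image (?\<gamma> e) \<inter> p ` verts H = p ` ends H e"
      using d dK[OF e] en[OF e] V by simp_all
  next
    fix e f assume ef: "e \<in> edges H" "f \<in> edges H" "e \<noteq> f"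
    then have "\<delta> e \<noteq> \<delta> f" using inj by (auto simp: inj_on_def)
    then show "path_image (?\<gamma> e) \<inter> path_image (?\<gamma> f) \<subseteq> p ` verts H"
      using r(2)[unfolded plane_drawing_def] dK[OF ef(1)] dK[OF ef(2)] V by simp
  qed
  have "planar H" using drawing by (auto simp: planar_def)
  moreover have "planar_dual H G"
    unfolding planar_dual_def
  proof (intro exI conjI ballI)
    show "plane_drawing H p ?\<gamma>" by (rule drawing)
    show "bij_betw \<psi> (verts G) (faces H p ?\<gamma>)" using \<psi> by (simp add: G_def faces)
    show "edges G = edges H" by (simp add: G_def)
  qed (simp add: dual faces)
  moreover have "even_edges H S \<longleftrightarrow> (\<exists>U. S = edge_cut G U)" for S
  proof (cases "S \<subseteq> edges H")
    case True
    have pull: "\<delta> ` edge_cut G (\<psi> -` U) = edge_cut ?D U" for U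
    proof -
      have "e \<in> edge_cut G (\<psi> -` U) \<longleftrightarrow> \<delta> e \<in> edge_cut ?D U" if e: "e \<in> edges H" for e
      proof -
        have "e \<in> edges G" "\<delta> e \<in> edges ?D" using e dK by (simp_all add: G_def face_dual_def)
        then show ?thesis unfolding edge_cut_def mem_Collect_eq dual'[symmetric] by blast
      qed
      moreover have "edge_cut ?D U \<subseteq> \<delta> ` edges H" using cut_subset[of ?D U] im by (simp add: face_dual_def)
      moreover have "edge_cut G (\<psi> -` U) \<subseteq> edges H" using cut_subset[of G] by (simp add: G_def)
      ultimately show ?thesis by blast
    qed
    have vim: "edge_cut G (\<psi> -` (\<psi> ` (U \<inter> verts G))) = edge_cut G U" for U
    proof -
      have "\<psi> -` (\<psi> ` (U \<inter> verts G)) \<inter> verts G = U \<inter> verts G" using \<psi>i by (auto simp: inj_on_def G_def)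
      then show ?thesis using cut_Int_verts[OF mG] by metis
    qed
    have "even_edges H S \<longleftrightarrow> even_edges K (\<delta> ` S)" by (rule even_edges_relabel[OF inj en im True])
    also have "\<dots> \<longleftrightarrow> (\<exists>U. \<delta> ` S = edge_cut ?D U)" by (rule r(5))
    also have "\<dots> \<longleftrightarrow> (\<exists>U. S = edge_cut G U)"
    proof
      assume "\<exists>U. \<delta> ` S = edge_cut ?D U"
      then obtain U where "\<delta> ` S = edge_cut ?D U" by blast
      then have "\<delta> ` S = \<delta> ` edge_cut G (\<psi> -` U)" using pull by simp
      moreover have "edge_cut G (\<psi> -` U) \<subseteq> edges H" using cut_subset[of G] by (simp add: G_def)
      ultimately have "S = edge_cut G (\<psi> -` U)" using inj_on_image_eq_iff[OF inj True] by blast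
      then show "\<exists>U. S = edge_cut G U" by blast
    next
      assume "\<exists>U. S = edge_cut G U"
      then obtain U where "S = edge_cut G (\<psi> -` (\<psi> ` (U \<inter> verts G)))" using vim by blast
      then have "\<delta> ` S = edge_cut ?D (\<psi> ` (U \<inter> verts G))" using pull by simp
      then show "\<exists>U. \<delta> ` S = edge_cut ?D U" by blast
    qed
    finally show ?thesis .
  next
    case False
    moreover have "edge_cut G U \<subseteq> edges H" for U using cut_subset[of G U] by (simp add: G_def)
    ultimately show ?thesis by (auto simp: even_edges_def)
  qed
  ultimately show thesis using that[OF mH mG] by blast
qed

theorem theorem5p1:
  fixes M :: "'e matroid" and r :: nat
  assumes "is_matroid M"
    and "simple_matroid M"
    and "cographic M"
    and "matroid_rank M = r"
    and "\<forall>z :: complex. poly (map_poly of_int (char_poly M)) z = 0 \<longrightarrow> z \<in> \<int>"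
  shows "\<exists>(H :: (nat, 'e) mgraph) (G :: (nat, 'e) mgraph).
           is_mgraph H \<and> is_mgraph G \<and> planar H \<and> chordal H \<and> planar_dual H G \<and>
           M = cocycle_matroid G \<and> cocycle_matroid G = cycle_matroid H"
proof -
  obtain G0 :: "(nat, nat) mgraph" where G0: "three_conn G0" "matroid_iso M (cocycle_matroid G0)"
    using three_conn_cographic[OF assms(2,3)] .
  have m0: "is_mgraph G0" using G0(1) by (simp add: three_conn_def)
  have "\<nexists>e. is_loop M e" using assms(2) by (simp add: simple_matroid_def)
  then have "char_poly M = flow_poly G0" by (rule char_poly_iso_cocycle[OF assms(1) m0 G0(2)])
  then have "integral_roots (flow_poly G0)" using assms(5) by (simp add: integral_roots_def)
  then obtain V F \<epsilon> \<pi> where R: "represents V F \<epsilon> \<pi> G0" using represents_exists[OF G0(1)] by blast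
  note rep = representsD[OF R]
  obtain p where p: "regular_drawing (hgraph V (sphere_edges F) id) p (segment_path p)"
    using sphere_regular_drawing[OF rep(1)] by blast
  obtain \<phi> where \<phi>: "bij_betw \<phi> (ground M) (edges G0)"
    and i: "\<And>X. X \<subseteq> ground M \<Longrightarrow> X \<in> indep M \<longleftrightarrow> \<phi> ` X \<in> indep (cocycle_matroid G0)"
    using G0(2) by (auto simp: matroid_iso_def ground_cocycle_matroid)
  have inj: "inj_on \<phi> (ground M)" and im: "\<phi> ` ground M = edges G0" using \<phi> by (auto simp: bij_betw_def)
  let ?B = "hgraph V (edges G0) \<epsilon>" and ?T = "hgraph V (sphere_edges F) id"
  \<comment> \<open>The elements of \<open>M\<close> themselves become the edges of
    \<open>H\<close>, which yields equality of matroids and not only an isomorphism.\<close>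
  define \<delta> where "\<delta> e = \<epsilon> (\<phi> e)" for e
  define H where "H = \<lparr>verts = V, edges = ground M, ends = \<delta>\<rparr>"
  let ?K = "del_edges ?T (sphere_edges F - \<epsilon> ` edges G0)"
  have kept: "\<epsilon> ` edges G0 \<subseteq> sphere_edges F"
  proof
    fix d assume "d \<in> \<epsilon> ` edges G0"
    then obtain e where e: "e \<in> edges G0" "d = \<epsilon> e" by blast
    have "ends G0 e \<noteq> {}" using m0 e(1) by (auto simp: is_mgraph_def)
    then have "{P \<in> F. \<epsilon> e \<subseteq> fst P} \<noteq> {}" using rep(5)[OF e(1)] by (metis image_is_empty)
    then obtain P where "P \<in> F" "\<epsilon> e \<subseteq> fst P" by blast
    then show "d \<in> sphere_edges F" unfolding sphere_edges_def e(2) using rep(3)[OF e(1)] by blast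
  qed
  have RK: "regular_drawing ?K p (segment_path p)"
    by (rule regular_drawing_delete_set[OF _ _ p])
      (use sphere_edges_finite(1)[OF rep(1)] in \<open>auto simp: hgraph_def\<close>)
  have bij: "bij_betw \<delta> (edges H) (edges ?K)"
  proof -
    have "bij_betw \<epsilon> (edges G0) (\<epsilon> ` edges G0)" using rep(2) by (rule inj_on_imp_bij_betw)
    then have "bij_betw (\<epsilon> \<circ> \<phi>) (ground M) (\<epsilon> ` edges G0)" by (rule bij_betw_trans[OF \<phi>])
    moreover have "edges ?K = \<epsilon> ` edges G0" using kept by (auto simp: del_edges_def hgraph_def)
    moreover have "\<epsilon> \<circ> \<phi> = \<delta>" by (auto simp: \<delta>_def)
    ultimately show ?thesis by (simp add: H_def)
  qed
  have "ends H e = ends ?K (\<delta> e)" for e by (simp add: H_def del_edges_def hgraph_def)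
  moreover have "verts H = verts ?K" by (simp add: H_def del_edges_def hgraph_def)
  ultimately obtain G :: "(nat, 'e) mgraph" where G: "is_mgraph H" "is_mgraph G" "planar H" "planar_dual H G"
    and ev: "\<And>S. even_edges H S \<longleftrightarrow> (\<exists>U. S = edge_cut G U)"
    using relabelled_dual[OF RK bij] by metis
  have eG: "edges G = edges H" using G(4) by (auto simp: planar_dual_def)
  have two: "card (ends H e) = 2" if "e \<in> edges H" for e
  proof -
    have "\<phi> e \<in> edges G0" using that im by (auto simp: H_def)
    then show ?thesis using rep(3) by (simp add: H_def \<delta>_def)
  qed
  have cyc: "X \<in> indep (cycle_matroid H) \<longleftrightarrow> X \<subseteq> ground M \<and> (\<forall>S. even_edges H S \<and> S \<subseteq> X \<longrightarrow> S = {})" for X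
    using indep_cycle_even[OF G(1) two] by (simp add: H_def)
  have "cocycle_matroid G = cycle_matroid H"
  proof (rule matroid.equality)
    show "ground (cocycle_matroid G) = ground (cycle_matroid H)"
      by (simp add: ground_cocycle_matroid eG cycle_matroid_def)
    show "indep (cocycle_matroid G) = indep (cycle_matroid H)"
    proof (rule set_eqI)
      fix X
      show "X \<in> indep (cocycle_matroid G) \<longleftrightarrow> X \<in> indep (cycle_matroid H)"
        unfolding cyc indep_cocycle_matroid[OF G(2)] ev eG by (auto simp: H_def)
    qed
  qed simp
  moreover have "M = cycle_matroid H"
  proof (rule matroid.equality)
    show "ground M = ground (cycle_matroid H)" by (simp add: cycle_matroid_def H_def)
    \<comment> \<open>The even sets of \<open>H\<close> correspond to the cuts of \<open>G0\<close>,
      just as they are the cuts of \<open>G\<close>; independence in \<open>M\<close> can therefore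
      be tested on them.\<close>
    have rel: "even_edges H S \<longleftrightarrow> (\<exists>U. \<phi> ` S = edge_cut G0 U)" if "S \<subseteq> ground M" for S
    proof -
      have "even_edges H S \<longleftrightarrow> even_edges ?B (\<phi> ` S)"
        by (rule even_edges_relabel) (use inj im that in \<open>auto simp: H_def hgraph_def \<delta>_def\<close>)
      then show ?thesis using rep(7) by simp
    qed
    show "indep M = indep (cycle_matroid H)"
    proof (rule set_eqI)
      fix X
      show "X \<in> indep M \<longleftrightarrow> X \<in> indep (cycle_matroid H)"
      proof (cases "X \<subseteq> ground M")
        case True
        have "(\<forall>U. edge_cut G0 U \<subseteq> \<phi> ` X \<longrightarrow> edge_cut G0 U = {}) \<longleftrightarrow> (\<forall>S. even_edges H S \<and> S \<subseteq> X \<longrightarrow> S = {})"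
        proof (intro iffI allI impI)
          fix S assume c: "\<forall>U. edge_cut G0 U \<subseteq> \<phi> ` X \<longrightarrow> edge_cut G0 U = {}" and S: "even_edges H S \<and> S \<subseteq> X"
          then obtain U where "\<phi> ` S = edge_cut G0 U" using rel[of S] True by blast
          then have "\<phi> ` S = {}" using c S by blast
          then show "S = {}" by simp
        next
          fix U assume c: "\<forall>S. even_edges H S \<and> S \<subseteq> X \<longrightarrow> S = {}" and U: "edge_cut G0 U \<subseteq> \<phi> ` X"
          obtain S where S: "S \<subseteq> X" "edge_cut G0 U = \<phi> ` S" using U subset_imageE by metis
          then have "even_edges H S" using rel[of S] True by (metis order_trans)
          then show "edge_cut G0 U = {}" using c S by simp
        qed
        moreover have "\<phi> ` X \<subseteq> edges G0" using True im by blast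
        ultimately show ?thesis using i[OF True] indep_cocycle_matroid[OF m0, of "\<phi> ` X"] cyc[of X] True by simp
      next
        case False
        moreover have "indep M \<subseteq> Pow (ground M)" using assms(1) by (simp add: is_matroid_def)
        ultimately show ?thesis using cyc[of X] by blast
      qed
    qed
  qed simp
  moreover have "chordal H"
  proof -
    have "adjacent H u v \<longleftrightarrow> adjacent ?B u v" for u v
      unfolding adjacent_def by (simp add: H_def hgraph_def \<delta>_def im[symmetric])
    moreover have "verts H = verts ?B" by (simp add: H_def hgraph_def)
    ultimately show ?thesis using chordal_relabel[of H ?B] rep(8) by blast
  qed
  ultimately show ?thesis using G by metis
qed

end
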